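(* Let $M$ be a helix surface in $\mathbb{H}^3_{1,\tau}\subset\mathbb{R}^4_2$, with $\lambda=g_\tau(N,N)$ and constant angle function $\nu\neq0$ such that $B=\nu^2(\tau^2-1)-\lambda>0$. Then, locally, the position vector of $M$ in $\mathbb{R}^4_2$, with respect to the local coordinates $(x,y)$ on $M$ described in the context, is $$F(x,y)=A(y)\,\gamma(x),$$ where $$\gamma(x)=\big(\sqrt{w_{11}}\cos(\alpha_1x),\,-\lambda\sqrt{w_{11}}\sin(\alpha_1x),\,\sqrt{-w_{33}}\cos(\alpha_2x),\,\lambda\sqrt{-w_{33}}\sin(\alpha_2x)\big)$$ is a twisted geodesic of the Lorentz torus $\mathbb{S}^1(\sqrt{w_{11}})\times\mathbb{S}^1(\sqrt{-w_{33}})\subset\mathbb{H}^3_{1,\tau}$, with $$\alpha_{1,2}=\frac{\sqrt\kappa}{2}\Big(|\nu|\sqrt B\pm\frac{B}{\tau}\Big),\qquad w_{11}=\frac{4\tau}{\kappa^{3/2}B}\alpha_2,\qquad w_{33}=-\frac{4\tau}{\kappa^{3/2}B}\alpha_1,$$ and $A(y)=A(\xi,\xi_1,\xi_2,\xi_3)(y)$ is a $1$-parameter family of $4\times4$ pseudo-orthogonal matrices commuting with $J_1$ (of the form described in the context), where $\xi$ is a constant and $$\cosh^2(\xi_1(y))\,\xi_2'(y)+\sinh^2(\xi_1(y))\,\xi_3'(y)=0.$$ Conversely, a parametrization (immersion) $F(x,y)=A(y)\gamma(x)$, with $\gamma(x)$ and $A(y)$ as just described, defines a helix surface in $\mathbb{H}^3_{1,\tau}$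 with constant angle function $\nu$ (for a suitable choice of the unit normal $N$).
   Context: Let $\kappa>0$ and $\tau>0$ be real constants. $\mathbb{R}^4_2$ is $\mathbb{R}^4$ with the metric $g_0=dx_1^2+dx_2^2-dx_3^2-dx_4^2$, also denoted $\langle\,,\rangle$. The anti-de Sitter space is $\mathbb{H}^3_1(\kappa/4)=\{x\in\mathbb{R}^4: x_1^2+x_2^2-x_3^2-x_4^2=-4/\kappa\}$ with the induced Lorentzian metric $\langle\,,\rangle$. Define linear maps of $\mathbb{R}^4$ by $J_1(x)=(-x_2,x_1,-x_4,x_3)$, $J_2(x)=(x_3,-x_4,x_1,-x_2)$, $J_3(x)=(x_4,x_3,x_2,x_1)$, and $X_i(q)=\frac{\sqrt\kappa}{2}J_iq$. The Berger-like metric is $g_\tau(X,Y)=\langle X,Y\rangle+(1-\tau^2)\langle X,X_1\rangle\langle Y,X_1\rangle$; $E_1=\tau^{-1}X_1$, $E_2=X_2$, $E_3=X_3$ is a $g_\tau$-pseudo-orthonormal frame with $E_1$ timelike; $\mathbb{H}^3_{1,\tau}=(\mathbb{H}^3_1(\kappa/4),g_\tau)$ with Levi-Civita connection $\nabla^\tau$. The wedge product is the bilinear skew product with $E_1\wedge E_2=E_3$, $E_2\wedge E_3=-E_1$, $E_3\wedge E_1=E_2$. For an oriented pseudo-Riemannian surface $M$ immersed in $\mathbb{H}^3_{1,\tau}$ with unit normal $N$, put $\lambda=g_\tau(N,N)\in\{-1,1\}$, angle function $\nu=\lambda g_\tau(N,E_1)$, $E_1=T+\nu N$ with $T$ tangent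 to $M$, and $JX=N\wedge X$. $M$ is a helix surface if $\nu$ is constant; throughout $\nu\neq0$, and then $\lambda+\nu^2>0$ (this inequality is also part of the requirements on the constants $\lambda,\nu$ in the converse). On a helix surface the shape operator $A(X)=-\nabla^\tau_XN$ satisfies $A(JT)=-\frac{\sqrt\kappa}{2}\lambda\tau T+\mu JT$ for a smooth function $\mu$. Local coordinates (case $B>0$): $(x,y)$ are local coordinates on $M$ (on a product of intervals) with $\partial_x=T$, $\partial_y=a\,T+b\,JT$, where $\mu=\sqrt{\kappa B}\tan(\eta(y)-\nu\sqrt{\kappa B}\,x)$ for a smooth function $\eta(y)$, $b=\cos(\eta(y)-\nu\sqrt{\kappa B}\,x)$ and $a=\frac{\lambda\tau}{\sqrt B}\sin(\eta(y)-\nu\sqrt{\kappa B}\,x)$. Pseudo-orthogonal matrices: those preserving $g_0$. For real functions $\xi,\xi_1,\xi_2,\xi_3$ of $y$, $A(\xi,\xi_1,\xi_2,\xi_3)(y)$ is the matrix (commuting with $J_1$) with rows $\mathbf r_1=(\cosh\xi_1\cos\xi_2,-\cosh\xi_1\sin\xi_2,\sinh\xi_1\cos\xi_3,-\sinh\xi_1\sin\xi_3)$, $\mathbf r_2=J_1\mathbf r_1$, $\mathbf r_3=\sin\xi\,J_2\mathbf r_1+\cos\xi\,J_3\mathbf r_1$, $\mathbf r_4=J_1\mathbf r_3=-\cos\xi\,J_2\mathbf r_1+\sin\xi\,J_3\mathbf r_1$. The torus $\mathbb{S}^1(r)\times\mathbb{S}^1(s)$ is $\{x_1^2+x_2^2=r^2,\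 x_3^2+x_4^2=s^2\}$ with the metric induced by $\langle\,,\rangle$; a twisted geodesic is a geodesic of this flat torus neither of whose two circle components is constant. *)

theory Defs
  imports "HOL-Analysis.Analysis"
begin

section \<open>Smooth maps on open sets\<close>

primrec diff_times_on ::
  "nat \<Rightarrow> 'a::real_normed_vector set \<Rightarrow> ('a \<Rightarrow> 'b::real_normed_vector) \<Rightarrow> bool" where
  "diff_times_on 0 S f \<longleftrightarrow> continuous_on S f"
| "diff_times_on (Suc n) S f \<longleftrightarrow>
     (\<forall>x\<in>S. f differentiable (at x)) \<and>
     (\<forall>v. diff_times_on n S (\<lambda>x. frechet_derivative f (at x) v))"

definition smooth_on ::
  "'a::real_normed_vector set \<Rightarrow> ('a \<Rightarrow> 'b::real_normed_vector) \<Rightarrow> bool" where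
  "smooth_on S f \<longleftrightarrow> (\<forall>n. diff_times_on n S f)"

definition immersion_on ::
  "'a::real_normed_vector set \<Rightarrow> ('a \<Rightarrow> 'b::real_normed_vector) \<Rightarrow> bool" where
  "immersion_on S f \<longleftrightarrow> smooth_on S f \<and> (\<forall>x\<in>S. inj (frechet_derivative f (at x)))"

section \<open>Abstract smooth surfaces\<close>

text \<open>
  A surface is a set \<open>M\<close> together with an atlas, given as a set of local parametrizations
  \<open>(V, \<phi>)\<close> with \<open>V\<close> open in the plane and \<open>\<phi>\<close> injective from \<open>V\<close> into \<open>M\<close>; the topology of \<open>M\<close>
  is the one induced by the atlas.  Hausdorffness and second countability are not imposed:
  everything below is local.
\<close>

type_synonym 'm param = "(real \<times> real) set \<times> (real \<times> real \<Rightarrow> 'm)"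

definition smooth_transition :: "'m param \<Rightarrow> 'm param \<Rightarrow> bool" where
  "smooth_transition c d \<longleftrightarrow>
     (let S = fst c \<inter> snd c -` (snd d ` fst d)
      in open S \<and> smooth_on S (inv_into (fst d) (snd d) \<circ> snd c))"

definition local_param :: "'m set \<Rightarrow> 'm param set \<Rightarrow> 'm param \<Rightarrow> bool" where
  "local_param M \<A> c \<longleftrightarrow>
     open (fst c) \<and> inj_on (snd c) (fst c) \<and> snd c ` fst c \<subseteq> M \<and>
     (\<forall>d\<in>\<A>. smooth_transition c d \<and> smooth_transition d c)"

definition smooth_surface :: "'m set \<Rightarrow> 'm param set \<Rightarrow> bool" where
  "smooth_surface M \<A> \<longleftrightarrow>
     (\<forall>c\<in>\<A>. local_param M \<A> c) \<and> (\<Union>c\<in>\<A>. snd c ` fst c) = M"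

section \<open>Anti-de Sitter space with the Berger-like metric\<close>

definition g0 :: "real^4 \<Rightarrow> real^4 \<Rightarrow> real" where
  "g0 u v = u$1 * v$1 + u$2 * v$2 - u$3 * v$3 - u$4 * v$4"

definition AdS :: "real \<Rightarrow> (real^4) set" where
  "AdS \<kappa> = {x. (x$1)^2 + (x$2)^2 - (x$3)^2 - (x$4)^2 = - 4 / \<kappa>}"

text \<open>The tangent space of \<open>AdS \<kappa>\<close> at one of its points \<open>q\<close>.\<close>

definition AdS_tangent :: "real^4 \<Rightarrow> (real^4) set" where
  "AdS_tangent q = {v. g0 q v = 0}"

definition J1 :: "real^4 \<Rightarrow> real^4" where
  "J1 x = vector [- x$2, x$1, - x$4, x$3]"

definition J2 :: "real^4 \<Rightarrow> real^4" where
  "J2 x = vector [x$3, - x$4, x$1, - x$2]"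

definition J3 :: "real^4 \<Rightarrow> real^4" where
  "J3 x = vector [x$4, x$3, x$2, x$1]"

definition X1 :: "real \<Rightarrow> real^4 \<Rightarrow> real^4" where
  "X1 \<kappa> q = (sqrt \<kappa> / 2) *\<^sub>R J1 q"

definition X2 :: "real \<Rightarrow> real^4 \<Rightarrow> real^4" where
  "X2 \<kappa> q = (sqrt \<kappa> / 2) *\<^sub>R J2 q"

definition X3 :: "real \<Rightarrow> real^4 \<Rightarrow> real^4" where
  "X3 \<kappa> q = (sqrt \<kappa> / 2) *\<^sub>R J3 q"

definition gtau :: "real \<Rightarrow> real \<Rightarrow> real^4 \<Rightarrow> real^4 \<Rightarrow> real^4 \<Rightarrow> real" where
  "gtau \<kappa> \<tau> q U V = g0 U V + (1 - \<tau>^2) * g0 U (X1 \<kappa> q) * g0 V (X1 \<kappa> q)"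

definition E1 :: "real \<Rightarrow> real \<Rightarrow> real^4 \<Rightarrow> real^4" where
  "E1 \<kappa> \<tau> q = (1 / \<tau>) *\<^sub>R X1 \<kappa> q"

definition E2 :: "real \<Rightarrow> real^4 \<Rightarrow> real^4" where
  "E2 \<kappa> q = X2 \<kappa> q"

definition E3 :: "real \<Rightarrow> real^4 \<Rightarrow> real^4" where
  "E3 \<kappa> q = X3 \<kappa> q"

text \<open>
  Components of a tangent vector in the frame \<open>E1, E2, E3\<close>;
  the sign in the first one is due to \<open>E1\<close> being timelike.
\<close>

definition comp1 :: "real \<Rightarrow> real \<Rightarrow> real^4 \<Rightarrow> real^4 \<Rightarrow> real" where
  "comp1 \<kappa> \<tau> q U = - gtau \<kappa> \<tau> q U (E1 \<kappa> \<tau> q)"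

definition comp2 :: "real \<Rightarrow> real \<Rightarrow> real^4 \<Rightarrow> real^4 \<Rightarrow> real" where
  "comp2 \<kappa> \<tau> q U = gtau \<kappa> \<tau> q U (E2 \<kappa> q)"

definition comp3 :: "real \<Rightarrow> real \<Rightarrow> real^4 \<Rightarrow> real^4 \<Rightarrow> real" where
  "comp3 \<kappa> \<tau> q U = gtau \<kappa> \<tau> q U (E3 \<kappa> q)"

text \<open>
  The bilinear skew product on the tangent space at \<open>q\<close> determined by
  \<open>E1 \<and> E2 = E3\<close>, \<open>E2 \<and> E3 = - E1\<close>, \<open>E3 \<and> E1 = E2\<close>.
\<close>

definition wedge :: "real \<Rightarrow> real \<Rightarrow> real^4 \<Rightarrow> real^4 \<Rightarrow> real^4 \<Rightarrow> real^4" where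
  "wedge \<kappa> \<tau> q U V =
     (comp1 \<kappa> \<tau> q U * comp2 \<kappa> \<tau> q V - comp2 \<kappa> \<tau> q U * comp1 \<kappa> \<tau> q V) *\<^sub>R E3 \<kappa> q
   - (comp2 \<kappa> \<tau> q U * comp3 \<kappa> \<tau> q V - comp3 \<kappa> \<tau> q U * comp2 \<kappa> \<tau> q V) *\<^sub>R E1 \<kappa> \<tau> q
   + (comp3 \<kappa> \<tau> q U * comp1 \<kappa> \<tau> q V - comp1 \<kappa> \<tau> q U * comp3 \<kappa> \<tau> q V) *\<^sub>R E2 \<kappa> q"

section \<open>The Levi-Civita connection\<close>

text \<open>
  Since \<open>AdS \<kappa>\<close> is a closed submanifold, its smooth vector fields (and functions) are the
  restrictions of smooth maps on the whole of \<open>real^4\<close>; only the values on \<open>AdS \<kappa>\<close> matter.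
\<close>

definition vector_field :: "real \<Rightarrow> (real^4 \<Rightarrow> real^4) \<Rightarrow> bool" where
  "vector_field \<kappa> Y \<longleftrightarrow> smooth_on UNIV Y \<and> (\<forall>q\<in>AdS \<kappa>. Y q \<in> AdS_tangent q)"

definition lie_bracket :: "(real^4 \<Rightarrow> real^4) \<Rightarrow> (real^4 \<Rightarrow> real^4) \<Rightarrow> real^4 \<Rightarrow> real^4" where
  "lie_bracket X Y q = frechet_derivative Y (at q) (X q) - frechet_derivative X (at q) (Y q)"

text \<open>\<open>D q v Y\<close> stands for the covariant derivative at \<open>q\<close> of the field \<open>Y\<close> along the tangent vector \<open>v\<close>.\<close>

type_synonym connection = "real^4 \<Rightarrow> real^4 \<Rightarrow> (real^4 \<Rightarrow> real^4) \<Rightarrow> real^4"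

definition affine_connection :: "real \<Rightarrow> connection \<Rightarrow> bool" where
  "affine_connection \<kappa> D \<longleftrightarrow>
     (\<forall>X Y. vector_field \<kappa> X \<and> vector_field \<kappa> Y \<longrightarrow>
        (\<exists>Z. vector_field \<kappa> Z \<and> (\<forall>q\<in>AdS \<kappa>. D q (X q) Y = Z q))) \<and>
     (\<forall>Y Y'. vector_field \<kappa> Y \<and> vector_field \<kappa> Y' \<and> (\<forall>q\<in>AdS \<kappa>. Y q = Y' q) \<longrightarrow>
        (\<forall>q\<in>AdS \<kappa>. \<forall>v\<in>AdS_tangent q. D q v Y = D q v Y')) \<and>
     (\<forall>Y. vector_field \<kappa> Y \<longrightarrow>
        (\<forall>q\<in>AdS \<kappa>. \<forall>u\<in>AdS_tangent q. \<forall>v\<in>AdS_tangent q. \<forall>a b.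
           D q (a *\<^sub>R u + b *\<^sub>R v) Y = a *\<^sub>R D q u Y + b *\<^sub>R D q v Y)) \<and>
     (\<forall>Y Z. vector_field \<kappa> Y \<and> vector_field \<kappa> Z \<longrightarrow>
        (\<forall>q\<in>AdS \<kappa>. \<forall>v\<in>AdS_tangent q.
           D q v (\<lambda>p. Y p + Z p) = D q v Y + D q v Z)) \<and>
     (\<forall>(h :: real^4 \<Rightarrow> real) Y. smooth_on UNIV h \<and> vector_field \<kappa> Y \<longrightarrow>
        (\<forall>q\<in>AdS \<kappa>. \<forall>v\<in>AdS_tangent q.
           D q v (\<lambda>p. h p *\<^sub>R Y p) = frechet_derivative h (at q) v *\<^sub>R Y q + h q *\<^sub>R D q v Y))"

definition levi_civita :: "real \<Rightarrow> real \<Rightarrow> connection \<Rightarrow> bool" where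
  "levi_civita \<kappa> \<tau> D \<longleftrightarrow>
     affine_connection \<kappa> D \<and>
     (\<forall>X Y. vector_field \<kappa> X \<and> vector_field \<kappa> Y \<longrightarrow>
        (\<forall>q\<in>AdS \<kappa>. D q (X q) Y - D q (Y q) X = lie_bracket X Y q)) \<and>
     (\<forall>Y Z. vector_field \<kappa> Y \<and> vector_field \<kappa> Z \<longrightarrow>
        (\<forall>q\<in>AdS \<kappa>. \<forall>v\<in>AdS_tangent q.
           frechet_derivative (\<lambda>p. gtau \<kappa> \<tau> p (Y p) (Z p)) (at q) v =
             gtau \<kappa> \<tau> q (D q v Y) (Z q) + gtau \<kappa> \<tau> q (Y q) (D q v Z)))"

text \<open>
  The covariant derivative along a map \<open>F\<close> of a field \<open>N\<close> along \<open>F\<close> (the pull-back connection),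
  at the point \<open>w\<close> in the coordinate direction \<open>v\<close>: expand \<open>N\<close> in the frame \<open>E1, E2, E3\<close>
  along \<open>F\<close> and apply the Leibniz rule.
\<close>

definition cov_along ::
  "real \<Rightarrow> real \<Rightarrow> connection \<Rightarrow> (real \<times> real \<Rightarrow> real^4) \<Rightarrow> (real \<times> real \<Rightarrow> real^4) \<Rightarrow>
   real \<times> real \<Rightarrow> real \<times> real \<Rightarrow> real^4" where
  "cov_along \<kappa> \<tau> D F N w v =
     (let dF = frechet_derivative F (at w) v in
        frechet_derivative (\<lambda>z. comp1 \<kappa> \<tau> (F z) (N z)) (at w) v *\<^sub>R E1 \<kappa> \<tau> (F w)
      + comp1 \<kappa> \<tau> (F w) (N w) *\<^sub>R D (F w) dF (E1 \<kappa> \<tau>)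
      + frechet_derivative (\<lambda>z. comp2 \<kappa> \<tau> (F z) (N z)) (at w) v *\<^sub>R E2 \<kappa> (F w)
      + comp2 \<kappa> \<tau> (F w) (N w) *\<^sub>R D (F w) dF (E2 \<kappa>)
      + frechet_derivative (\<lambda>z. comp3 \<kappa> \<tau> (F z) (N z)) (at w) v *\<^sub>R E3 \<kappa> (F w)
      + comp3 \<kappa> \<tau> (F w) (N w) *\<^sub>R D (F w) dF (E3 \<kappa>))"

text \<open>
  The shape operator of a parametrized surface \<open>F\<close> with unit normal \<open>N\<close> at the parameter \<open>w\<close>,
  acting on vectors \<open>X\<close> of the tangent plane, that is of the range of the derivative of \<open>F\<close>.
\<close>

definition shape_op ::
  "real \<Rightarrow> real \<Rightarrow> connection \<Rightarrow> (real \<times> real \<Rightarrow> real^4) \<Rightarrow> (real \<times> real \<Rightarrow> real^4) \<Rightarrow>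
   real \<times> real \<Rightarrow> real^4 \<Rightarrow> real^4" where
  "shape_op \<kappa> \<tau> D F N w X = - cov_along \<kappa> \<tau> D F N w (inv (frechet_derivative F (at w)) X)"

section \<open>Helix surfaces\<close>

text \<open>
  An immersion \<open>f\<close> of the surface \<open>M\<close> with a smooth unit normal \<open>N\<close> (which orients \<open>M\<close>).  The
  induced metric is nondegenerate because \<open>N\<close> is not null.
\<close>

definition immersed_surface ::
  "real \<Rightarrow> real \<Rightarrow> real \<Rightarrow> 'm set \<Rightarrow> 'm param set \<Rightarrow> ('m \<Rightarrow> real^4) \<Rightarrow> ('m \<Rightarrow> real^4) \<Rightarrow> bool" where
  "immersed_surface \<kappa> \<tau> lam M \<A> f N \<longleftrightarrow>
     smooth_surface M \<A> \<and> f ` M \<subseteq> AdS \<kappa> \<and>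
     (\<forall>(V, \<phi>)\<in>\<A>. immersion_on V (f \<circ> \<phi>) \<and> smooth_on V (N \<circ> \<phi>) \<and>
        (\<forall>w\<in>V. \<forall>v. gtau \<kappa> \<tau> (f (\<phi> w)) (N (\<phi> w)) (frechet_derivative (f \<circ> \<phi>) (at w) v) = 0)) \<and>
     (\<forall>p\<in>M. N p \<in> AdS_tangent (f p) \<and> gtau \<kappa> \<tau> (f p) (N p) (N p) = lam)"

definition angle_fun :: "real \<Rightarrow> real \<Rightarrow> real \<Rightarrow> real^4 \<Rightarrow> real^4 \<Rightarrow> real" where
  "angle_fun \<kappa> \<tau> lam q n = lam * gtau \<kappa> \<tau> q n (E1 \<kappa> \<tau> q)"

definition helix_surface ::
  "real \<Rightarrow> real \<Rightarrow> real \<Rightarrow> real \<Rightarrow> 'm set \<Rightarrow> 'm param set \<Rightarrow> ('m \<Rightarrow> real^4) \<Rightarrow> ('m \<Rightarrow> real^4) \<Rightarrow> bool"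
  where
  "helix_surface \<kappa> \<tau> lam \<nu> M \<A> f N \<longleftrightarrow>
     immersed_surface \<kappa> \<tau> lam M \<A> f N \<and> (\<forall>p\<in>M. angle_fun \<kappa> \<tau> lam (f p) (N p) = \<nu>)"

definition T_vec :: "real \<Rightarrow> real \<Rightarrow> real \<Rightarrow> real^4 \<Rightarrow> real^4 \<Rightarrow> real^4" where
  "T_vec \<kappa> \<tau> lam q n = E1 \<kappa> \<tau> q - angle_fun \<kappa> \<tau> lam q n *\<^sub>R n"

definition JT_vec :: "real \<Rightarrow> real \<Rightarrow> real \<Rightarrow> real^4 \<Rightarrow> real^4 \<Rightarrow> real^4" where
  "JT_vec \<kappa> \<tau> lam q n = wedge \<kappa> \<tau> q n (T_vec \<kappa> \<tau> lam q n)"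

definition B_const :: "real \<Rightarrow> real \<Rightarrow> real \<Rightarrow> real" where
  "B_const \<tau> lam \<nu> = \<nu>^2 * (\<tau>^2 - 1) - lam"

text \<open>
  The distinguished local coordinates \<open>(x, y)\<close> on a product \<open>I \<times> J\<close> of open intervals, given by the
  local parametrization \<open>\<psi>\<close> of \<open>M\<close>.  Tangent vectors of \<open>M\<close> are identified with their images
  under the derivative of the immersion \<open>f\<close>.
\<close>

definition helix_coords ::
  "real \<Rightarrow> real \<Rightarrow> real \<Rightarrow> real \<Rightarrow> connection \<Rightarrow>
   'm set \<Rightarrow> 'm param set \<Rightarrow> ('m \<Rightarrow> real^4) \<Rightarrow> ('m \<Rightarrow> real^4) \<Rightarrow>
   real set \<Rightarrow> real set \<Rightarrow> (real \<times> real \<Rightarrow> 'm) \<Rightarrow> (real \<Rightarrow> real) \<Rightarrow> bool" where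
  "helix_coords \<kappa> \<tau> lam \<nu> D M \<A> f N I J \<psi> \<eta> \<longleftrightarrow>
     open I \<and> is_interval I \<and> I \<noteq> {} \<and> open J \<and> is_interval J \<and> J \<noteq> {} \<and>
     local_param M \<A> (I \<times> J, \<psi>) \<and> smooth_on J \<eta> \<and>
     (\<forall>x\<in>I. \<forall>y\<in>J.
        let B = B_const \<tau> lam \<nu>;
            p = \<psi> (x, y);
            dF = frechet_derivative (f \<circ> \<psi>) (at (x, y));
            T = T_vec \<kappa> \<tau> lam (f p) (N p);
            JT = JT_vec \<kappa> \<tau> lam (f p) (N p);
            \<theta> = \<eta> y - \<nu> * sqrt (\<kappa> * B) * x;
            \<mu> = sqrt (\<kappa> * B) * tan \<theta>;
            b = cos \<theta>;
            a = lam * \<tau> / sqrt B * sin \<theta>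
        in dF (1, 0) = T \<and> dF (0, 1) = a *\<^sub>R T + b *\<^sub>R JT \<and>
           shape_op \<kappa> \<tau> D (f \<circ> \<psi>) (N \<circ> \<psi>) (x, y) JT
             = (- (sqrt \<kappa> / 2) * lam * \<tau>) *\<^sub>R T + \<mu> *\<^sub>R JT)"

section \<open>The family of matrices\<close>

definition row1 :: "real \<Rightarrow> real \<Rightarrow> real \<Rightarrow> real^4" where
  "row1 \<xi>1 \<xi>2 \<xi>3 =
     vector [cosh \<xi>1 * cos \<xi>2, - cosh \<xi>1 * sin \<xi>2, sinh \<xi>1 * cos \<xi>3, - sinh \<xi>1 * sin \<xi>3]"

definition A_mat :: "real \<Rightarrow> real \<Rightarrow> real \<Rightarrow> real \<Rightarrow> real^4^4" where
  "A_mat \<xi> \<xi>1 \<xi>2 \<xi>3 =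
     (let r1 = row1 \<xi>1 \<xi>2 \<xi>3;
          r3 = sin \<xi> *\<^sub>R J2 r1 + cos \<xi> *\<^sub>R J3 r1
      in vector [r1, J1 r1, r3, J1 r3])"

definition pseudo_orthogonal :: "real^4^4 \<Rightarrow> bool" where
  "pseudo_orthogonal A \<longleftrightarrow> (\<forall>u v. g0 (A *v u) (A *v v) = g0 u v)"

definition commutes_J1 :: "real^4^4 \<Rightarrow> bool" where
  "commutes_J1 A \<longleftrightarrow> (\<forall>u. A *v J1 u = J1 (A *v u))"

text \<open>
  The functions \<open>\<xi>1, \<xi>2, \<xi>3\<close> of \<open>y\<close> on the interval \<open>J\<close>; the remaining parameter \<open>\<xi>\<close> is constant.
\<close>

definition admissible_angles ::
  "real set \<Rightarrow> (real \<Rightarrow> real) \<Rightarrow> (real \<Rightarrow> real) \<Rightarrow> (real \<Rightarrow> real) \<Rightarrow> bool" where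
  "admissible_angles J \<xi>1 \<xi>2 \<xi>3 \<longleftrightarrow>
     smooth_on J \<xi>1 \<and> smooth_on J \<xi>2 \<and> smooth_on J \<xi>3 \<and>
     (\<forall>y\<in>J. (cosh (\<xi>1 y))^2 * deriv \<xi>2 y + (sinh (\<xi>1 y))^2 * deriv \<xi>3 y = 0)"

section \<open>The torus and the curve in it\<close>

definition alpha1 :: "real \<Rightarrow> real \<Rightarrow> real \<Rightarrow> real \<Rightarrow> real" where
  "alpha1 \<kappa> \<tau> lam \<nu> = sqrt \<kappa> / 2 * (\<bar>\<nu>\<bar> * sqrt (B_const \<tau> lam \<nu>) + B_const \<tau> lam \<nu> / \<tau>)"

definition alpha2 :: "real \<Rightarrow> real \<Rightarrow> real \<Rightarrow> real \<Rightarrow> real" where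
  "alpha2 \<kappa> \<tau> lam \<nu> = sqrt \<kappa> / 2 * (\<bar>\<nu>\<bar> * sqrt (B_const \<tau> lam \<nu>) - B_const \<tau> lam \<nu> / \<tau>)"

definition w11 :: "real \<Rightarrow> real \<Rightarrow> real \<Rightarrow> real \<Rightarrow> real" where
  "w11 \<kappa> \<tau> lam \<nu> = 4 * \<tau> / (\<kappa> powr (3 / 2) * B_const \<tau> lam \<nu>) * alpha2 \<kappa> \<tau> lam \<nu>"

definition w33 :: "real \<Rightarrow> real \<Rightarrow> real \<Rightarrow> real \<Rightarrow> real" where
  "w33 \<kappa> \<tau> lam \<nu> = - (4 * \<tau> / (\<kappa> powr (3 / 2) * B_const \<tau> lam \<nu>)) * alpha1 \<kappa> \<tau> lam \<nu>"

definition gam :: "real \<Rightarrow> real \<Rightarrow> real \<Rightarrow> real \<Rightarrow> real \<Rightarrow> real^4" where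
  "gam \<kappa> \<tau> lam \<nu> x =
     vector [sqrt (w11 \<kappa> \<tau> lam \<nu>) * cos (alpha1 \<kappa> \<tau> lam \<nu> * x),
             - lam * sqrt (w11 \<kappa> \<tau> lam \<nu>) * sin (alpha1 \<kappa> \<tau> lam \<nu> * x),
             sqrt (- w33 \<kappa> \<tau> lam \<nu>) * cos (alpha2 \<kappa> \<tau> lam \<nu> * x),
             lam * sqrt (- w33 \<kappa> \<tau> lam \<nu>) * sin (alpha2 \<kappa> \<tau> lam \<nu> * x)]"

definition torus :: "real \<Rightarrow> real \<Rightarrow> (real^4) set" where
  "torus r s = {x. (x$1)^2 + (x$2)^2 = r^2 \<and> (x$3)^2 + (x$4)^2 = s^2}"

text \<open>The tangent plane at \<open>p\<close> of the torus through \<open>p\<close> (for nonzero radii).\<close>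

definition torus_tangent :: "real^4 \<Rightarrow> (real^4) set" where
  "torus_tangent p = {v. p$1 * v$1 + p$2 * v$2 = 0 \<and> p$3 * v$3 + p$4 * v$4 = 0}"

definition lorentz_torus :: "real \<Rightarrow> real \<Rightarrow> bool" where
  "lorentz_torus r s \<longleftrightarrow> 0 < r \<and> 0 < s \<and>
     (\<forall>p\<in>torus r s. \<exists>u v. torus_tangent p = span {u, v} \<and>
        g0 u u = 1 \<and> g0 v v = - 1 \<and> g0 u v = 0)"

text \<open>
  The covariant acceleration of a curve in the torus is the part of its ordinary acceleration
  tangent to the torus; it vanishes iff the acceleration is normal to the torus with respect
  to \<open>g0\<close>.
\<close>

definition torus_geodesic :: "real \<Rightarrow> real \<Rightarrow> (real \<Rightarrow> real^4) \<Rightarrow> bool" where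
  "torus_geodesic r s c \<longleftrightarrow> smooth_on UNIV c \<and> (\<forall>t. c t \<in> torus r s) \<and>
     (\<forall>t. \<forall>v\<in>torus_tangent (c t).
        g0 (vector_derivative (\<lambda>s. vector_derivative c (at s)) (at t)) v = 0)"

definition twisted_geodesic :: "real \<Rightarrow> real \<Rightarrow> (real \<Rightarrow> real^4) \<Rightarrow> bool" where
  "twisted_geodesic r s c \<longleftrightarrow> torus_geodesic r s c \<and>
     \<not> (\<exists>z. \<forall>t. (c t $ 1, c t $ 2) = z) \<and> \<not> (\<exists>z. \<forall>t. (c t $ 3, c t $ 4) = z)"

end

theory Submission
  imports Defs
begin

text \<open>
  Write \<open>n2 + i n3\<close> for the components of the normal along \<open>E2, E3\<close>; since \<open>\<nu>\<close> is constant, it moves on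
  a circle.  The structure equations of the frame \<open>X1, X2, X3\<close> show that its angle has constant
  velocity \<open>k\<close> along \<open>T\<close>, and so serves as the coordinate \<open>x\<close>.  With \<open>z1 = x1 + i x2\<close> and
  \<open>z2 = x3 + i x4\<close>, the integral curves of \<open>T\<close> obey a linear ordinary differential equation that is
  invariant under the matrices commuting with \<open>J1\<close>, and that \<open>\<gamma>\<close> solves.  Hence the
  matrix taking \<open>\<gamma> x\<close> to the point \<open>F (x, y)\<close> depends on \<open>y\<close> only, up to the constant phase \<open>\<xi>\<close>.
  Its first row \<open>(p, q)\<close> satisfies \<open>|p|^2 - |q|^2 = 1\<close>, so \<open>\<xi>1, \<xi>2, \<xi>3\<close> are its polar coordinates;
  these are smooth because \<open>q\<close> has only simple zeros, if \<open>sinh \<xi>1\<close> is allowed to change its sign.  The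
  condition on \<open>\<xi>2', \<xi>3'\<close> is the orthogonality of the normal to \<open>\<partial>F/\<partial>y\<close>.  These rows, being
  first integrals of \<open>T\<close>, also provide a second coordinate, and reparametrizing it so that
  \<open>b^2 + (B/\<tau>^2) a^2 = 1\<close> gives the coordinates \<open>(x, y)\<close>.
\<close>

section \<open>Smooth maps\<close>

text \<open>A unit normal of constant angle has one unknown, the phase of its \<open>E2\<close>,
  \<open>E3\<close> part. The exterior derivative of \<open>g(dF, N) = 0\<close>, read through the
  structure equations, fixes the velocity of that phase along \<open>T\<close>, so no Gauss or
  Codazzi equation is needed. The connection only serves to identify \<mu> with the angular velocity
  of the normal along \<open>JT\<close>. In \<open>z1\<close>, \<open>z2\<close> the equation of the
  integral curves of \<open>T\<close> couples each coordinate with the conjugate of the other,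
  through a coefficient rotating at speed \<open>k\<close>. Two uniformly rotating coordinates solve
  it if their frequencies add up to \<open>k\<close> and their radii have the right ratio. The
  factorization of lam + \<nu>^2 into |\<nu>| \<tau> - sqrt B and |\<nu>| \<tau> + sqrt B supplies
  both: this is the origin of \<open>alpha1\<close>, \<open>alpha2\<close>, \<open>w11\<close>,
  \<open>w33\<close>. The coefficients \<open>a\<close>, \<open>b\<close> of the second coordinate
  field obey a harmonic oscillator of frequency \<nu> sqrt(\<kappa> B), hence the sine, cosine and
  tangent; its energy is b^2 + (B/\<tau>^2) a^2. Conversely, prescribing these functions forces the
  phase of the normal to be independent of \<open>y\<close>, and the position formula uses only this
  and the fact that the first coordinate field is \<open>T\<close>.\<close>

lemma diff_times_on_cong:
  fixes f g :: "'a::real_normed_vector \<Rightarrow> 'b::real_normed_vector"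
  assumes "open S" "\<And>x. x \<in> S \<Longrightarrow> f x = g x" "diff_times_on n S f"
  shows "diff_times_on n S g"
  using assms(2,3)
proof (induction n arbitrary: f g)
  case 0
  then show ?case by (simp cong: continuous_on_cong)
next
  case (Suc n)
  have hd: "(g has_derivative frechet_derivative f (at x)) (at x)" if "x \<in> S" for x
  proof (rule has_derivative_transform_within_open[OF _ \<open>open S\<close> that])
    show "(f has_derivative frechet_derivative f (at x)) (at x)"
      using Suc.prems that by (simp add: frechet_derivative_works[symmetric])
  qed (use Suc.prems in auto)
  have "diff_times_on n S (\<lambda>x. frechet_derivative g (at x) v)" for v
  proof (rule Suc.IH)
    show "frechet_derivative f (at x) v = frechet_derivative g (at x) v" if "x \<in> S" for x
      using frechet_derivative_at[OF hd[OF that]] by (rule fun_cong)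
    show "diff_times_on n S (\<lambda>x. frechet_derivative f (at x) v)"
      using Suc.prems(2) unfolding diff_times_on.simps by blast
  qed
  moreover have "g differentiable at x" if "x \<in> S" for x
    using hd[OF that] by (rule differentiableI)
  ultimately show ?case unfolding diff_times_on.simps by blast
qed

text \<open>\<open>frechet_derivative\<close> is a chosen object; on an open set it agrees with any
  derivative found by the differentiation rules, and the inductions below run on such explicit
  forms.\<close>

lemma diff_times_on_SucI:
  fixes f :: "'a::real_normed_vector \<Rightarrow> 'b::real_normed_vector"
  assumes "open S" and der: "\<And>x. x \<in> S \<Longrightarrow> (f has_derivative f' x) (at x)"
    and d: "\<And>v. diff_times_on n S (\<lambda>x. f' x v)"
  shows "diff_times_on (Suc n) S f"
  unfolding diff_times_on.simps
proof (intro conjI ballI allI)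
  show "f differentiable at x" if "x \<in> S" for x
    using der[OF that] by (rule differentiableI)
  fix v
  have "f' x v = frechet_derivative f (at x) v" if "x \<in> S" for x
    using frechet_derivative_at[OF der[OF that]] by (rule fun_cong)
  then show "diff_times_on n S (\<lambda>x. frechet_derivative f (at x) v)"
    using d by (rule diff_times_on_cong[OF \<open>open S\<close>])
qed

lemma diff_times_on_SucD:
  fixes f :: "'a::real_normed_vector \<Rightarrow> 'b::real_normed_vector"
  assumes "diff_times_on (Suc n) S f"
  shows "x \<in> S \<Longrightarrow> (f has_derivative frechet_derivative f (at x)) (at x)"
    and "diff_times_on n S (\<lambda>x. frechet_derivative f (at x) v)"
  using assms unfolding diff_times_on.simps frechet_derivative_works by blast+

lemma diff_times_on_pred:
  fixes f :: "'a::real_normed_vector \<Rightarrow> 'b::real_normed_vector"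
  assumes "diff_times_on (Suc n) S f"
  shows "diff_times_on n S f"
  using assms
proof (induction n arbitrary: f)
  case 0
  then show ?case
    by (simp add: continuous_at_imp_continuous_on differentiable_imp_continuous_within)
next
  case (Suc n)
  have "diff_times_on n S (\<lambda>x. frechet_derivative f (at x) v)" for v
    using Suc.prems by (intro Suc.IH) simp
  with Suc.prems show ?case by simp
qed

lemma diff_times_on_subset:
  assumes "diff_times_on n S f" "T \<subseteq> S"
  shows "diff_times_on n T f"
  using assms(1)
proof (induction n arbitrary: f)
  case 0
  then show ?case using assms(2) by (auto intro: continuous_on_subset)
next
  case (Suc n)
  then show ?case using assms(2) unfolding diff_times_on.simps by blast
qed

lemma diff_times_on_open_local:
  fixes f :: "'a::real_normed_vector \<Rightarrow> 'b::real_normed_vector"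
  assumes "\<And>x. x \<in> S \<Longrightarrow> \<exists>U. open U \<and> x \<in> U \<and> diff_times_on n U f"
  shows "diff_times_on n S f"
  using assms
proof (induction n arbitrary: f)
  case 0
  then show ?case
    by (metis continuous_at_imp_continuous_on continuous_on_eq_continuous_at diff_times_on.simps(1))
next
  case (Suc n)
  have "f differentiable at x" if "x \<in> S" for x
    using Suc.prems[OF that] unfolding diff_times_on.simps by blast
  moreover have "diff_times_on n S (\<lambda>x. frechet_derivative f (at x) v)" for v
    using Suc.prems unfolding diff_times_on.simps by (intro Suc.IH) blast
  ultimately show ?case unfolding diff_times_on.simps by blast
qed

lemma diff_times_on_const: "diff_times_on n S (\<lambda>x. c)"
  by (induction n arbitrary: c) (auto simp: diff_times_on.simps(2))

lemma diff_times_on_add: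
  fixes f g :: "'a::real_normed_vector \<Rightarrow> 'b::real_normed_vector"
  assumes "open S" "diff_times_on n S f" "diff_times_on n S g"
  shows "diff_times_on n S (\<lambda>x. f x + g x)"
  using assms(2,3)
proof (induction n arbitrary: f g)
  case 0
  then show ?case by (auto intro: continuous_intros)
next
  case (Suc n)
  show ?case
    by (rule diff_times_on_SucI[OF \<open>open S\<close> has_derivative_add[OF diff_times_on_SucD(1)[OF Suc.prems(1)]
        diff_times_on_SucD(1)[OF Suc.prems(2)]]])
      (use Suc diff_times_on_SucD(2) in blast)+
qed

text \<open>By the product rule the derivative is a sum of two terms of the same shape, with one
  factor differentiated; hence the induction keeps both factors arbitrary.\<close>

lemma diff_times_on_bilinear:
  fixes f :: "'a::real_normed_vector \<Rightarrow> 'b::real_normed_vector"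
    and g :: "'a \<Rightarrow> 'c::real_normed_vector"
    and h :: "'b \<Rightarrow> 'c \<Rightarrow> 'd::real_normed_vector"
  assumes "bounded_bilinear h" "open S" "diff_times_on n S f" "diff_times_on n S g"
  shows "diff_times_on n S (\<lambda>x. h (f x) (g x))"
  using assms(3,4)
proof (induction n arbitrary: f g)
  case 0
  then show ?case by (auto intro: bounded_bilinear.continuous_on[OF assms(1)])
next
  case (Suc n)
  show ?case
  proof (rule diff_times_on_SucI[OF \<open>open S\<close> bounded_bilinear.FDERIV[OF assms(1)]])
    show "(f has_derivative frechet_derivative f (at x)) (at x)"
      and "(g has_derivative frechet_derivative g (at x)) (at x)" if "x \<in> S" for x
      using Suc.prems that diff_times_on_SucD(1) by blast+
    fix v
    show "diff_times_on n S (\<lambda>x. h (f x) (frechet_derivative g (at x) v) + h (frechet_derivative f (at x) v) (g x))"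
      by (intro diff_times_on_add[OF \<open>open S\<close>] Suc.IH diff_times_on_pred[OF Suc.prems(1)]
          diff_times_on_pred[OF Suc.prems(2)] diff_times_on_SucD(2)[OF Suc.prems(1)]
          diff_times_on_SucD(2)[OF Suc.prems(2)])
  qed
qed

lemma diff_times_on_linear:
  fixes L :: "'a::real_normed_vector \<Rightarrow> 'b::real_normed_vector"
  assumes "bounded_linear L" "open S"
  shows "diff_times_on n S L"
proof (cases n)
  case 0
  then show ?thesis using assms by (simp add: linear_continuous_on)
next
  case (Suc m)
  show ?thesis unfolding Suc
    by (rule diff_times_on_SucI[OF \<open>open S\<close> bounded_linear_imp_has_derivative[OF assms(1)] diff_times_on_const])
qed

lemma diff_times_on_sum:
  fixes f :: "'i \<Rightarrow> 'a::real_normed_vector \<Rightarrow> 'b::real_normed_vector"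
  assumes "open S" "\<And>i. i \<in> I \<Longrightarrow> diff_times_on n S (f i)"
  shows "diff_times_on n S (\<lambda>x. \<Sum>i\<in>I. f i x)"
proof (cases "finite I")
  case True
  then show ?thesis using assms(2)
    by (induction I) (auto intro!: diff_times_on_const diff_times_on_add[OF \<open>open S\<close>])
next
  case False
  then show ?thesis by (simp add: diff_times_on_const)
qed

text \<open>\<open>diff_times_on\<close> sees derivatives in fixed directions only, but the chain
  rule applies the derivative of \<open>g\<close> in the moving direction \<open>?Df x v\<close>.
  Expanding this direction in a finite basis leaves scalar coefficients times derivatives in fixed
  directions, which is why the middle space is Euclidean.\<close>

lemma diff_times_on_compose:
  fixes f :: "'a::real_normed_vector \<Rightarrow> 'b::euclidean_space"
    and g :: "'b \<Rightarrow> 'c::real_normed_vector"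
  assumes "open S" "open T" "f ` S \<subseteq> T" "diff_times_on n S f" "diff_times_on n T g"
  shows "diff_times_on n S (\<lambda>x. g (f x))"
  using assms(4,5)
proof (induction n arbitrary: g)
  case 0
  then show ?case using assms(3) by (auto intro: continuous_on_compose2)
next
  case (Suc n)
  let ?Df = "\<lambda>x v. frechet_derivative f (at x) v" and ?Dg = "\<lambda>y w. frechet_derivative g (at y) w"
  have "((\<lambda>x. g (f x)) has_derivative (\<lambda>v. \<Sum>b\<in>Basis. (?Df x v \<bullet> b) *\<^sub>R ?Dg (f x) b)) (at x)"
    if "x \<in> S" for x
  proof -
    have f: "(f has_derivative ?Df x) (at x)" and g: "(g has_derivative ?Dg (f x)) (at (f x))"
      using diff_times_on_SucD(1)[OF Suc.prems(1)] diff_times_on_SucD(1)[OF Suc.prems(2)] assms(3) that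
      by auto
    have "linear (?Dg (f x))"
      using g by (simp add: has_derivative_linear)
    then have "?Dg (f x) (?Df x v) = (\<Sum>b\<in>Basis. (?Df x v \<bullet> b) *\<^sub>R ?Dg (f x) b)" for v
      by (subst euclidean_representation[symmetric])
        (simp add: linear_sum linear_scale)
    with has_derivative_compose[OF f g] show ?thesis by simp
  qed
  then show ?case
  proof (rule diff_times_on_SucI[OF \<open>open S\<close>])
    fix v
    show "diff_times_on n S (\<lambda>x. \<Sum>b\<in>Basis. (?Df x v \<bullet> b) *\<^sub>R ?Dg (f x) b)"
      by (intro diff_times_on_sum[OF \<open>open S\<close>]
          diff_times_on_bilinear[OF bounded_bilinear_scaleR \<open>open S\<close>]
          diff_times_on_bilinear[OF bounded_bilinear_inner \<open>open S\<close>]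
          diff_times_on_const Suc.IH diff_times_on_pred[OF Suc.prems(1)]
          diff_times_on_SucD(2)[OF Suc.prems(1)] diff_times_on_SucD(2)[OF Suc.prems(2)])
  qed
qed

lemma diff_times_on_vector_derivativeI:
  fixes f :: "real \<Rightarrow> 'b::real_normed_vector"
  assumes "open S" "\<And>x. x \<in> S \<Longrightarrow> (f has_vector_derivative f' x) (at x)" "diff_times_on n S f'"
  shows "diff_times_on (Suc n) S f"
  using assms(1,2) unfolding has_vector_derivative_def
  by (rule diff_times_on_SucI)
    (auto intro!: diff_times_on_bilinear[OF bounded_bilinear_scaleR] diff_times_on_const assms)

section \<open>Calculus of smooth maps, and smoothness of the elementary functions\<close>

lemma smooth_on_cong:
  assumes "open S" "\<And>x. x \<in> S \<Longrightarrow> f x = g x" "smooth_on S f"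
  shows "smooth_on S g"
  using assms diff_times_on_cong unfolding smooth_on_def by blast

lemma smooth_on_subset: "smooth_on S f \<Longrightarrow> T \<subseteq> S \<Longrightarrow> smooth_on T f"
  using diff_times_on_subset unfolding smooth_on_def by blast

lemma smooth_on_open_local:
  assumes "\<And>x. x \<in> S \<Longrightarrow> \<exists>U. open U \<and> x \<in> U \<and> smooth_on U f"
  shows "smooth_on S f"
  using assms diff_times_on_open_local unfolding smooth_on_def by meson

lemma smooth_on_has_derivative:
  assumes "smooth_on S f" "x \<in> S"
  shows "(f has_derivative frechet_derivative f (at x)) (at x)"
  using assms diff_times_on_SucD(1) unfolding smooth_on_def by blast

lemma smooth_on_frechet_derivative:
  "smooth_on S f \<Longrightarrow> smooth_on S (\<lambda>x. frechet_derivative f (at x) v)"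
  using diff_times_on_SucD(2) unfolding smooth_on_def by blast

lemma smooth_on_imp_continuous_on: "smooth_on S f \<Longrightarrow> continuous_on S f"
  unfolding smooth_on_def by (metis diff_times_on.simps(1))

lemma smooth_on_const: "smooth_on S (\<lambda>x. c)"
  by (simp add: smooth_on_def diff_times_on_const)

lemma smooth_on_add:
  "open S \<Longrightarrow> smooth_on S f \<Longrightarrow> smooth_on S g \<Longrightarrow> smooth_on S (\<lambda>x. f x + g x)"
  by (simp add: smooth_on_def diff_times_on_add)

lemma smooth_on_bilinear:
  "bounded_bilinear h \<Longrightarrow> open S \<Longrightarrow> smooth_on S f \<Longrightarrow> smooth_on S g \<Longrightarrow> smooth_on S (\<lambda>x. h (f x) (g x))"
  by (simp add: smooth_on_def diff_times_on_bilinear)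

lemmas smooth_on_mult = smooth_on_bilinear[OF bounded_bilinear_mult]
  and smooth_on_scaleR = smooth_on_bilinear[OF bounded_bilinear_scaleR]

lemma smooth_on_linear: "bounded_linear L \<Longrightarrow> open S \<Longrightarrow> smooth_on S L"
  by (simp add: smooth_on_def diff_times_on_linear)

lemma smooth_on_compose:
  fixes f :: "'a::real_normed_vector \<Rightarrow> 'b::euclidean_space"
  shows "smooth_on T g \<Longrightarrow> open S \<Longrightarrow> open T \<Longrightarrow> f ` S \<subseteq> T \<Longrightarrow> smooth_on S f \<Longrightarrow> smooth_on S (\<lambda>x. g (f x))"
  using diff_times_on_compose unfolding smooth_on_def by blast

lemma smooth_on_linear_compose:
  fixes f :: "'a::real_normed_vector \<Rightarrow> 'b::euclidean_space"
  shows "bounded_linear L \<Longrightarrow> open S \<Longrightarrow> smooth_on S f \<Longrightarrow> smooth_on S (\<lambda>x. L (f x))"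
  by (rule smooth_on_compose[OF smooth_on_linear[of L UNIV]]) auto

lemma smooth_on_minus:
  fixes f :: "'a::real_normed_vector \<Rightarrow> 'b::euclidean_space"
  shows "open S \<Longrightarrow> smooth_on S f \<Longrightarrow> smooth_on S (\<lambda>x. - f x)"
  by (rule smooth_on_linear_compose[OF bounded_linear_minus[OF bounded_linear_ident]])

lemma smooth_on_diff:
  fixes f g :: "'a::real_normed_vector \<Rightarrow> 'b::euclidean_space"
  shows "open S \<Longrightarrow> smooth_on S f \<Longrightarrow> smooth_on S g \<Longrightarrow> smooth_on S (\<lambda>x. f x - g x)"
  using smooth_on_add[of S f "\<lambda>x. - g x"] by (auto intro: smooth_on_minus)

lemma smooth_on_power:
  fixes f :: "'a::real_normed_vector \<Rightarrow> real"
  shows "open S \<Longrightarrow> smooth_on S f \<Longrightarrow> smooth_on S (\<lambda>x. f x ^ n)"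
  by (induction n) (auto intro: smooth_on_const smooth_on_mult)

lemma smooth_on_Pair:
  fixes f :: "'a::real_normed_vector \<Rightarrow> 'b::euclidean_space" and g :: "'a \<Rightarrow> 'c::euclidean_space"
  assumes "open S" "smooth_on S f" "smooth_on S g"
  shows "smooth_on S (\<lambda>x. (f x, g x))"
proof -
  have "bounded_linear (\<lambda>u::'b. (u, 0::'c))" "bounded_linear (\<lambda>u::'c. (0::'b, u))"
    by (auto intro!: bounded_linear_intros)
  then have "smooth_on S (\<lambda>x. (f x, 0) + (0, g x))"
    using assms by (intro smooth_on_add[OF assms(1)]) (auto intro: smooth_on_linear_compose)
  then show ?thesis by simp
qed

lemma smooth_on_real_derivativeI:
  fixes f :: "real \<Rightarrow> real"
  assumes "open S" "\<And>x. x \<in> S \<Longrightarrow> (f has_real_derivative f' x) (at x)" "smooth_on S f'"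
  shows "smooth_on S f"
  unfolding smooth_on_def
proof
  fix n
  have "diff_times_on (Suc n) S f"
    using assms(1)
  proof (rule diff_times_on_vector_derivativeI)
    show "(f has_vector_derivative f' x) (at x)" if "x \<in> S" for x
      using assms(2)[OF that] by (simp only: has_real_derivative_iff_has_vector_derivative)
    show "diff_times_on n S f'"
      using assms(3) by (simp add: smooth_on_def)
  qed
  then show "diff_times_on n S f" by (rule diff_times_on_pred)
qed

lemma smooth_on_sin_cos: "smooth_on UNIV (sin :: real \<Rightarrow> real)" "smooth_on UNIV (cos :: real \<Rightarrow> real)"
proof -
  have "diff_times_on n UNIV (sin :: real \<Rightarrow> real) \<and> diff_times_on n UNIV (cos :: real \<Rightarrow> real)" for n
  proof (induction n)
    case 0
    show ?case by (auto intro: continuous_intros)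
  next
    case (Suc n)
    have *: "diff_times_on n UNIV (\<lambda>x::real. (-1) * sin x)"
      using Suc by (intro diff_times_on_bilinear[OF bounded_bilinear_mult] diff_times_on_const) auto
    have "(sin has_vector_derivative cos x) (at x)" "(cos has_vector_derivative (-1) * sin x) (at x)" for x :: real
      by (auto intro!: derivative_eq_intros simp flip: has_real_derivative_iff_has_vector_derivative)
    with Suc * open_UNIV show ?case
      using diff_times_on_vector_derivativeI[of UNIV sin cos n]
        diff_times_on_vector_derivativeI[of UNIV cos "\<lambda>x. (-1) * sin x" n] by blast
  qed
  then show "smooth_on UNIV (sin :: real \<Rightarrow> real)" "smooth_on UNIV (cos :: real \<Rightarrow> real)"
    by (auto simp: smooth_on_def)
qed

lemma smooth_on_sin:
  fixes f :: "'a::real_normed_vector \<Rightarrow> real"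
  shows "open S \<Longrightarrow> smooth_on S f \<Longrightarrow> smooth_on S (\<lambda>x. sin (f x))"
  by (rule smooth_on_compose[OF smooth_on_sin_cos(1)]) auto

lemma smooth_on_cos:
  fixes f :: "'a::real_normed_vector \<Rightarrow> real"
  shows "open S \<Longrightarrow> smooth_on S f \<Longrightarrow> smooth_on S (\<lambda>x. cos (f x))"
  by (rule smooth_on_compose[OF smooth_on_sin_cos(2)]) auto

lemma smooth_on_inverse_real: "smooth_on (-{0}) (inverse :: real \<Rightarrow> real)"
proof -
  have "diff_times_on n (-{0}) (inverse :: real \<Rightarrow> real)" for n
  proof (induction n)
    case 0
    show ?case by (auto intro!: continuous_intros)
  next
    case (Suc n)
    then have "diff_times_on n (-{0}) (\<lambda>x::real. (-1) * (inverse x * inverse x))"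
      by (intro diff_times_on_bilinear[OF bounded_bilinear_mult] diff_times_on_const) auto
    then show ?case
      by (rule diff_times_on_vector_derivativeI[rotated 2])
        (auto intro!: derivative_eq_intros simp: power2_eq_square
          simp flip: has_real_derivative_iff_has_vector_derivative)
  qed
  then show ?thesis by (auto simp: smooth_on_def)
qed

lemma smooth_on_inverse:
  fixes f :: "'a::real_normed_vector \<Rightarrow> real"
  shows "open S \<Longrightarrow> smooth_on S f \<Longrightarrow> (\<And>x. x \<in> S \<Longrightarrow> f x \<noteq> 0) \<Longrightarrow> smooth_on S (\<lambda>x. inverse (f x))"
  by (rule smooth_on_compose[OF smooth_on_inverse_real]) auto

lemma smooth_on_divide:
  fixes f g :: "'a::real_normed_vector \<Rightarrow> real"
  shows "open S \<Longrightarrow> smooth_on S f \<Longrightarrow> smooth_on S g \<Longrightarrow> (\<And>x. x \<in> S \<Longrightarrow> g x \<noteq> 0) \<Longrightarrow> smooth_on S (\<lambda>x. f x / g x)"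
  by (simp add: divide_inverse smooth_on_mult smooth_on_inverse)

lemma smooth_on_sqrt_real: "smooth_on {0<..} sqrt"
proof -
  have "diff_times_on n {0<..} sqrt" for n
  proof (induction n)
    case 0
    show ?case by (auto intro!: continuous_intros)
  next
    case (Suc n)
    have "diff_times_on n {0<..} (\<lambda>x. inverse (sqrt x) * (1/2))"
      by (intro diff_times_on_bilinear[OF bounded_bilinear_mult] diff_times_on_const
          diff_times_on_compose[OF _ _ _ Suc, of "-{0}"])
        (use smooth_on_inverse_real in \<open>auto simp: smooth_on_def\<close>)
    then show ?case
      by (rule diff_times_on_vector_derivativeI[rotated 2])
        (auto intro!: derivative_eq_intros
          simp flip: has_real_derivative_iff_has_vector_derivative)
  qed
  then show ?thesis by (auto simp: smooth_on_def)
qed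

lemma smooth_on_sqrt:
  fixes f :: "'a::real_normed_vector \<Rightarrow> real"
  shows "open S \<Longrightarrow> smooth_on S f \<Longrightarrow> (\<And>x. x \<in> S \<Longrightarrow> f x > 0) \<Longrightarrow> smooth_on S (\<lambda>x. sqrt (f x))"
  by (rule smooth_on_compose[OF smooth_on_sqrt_real]) auto

lemma smooth_on_id: "open S \<Longrightarrow> smooth_on S (\<lambda>x. x)"
  by (rule smooth_on_linear[OF bounded_linear_ident])

lemma smooth_on_arctan:
  fixes f :: "'a::real_normed_vector \<Rightarrow> real"
  assumes "open S" "smooth_on S f"
  shows "smooth_on S (\<lambda>x. arctan (f x))"
proof (rule smooth_on_compose[of UNIV arctan])
  show "smooth_on UNIV arctan"
  proof (rule smooth_on_real_derivativeI)
    show "smooth_on UNIV (\<lambda>x::real. inverse (1 + x^2))"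
      by (intro smooth_on_inverse smooth_on_add smooth_on_const smooth_on_power smooth_on_id)
        (auto simp: add_nonneg_eq_0_iff)
    show "(arctan has_real_derivative inverse (1 + x^2)) (at x)" for x
      by (rule DERIV_arctan)
  qed auto
qed (use assms in auto)

lemma smooth_on_arsinh:
  fixes f :: "'a::real_normed_vector \<Rightarrow> real"
  assumes "open S" "smooth_on S f"
  shows "smooth_on S (\<lambda>x. arsinh (f x))"
proof (rule smooth_on_compose[of UNIV arsinh])
  show "smooth_on UNIV (arsinh :: real \<Rightarrow> real)"
  proof (rule smooth_on_real_derivativeI)
    show "smooth_on UNIV (\<lambda>x::real. inverse (sqrt (x^2 + 1)))"
      by (intro smooth_on_inverse smooth_on_add smooth_on_const smooth_on_power smooth_on_id smooth_on_sqrt)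
        (auto simp: add_nonneg_eq_0_iff add_nonneg_pos)
    show "(arsinh has_real_derivative inverse (sqrt (x^2 + 1))) (at x)" for x :: real
      using arsinh_real_has_field_derivative[of x UNIV] by (simp add: inverse_eq_divide)
  qed auto
qed (use assms in auto)

lemmas smooth_intros =
  smooth_on_const smooth_on_id smooth_on_add smooth_on_diff smooth_on_minus smooth_on_mult
  smooth_on_scaleR smooth_on_power smooth_on_sin smooth_on_cos smooth_on_divide smooth_on_inverse
  smooth_on_sqrt smooth_on_arctan smooth_on_arsinh smooth_on_Pair

section \<open>Mixed partial derivatives, antiderivatives and division\<close>

text \<open>The mean value theorem is applied twice: along \<open>u\<close> to the difference of
  \<open>f\<close> across a step in direction \<open>v\<close>, then along \<open>v\<close> to
  \<open>?D\<close>. The second difference is symmetric in \<open>u\<close> and \<open>v\<close>,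
  and this symmetry passes to the second derivatives.\<close>

lemma mixed_second_difference:
  fixes f :: "'a::real_normed_vector \<Rightarrow> real"
  assumes f: "smooth_on (ball w r) f" and t: "0 < t" "t * (norm u + norm v) < r"
  obtains p where "norm (p - w) \<le> t * (norm u + norm v)"
    "f (w + t *\<^sub>R u + t *\<^sub>R v) - f (w + t *\<^sub>R u) - f (w + t *\<^sub>R v) + f w =
      t\<^sup>2 * frechet_derivative (\<lambda>z. frechet_derivative f (at z) u) (at p) v"
proof -
  let ?D = "\<lambda>z. frechet_derivative f (at z) u"
  have near: "norm (a *\<^sub>R u + b *\<^sub>R v) \<le> t * (norm u + norm v)" if "0 \<le> a" "a \<le> t" "0 \<le> b" "b \<le> t" for a b
  proof -
    have "norm (a *\<^sub>R u + b *\<^sub>R v) \<le> a * norm u + b * norm v"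
      using that by (intro order_trans[OF norm_triangle_ineq]) simp
    also have "\<dots> \<le> t * (norm u + norm v)"
      using that by (simp add: distrib_left add_mono mult_right_mono)
    finally show ?thesis .
  qed
  have inb: "w + a *\<^sub>R u + b *\<^sub>R v \<in> ball w r" if "0 \<le> a" "a \<le> t" "0 \<le> b" "b \<le> t" for a b
  proof -
    have "dist w (w + z) = norm z" for z :: 'a
      by (simp add: dist_norm)
    then have "dist w (w + a *\<^sub>R u + b *\<^sub>R v) = norm (a *\<^sub>R u + b *\<^sub>R v)"
      by (metis add.assoc)
    with near[OF that] t(2) show ?thesis by simp
  qed
  have Df: "((\<lambda>s. f (c s)) has_real_derivative frechet_derivative f (at (c s)) e) (at s)"
    if "(c has_vector_derivative e) (at s)" "c s \<in> ball w r" for c e and s :: real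
  proof -
    have d: "(f has_derivative frechet_derivative f (at (c s))) (at (c s))"
      using f that(2) by (rule smooth_on_has_derivative)
    from has_derivative_compose[OF that(1)[unfolded has_vector_derivative_def] d]
    have "((\<lambda>s. f (c s)) has_derivative (\<lambda>x. frechet_derivative f (at (c s)) (x *\<^sub>R e))) (at s)" .
    moreover have "frechet_derivative f (at (c s)) (x *\<^sub>R e) = frechet_derivative f (at (c s)) e * x" for x
      using linear_scale[OF has_derivative_linear[OF d]] by simp
    ultimately show ?thesis by (simp add: has_field_derivative_def)
  qed
  have sD: "smooth_on (ball w r) ?D"
    using f by (rule smooth_on_frechet_derivative)
  have DD: "((\<lambda>s. ?D (c s)) has_real_derivative frechet_derivative ?D (at (c s)) e) (at s)"
    if "(c has_vector_derivative e) (at s)" "c s \<in> ball w r" for c e and s :: real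
  proof -
    have d: "(?D has_derivative frechet_derivative ?D (at (c s))) (at (c s))"
      using sD that(2) by (rule smooth_on_has_derivative)
    from has_derivative_compose[OF that(1)[unfolded has_vector_derivative_def] d]
    have "((\<lambda>s. ?D (c s)) has_derivative (\<lambda>x. frechet_derivative ?D (at (c s)) (x *\<^sub>R e))) (at s)" .
    moreover have "frechet_derivative ?D (at (c s)) (x *\<^sub>R e) = frechet_derivative ?D (at (c s)) e * x" for x
      using linear_scale[OF has_derivative_linear[OF d]] by simp
    ultimately show ?thesis by (simp add: has_field_derivative_def)
  qed
  have line: "((\<lambda>s. w + s *\<^sub>R u + b *\<^sub>R v) has_vector_derivative u) (at s)"
    "((\<lambda>s. w + b *\<^sub>R u + s *\<^sub>R v) has_vector_derivative v) (at s)" for b s :: real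
    by (auto intro!: derivative_eq_intros simp: has_vector_derivative_def)
  let ?g = "\<lambda>s. f (w + s *\<^sub>R u + t *\<^sub>R v) - f (w + s *\<^sub>R u + 0 *\<^sub>R v)"
  have "(?g has_real_derivative (?D (w + s *\<^sub>R u + t *\<^sub>R v) - ?D (w + s *\<^sub>R u + 0 *\<^sub>R v))) (at s)"
    if "0 \<le> s" "s \<le> t" for s
    using that t by (intro DERIV_diff Df line inb) auto
  from MVT2[OF t(1) this] obtain s where s: "0 < s" "s < t"
    "?g t - ?g 0 = t * (?D (w + s *\<^sub>R u + t *\<^sub>R v) - ?D (w + s *\<^sub>R u + 0 *\<^sub>R v))"
    by auto
  have "((\<lambda>x. ?D (w + s *\<^sub>R u + x *\<^sub>R v)) has_real_derivative
      frechet_derivative ?D (at (w + s *\<^sub>R u + x *\<^sub>R v)) v) (at x)" if "0 \<le> x" "x \<le> t" for x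
    using that s by (intro DD line inb) auto
  from MVT2[OF t(1) this] obtain x where x: "0 < x" "x < t"
    "?D (w + s *\<^sub>R u + t *\<^sub>R v) - ?D (w + s *\<^sub>R u + 0 *\<^sub>R v) =
      t * frechet_derivative ?D (at (w + s *\<^sub>R u + x *\<^sub>R v)) v"
    by auto
  show ?thesis
  proof (rule that)
    show "norm ((w + s *\<^sub>R u + x *\<^sub>R v) - w) \<le> t * (norm u + norm v)"
      using near[of s x] s x by (simp add: algebra_simps)
    show "f (w + t *\<^sub>R u + t *\<^sub>R v) - f (w + t *\<^sub>R u) - f (w + t *\<^sub>R v) + f w =
      t\<^sup>2 * frechet_derivative ?D (at (w + s *\<^sub>R u + x *\<^sub>R v)) v"
      using s(3) x(3) by (simp add: power2_eq_square)
  qed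
qed

text \<open>One and the same second difference equals \<open>?A p\<close> and \<open>?B q\<close>,
  up to the factor \<open>t^2\<close>, at points \<open>p\<close>, \<open>q\<close> close to
  \<open>w\<close>. By continuity both values lie within half the supposed gap of
  \<open>?A w\<close> and \<open>?B w\<close>.\<close>

lemma mixed_partials_commute_real:
  fixes f :: "'a::real_normed_vector \<Rightarrow> real"
  assumes "open V" "smooth_on V f" "w \<in> V"
  shows "frechet_derivative (\<lambda>z. frechet_derivative f (at z) u) (at w) v =
    frechet_derivative (\<lambda>z. frechet_derivative f (at z) v) (at w) u" (is "?A w = ?B w")
proof (rule ccontr)
  assume ne: "?A w \<noteq> ?B w"
  define e where "e = \<bar>?A w - ?B w\<bar> / 2"
  have "e > 0" using ne by (simp add: e_def)
  have "isCont ?A w" "isCont ?B w"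
    using assms smooth_on_imp_continuous_on[OF smooth_on_frechet_derivative[OF smooth_on_frechet_derivative[OF assms(2)]]]
    by (simp_all add: continuous_on_eq_continuous_at)
  then obtain d1 d2 where d: "d1 > 0" "d2 > 0"
    "\<And>p. dist p w < d1 \<Longrightarrow> dist (?A p) (?A w) < e" "\<And>p. dist p w < d2 \<Longrightarrow> dist (?B p) (?B w) < e"
    using \<open>e > 0\<close> unfolding continuous_at_eps_delta by (metis dist_commute)
  obtain r where r: "r > 0" "ball w r \<subseteq> V"
    using assms openE by blast
  define m where "m = min r (min d1 d2)"
  \<comment> \<open>The parallelogram with sides \<open>t u\<close>, \<open>t v\<close> must stay in
    the ball of radius \<open>m\<close>; the summand 1 keeps the denominator positive for
    \<open>u = v = 0\<close>.\<close>
  define t where "t = m / (2 * (norm u + norm v + 1))"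
  have m: "m > 0" "m \<le> r" "m \<le> d1" "m \<le> d2" using r d by (auto simp: m_def)
  have K: "norm u + norm v + 1 > 0"
    using norm_ge_zero[of u] norm_ge_zero[of v] by linarith
  have t: "t > 0" using m K by (simp add: t_def)
  have "t * (norm u + norm v) < t * (2 * (norm u + norm v + 1))"
  proof (rule mult_strict_left_mono[OF _ t])
    show "norm u + norm v < 2 * (norm u + norm v + 1)" using K by simp
  qed
  also have "\<dots> = m"
    using K unfolding t_def by (metis mult.commute nonzero_eq_divide_eq less_numeral_extra(3) mult_pos_pos zero_less_numeral)
  finally have tm: "t * (norm u + norm v) < m" .
  have f: "smooth_on (ball w r) f"
    using assms(2) r(2) by (rule smooth_on_subset)
  have tr: "t * (norm u + norm v) < r" "t * (norm v + norm u) < r"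
    using tm m by (simp_all add: add.commute)
  obtain p where p: "norm (p - w) \<le> t * (norm u + norm v)"
    "f (w + t *\<^sub>R u + t *\<^sub>R v) - f (w + t *\<^sub>R u) - f (w + t *\<^sub>R v) + f w = t\<^sup>2 * ?A p"
    using mixed_second_difference[OF f t tr(1)] .
  obtain q where q: "norm (q - w) \<le> t * (norm v + norm u)"
    "f (w + t *\<^sub>R v + t *\<^sub>R u) - f (w + t *\<^sub>R v) - f (w + t *\<^sub>R u) + f w = t\<^sup>2 * ?B q"
    using mixed_second_difference[OF f t tr(2)] .
  have "t\<^sup>2 * ?A p = t\<^sup>2 * ?B q"
    using p(2) q(2) by (simp add: algebra_simps)
  then have "?A p = ?B q" using t by simp
  moreover have "dist (?A p) (?A w) < e" "dist (?B q) (?B w) < e"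
    using p(1) q(1) tm m by (intro d; simp add: dist_norm add.commute)+
  moreover have "\<bar>?A w - ?B w\<bar> \<le> \<bar>?A p - ?A w\<bar> + \<bar>?A p - ?B w\<bar>"
    by linarith
  ultimately show False
    unfolding e_def dist_real_def by (simp add: field_simps)
qed

lemma smooth_on_has_vector_derivative:
  fixes f :: "real \<Rightarrow> 'b::real_normed_vector"
  assumes "smooth_on S f" "x \<in> S"
  shows "(f has_vector_derivative frechet_derivative f (at x) 1) (at x)"
proof -
  have d: "(f has_derivative frechet_derivative f (at x)) (at x)"
    using assms by (rule smooth_on_has_derivative)
  have "frechet_derivative f (at x) = (\<lambda>t. t *\<^sub>R frechet_derivative f (at x) 1)"
  proof
    show "frechet_derivative f (at x) t = t *\<^sub>R frechet_derivative f (at x) 1" for t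
      using linear_scale[OF has_derivative_linear[OF d], of t 1] by simp
  qed
  with d show ?thesis unfolding has_vector_derivative_def by (rule subst[rotated])
qed

lemma smooth_antiderivative:
  fixes h :: "real \<Rightarrow> real"
  assumes J: "open J" "is_interval J" and h: "smooth_on J h"
  obtains H where "smooth_on J H" "\<And>y. y \<in> J \<Longrightarrow> (H has_real_derivative h y) (at y)"
proof (cases "J = {}")
  case True
  then show ?thesis using that[OF smooth_on_const] by blast
next
  case False
  then obtain c where c: "c \<in> J" by auto
  let ?H = "\<lambda>u. LBINT y=c..u. h y"
  have der: "(?H has_real_derivative h y) (at y)" if y: "y \<in> J" for y
  proof -
    obtain r where r: "r > 0" "ball y r \<subseteq> J" using J(1) y openE by blast
    \<comment> \<open>The compact interval from \<open>a\<close> to \<open>b\<close> contains the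
      base point \<open>c\<close> and has \<open>y\<close> in its interior, so the derivative within
      it is a two-sided one.\<close>
    define a b where "a = min c (y - r/2)" and "b = max c (y + r/2)"
    have "y - r/2 \<in> J" "y + r/2 \<in> J" using r by (auto intro!: subsetD[OF r(2)] simp: dist_real_def)
    then have "a \<in> J" "b \<in> J" using c by (auto simp: a_def b_def min_def max_def)
    then have "{a..b} \<subseteq> J"
      using mem_is_interval_1_I[OF J(2)] by (meson atLeastAtMost_iff subsetI)
    then have "(?H has_vector_derivative h y) (at y within {a..b})"
      using continuous_on_subset[OF smooth_on_imp_continuous_on[OF h]] r
      by (intro interval_integral_FTC2[of a c b]) (auto simp: a_def b_def)
    moreover have "at y within {a..b} = at y"
      using r by (intro at_within_interior) (auto simp: a_def b_def)
    ultimately show ?thesis by (simp add: has_real_derivative_iff_has_vector_derivative)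
  qed
  with that[OF smooth_on_real_derivativeI[OF J(1) _ h]] show ?thesis by blast
qed

text \<open>Hadamard's lemma: \<open>g y\<close> is the integral over \<open>t\<close> in [0, 1] of
  \<open>u'\<close> at \<open>y0 + t (y - y0)\<close>. It is smooth by repeated differentiation
  under the integral sign.\<close>

lemma smooth_division:
  fixes u :: "real \<Rightarrow> 'b::euclidean_space"
  assumes J: "open J" "is_interval J" "y0 \<in> J" and u: "smooth_on J u" "u y0 = 0"
  obtains g where "smooth_on J g" "\<And>y. y \<in> J \<Longrightarrow> u y = (y - y0) *\<^sub>R g y"
proof -
  define U where "U k = ((\<lambda>f x. frechet_derivative f (at x) 1) ^^ k) u" for k
  have U0: "U 0 = u" and USuc: "U (Suc k) = (\<lambda>x. frechet_derivative (U k) (at x) 1)" for k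
    by (simp_all add: U_def)
  have sU: "smooth_on J (U k)" for k
    by (induction k) (use U0 u(1) USuc smooth_on_frechet_derivative in metis)+
  have dU: "(U k has_vector_derivative U (Suc k) x) (at x)" if "x \<in> J" for k x
    unfolding USuc by (rule smooth_on_has_vector_derivative[OF sU that])
  have cU: "continuous_on J (U k)" for k
    using sU smooth_on_imp_continuous_on by blast
  have seg: "y0 + t * (y - y0) \<in> J" if "y \<in> J" "t \<in> cbox 0 1" for t y
  proof -
    have "(1 - t) *\<^sub>R y0 + t *\<^sub>R y \<in> J"
      using is_interval_convex[OF J(2)] J(3) that unfolding convex_alt by auto
    then show ?thesis by (simp add: algebra_simps)
  qed
  \<comment> \<open>Each differentiation in \<open>y\<close> brings down one factor
    \<open>t\<close>, so \<open>G k\<close> is the \<open>k\<close>-th derivative of the quotient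
    \<open>G 0\<close>.\<close>
  define G where "G k y = integral (cbox 0 1) (\<lambda>t. t ^ k *\<^sub>R U (Suc k) (y0 + t * (y - y0)))" for k y
  have cont: "continuous_on (J \<times> cbox 0 1) (\<lambda>(y, t). t ^ m *\<^sub>R U k (y0 + t * (y - y0)))" for k m
    unfolding split_beta
    by (intro continuous_intros continuous_on_compose2[OF cU]) (auto simp: seg)
  have dG: "(G k has_vector_derivative G (Suc k) y) (at y)" if y: "y \<in> J" for k y
  proof -
    have "((\<lambda>y. integral (cbox 0 1) (\<lambda>t. t ^ k *\<^sub>R U (Suc k) (y0 + t * (y - y0)))) has_vector_derivative
      integral (cbox 0 1) (\<lambda>t. t ^ Suc k *\<^sub>R U (Suc (Suc k)) (y0 + t * (y - y0)))) (at y within J)"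
    proof (rule leibniz_rule_vector_derivative[OF _ _ _ y is_interval_convex[OF J(2)]])
      fix z t :: real assume z: "z \<in> J" and t: "t \<in> cbox 0 1"
      have "((\<lambda>z. y0 + t * (z - y0)) has_vector_derivative t) (at z within J)"
        by (auto intro!: derivative_eq_intros simp flip: has_real_derivative_iff_has_vector_derivative)
      from vector_diff_chain_within[OF this has_vector_derivative_at_within[OF dU[OF seg[OF z t]]]]
      have "((\<lambda>z. U (Suc k) (y0 + t * (z - y0))) has_vector_derivative
          t *\<^sub>R U (Suc (Suc k)) (y0 + t * (z - y0))) (at z within J)"
        by (simp add: o_def)
      from has_vector_derivative_scaleR[OF DERIV_const this, of "t ^ k"]
      show "((\<lambda>z. t ^ k *\<^sub>R U (Suc k) (y0 + t * (z - y0))) has_vector_derivative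
          t ^ Suc k *\<^sub>R U (Suc (Suc k)) (y0 + t * (z - y0))) (at z within J)"
        by (simp add: mult.commute)
    next
      fix z assume "z \<in> J"
      then show "(\<lambda>t. t ^ k *\<^sub>R U (Suc k) (y0 + t * (z - y0))) integrable_on cbox 0 1"
        by (intro integrable_continuous continuous_intros continuous_on_compose2[OF cU]) (auto simp: seg)
    qed (rule cont)
    then show ?thesis
      using at_within_open[OF y J(1)] by (simp add: G_def[abs_def])
  qed
  have "diff_times_on n J (G k)" for n k
  proof (induction n arbitrary: k)
    case 0
    have "isCont (G k) y" if "y \<in> J" for y
      using dG[OF that] by (rule has_vector_derivative_continuous)
    then show ?case by (simp add: continuous_at_imp_continuous_on)
  next
    case (Suc n)
    show ?case by (rule diff_times_on_vector_derivativeI[OF J(1) dG Suc])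
  qed
  then have "smooth_on J (G 0)" by (simp add: smooth_on_def)
  moreover have "u y = (y - y0) *\<^sub>R G 0 y" if y: "y \<in> J" for y
  proof -
    have "((\<lambda>t. (y - y0) *\<^sub>R U 1 (y0 + t * (y - y0))) has_integral u (y0 + 1 * (y - y0)) - u (y0 + 0 * (y - y0))) {0..1}"
    proof (rule fundamental_theorem_of_calculus)
      fix t :: real assume t: "t \<in> {0..1}"
      have a: "((\<lambda>t. y0 + t * (y - y0)) has_vector_derivative (y - y0)) (at t within {0..1})"
        by (auto intro!: derivative_eq_intros simp flip: has_real_derivative_iff_has_vector_derivative)
      have "y0 + t * (y - y0) \<in> J" using seg y t by simp
      from vector_diff_chain_within[OF a has_vector_derivative_at_within[OF dU[OF this, of 0]]]
      show "((\<lambda>t. u (y0 + t * (y - y0))) has_vector_derivative (y - y0) *\<^sub>R U 1 (y0 + t * (y - y0))) (at t within {0..1})"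
        by (simp add: o_def U0)
    qed simp
    then show ?thesis
      by (simp add: G_def u(2) integral_unique[symmetric] flip: integral_cmul)
  qed
  ultimately show ?thesis using that by blast
qed

section \<open>Polar coordinates\<close>

lemma mixed_partials_commute:
  fixes f :: "'a::real_normed_vector \<Rightarrow> 'b::euclidean_space"
  assumes "open V" "smooth_on V f" "w \<in> V"
  shows "frechet_derivative (\<lambda>z. frechet_derivative f (at z) u) (at w) v =
    frechet_derivative (\<lambda>z. frechet_derivative f (at z) v) (at w) u"
proof (rule euclidean_eqI)
  fix b :: 'b
  let ?g = "\<lambda>z. f z \<bullet> b"
  have comp: "frechet_derivative (\<lambda>z. F z \<bullet> b) (at z) = (\<lambda>e. frechet_derivative F (at z) e \<bullet> b)"
    if "smooth_on V F" "z \<in> V" for F :: "'a \<Rightarrow> 'b" and z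
    using bounded_linear.has_derivative[OF bounded_linear_inner_left[of b] smooth_on_has_derivative[OF that]]
    by (rule frechet_derivative_at[symmetric])
  have "frechet_derivative (\<lambda>z. frechet_derivative f (at z) e) (at w) e' \<bullet> b =
    frechet_derivative (\<lambda>z. frechet_derivative ?g (at z) e) (at w) e'" for e e'
  proof -
    have "((\<lambda>z. frechet_derivative f (at z) e \<bullet> b) has_derivative
        (\<lambda>e'. frechet_derivative (\<lambda>z. frechet_derivative f (at z) e) (at w) e' \<bullet> b)) (at w)"
      using bounded_linear.has_derivative[OF bounded_linear_inner_left[of b]
          smooth_on_has_derivative[OF smooth_on_frechet_derivative[OF assms(2)] assms(3)]] .
    then have "((\<lambda>z. frechet_derivative ?g (at z) e) has_derivative
        (\<lambda>e'. frechet_derivative (\<lambda>z. frechet_derivative f (at z) e) (at w) e' \<bullet> b)) (at w)"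
      by (rule has_derivative_transform_within_open[OF _ assms(1,3)]) (simp add: comp[OF assms(2)])
    from fun_cong[OF frechet_derivative_at[OF this]] show ?thesis .
  qed
  moreover have "smooth_on V ?g"
    using smooth_on_linear_compose[OF bounded_linear_inner_left assms(1,2)] .
  ultimately show "frechet_derivative (\<lambda>z. frechet_derivative f (at z) u) (at w) v \<bullet> b =
    frechet_derivative (\<lambda>z. frechet_derivative f (at z) v) (at w) u \<bullet> b"
    using mixed_partials_commute_real[OF assms(1) _ assms(3)] by metis
qed

section \<open>Smooth phases of curves in the complex plane\<close>

lemma has_vector_derivative_cis:
  assumes "(f has_real_derivative d) (at t)"
  shows "((\<lambda>t. cis (f t)) has_vector_derivative (of_real d * \<i> * cis (f t))) (at t)"
proof -
  have "(f has_derivative (\<lambda>x. x * d)) (at t)"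
    using assms by (simp add: has_field_derivative_def mult.commute[of _ d])
  from has_derivative_cis[OF this] show ?thesis
    by (simp add: has_vector_derivative_def scaleR_conv_of_real mult.assoc)
qed

lemma smooth_on_Re:
  fixes f :: "'a::real_normed_vector \<Rightarrow> complex"
  shows "open S \<Longrightarrow> smooth_on S f \<Longrightarrow> smooth_on S (\<lambda>x. Re (f x))"
  by (rule smooth_on_linear_compose[OF bounded_linear_Re])

lemma smooth_on_Im:
  fixes f :: "'a::real_normed_vector \<Rightarrow> complex"
  shows "open S \<Longrightarrow> smooth_on S f \<Longrightarrow> smooth_on S (\<lambda>x. Im (f x))"
  by (rule smooth_on_linear_compose[OF bounded_linear_Im])

text \<open>The angular velocity \<open>Im (u' / u)\<close> extends smoothly across a simple zero:
  there \<open>u\<close> is the real factor \<open>y - y0\<close> times a nonvanishing function, and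
  a real factor does not turn. Its antiderivative is the phase up to a constant; at a zero the
  modulus changes sign instead of the phase jumping by \<open>pi\<close>.\<close>

lemma smooth_signed_polar:
  fixes u :: "real \<Rightarrow> complex"
  assumes J: "open J" "is_interval J" and u: "smooth_on J u"
    and simple: "\<And>y. y \<in> J \<Longrightarrow> u y = 0 \<Longrightarrow> frechet_derivative u (at y) 1 \<noteq> 0"
  obtains \<sigma> \<xi> where "smooth_on J \<sigma>" "smooth_on J \<xi>" "\<forall>y\<in>J. u y = of_real (\<sigma> y) * cis (- \<xi> y)"
proof -
  define u1 where "u1 y = frechet_derivative u (at y) 1" for y
  define u2 where "u2 y = frechet_derivative u1 (at y) 1" for y
  have s1: "smooth_on J u1"
    unfolding u1_def by (rule smooth_on_frechet_derivative[OF u])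
  have d0: "(u has_vector_derivative u1 y) (at y)" and d1: "(u1 has_vector_derivative u2 y) (at y)" if "y \<in> J" for y
    using smooth_on_has_vector_derivative[OF u that] smooth_on_has_vector_derivative[OF s1 that]
    by (simp_all add: u1_def u2_def)
  \<comment> \<open>At a zero \<open>y0\<close>, writing \<open>u = (y - y0) g\<close> gives
    \<open>u' = g\<close> and \<open>u'' = 2 g'\<close> there, so the second branch is
    \<open>Im (g' / g)\<close>, the limit of the first.\<close>
  define h where "h y = (if u y \<noteq> 0 then Im (u1 y / u y) else Im (u2 y / (2 * u1 y)))" for y
  define v where "v y = (if u y \<noteq> 0 then u y else u1 y)" for y
  have v0: "v y \<noteq> 0" if "y \<in> J" for y
    using simple[OF that] by (simp add: v_def u1_def)
  define loc where "loc g y \<longleftrightarrow> g y \<noteq> 0 \<and> h y = Im (frechet_derivative g (at y) 1 / g y) \<and>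
    (\<exists>m. m \<noteq> 0 \<and> v y = of_real m * g y)" for g y
  \<comment> \<open>locally \<open>u\<close> is a nowhere vanishing smooth \<open>g\<close>, multiplied by \<open>y - y0\<close> if \<open>u\<close> vanishes at \<open>y0\<close>\<close>
  have local: "\<exists>U g. open U \<and> y0 \<in> U \<and> U \<subseteq> J \<and> smooth_on U g \<and> (\<forall>y\<in>U. loc g y)"
    if y0: "y0 \<in> J" for y0
  proof (cases "u y0 = 0")
    case False
    let ?U = "J \<inter> u -` (-{0})"
    have "open ?U"
      using smooth_on_imp_continuous_on[OF u] J(1) by (intro continuous_open_preimage) auto
    moreover have "smooth_on ?U u" by (rule smooth_on_subset[OF u]) auto
    moreover have "loc u y" if "y \<in> ?U" for y
      unfolding loc_def
    proof (intro conjI exI[of _ 1])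
      show "v y = of_real 1 * u y" "h y = Im (frechet_derivative u (at y) 1 / u y)" "u y \<noteq> 0"
        using that by (simp_all add: h_def v_def u1_def)
    qed simp
    moreover have "y0 \<in> ?U" "?U \<subseteq> J" using y0 False by auto
    ultimately show ?thesis by blast
  next
    case True
    obtain g where g: "smooth_on J g" "\<And>y. y \<in> J \<Longrightarrow> u y = (y - y0) *\<^sub>R g y"
      using smooth_division[OF J y0 u True] by blast
    have dlin: "((\<lambda>y. y - y0) has_real_derivative 1) (at y)" for y
      by (auto intro!: derivative_eq_intros)
    define g1 where "g1 y = frechet_derivative g (at y) 1" for y
    have dg: "(g has_vector_derivative g1 y) (at y)" if "y \<in> J" for y
      unfolding g1_def by (rule smooth_on_has_vector_derivative[OF g(1) that])
    have u1: "u1 y = g y + (y - y0) *\<^sub>R g1 y" if "y \<in> J" for y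
    proof -
      have "((\<lambda>y. (y - y0) *\<^sub>R g y) has_vector_derivative (g y + (y - y0) *\<^sub>R g1 y)) (at y)"
        using has_vector_derivative_scaleR[OF dlin dg[OF that]] by (simp only: scaleR_one add.commute)
      then have "(u has_vector_derivative (g y + (y - y0) *\<^sub>R g1 y)) (at y)"
        by (rule has_vector_derivative_transform_within_open[OF _ J(1) that]) (simp add: g(2))
      with d0[OF that] show ?thesis by (rule vector_derivative_unique_at)
    qed
    have "(g1 has_vector_derivative frechet_derivative g1 (at y0) 1) (at y0)"
      using smooth_on_has_vector_derivative[OF _ y0, of g1] smooth_on_frechet_derivative[OF g(1)]
      by (simp add: g1_def[abs_def])
    from has_vector_derivative_add[OF dg[OF y0] has_vector_derivative_scaleR[OF dlin this]]
    have "((\<lambda>y. g y + (y - y0) *\<^sub>R g1 y) has_vector_derivative 2 * g1 y0) (at y0)"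
      by simp
    then have "(u1 has_vector_derivative 2 * g1 y0) (at y0)"
      by (rule has_vector_derivative_transform_within_open[OF _ J(1) y0]) (simp add: u1)
    with d1[OF y0] have u2: "u2 y0 = 2 * g1 y0" by (rule vector_derivative_unique_at)
    have "g y0 \<noteq> 0" using v0[OF y0] u1[OF y0] True by (simp add: v_def)
    let ?U = "J \<inter> g -` (-{0})"
    have "open ?U"
      using smooth_on_imp_continuous_on[OF g(1)] J(1) by (intro continuous_open_preimage) auto
    moreover have "loc g y" if y: "y \<in> ?U" for y
    proof (cases "y = y0")
      case True
      have "v y = of_real 1 * g y" "h y = Im (g1 y / g y)"
        using u1[OF y0] u2 \<open>u y0 = 0\<close> True by (simp_all add: h_def v_def)
      then show ?thesis using y unfolding g1_def loc_def by (intro conjI exI[of _ 1]) simp_all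
    next
      case False
      have "u1 y / u y = of_real (1 / (y - y0)) + g1 y / g y"
        using y False by (simp add: u1 g(2) add_divide_distrib scaleR_conv_of_real)
      then have "v y = of_real (y - y0) * g y" "h y = Im (g1 y / g y)"
        using y False by (simp_all add: h_def v_def g(2) scaleR_conv_of_real)
      then show ?thesis using y False unfolding g1_def loc_def by (intro conjI exI[of _ "y - y0"]) simp_all
    qed
    moreover have "y0 \<in> ?U" "?U \<subseteq> J" using y0 \<open>g y0 \<noteq> 0\<close> by auto
    moreover have "smooth_on ?U g" by (rule smooth_on_subset[OF g(1)]) auto
    ultimately show ?thesis by blast
  qed
  have "smooth_on J h"
  proof (rule smooth_on_open_local)
    fix y0 assume "y0 \<in> J"
    from local[OF this] obtain U g where U: "open U" "y0 \<in> U" "smooth_on U g" and lg: "\<forall>y\<in>U. loc g y"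
      by blast
    then have g: "\<And>y. y \<in> U \<Longrightarrow> g y \<noteq> 0" "\<And>y. y \<in> U \<Longrightarrow> h y = Im (frechet_derivative g (at y) 1 / g y)"
      by (simp_all add: loc_def)
    have "smooth_on U (\<lambda>y. (Im (frechet_derivative g (at y) 1) * Re (g y) - Re (frechet_derivative g (at y) 1) * Im (g y))
        / ((Re (g y))\<^sup>2 + (Im (g y))\<^sup>2))"
      using U g(1) smooth_on_frechet_derivative[OF U(3), of 1]
      by (intro smooth_on_divide smooth_intros smooth_on_Re smooth_on_Im)
        (auto simp: complex_eq_iff sum_power2_eq_zero_iff)
    then have "smooth_on U h"
      by (rule smooth_on_cong[OF U(1), rotated]) (simp add: g Im_divide)
    then show "\<exists>U. open U \<and> y0 \<in> U \<and> smooth_on U h" using U by blast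
  qed
  then obtain H where H: "smooth_on J H" "\<And>y. y \<in> J \<Longrightarrow> (H has_real_derivative h y) (at y)"
    using smooth_antiderivative[OF J] by blast
  \<comment> \<open>Division by the conjugate forgets nonzero real factors. Hence \<open>Q\<close>,
    the doubled phase minus \<open>2 H\<close>, is differentiable although \<open>v\<close> itself
    jumps at the zeros of \<open>u\<close>.\<close>
  define Q where "Q y = v y * cis (- H y) / cnj (v y * cis (- H y))" for y
  have dQ: "(Q has_vector_derivative 0) (at y0)" if "y0 \<in> J" for y0
  proof -
    from local[OF that] obtain U g where U: "open U" "y0 \<in> U" "smooth_on U g" and lg: "\<forall>y\<in>U. loc g y"
      by blast
    then have g: "\<And>y. y \<in> U \<Longrightarrow> g y \<noteq> 0" "\<And>y. y \<in> U \<Longrightarrow> h y = Im (frechet_derivative g (at y) 1 / g y)"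
        "\<And>y. y \<in> U \<Longrightarrow> \<exists>m. m \<noteq> 0 \<and> v y = of_real m * g y"
      by (simp_all add: loc_def)
    define G where "G y = g y * cis (- H y)" for y
    define r where "r = Re (frechet_derivative g (at y0) 1 / g y0)"
    have dg: "(g has_vector_derivative frechet_derivative g (at y0) 1) (at y0)"
      using smooth_on_has_vector_derivative[OF U(3,2)] .
    have "((\<lambda>y. cis (- H y)) has_vector_derivative (of_real (- h y0) * \<i> * cis (- H y0))) (at y0)"
      using DERIV_minus[OF H(2)[OF that]] by (rule has_vector_derivative_cis)
    from has_vector_derivative_mult[OF dg this]
    have "(G has_vector_derivative
        (g y0 * (of_real (- h y0) * \<i> * cis (- H y0)) + frechet_derivative g (at y0) 1 * cis (- H y0))) (at y0)"
      unfolding G_def[abs_def] .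
    moreover have "g y0 * (of_real (- h y0) * \<i> * cis (- H y0)) + frechet_derivative g (at y0) 1 * cis (- H y0) = of_real r * G y0"
    proof -
      have "frechet_derivative g (at y0) 1 / g y0 = of_real r + \<i> * of_real (h y0)"
        using g(2)[OF U(2)] by (simp add: r_def complex_eq_iff)
      then have "frechet_derivative g (at y0) 1 = (of_real r + \<i> * of_real (h y0)) * g y0"
        using g(1)[OF U(2)] by (metis nonzero_divide_eq_eq)
      then show ?thesis by (simp add: G_def algebra_simps)
    qed
    ultimately have dG: "(G has_vector_derivative of_real r * G y0) (at y0)" by simp
    have G0: "G y0 \<noteq> 0" using g(1)[OF U(2)] by (simp add: G_def cis_neq_zero)
    have "((\<lambda>y. cnj (G y)) has_vector_derivative cnj (of_real r * G y0)) (at y0)"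
      using dG by (rule bounded_linear.has_vector_derivative[OF bounded_linear_cnj])
    from has_derivative_divide'[OF dG[unfolded has_vector_derivative_def] this[unfolded has_vector_derivative_def]]
    have "((\<lambda>y. G y / cnj (G y)) has_vector_derivative 0) (at y0)"
      using G0 by (simp add: has_vector_derivative_def scaleR_conv_of_real mult_ac)
    then show ?thesis
    proof (rule has_vector_derivative_transform_within_open[OF _ U(1,2)])
      show "G y / cnj (G y) = Q y" if "y \<in> U" for y
        using g(3)[OF that] by (auto simp: Q_def G_def)
    qed
  qed
  obtain c where c: "\<And>y. y \<in> J \<Longrightarrow> Q y = c"
  proof (rule has_vector_derivative_zero_constant[OF is_interval_convex[OF J(2)] has_vector_derivative_at_within[OF dQ]])
    fix c assume "\<And>y. y \<in> J \<Longrightarrow> Q y = c"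
    then show thesis by (rule that)
  qed
  \<comment> \<open>A number \<open>w\<close> with \<open>w = c * cnj w\<close> becomes real after
    multiplication by \<open>cis a\<close> as soon as \<open>c * cis (2 * a) = 1\<close>.\<close>
  define a where "a = - Arg c / 2"
  define \<xi> where "\<xi> y = - H y + a" for y
  have real: "u y * cis (\<xi> y) = of_real (Re (u y * cis (\<xi> y)))" if y: "y \<in> J" for y
  proof -
    have w0: "v y * cis (- H y) \<noteq> 0" using v0[OF y] by (simp add: cis_neq_zero)
    have nc: "norm c = 1"
      using w0 by (simp add: c[OF y, symmetric] Q_def norm_divide norm_mult)
    then have "c = cis (Arg c)" by (metis cis_Arg div_by_1 norm_zero of_real_1 sgn_eq zero_neq_one)
    have "c * cis a = cnj (cis a)"
    proof -
      have "c * cis a = cis (Arg c) * cis a" using \<open>c = cis (Arg c)\<close> by simp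
      also have "\<dots> = cis (- a)" by (simp add: cis_mult a_def)
      finally show ?thesis by (simp add: cis_cnj)
    qed
    moreover have "v y * cis (- H y) = c * cnj (v y * cis (- H y))"
    proof -
      have "c = v y * cis (- H y) / cnj (v y * cis (- H y))"
        using c[OF y] unfolding Q_def by (rule sym)
      then show ?thesis
        using w0 complex_cnj_zero_iff nonzero_eq_divide_eq by metis
    qed
    ultimately have "v y * cis (- H y) * cis a = cnj (v y * cis (- H y)) * cnj (cis a)"
      by (metis mult.assoc mult.commute)
    then have "v y * cis (- H y) * cis a = cnj (v y * cis (- H y) * cis a)"
      by (rule trans) (rule complex_cnj_mult[symmetric])
    moreover have "v y * cis (- H y) * cis a = v y * cis (\<xi> y)"
      by (simp add: \<xi>_def mult.assoc cis_mult)
    ultimately have "v y * cis (\<xi> y) = cnj (v y * cis (\<xi> y))"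
      by (simp only:)
    then have "Im (v y * cis (\<xi> y)) = 0"
      by (metis cnj.sel(2) equal_neg_zero)
    then have "Im (u y * cis (\<xi> y)) = 0"
    proof (cases "u y = 0")
      case False
      with \<open>Im (v y * cis (\<xi> y)) = 0\<close> show ?thesis unfolding v_def by (simp only: if_True simp_thms)
    qed simp
    then show ?thesis by (simp only: complex_eq_iff Re_complex_of_real Im_complex_of_real simp_thms)
  qed
  show ?thesis
  proof (rule that[of "\<lambda>y. Re (u y) * cos (\<xi> y) - Im (u y) * sin (\<xi> y)" \<xi>])
    show "smooth_on J \<xi>" unfolding \<xi>_def by (intro smooth_intros J H)
    then show "smooth_on J (\<lambda>y. Re (u y) * cos (\<xi> y) - Im (u y) * sin (\<xi> y))"
      by (intro smooth_intros smooth_on_Re smooth_on_Im J u)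
    show "\<forall>y\<in>J. u y = of_real (Re (u y) * cos (\<xi> y) - Im (u y) * sin (\<xi> y)) * cis (- \<xi> y)"
    proof
      fix y assume that: "y \<in> J"
      have "u y = u y * cis (\<xi> y) * cis (- \<xi> y)" by (simp only: mult.assoc cis_mult add.right_inverse cis_zero mult_1_right)
      also have "\<dots> = of_real (Re (u y * cis (\<xi> y))) * cis (- \<xi> y)" using real[OF that] by (rule arg_cong)
      finally show "u y = of_real (Re (u y) * cos (\<xi> y) - Im (u y) * sin (\<xi> y)) * cis (- \<xi> y)"
        by (simp only: times_complex.sel cis.sel)
    qed
  qed
qed

text \<open>Without zeros the signed modulus keeps one sign on the interval, and a negative sign is
  absorbed by adding \<open>pi\<close> to the phase.\<close>

lemma smooth_polar:
  fixes u :: "real \<Rightarrow> complex"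
  assumes J: "open J" "is_interval J" and u: "smooth_on J u" and nz: "\<And>y. y \<in> J \<Longrightarrow> u y \<noteq> 0"
  obtains \<xi> where "smooth_on J \<xi>" "\<forall>y\<in>J. u y = of_real (norm (u y)) * cis (- \<xi> y)"
proof -
  have simple: "u y = 0 \<Longrightarrow> frechet_derivative u (at y) 1 \<noteq> 0" if "y \<in> J" for y
    using nz[OF that] by (rule notE)
  obtain \<sigma> \<xi> where s: "smooth_on J \<sigma>" "smooth_on J \<xi>" and s3: "\<forall>y\<in>J. u y = of_real (\<sigma> y) * cis (- \<xi> y)"
    using smooth_signed_polar[OF J u simple] .
  have \<sigma>0: "\<sigma> y \<noteq> 0" if "y \<in> J" for y
    using nz[OF that] bspec[OF s3 that] by (metis mult_zero_left of_real_0)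
  have norm: "norm (u y) = \<bar>\<sigma> y\<bar>" if "y \<in> J" for y
    using bspec[OF s3 that] by (metis norm_cis norm_mult norm_of_real mult.right_neutral)
  have "connected (\<sigma> ` J)"
    using smooth_on_imp_continuous_on[OF s(1)] is_interval_connected[OF J(2)] by (rule connected_continuous_image)
  then have iv: "is_interval (\<sigma> ` J)" by (simp add: is_interval_connected_1)
  have "0 \<in> \<sigma> ` J" if "y \<in> J" "z \<in> J" "\<sigma> y \<le> 0" "0 \<le> \<sigma> z" for y z
    using mem_is_interval_1_I[OF iv imageI[OF that(1)] imageI[OF that(2)] that(3,4)] .
  then have "\<not> (\<sigma> y \<le> 0 \<and> 0 \<le> \<sigma> z)" if "y \<in> J" "z \<in> J" for y z
    using that \<sigma>0 by (metis imageE)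
  then consider (pos) "\<And>y. y \<in> J \<Longrightarrow> \<sigma> y > 0" | (neg) "\<And>y. y \<in> J \<Longrightarrow> \<sigma> y < 0"
    by (meson linorder_not_le)
  then show ?thesis
  proof cases
    case pos
    have "\<forall>y\<in>J. u y = of_real (norm (u y)) * cis (- \<xi> y)"
    proof
      fix y assume that: "y \<in> J"
      show "u y = of_real (norm (u y)) * cis (- \<xi> y)"
        using bspec[OF s3 that] norm[OF that] pos[OF that] by simp
    qed
    with s(2) show ?thesis by (rule that)
  next
    case neg
    have "\<forall>y\<in>J. u y = of_real (norm (u y)) * cis (- (\<xi> y + pi))"
    proof
      fix y assume that: "y \<in> J"
      have "cis (- (\<xi> y + pi)) = - cis (- \<xi> y)"
        by (simp add: complex_eq_iff)
      then show "u y = of_real (norm (u y)) * cis (- (\<xi> y + pi))"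
        using bspec[OF s3 that] norm[OF that] neg[OF that] by simp
    qed
    with smooth_on_add[OF J(1) s(2) smooth_on_const] show ?thesis by (rule that)
  qed
qed

section \<open>Local inverses and changes of parameters\<close>

lemma frechet_derivative_pair:
  fixes f :: "real \<times> real \<Rightarrow> 'b::real_normed_vector"
  assumes "(f has_derivative f') (at w)"
  shows "f' (p, q) = p *\<^sub>R f' (1, 0) + q *\<^sub>R f' (0, 1)"
proof -
  have "linear f'" using assms by (rule has_derivative_linear)
  then have "f' (p *\<^sub>R (1, 0) + q *\<^sub>R (0, 1)) = p *\<^sub>R f' (1, 0) + q *\<^sub>R f' (0, 1)"
    by (simp only: linear_add linear_scale)
  then show ?thesis by simp
qed

text \<open>Cramer's rule, kept explicit so that the derivative of a local inverse is visibly a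
  rational function of first partial derivatives.\<close>

lemma inj_linear_plane:
  fixes L :: "real \<times> real \<Rightarrow> real \<times> real"
  assumes L: "linear L" "inj L" and e: "L (1, 0) = (a, c)" "L (0, 1) = (b, d)"
  shows "a * d - b * c \<noteq> 0"
    and "inv L (p, q) = ((d * p - b * q) / (a * d - b * c), (a * q - c * p) / (a * d - b * c))"
proof -
  have Lpq: "L (p, q) = (p * a + q * b, p * c + q * d)" for p q
  proof -
    have "L (p *\<^sub>R (1, 0) + q *\<^sub>R (0, 1)) = p *\<^sub>R L (1, 0) + q *\<^sub>R L (0, 1)"
      using L(1) by (simp only: linear_add linear_scale)
    then show ?thesis by (simp add: e)
  qed
  show nz: "a * d - b * c \<noteq> 0"
  proof
    assume 0: "a * d - b * c = 0"
    have "L (d, - c) = L (0, 0)" "L (- b, a) = L (0, 0)" using 0 by (simp_all add: Lpq algebra_simps)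
    then have "d = 0" "c = 0" "b = 0" "a = 0" using injD[OF L(2)] by (metis prod.inject neg_equal_0_iff_equal)+
    then have "L (1, 0) = L (0, 0)" by (simp add: Lpq)
    then show False using injD[OF L(2)] by (metis prod.inject zero_neq_one)
  qed
  show "inv L (p, q) = ((d * p - b * q) / (a * d - b * c), (a * q - c * p) / (a * d - b * c))"
  proof (rule inv_f_eq[OF L(2)])
    have "((d * p - b * q) * a + (a * q - c * p) * b) = p * (a * d - b * c)"
      "((d * p - b * q) * c + (a * q - c * p) * d) = q * (a * d - b * c)" by algebra+
    then show "L ((d * p - b * q) / (a * d - b * c), (a * q - c * p) / (a * d - b * c)) = (p, q)"
      using nz by (simp add: Lpq add_divide_distrib[symmetric])
  qed
qed

text \<open>The inverse function theorem yields a differentiable \<open>G\<close>, and smoothness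
  follows by bootstrapping: by Cramer's rule the derivative of \<open>G\<close> is rational in the
  partial derivatives of \<Phi> evaluated along \<open>G\<close>, so each order of differentiability
  of \<open>G\<close> gives the next.\<close>

lemma smooth_local_inverse:
  fixes \<Phi> :: "real \<times> real \<Rightarrow> real \<times> real"
  assumes V: "open V" "w0 \<in> V" and \<Phi>: "smooth_on V \<Phi>" and inj: "inj (frechet_derivative \<Phi> (at w0))"
  obtains I J G where "open I" "is_interval I" "open J" "is_interval J" "\<Phi> w0 \<in> I \<times> J"
    "smooth_on (I \<times> J) G" "G ` (I \<times> J) \<subseteq> V" "open (G ` (I \<times> J))" "G (\<Phi> w0) = w0"
    "\<forall>z\<in>I \<times> J. \<Phi> (G z) = z"
    "\<forall>z\<in>I \<times> J. inj (frechet_derivative \<Phi> (at (G z))) \<and>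
      frechet_derivative G (at z) = inv (frechet_derivative \<Phi> (at (G z)))"
proof -
  let ?D = "\<lambda>w. frechet_derivative \<Phi> (at w)"
  have d\<Phi>: "(\<Phi> has_derivative ?D w) (at w)" if "w \<in> V" for w
    using \<Phi> that by (rule smooth_on_has_derivative)
  define f' where "f' w = Blinfun (?D w)" for w
  have f': "blinfun_apply (f' w) = ?D w" if "w \<in> V" for w
    unfolding f'_def by (rule bounded_linear_Blinfun_apply[OF has_derivative_bounded_linear[OF d\<Phi>[OF that]]])
  have cont: "continuous_on V f'"
  proof (rule continuous_on_blinfun_componentwise)
    fix i :: "real \<times> real" assume "i \<in> Basis"
    have "continuous_on V (\<lambda>w. ?D w i)"
      using smooth_on_frechet_derivative[OF \<Phi>] by (rule smooth_on_imp_continuous_on)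
    then show "continuous_on V (\<lambda>w. blinfun_apply (f' w) i)"
      by (rule continuous_on_eq) (simp only: f')
  qed
  have lin: "linear (?D w)" if "w \<in> V" for w using d\<Phi>[OF that] by (rule has_derivative_linear)
  obtain g where g: "linear g" "g \<circ> ?D w0 = id"
    using linear_injective_left_inverse[OF lin[OF V(2)] inj] by blast
  have "Blinfun g o\<^sub>L f' w0 = id_blinfun"
  proof (rule blinfun_eqI)
    fix i
    have "blinfun_apply (Blinfun g) = g"
      using g(1) by (intro bounded_linear_Blinfun_apply) (simp add: linear_conv_bounded_linear)
    then show "blinfun_apply (Blinfun g o\<^sub>L f' w0) i = blinfun_apply id_blinfun i"
      using fun_cong[OF g(2), of i] by (simp add: f'[OF V(2)])
  qed
  moreover have "(\<Phi> has_derivative blinfun_apply (f' w)) (at w)" if "w \<in> V" for w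
    using d\<Phi>[OF that] f'[OF that] by (simp only:)
  ultimately obtain U' V' G G' where U: "open U'" "U' \<subseteq> V" "w0 \<in> U'" "open V'" "\<Phi> w0 \<in> V'"
    "homeomorphism U' V' \<Phi> G"
    and G': "\<And>y. y \<in> V' \<Longrightarrow> (G has_derivative G' y) (at y)"
    "\<And>y. y \<in> V' \<Longrightarrow> G' y = inv (blinfun_apply (f' (G y)))"
    and bij: "\<And>y. y \<in> V' \<Longrightarrow> bij (blinfun_apply (f' (G y)))"
    using inverse_function_theorem[of V \<Phi> f' w0 "Blinfun g"] V cont by metis
  have GV: "G y \<in> U'" "G y \<in> V" "\<Phi> (G y) = y" if "y \<in> V'" for y
    using U(2,6) that unfolding homeomorphism_def by auto
  have bijD: "inj (?D (G y))" and G'D: "G' y = inv (?D (G y))" if "y \<in> V'" for y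
    using bij[OF that] G'(2)[OF that] f'[OF GV(2)[OF that]] by (simp_all add: bij_def)
  define d where "d i w = ?D w i" for i w
  have Gform: "G' z (p, q) =
    ((snd (d (0,1) (G z)) * p - fst (d (0,1) (G z)) * q) /
      (fst (d (1,0) (G z)) * snd (d (0,1) (G z)) - fst (d (0,1) (G z)) * snd (d (1,0) (G z))),
     (fst (d (1,0) (G z)) * q - snd (d (1,0) (G z)) * p) /
      (fst (d (1,0) (G z)) * snd (d (0,1) (G z)) - fst (d (0,1) (G z)) * snd (d (1,0) (G z))))"
    and det: "fst (d (1,0) (G z)) * snd (d (0,1) (G z)) - fst (d (0,1) (G z)) * snd (d (1,0) (G z)) \<noteq> 0"
    if "z \<in> V'" for z p q
    using inj_linear_plane[OF lin[OF GV(2)[OF that]] bijD[OF that], of "fst (d (1,0) (G z))" "snd (d (1,0) (G z))"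
       "fst (d (0,1) (G z))" "snd (d (0,1) (G z))"]
    by (simp_all add: d_def G'D[OF that])
  have sd: "smooth_on V (\<lambda>w. fst (d i w))" "smooth_on V (\<lambda>w. snd (d i w))" for i
    unfolding d_def using smooth_on_frechet_derivative[OF \<Phi>, of i]
    by (rule smooth_on_linear_compose[OF bounded_linear_fst V(1)],
        rule smooth_on_linear_compose[OF bounded_linear_snd V(1)])
  have "diff_times_on n V' G" for n
  proof (induction n)
    case 0
    have "isCont G y" if "y \<in> V'" for y using G'(1)[OF that] by (rule has_derivative_continuous)
    then show ?case by (simp add: continuous_at_imp_continuous_on)
  next
    case (Suc n)
    show ?case
    proof (rule diff_times_on_SucI[OF U(4) G'(1)])
      fix v :: "real \<times> real"
      obtain p q where v: "v = (p, q)" by (cases v)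
      define a b c e where "a = (\<lambda>z. fst (d (1,0) (G z)))" and "b = (\<lambda>z. fst (d (0,1) (G z)))"
        and "c = (\<lambda>z. snd (d (1,0) (G z)))" and "e = (\<lambda>z. snd (d (0,1) (G z)))"
      have comp: "diff_times_on n V' (\<lambda>z. F (G z))" if "smooth_on V F" for F :: "real \<times> real \<Rightarrow> real"
      proof (rule diff_times_on_compose[OF U(4) V(1) _ Suc])
        show "G ` V' \<subseteq> V" using GV(2) by (rule image_subsetI)
        show "diff_times_on n V F" using that unfolding smooth_on_def by (rule spec)
      qed
      have n: "diff_times_on n V' a" "diff_times_on n V' b" "diff_times_on n V' c" "diff_times_on n V' e"
        unfolding a_def b_def c_def e_def by (intro comp sd)+
      have mult: "diff_times_on n V' (\<lambda>z. F z * H z)" if "diff_times_on n V' F" "diff_times_on n V' H" for F H :: "real \<times> real \<Rightarrow> real"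
        using that by (rule diff_times_on_bilinear[OF bounded_bilinear_mult U(4)])
      have minus: "diff_times_on n V' (\<lambda>z. F z - H z)" if "diff_times_on n V' F" "diff_times_on n V' H" for F H :: "real \<times> real \<Rightarrow> real"
        using diff_times_on_add[OF U(4) that(1) mult[OF diff_times_on_const that(2)], of "-1"] by simp
      have inv: "diff_times_on n V' (\<lambda>z. inverse (a z * e z - b z * c z))"
      proof (rule diff_times_on_compose[OF U(4) _ _ minus[OF mult[OF n(1,4)] mult[OF n(2,3)]]])
        show "(\<lambda>z. a z * e z - b z * c z) ` V' \<subseteq> - {0}"
          using det unfolding a_def b_def c_def e_def by (intro image_subsetI) (simp only: Compl_iff singleton_iff not_False_eq_True)
        show "diff_times_on n (- {0}) (inverse :: real \<Rightarrow> real)"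
          using smooth_on_inverse_real unfolding smooth_on_def by (rule spec)
      qed (simp add: open_Compl)
      define X Y where "X = (\<lambda>z. (e z * p - b z * q) * inverse (a z * e z - b z * c z))"
        and "Y = (\<lambda>z. (a z * q - c z * p) * inverse (a z * e z - b z * c z))"
      have XY: "diff_times_on n V' X" "diff_times_on n V' Y"
        unfolding X_def Y_def by (intro mult minus n inv diff_times_on_const)+
      have "diff_times_on n V' (\<lambda>z. X z *\<^sub>R (1, 0) + Y z *\<^sub>R (0, 1 :: real))"
        by (intro diff_times_on_add[OF U(4)] diff_times_on_bilinear[OF bounded_bilinear_scaleR U(4)] XY diff_times_on_const)
      then show "diff_times_on n V' (\<lambda>z. G' z v)"
        by (rule diff_times_on_cong[OF U(4), rotated])
          (simp add: v Gform X_def Y_def a_def b_def c_def e_def divide_inverse)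
    qed
  qed
  then have sG: "smooth_on V' G" by (simp add: smooth_on_def)
  \<comment> \<open>The domain is shrunk to a product of intervals, the shape that the adapted
    coordinates require.\<close>
  obtain A B where AB: "open A" "open B" "\<Phi> w0 \<in> A \<times> B" "A \<times> B \<subseteq> V'"
    using open_prod_elim[OF U(4,5)] by blast
  obtain r where r: "r > 0" "ball (fst (\<Phi> w0)) r \<subseteq> A" using AB(1,3) openE by (metis mem_Times_iff)
  obtain s where s: "s > 0" "ball (snd (\<Phi> w0)) s \<subseteq> B" using AB(2,3) openE by (metis mem_Times_iff)
  let ?I = "ball (fst (\<Phi> w0)) r" and ?J = "ball (snd (\<Phi> w0)) s"
  have sub: "?I \<times> ?J \<subseteq> V'" using r(2) s(2) AB(4) by blast
  have "openin (top_of_set U') (G ` (?I \<times> ?J))"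
    using homeomorphism_imp_open_map[OF homeomorphism_symD[OF U(6)], of "?I \<times> ?J"] sub U(4)
    by (simp add: openin_open_eq open_Times)
  then have "open (G ` (?I \<times> ?J))" using U(1) by (metis openin_open_trans)
  show ?thesis
  proof (rule that[of ?I ?J G])
    show "smooth_on (?I \<times> ?J) G" using sG sub by (rule smooth_on_subset)
    show "G ` (?I \<times> ?J) \<subseteq> V" using GV(2) sub by blast
    show "open (G ` (?I \<times> ?J))" by fact
    show "G (\<Phi> w0) = w0" using U(3,6) by (simp add: homeomorphism_def)
    show "\<forall>z\<in>?I \<times> ?J. \<Phi> (G z) = z" using GV(3) sub by blast
    show "\<forall>z\<in>?I \<times> ?J. inj (?D (G z)) \<and> frechet_derivative G (at z) = inv (?D (G z))"
      using bijD G'D frechet_derivative_at[OF G'(1)] sub by (metis subsetD)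
    show "\<Phi> w0 \<in> ?I \<times> ?J" using r(1) s(1) by (simp add: mem_Times_iff)
  qed (auto simp: is_interval_ball_real)
qed

lemma local_param_reparam:
  assumes \<psi>: "local_param M \<A> (V, \<psi>)" and W: "open W" "smooth_on W G" "G ` W \<subseteq> V" "open (G ` W)"
    and \<Phi>: "smooth_on V \<Phi>" "\<And>z. z \<in> W \<Longrightarrow> \<Phi> (G z) = z"
  shows "local_param M \<A> (W, \<psi> \<circ> G)"
proof -
  have V: "open V" "inj_on \<psi> V" "\<psi> ` V \<subseteq> M" and tr: "\<And>d. d \<in> \<A> \<Longrightarrow> smooth_transition (V, \<psi>) d \<and> smooth_transition d (V, \<psi>)"
    using \<psi> by (auto simp: local_param_def)
  have inj: "inj_on (\<psi> \<circ> G) W"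
    using V(2) W(3) \<Phi>(2) by (intro comp_inj_on inj_on_inverseI[of W \<Phi>]) (auto intro: inj_on_subset)
  have "smooth_transition (W, \<psi> \<circ> G) (V0, \<phi>) \<and> smooth_transition (V0, \<phi>) (W, \<psi> \<circ> G)" if d: "(V0, \<phi>) \<in> \<A>" for V0 \<phi>
  proof
    define S where "S = V \<inter> \<psi> -` (\<phi> ` V0)"
    have S: "open S" "smooth_on S (inv_into V0 \<phi> \<circ> \<psi>)"
      using tr[OF d] by (simp_all add: smooth_transition_def S_def)
    define S1 where "S1 = W \<inter> G -` S"
    have "open S1" unfolding S1_def
      using smooth_on_imp_continuous_on[OF W(2)] W(1) S(1) by (rule continuous_open_preimage)
    moreover have "smooth_on S1 (\<lambda>z. (inv_into V0 \<phi> \<circ> \<psi>) (G z))"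
      using S(2) \<open>open S1\<close> S(1) by (rule smooth_on_compose) (use W(2) smooth_on_subset[of W G S1] in \<open>auto simp: S1_def\<close>)
    moreover have "W \<inter> (\<psi> \<circ> G) -` (\<phi> ` V0) = S1"
      using W(3) by (auto simp: S1_def S_def)
    ultimately show "smooth_transition (W, \<psi> \<circ> G) (V0, \<phi>)"
      by (simp add: smooth_transition_def o_def)
    define T where "T = V0 \<inter> \<phi> -` (\<psi> ` V)"
    define h where "h = inv_into V \<psi> \<circ> \<phi>"
    have T: "open T" "smooth_on T h"
      using tr[OF d] by (simp_all add: smooth_transition_def T_def h_def)
    define T1 where "T1 = T \<inter> h -` (G ` W)"
    have "open T1" unfolding T1_def
      using smooth_on_imp_continuous_on[OF T(2)] T(1) W(4) by (rule continuous_open_preimage)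
    have sT1: "smooth_on T1 (\<lambda>z. \<Phi> (h z))"
      using \<Phi>(1) \<open>open T1\<close> V(1) by (rule smooth_on_compose) (use T(2) smooth_on_subset[of T h T1] W(3) in \<open>auto simp: T1_def\<close>)
    have T1: "V0 \<inter> \<phi> -` ((\<psi> \<circ> G) ` W) = T1"
    proof (intro set_eqI iffI)
      fix z assume "z \<in> V0 \<inter> \<phi> -` ((\<psi> \<circ> G) ` W)"
      then obtain x where x: "z \<in> V0" "\<phi> z = \<psi> (G x)" "x \<in> W" by auto
      then have "h z = G x" using W(3) V(2) by (auto simp: h_def intro!: inv_into_f_f)
      then show "z \<in> T1" using x W(3) by (auto simp: T1_def T_def)
    next
      fix z assume z: "z \<in> T1"
      then obtain x where x: "x \<in> W" "h z = G x" unfolding T1_def by blast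
      have "\<psi> (h z) = \<phi> z" using z by (auto simp: T1_def T_def h_def intro!: f_inv_into_f)
      then have "\<phi> z = (\<psi> \<circ> G) x" using x(2) by simp
      with x(1) have "\<phi> z \<in> (\<psi> \<circ> G) ` W" by (rule image_eqI[rotated])
      then show "z \<in> V0 \<inter> \<phi> -` ((\<psi> \<circ> G) ` W)" using z by (auto simp: T1_def T_def)
    qed
    have eq: "\<Phi> (h z) = (inv_into W (\<psi> \<circ> G) \<circ> \<phi>) z" if z: "z \<in> T1" for z
    proof -
      obtain x where x: "x \<in> W" "h z = G x" using z unfolding T1_def by blast
      have "\<phi> z = \<psi> (h z)" using z by (auto simp: T1_def T_def h_def intro!: f_inv_into_f[symmetric])
      then have "inv_into W (\<psi> \<circ> G) (\<phi> z) = x" using x inv_into_f_f[OF inj x(1)] by simp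
      then show ?thesis using x \<Phi>(2) by simp
    qed
    have "smooth_on T1 (inv_into W (\<psi> \<circ> G) \<circ> \<phi>)"
      by (rule smooth_on_cong[OF \<open>open T1\<close> eq sT1])
    with T1 \<open>open T1\<close> show "smooth_transition (V0, \<phi>) (W, \<psi> \<circ> G)"
      by (simp add: smooth_transition_def)
  qed
  moreover have "(\<psi> \<circ> G) ` W \<subseteq> M" using V(3) W(3) by auto
  ultimately show ?thesis
    using W(1) inj by (auto simp: local_param_def)
qed

text \<open>The definition speaks about members of the atlas only. For any compatible
  parametrization the properties are transported by the chain rule through the transition map
  \<open>g\<close>, whose derivative is injective because \<open>h\<close> inverts \<open>g\<close>
  on the left.\<close>

lemma immersed_surface_local_param:
  assumes im: "immersed_surface \<kappa> \<tau> lam M \<A> f N" and \<psi>: "local_param M \<A> (V, \<psi>)"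
  shows "immersion_on V (f \<circ> \<psi>)" "smooth_on V (N \<circ> \<psi>)"
    "w \<in> V \<Longrightarrow> gtau \<kappa> \<tau> (f (\<psi> w)) (N (\<psi> w)) (frechet_derivative (f \<circ> \<psi>) (at w) v) = 0"
proof -
  have V: "open V" "inj_on \<psi> V" "\<psi> ` V \<subseteq> M" and tr: "\<And>d. d \<in> \<A> \<Longrightarrow> smooth_transition (V, \<psi>) d \<and> smooth_transition d (V, \<psi>)"
    using \<psi> by (auto simp: local_param_def)
  have main: "\<exists>S. open S \<and> w \<in> S \<and> smooth_on S (f \<circ> \<psi>) \<and> smooth_on S (N \<circ> \<psi>) \<and>
      inj (frechet_derivative (f \<circ> \<psi>) (at w)) \<and>
      (\<forall>v. gtau \<kappa> \<tau> (f (\<psi> w)) (N (\<psi> w)) (frechet_derivative (f \<circ> \<psi>) (at w) v) = 0)" if w: "w \<in> V" for w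
  proof -
    have "\<psi> w \<in> M" using V(3) w by auto
    then obtain V0 \<phi> where d: "(V0, \<phi>) \<in> \<A>" "\<psi> w \<in> \<phi> ` V0"
      using im by (force simp: immersed_surface_def smooth_surface_def)
    have \<phi>: "immersion_on V0 (f \<circ> \<phi>)" "smooth_on V0 (N \<circ> \<phi>)"
      and orth: "\<And>w v. w \<in> V0 \<Longrightarrow> gtau \<kappa> \<tau> (f (\<phi> w)) (N (\<phi> w)) (frechet_derivative (f \<circ> \<phi>) (at w) v) = 0"
      using im d(1) by (auto simp: immersed_surface_def)
    have V0: "open V0" "inj_on \<phi> V0"
      using im d(1) by (auto simp: immersed_surface_def smooth_surface_def local_param_def)
    define S where "S = V \<inter> \<psi> -` (\<phi> ` V0)"
    define g where "g = inv_into V0 \<phi> \<circ> \<psi>"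
    define T where "T = V0 \<inter> \<phi> -` (\<psi> ` V)"
    define h where "h = inv_into V \<psi> \<circ> \<phi>"
    have S: "open S" "smooth_on S g" and T: "open T" "smooth_on T h"
      using tr[OF d(1)] by (simp_all add: smooth_transition_def S_def g_def T_def h_def)
    have wS: "w \<in> S" using w d(2) by (simp add: S_def)
    have g: "g z \<in> V0" "\<phi> (g z) = \<psi> z" if "z \<in> S" for z
      using that by (auto simp: S_def g_def intro: inv_into_into f_inv_into_f)
    have gT: "g z \<in> T" "h (g z) = z" if "z \<in> S" for z
      using g[OF that] that V(2) by (auto simp: T_def h_def S_def intro: inv_into_f_f)
    have sub: "g ` S \<subseteq> V0" using g(1) by blast
    have "smooth_on S (\<lambda>z. (f \<circ> \<phi>) (g z))"
      using \<phi>(1) unfolding immersion_on_def by (intro smooth_on_compose[OF _ S(1) V0(1) sub S(2)]) (rule conjunct1)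
    then have sf: "smooth_on S (f \<circ> \<psi>)"
      by (rule smooth_on_cong[OF S(1), rotated]) (simp only: o_apply g(2))
    have "smooth_on S (\<lambda>z. (N \<circ> \<phi>) (g z))"
      by (rule smooth_on_compose[OF \<phi>(2) S(1) V0(1) sub S(2)])
    then have sN: "smooth_on S (N \<circ> \<psi>)"
      by (rule smooth_on_cong[OF S(1), rotated]) (simp only: o_apply g(2))
    let ?Dg = "frechet_derivative g (at w)" and ?Df = "frechet_derivative (f \<circ> \<phi>) (at (g w))"
    have dg: "(g has_derivative ?Dg) (at w)" using S(2) wS by (rule smooth_on_has_derivative)
    have "smooth_on V0 (f \<circ> \<phi>)" using \<phi>(1) by (simp add: immersion_on_def)
    then have "((f \<circ> \<phi>) has_derivative ?Df) (at (g w))"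
      using g(1)[OF wS] by (rule smooth_on_has_derivative)
    from has_derivative_compose[OF dg this]
    have "((f \<circ> \<psi>) has_derivative (\<lambda>v. ?Df (?Dg v))) (at w)"
      by (rule has_derivative_transform_within_open[OF _ S(1) wS]) (simp only: o_apply g(2))
    then have D: "frechet_derivative (f \<circ> \<psi>) (at w) = (\<lambda>v. ?Df (?Dg v))"
      by (rule frechet_derivative_at[symmetric])
    have "(h has_derivative frechet_derivative h (at (g w))) (at (g w))"
      using T(2) gT(1)[OF wS] by (rule smooth_on_has_derivative)
    from has_derivative_compose[OF dg this]
    have "((\<lambda>z. z) has_derivative (\<lambda>v. frechet_derivative h (at (g w)) (?Dg v))) (at w)"
      by (rule has_derivative_transform_within_open[OF _ S(1) wS]) (rule gT(2))
    then have id: "(\<lambda>v. frechet_derivative h (at (g w)) (?Dg v)) = (\<lambda>v. v)"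
      using has_derivative_ident by (rule has_derivative_unique)
    have "inj ?Dg"
    proof (rule inj_on_inverseI)
      show "frechet_derivative h (at (g w)) (?Dg v) = v" for v
        using id by (rule fun_cong)
    qed
    moreover have "inj ?Df" using \<phi>(1) g(1)[OF wS] unfolding immersion_on_def by blast
    ultimately have "inj (frechet_derivative (f \<circ> \<psi>) (at w))"
      unfolding D by (intro injI) (blast dest: injD)
    moreover have "gtau \<kappa> \<tau> (f (\<psi> w)) (N (\<psi> w)) (frechet_derivative (f \<circ> \<psi>) (at w) v) = 0" for v
      using orth[OF g(1)[OF wS], of "?Dg v"] by (simp only: D g(2)[OF wS])
    ultimately show ?thesis using S(1) wS sf sN by blast
  qed
  show "smooth_on V (N \<circ> \<psi>)"
  proof (rule smooth_on_open_local)
    show "\<exists>U. open U \<and> w \<in> U \<and> smooth_on U (N \<circ> \<psi>)" if "w \<in> V" for w using main[OF that] by blast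
  qed
  have "smooth_on V (f \<circ> \<psi>)"
  proof (rule smooth_on_open_local)
    show "\<exists>U. open U \<and> w \<in> U \<and> smooth_on U (f \<circ> \<psi>)" if "w \<in> V" for w using main[OF that] by blast
  qed
  moreover have "inj (frechet_derivative (f \<circ> \<psi>) (at w))" if "w \<in> V" for w using main[OF that] by blast
  ultimately show "immersion_on V (f \<circ> \<psi>)" unfolding immersion_on_def by blast
  show "gtau \<kappa> \<tau> (f (\<psi> w)) (N (\<psi> w)) (frechet_derivative (f \<circ> \<psi>) (at w) v) = 0" if "w \<in> V"
    using main[OF that] by blast
qed

section \<open>The frame of anti-de Sitter space\<close>

lemma vector_4 [simp]:
  "(vector [x, y, z, w] :: 'a::zero^4) $ 1 = x" "(vector [x, y, z, w] :: 'a^4) $ 2 = y"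
  "(vector [x, y, z, w] :: 'a^4) $ 3 = z" "(vector [x, y, z, w] :: 'a^4) $ 4 = w"
  unfolding vector_def by simp_all

lemma J_nth [simp]:
  "J1 x $ 1 = - x$2" "J1 x $ 2 = x$1" "J1 x $ 3 = - x$4" "J1 x $ 4 = x$3"
  "J2 x $ 1 = x$3" "J2 x $ 2 = - x$4" "J2 x $ 3 = x$1" "J2 x $ 4 = - x$2"
  "J3 x $ 1 = x$4" "J3 x $ 2 = x$3" "J3 x $ 3 = x$2" "J3 x $ 4 = x$1"
  by (simp_all add: J1_def J2_def J3_def vector_4)

lemma vec4_eqI:
  fixes u v :: "real^4"
  shows "u$1 = v$1 \<Longrightarrow> u$2 = v$2 \<Longrightarrow> u$3 = v$3 \<Longrightarrow> u$4 = v$4 \<Longrightarrow> u = v"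
  by (simp add: vec_eq_iff forall_4)

lemma linear_J: "linear J1" "linear J2" "linear J3"
  by (auto intro!: linearI vec4_eqI)

lemma bounded_linear_J: "bounded_linear J1" "bounded_linear J2" "bounded_linear J3"
  using linear_J by (simp_all add: linear_conv_bounded_linear)

lemma bounded_linear_X: "bounded_linear (X1 \<kappa>)" "bounded_linear (X2 \<kappa>)" "bounded_linear (X3 \<kappa>)"
  using bounded_linear_J by (auto simp: X1_def[abs_def] X2_def[abs_def] X3_def[abs_def] intro!: bounded_linear_intros bounded_linear_const_scaleR)

lemma bilinear_g0: "bounded_bilinear g0"
proof -
  have "bilinear g0"
    unfolding bilinear_def by (auto intro!: linearI simp: g0_def algebra_simps)
  then show ?thesis by (simp add: bilinear_conv_bounded_bilinear)
qed

lemma g0_simps: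
  "g0 (u + v) w = g0 u w + g0 v w" "g0 w (u + v) = g0 w u + g0 w v"
  "g0 (u - v) w = g0 u w - g0 v w" "g0 w (u - v) = g0 w u - g0 w v"
  "g0 (r *\<^sub>R u) w = r * g0 u w" "g0 w (r *\<^sub>R u) = r * g0 w u"
  "g0 (- u) w = - g0 u w" "g0 w (- u) = - g0 w u"
  by (simp_all add: g0_def algebra_simps)

lemma g0_commute: "g0 u v = g0 v u"
  by (simp add: g0_def algebra_simps)

lemma X_simps:
  "X1 \<kappa> (u + v) = X1 \<kappa> u + X1 \<kappa> v" "X1 \<kappa> (r *\<^sub>R u) = r *\<^sub>R X1 \<kappa> u"
  "X2 \<kappa> (u + v) = X2 \<kappa> u + X2 \<kappa> v" "X2 \<kappa> (r *\<^sub>R u) = r *\<^sub>R X2 \<kappa> u"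
  "X3 \<kappa> (u + v) = X3 \<kappa> u + X3 \<kappa> v" "X3 \<kappa> (r *\<^sub>R u) = r *\<^sub>R X3 \<kappa> u"
  using bounded_linear_X[of \<kappa>, THEN bounded_linear.linear] by (simp_all add: linear_add linear_scale)

text \<open>The relations of the split quaternions, with \<open>J1\<close> squaring to -1 and
  \<open>J2\<close>, \<open>J3\<close> to 1. All structure constants of the frame come from
  here.\<close>

lemma X_X:
  "X1 \<kappa> (X1 \<kappa> q) = (- (sqrt \<kappa> / 2)\<^sup>2) *\<^sub>R q" "X1 \<kappa> (X2 \<kappa> q) = (sqrt \<kappa> / 2) *\<^sub>R X3 \<kappa> q"
  "X1 \<kappa> (X3 \<kappa> q) = (- (sqrt \<kappa> / 2)) *\<^sub>R X2 \<kappa> q"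
  "X2 \<kappa> (X1 \<kappa> q) = (- (sqrt \<kappa> / 2)) *\<^sub>R X3 \<kappa> q" "X2 \<kappa> (X2 \<kappa> q) = (sqrt \<kappa> / 2)\<^sup>2 *\<^sub>R q"
  "X2 \<kappa> (X3 \<kappa> q) = (- (sqrt \<kappa> / 2)) *\<^sub>R X1 \<kappa> q"
  "X3 \<kappa> (X1 \<kappa> q) = (sqrt \<kappa> / 2) *\<^sub>R X2 \<kappa> q" "X3 \<kappa> (X2 \<kappa> q) = (sqrt \<kappa> / 2) *\<^sub>R X1 \<kappa> q"
  "X3 \<kappa> (X3 \<kappa> q) = (sqrt \<kappa> / 2)\<^sup>2 *\<^sub>R q"
  by (rule vec4_eqI; simp add: X1_def X2_def X3_def power2_eq_square)+

lemma AdS_g0: "q \<in> AdS \<kappa> \<longleftrightarrow> g0 q q = - 4 / \<kappa>"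
  by (simp add: AdS_def g0_def power2_eq_square)

lemma g0_X:
  assumes "\<kappa> > 0" "q \<in> AdS \<kappa>"
  shows "g0 (X1 \<kappa> q) (X1 \<kappa> q) = - 1" "g0 (X2 \<kappa> q) (X2 \<kappa> q) = 1" "g0 (X3 \<kappa> q) (X3 \<kappa> q) = 1"
proof -
  have s: "sqrt \<kappa> * sqrt \<kappa> = \<kappa>" using assms(1) by simp
  have "g0 (J1 q) (J1 q) = g0 q q" "g0 (J2 q) (J2 q) = - g0 q q" "g0 (J3 q) (J3 q) = - g0 q q"
    by (simp_all add: g0_def)
  moreover have "g0 q q = - 4 / \<kappa>" using assms(2) by (simp add: AdS_g0)
  ultimately show "g0 (X1 \<kappa> q) (X1 \<kappa> q) = - 1" "g0 (X2 \<kappa> q) (X2 \<kappa> q) = 1" "g0 (X3 \<kappa> q) (X3 \<kappa> q) = 1"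
    using assms(1) by (simp_all add: X1_def X2_def X3_def g0_simps mult.assoc[symmetric])
qed

lemma g0_X_orth [simp]:
  "g0 (X1 \<kappa> q) (X2 \<kappa> q) = 0" "g0 (X2 \<kappa> q) (X1 \<kappa> q) = 0" "g0 (X1 \<kappa> q) (X3 \<kappa> q) = 0"
  "g0 (X3 \<kappa> q) (X1 \<kappa> q) = 0" "g0 (X2 \<kappa> q) (X3 \<kappa> q) = 0" "g0 (X3 \<kappa> q) (X2 \<kappa> q) = 0"
  "g0 q (X1 \<kappa> q) = 0" "g0 q (X2 \<kappa> q) = 0" "g0 q (X3 \<kappa> q) = 0"
  "g0 (X1 \<kappa> q) q = 0" "g0 (X2 \<kappa> q) q = 0" "g0 (X3 \<kappa> q) q = 0"
  by (simp_all add: g0_def X1_def X2_def X3_def algebra_simps)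

text \<open>Components with respect to \<open>X1, X2, X3\<close>; the sign in the first one is due to \<open>X1\<close> being timelike.\<close>

definition xc1 :: "real \<Rightarrow> real^4 \<Rightarrow> real^4 \<Rightarrow> real" where "xc1 \<kappa> q U = - g0 U (X1 \<kappa> q)"
definition xc2 :: "real \<Rightarrow> real^4 \<Rightarrow> real^4 \<Rightarrow> real" where "xc2 \<kappa> q U = g0 U (X2 \<kappa> q)"
definition xc3 :: "real \<Rightarrow> real^4 \<Rightarrow> real^4 \<Rightarrow> real" where "xc3 \<kappa> q U = g0 U (X3 \<kappa> q)"

text \<open>With \<open>X1\<close> in place of \<open>E1\<close> the frame does not involve \<tau>,
  and all dependence on \<tau> sits in the metric.\<close>

definition fr :: "real \<Rightarrow> real^4 \<Rightarrow> real \<Rightarrow> real \<Rightarrow> real \<Rightarrow> real^4" where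
  "fr \<kappa> q a b c = a *\<^sub>R X1 \<kappa> q + b *\<^sub>R X2 \<kappa> q + c *\<^sub>R X3 \<kappa> q"

lemma xc_fr:
  assumes "\<kappa> > 0" "q \<in> AdS \<kappa>"
  shows "xc1 \<kappa> q (fr \<kappa> q a b c) = a" "xc2 \<kappa> q (fr \<kappa> q a b c) = b" "xc3 \<kappa> q (fr \<kappa> q a b c) = c"
  using g0_X[OF assms] by (simp_all add: xc1_def xc2_def xc3_def fr_def g0_simps)

lemma fr_inject:
  assumes "\<kappa> > 0" "q \<in> AdS \<kappa>"
  shows "fr \<kappa> q a b c = fr \<kappa> q a' b' c' \<longleftrightarrow> a = a' \<and> b = b' \<and> c = c'"
  using xc_fr[OF assms] by metis

lemma fr_arith:
  "fr \<kappa> q a b c + fr \<kappa> q a' b' c' = fr \<kappa> q (a + a') (b + b') (c + c')"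
  "fr \<kappa> q a b c - fr \<kappa> q a' b' c' = fr \<kappa> q (a - a') (b - b') (c - c')"
  "r *\<^sub>R fr \<kappa> q a b c = fr \<kappa> q (r * a) (r * b) (r * c)"
  "- fr \<kappa> q a b c = fr \<kappa> q (- a) (- b) (- c)"
  "fr \<kappa> q 0 0 0 = 0"
  by (simp_all add: fr_def algebra_simps)

lemma X_fr: "X1 \<kappa> q = fr \<kappa> q 1 0 0" "X2 \<kappa> q = fr \<kappa> q 0 1 0" "X3 \<kappa> q = fr \<kappa> q 0 0 1"
  by (simp_all add: fr_def)

lemma fr_tangent [simp]: "fr \<kappa> q a b c \<in> AdS_tangent q"
  by (simp add: AdS_tangent_def fr_def g0_simps)

lemma fr_xc:
  assumes "\<kappa> > 0" "q \<in> AdS \<kappa>" "U \<in> AdS_tangent q"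
  shows "U = fr \<kappa> q (xc1 \<kappa> q U) (xc2 \<kappa> q U) (xc3 \<kappa> q U)"
proof -
  have q: "g0 q q = - 4 / \<kappa>" and U: "g0 U q = 0"
    using assms by (simp_all add: AdS_g0 AdS_tangent_def g0_commute)
  \<comment> \<open>The vectors \<open>q, J1 q, J2 q, J3 q\<close> are \<open>g0\<close>-orthogonal
    with squares \<open>g0 q q\<close> up to the sign; this is the expansion in them, cleared of
    denominators.\<close>
  have id: "g0 q q *\<^sub>R U = g0 U q *\<^sub>R q + g0 U (J1 q) *\<^sub>R J1 q - g0 U (J2 q) *\<^sub>R J2 q - g0 U (J3 q) *\<^sub>R J3 q"
    by (rule vec4_eqI) (simp_all add: g0_def, algebra+)
  have s: "sqrt \<kappa> * sqrt \<kappa> = \<kappa>" using assms(1) by simp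
  have "fr \<kappa> q (xc1 \<kappa> q U) (xc2 \<kappa> q U) (xc3 \<kappa> q U) =
    (- (\<kappa> / 4)) *\<^sub>R (g0 U (J1 q) *\<^sub>R J1 q - g0 U (J2 q) *\<^sub>R J2 q - g0 U (J3 q) *\<^sub>R J3 q)"
    by (simp add: fr_def xc1_def xc2_def xc3_def X1_def X2_def X3_def g0_simps s scaleR_right_diff_distrib mult_ac)
      (use assms(1) in \<open>simp add: mult.assoc[symmetric]\<close>)
  also have "\<dots> = (- (\<kappa> / 4)) *\<^sub>R (g0 q q *\<^sub>R U)"
    using id U by simp
  also have "\<dots> = U" using assms(1) by (simp add: q)
  finally show ?thesis by (rule sym)
qed

lemma gtau_fr:
  assumes "\<kappa> > 0" "q \<in> AdS \<kappa>"
  shows "gtau \<kappa> \<tau> q (fr \<kappa> q a b c) (fr \<kappa> q a' b' c') = - \<tau>\<^sup>2 * a * a' + b * b' + c * c'"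
  using g0_X[OF assms] by (simp add: gtau_def fr_def g0_simps algebra_simps)

lemma E_fr: "E1 \<kappa> \<tau> q = fr \<kappa> q (1 / \<tau>) 0 0" "E2 \<kappa> q = fr \<kappa> q 0 1 0" "E3 \<kappa> q = fr \<kappa> q 0 0 1"
  by (simp_all add: E1_def E2_def E3_def fr_def)

lemma comp_fr:
  assumes "\<kappa> > 0" "\<tau> > 0" "q \<in> AdS \<kappa>"
  shows "comp1 \<kappa> \<tau> q (fr \<kappa> q a b c) = \<tau> * a" "comp2 \<kappa> \<tau> q (fr \<kappa> q a b c) = b" "comp3 \<kappa> \<tau> q (fr \<kappa> q a b c) = c"
  using assms(2) by (simp_all add: comp1_def comp2_def comp3_def E_fr gtau_fr[OF assms(1,3)] power2_eq_square)

lemma AdS_map_tangent: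
  assumes "open V" "smooth_on V F" "F ` V \<subseteq> AdS \<kappa>" "w \<in> V"
  shows "frechet_derivative F (at w) e \<in> AdS_tangent (F w)"
proof -
  let ?D = "frechet_derivative F (at w)"
  have F: "(F has_derivative ?D) (at w)" using assms(2,4) by (rule smooth_on_has_derivative)
  have "((\<lambda>z. g0 (F z) (F z)) has_derivative (\<lambda>h. g0 (F w) (?D h) + g0 (?D h) (F w))) (at w)"
    by (rule bounded_bilinear.FDERIV[OF bilinear_g0 F F])
  moreover have "((\<lambda>z. g0 (F z) (F z)) has_derivative (\<lambda>h. 0)) (at w)"
  proof (rule has_derivative_transform_within_open[OF has_derivative_const assms(1,4)])
    show "- 4 / \<kappa> = g0 (F z) (F z)" if "z \<in> V" for z
      using assms(3) that AdS_g0 by (metis image_subset_iff)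
  qed
  ultimately have "(\<lambda>h. g0 (F w) (?D h) + g0 (?D h) (F w)) = (\<lambda>h. 0)" by (rule has_derivative_unique)
  from fun_cong[OF this, of e] show ?thesis by (simp add: AdS_tangent_def g0_commute)
qed

text \<open>The Maurer-Cartan equations of the frame \<open>X1, X2, X3\<close>, pulled back along a map \<open>F\<close>.\<close>

lemma structure_equations:
  fixes F :: "'a::real_normed_vector \<Rightarrow> real^4" and e e' :: 'a
  assumes \<kappa>: "\<kappa> > 0" and V: "open V" "smooth_on V F" "F ` V \<subseteq> AdS \<kappa>" "w \<in> V"
  defines "dF \<equiv> \<lambda>z. frechet_derivative F (at z)"
  defines "p \<equiv> \<lambda>i z. i \<kappa> (F z) (dF z e)" and "q \<equiv> \<lambda>i z. i \<kappa> (F z) (dF z e')"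
  shows "frechet_derivative (q xc1) (at w) e - frechet_derivative (p xc1) (at w) e' =
      - sqrt \<kappa> * (p xc2 w * q xc3 w - p xc3 w * q xc2 w)" (is ?t1)
    and "frechet_derivative (q xc2) (at w) e - frechet_derivative (p xc2) (at w) e' =
      sqrt \<kappa> * (p xc3 w * q xc1 w - p xc1 w * q xc3 w)" (is ?t2)
    and "frechet_derivative (q xc3) (at w) e - frechet_derivative (p xc3) (at w) e' =
      sqrt \<kappa> * (p xc1 w * q xc2 w - p xc2 w * q xc1 w)" (is ?t3)
    and "smooth_on V (p xc1)" "smooth_on V (p xc2)" "smooth_on V (p xc3)"
proof -
  define P where "P d i z = i \<kappa> (F z) (dF z d)" for d and i :: "real \<Rightarrow> real^4 \<Rightarrow> real^4 \<Rightarrow> real" and z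
  have pq: "p = P e" "q = P e'" unfolding p_def q_def P_def[abs_def] by (rule refl)+
  have FA: "F z \<in> AdS \<kappa>" if "z \<in> V" for z using V(3) imageI[OF that, of F] by (rule subsetD)
  have expand: "dF z d = fr \<kappa> (F z) (P d xc1 z) (P d xc2 z) (P d xc3 z)" if "z \<in> V" for z d
    unfolding P_def dF_def by (rule fr_xc[OF \<kappa> FA[OF that] AdS_map_tangent[OF V(1-3) that]])
  have sX: "smooth_on V (\<lambda>z. X1 \<kappa> (F z))" "smooth_on V (\<lambda>z. X2 \<kappa> (F z))" "smooth_on V (\<lambda>z. X3 \<kappa> (F z))"
    by (rule smooth_on_linear_compose[OF bounded_linear_X(1) V(1,2)] smooth_on_linear_compose[OF bounded_linear_X(2) V(1,2)]
        smooth_on_linear_compose[OF bounded_linear_X(3) V(1,2)])+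
  have sF: "smooth_on V (\<lambda>z. dF z d)" for d
    unfolding dF_def using V(2) by (rule smooth_on_frechet_derivative)
  have sP: "smooth_on V (P d xc1)" "smooth_on V (P d xc2)" "smooth_on V (P d xc3)" for d
    unfolding P_def[abs_def] xc1_def xc2_def xc3_def
    by (intro smooth_on_minus smooth_on_bilinear[OF bilinear_g0] V(1) sF sX)+
  show "smooth_on V (p xc1)" "smooth_on V (p xc2)" "smooth_on V (p xc3)"
    unfolding pq by (rule sP)+
  define DP where "DP d i d' = frechet_derivative (P d i) (at w) d'" for d i d'
  have second: "frechet_derivative (\<lambda>z. dF z d) (at w) d' =
      fr \<kappa> (F w) (DP d xc1 d') (DP d xc2 d') (DP d xc3 d') +
      (P d xc1 w *\<^sub>R X1 \<kappa> (dF w d') + P d xc2 w *\<^sub>R X2 \<kappa> (dF w d') + P d xc3 w *\<^sub>R X3 \<kappa> (dF w d'))" for d d'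
  proof -
    have F: "(F has_derivative dF w) (at w)" unfolding dF_def using V(2,4) by (rule smooth_on_has_derivative)
    have dP: "(P d i has_derivative DP d i) (at w)" if "smooth_on V (P d i)" for i
      unfolding DP_def[abs_def] using that V(4) by (rule smooth_on_has_derivative)
    note b = bounded_linear.has_derivative[OF bounded_linear_X(1) F] bounded_linear.has_derivative[OF bounded_linear_X(2) F]
      bounded_linear.has_derivative[OF bounded_linear_X(3) F]
    have "((\<lambda>z. fr \<kappa> (F z) (P d xc1 z) (P d xc2 z) (P d xc3 z)) has_derivative
      (\<lambda>d'. (P d xc1 w *\<^sub>R X1 \<kappa> (dF w d') + DP d xc1 d' *\<^sub>R X1 \<kappa> (F w)) +
        (P d xc2 w *\<^sub>R X2 \<kappa> (dF w d') + DP d xc2 d' *\<^sub>R X2 \<kappa> (F w)) +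
        (P d xc3 w *\<^sub>R X3 \<kappa> (dF w d') + DP d xc3 d' *\<^sub>R X3 \<kappa> (F w)))) (at w)"
      unfolding fr_def
      by (intro has_derivative_add has_derivative_scaleR dP[OF sP(1)] dP[OF sP(2)] dP[OF sP(3)] b)
    then have "((\<lambda>z. dF z d) has_derivative
      (\<lambda>d'. (P d xc1 w *\<^sub>R X1 \<kappa> (dF w d') + DP d xc1 d' *\<^sub>R X1 \<kappa> (F w)) +
        (P d xc2 w *\<^sub>R X2 \<kappa> (dF w d') + DP d xc2 d' *\<^sub>R X2 \<kappa> (F w)) +
        (P d xc3 w *\<^sub>R X3 \<kappa> (dF w d') + DP d xc3 d' *\<^sub>R X3 \<kappa> (F w)))) (at w)"
      by (rule has_derivative_transform_within_open[OF _ V(1,4)]) (rule expand[symmetric])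
    from fun_cong[OF frechet_derivative_at[OF this], of d', symmetric] show ?thesis
      by (simp add: fr_def algebra_simps)
  qed
  \<comment> \<open>The only analytic input is the symmetry of the second derivative of
    \<open>F\<close>; the rest is the algebra of the frame.\<close>
  have "frechet_derivative (\<lambda>z. dF z e) (at w) e' = frechet_derivative (\<lambda>z. dF z e') (at w) e"
    unfolding dF_def by (rule mixed_partials_commute[OF V(1,2,4)])
  then have eq: "fr \<kappa> (F w) (DP e xc1 e') (DP e xc2 e') (DP e xc3 e') +
      (P e xc1 w *\<^sub>R X1 \<kappa> (dF w e') + P e xc2 w *\<^sub>R X2 \<kappa> (dF w e') + P e xc3 w *\<^sub>R X3 \<kappa> (dF w e')) =
      fr \<kappa> (F w) (DP e' xc1 e) (DP e' xc2 e) (DP e' xc3 e) +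
      (P e' xc1 w *\<^sub>R X1 \<kappa> (dF w e) + P e' xc2 w *\<^sub>R X2 \<kappa> (dF w e) + P e' xc3 w *\<^sub>R X3 \<kappa> (dF w e))"
    by (simp only: second)
  let ?s = "sqrt \<kappa> / 2"
  have X: "X1 \<kappa> (fr \<kappa> x a b c) = fr \<kappa> x 0 (- ?s * c) (?s * b) - (?s\<^sup>2 * a) *\<^sub>R x"
    "X2 \<kappa> (fr \<kappa> x a b c) = fr \<kappa> x (- ?s * c) 0 (- ?s * a) + (?s\<^sup>2 * b) *\<^sub>R x"
    "X3 \<kappa> (fr \<kappa> x a b c) = fr \<kappa> x (?s * b) (?s * a) 0 + (?s\<^sup>2 * c) *\<^sub>R x" for x a b c
    by (simp_all add: fr_def X_simps X_X algebra_simps)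
  define a b c a' b' c' where abc: "a = P e xc1 w" "b = P e xc2 w" "c = P e xc3 w"
    "a' = P e' xc1 w" "b' = P e' xc2 w" "c' = P e' xc3 w"
  \<comment> \<open>The parts along the position vector \<open>F w\<close> are symmetric in the two
    directions and cancel, leaving an equation in the frame.\<close>
  have "fr \<kappa> (F w) (DP e xc1 e' - b * ?s * c' + c * ?s * b') (DP e xc2 e' - a * ?s * c' + c * ?s * a') (DP e xc3 e' + a * ?s * b' - b * ?s * a') =
     fr \<kappa> (F w) (DP e' xc1 e - b' * ?s * c + c' * ?s * b) (DP e' xc2 e - a' * ?s * c + c' * ?s * a) (DP e' xc3 e + a' * ?s * b - b' * ?s * a)"
    using eq unfolding expand[OF V(4)] X abc[symmetric]
    by (simp add: fr_def algebra_simps)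
  then show ?t1 ?t2 ?t3
    unfolding fr_inject[OF \<kappa> FA[OF V(4)]] pq DP_def[symmetric] abc[symmetric]
    by (simp_all add: algebra_simps)
qed

section \<open>The Levi-Civita connection and unit normals\<close>

lemma frechet_derivative_linear:
  assumes "bounded_linear L"
  shows "frechet_derivative L (at q) = L"
  using frechet_derivative_at[OF bounded_linear_imp_has_derivative[OF assms]] by (rule sym)

lemma bounded_linear_E: "bounded_linear (E1 \<kappa> \<tau>)" "bounded_linear (E2 \<kappa>)" "bounded_linear (E3 \<kappa>)"
  using bounded_linear_X[of \<kappa>]
  by (auto simp: E1_def[abs_def] E2_def[abs_def] E3_def[abs_def] intro: bounded_linear_const_scaleR)

lemma vector_field_E:
  "vector_field \<kappa> (E1 \<kappa> \<tau>)" "vector_field \<kappa> (E2 \<kappa>)" "vector_field \<kappa> (E3 \<kappa>)"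
  using bounded_linear_E by (simp_all add: vector_field_def smooth_on_linear E_fr)

lemma gtau_add: "gtau \<kappa> \<tau> q (U + U') V = gtau \<kappa> \<tau> q U V + gtau \<kappa> \<tau> q U' V"
  "gtau \<kappa> \<tau> q (U - U') V = gtau \<kappa> \<tau> q U V - gtau \<kappa> \<tau> q U' V"
  by (simp_all add: gtau_def g0_simps algebra_simps)

lemma gtau_commute: "gtau \<kappa> \<tau> q U V = gtau \<kappa> \<tau> q V U"
  by (simp add: gtau_def g0_commute algebra_simps)

text \<open>The frame is orthonormal on \<open>AdS\<close>; off it, the inner products are functions of \<open>g0 p p\<close>.\<close>

lemma frame_inner_derivative:
  assumes "X \<in> {E1 \<kappa> \<tau>, E2 \<kappa>, E3 \<kappa>}" "Y \<in> {E1 \<kappa> \<tau>, E2 \<kappa>, E3 \<kappa>}" "v \<in> AdS_tangent q"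
  shows "frechet_derivative (\<lambda>p. gtau \<kappa> \<tau> p (X p) (Y p)) (at q) v = 0"
proof -
  have gX: "g0 (X1 \<kappa> p) (X1 \<kappa> p) = (sqrt \<kappa> / 2)\<^sup>2 * g0 p p" "g0 (X2 \<kappa> p) (X2 \<kappa> p) = - (sqrt \<kappa> / 2)\<^sup>2 * g0 p p"
    "g0 (X3 \<kappa> p) (X3 \<kappa> p) = - (sqrt \<kappa> / 2)\<^sup>2 * g0 p p" for p
  proof -
    have "g0 (r *\<^sub>R J1 p) (r *\<^sub>R J1 p) = r\<^sup>2 * g0 p p" "g0 (r *\<^sub>R J2 p) (r *\<^sub>R J2 p) = - r\<^sup>2 * g0 p p"
      "g0 (r *\<^sub>R J3 p) (r *\<^sub>R J3 p) = - r\<^sup>2 * g0 p p" for r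
      by (simp_all add: g0_def power2_eq_square algebra_simps)
    then show "g0 (X1 \<kappa> p) (X1 \<kappa> p) = (sqrt \<kappa> / 2)\<^sup>2 * g0 p p" "g0 (X2 \<kappa> p) (X2 \<kappa> p) = - (sqrt \<kappa> / 2)\<^sup>2 * g0 p p"
      "g0 (X3 \<kappa> p) (X3 \<kappa> p) = - (sqrt \<kappa> / 2)\<^sup>2 * g0 p p"
      unfolding X1_def X2_def X3_def by blast+
  qed
  have "\<exists>a b. \<forall>p. gtau \<kappa> \<tau> p (X p) (Y p) = a * g0 p p + b * (g0 p p * g0 p p)"
  proof -
    let ?s = "(sqrt \<kappa> / 2)\<^sup>2" 
    have 1: "gtau \<kappa> \<tau> p (E1 \<kappa> \<tau> p) (E1 \<kappa> \<tau> p) = (1/\<tau> * (1/\<tau>) * ?s) * g0 p p + (1 - \<tau>\<^sup>2) * (1/\<tau> * (1/\<tau>)) * (?s * ?s) * (g0 p p * g0 p p)"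
      "gtau \<kappa> \<tau> p (E2 \<kappa> p) (E2 \<kappa> p) = (- ?s) * g0 p p + 0 * (g0 p p * g0 p p)"
      "gtau \<kappa> \<tau> p (E3 \<kappa> p) (E3 \<kappa> p) = (- ?s) * g0 p p + 0 * (g0 p p * g0 p p)" for p
      by (simp_all add: gtau_def E1_def E2_def E3_def g0_simps gX)
    have 2: "gtau \<kappa> \<tau> p (E1 \<kappa> \<tau> p) (E2 \<kappa> p) = 0 * g0 p p + 0 * (g0 p p * g0 p p)"
      "gtau \<kappa> \<tau> p (E1 \<kappa> \<tau> p) (E3 \<kappa> p) = 0 * g0 p p + 0 * (g0 p p * g0 p p)"
      "gtau \<kappa> \<tau> p (E2 \<kappa> p) (E3 \<kappa> p) = 0 * g0 p p + 0 * (g0 p p * g0 p p)"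
      "gtau \<kappa> \<tau> p (E2 \<kappa> p) (E1 \<kappa> \<tau> p) = 0 * g0 p p + 0 * (g0 p p * g0 p p)"
      "gtau \<kappa> \<tau> p (E3 \<kappa> p) (E1 \<kappa> \<tau> p) = 0 * g0 p p + 0 * (g0 p p * g0 p p)"
      "gtau \<kappa> \<tau> p (E3 \<kappa> p) (E2 \<kappa> p) = 0 * g0 p p + 0 * (g0 p p * g0 p p)" for p
      by (simp_all add: gtau_def E1_def E2_def E3_def g0_simps)
    show ?thesis using assms(1,2) 1 2 by blast
  qed
  then obtain a b where ab: "(\<lambda>p. gtau \<kappa> \<tau> p (X p) (Y p)) = (\<lambda>p. a * g0 p p + b * (g0 p p * g0 p p))"
    by blast
  have g: "((\<lambda>p. g0 p p) has_derivative (\<lambda>h. g0 q h + g0 h q)) (at q)"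
    by (rule bounded_bilinear.FDERIV[OF bilinear_g0 has_derivative_ident has_derivative_ident])
  have "((\<lambda>p. a * g0 p p + b * (g0 p p * g0 p p)) has_derivative
     (\<lambda>h. a * (g0 q h + g0 h q) + b * (g0 q q * (g0 q h + g0 h q) + (g0 q h + g0 h q) * g0 q q))) (at q)"
    by (intro has_derivative_add has_derivative_mult_right has_derivative_mult g)
  from fun_cong[OF frechet_derivative_at[OF this], of v] show ?thesis
    using assms(3) by (simp add: ab AdS_tangent_def g0_commute)
qed

text \<open>Koszul's formula. The inner products of the frame fields have no derivative along
  tangent vectors, so only Lie brackets remain, and these are read off from the quaternion relations
  since the frame fields are linear maps of \<real>^4.\<close>

lemma levi_civita_frame:
  assumes \<kappa>: "\<kappa> > 0" and \<tau>: "\<tau> > 0" and D: "levi_civita \<kappa> \<tau> D" and q: "q \<in> AdS \<kappa>"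
  shows "D q (fr \<kappa> q a b c) (E1 \<kappa> \<tau>) = fr \<kappa> q 0 (- (sqrt \<kappa> / 2) * \<tau> * c) (sqrt \<kappa> / 2 * \<tau> * b)" (is ?t1)
    and "D q (fr \<kappa> q a b c) (E2 \<kappa>) = fr \<kappa> q (- (sqrt \<kappa> / 2) * c) 0 (sqrt \<kappa> / 2 * (\<tau>\<^sup>2 - 2) * a)" (is ?t2)
    and "D q (fr \<kappa> q a b c) (E3 \<kappa>) = fr \<kappa> q (sqrt \<kappa> / 2 * b) (- (sqrt \<kappa> / 2) * (\<tau>\<^sup>2 - 2) * a) 0" (is ?t3)
proof -
  let ?Fr = "{E1 \<kappa> \<tau>, E2 \<kappa>, E3 \<kappa>}"
  let ?g = "gtau \<kappa> \<tau> q"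
  have lin: "bounded_linear X" if "X \<in> ?Fr" for X using that bounded_linear_E by auto
  have vf: "vector_field \<kappa> X" if "X \<in> ?Fr" for X using that vector_field_E by auto
  have tan: "X q \<in> AdS_tangent q" if "X \<in> ?Fr" for X using that by (auto simp: E_fr)
  define br where "br X Y = Y (X q) - X (Y q)" for X Y :: "real^4 \<Rightarrow> real^4"
  define G where "G X Y Z = ?g (D q (X q) Y) (Z q)" for X Y Z :: "real^4 \<Rightarrow> real^4"
  have aff: "affine_connection \<kappa> D" using D by (simp add: levi_civita_def)
  have Gt: "D q (X q) Y \<in> AdS_tangent q" if XY: "X \<in> ?Fr" "Y \<in> ?Fr" for X Y
  proof -
    obtain Z where "vector_field \<kappa> Z" "\<forall>q\<in>AdS \<kappa>. D q (X q) Y = Z q"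
      using conjunct1[OF aff[unfolded affine_connection_def], rule_format, OF conjI[OF vf[OF XY(1)] vf[OF XY(2)]]]
      by (elim exE conjE)
    then show ?thesis using q by (auto simp: vector_field_def)
  qed
  have tors: "G X Y Z - G Y X Z = ?g (br X Y) (Z q)" if XY: "X \<in> ?Fr" "Y \<in> ?Fr" for X Y Z
  proof -
    have "D q (X q) Y - D q (Y q) X = lie_bracket X Y q"
      using D vf[OF XY(1)] vf[OF XY(2)] q unfolding levi_civita_def by blast
    also have "\<dots> = br X Y"
      unfolding lie_bracket_def br_def
      by (simp only: frechet_derivative_linear[OF lin[OF XY(1)]] frechet_derivative_linear[OF lin[OF XY(2)]])
    finally show ?thesis unfolding G_def by (simp add: gtau_add(2)[symmetric])
  qed
  have met: "G X Y Z + G X Z Y = 0" if XYZ: "X \<in> ?Fr" "Y \<in> ?Fr" "Z \<in> ?Fr" for X Y Z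
  proof -
    have "frechet_derivative (\<lambda>p. gtau \<kappa> \<tau> p (Y p) (Z p)) (at q) (X q) =
        ?g (D q (X q) Y) (Z q) + ?g (Y q) (D q (X q) Z)"
      using D vf[OF XYZ(2)] vf[OF XYZ(3)] q tan[OF XYZ(1)] unfolding levi_civita_def by blast
    with frame_inner_derivative[OF XYZ(2,3) tan[OF XYZ(1)]] show ?thesis
      unfolding G_def by (simp add: gtau_commute[of \<kappa> \<tau> q "Y q"])
  qed
  have koszul: "2 * G X Y Z = ?g (br X Y) (Z q) - ?g (br Y Z) (X q) + ?g (br Z X) (Y q)"
    if XYZ: "X \<in> ?Fr" "Y \<in> ?Fr" "Z \<in> ?Fr" for X Y Z
    using tors[OF XYZ(1,2), of Z] tors[OF XYZ(2,3), of X] tors[OF XYZ(3,1), of Y]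
      met[OF XYZ] met[OF XYZ(2,3,1)] met[OF XYZ(3,1,2)] by linarith
  have E: "E1 \<kappa> \<tau> q = (1 / \<tau>) *\<^sub>R X1 \<kappa> q" "E2 \<kappa> q = X2 \<kappa> q" "E3 \<kappa> q = X3 \<kappa> q" for q
    by (simp_all add: E1_def E2_def E3_def)
  let ?s = "sqrt \<kappa> / 2"
  have brs: "br (E1 \<kappa> \<tau>) (E2 \<kappa>) = fr \<kappa> q 0 0 (- (2 * ?s / \<tau>))" "br (E2 \<kappa>) (E1 \<kappa> \<tau>) = fr \<kappa> q 0 0 (2 * ?s / \<tau>)"
    "br (E2 \<kappa>) (E3 \<kappa>) = fr \<kappa> q (2 * ?s) 0 0" "br (E3 \<kappa>) (E2 \<kappa>) = fr \<kappa> q (- (2 * ?s)) 0 0"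
    "br (E3 \<kappa>) (E1 \<kappa> \<tau>) = fr \<kappa> q 0 (- (2 * ?s / \<tau>)) 0" "br (E1 \<kappa> \<tau>) (E3 \<kappa>) = fr \<kappa> q 0 (2 * ?s / \<tau>) 0"
    "br X X = fr \<kappa> q 0 0 0" for X
    unfolding br_def E X_simps X_X scaleR_scaleR unfolding X_fr fr_arith
    by (simp_all add: fr_inject[OF \<kappa> q])
  note gfr = gtau_fr[OF \<kappa> q]
  have Gam: "D q (X q) Y = fr \<kappa> q (- G X Y (E1 \<kappa> \<tau>) / \<tau>) (G X Y (E2 \<kappa>)) (G X Y (E3 \<kappa>))"
    if XY: "X \<in> ?Fr" "Y \<in> ?Fr" for X Y
  proof -
    have "D q (X q) Y = fr \<kappa> q (xc1 \<kappa> q (D q (X q) Y)) (xc2 \<kappa> q (D q (X q) Y)) (xc3 \<kappa> q (D q (X q) Y))" (is "_ = ?R")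
      by (rule fr_xc[OF \<kappa> q Gt[OF XY]])
    then have "G X Y Z = ?g ?R (Z q)" for Z by (simp only: G_def)
    then have "G X Y (E1 \<kappa> \<tau>) = - \<tau>\<^sup>2 * xc1 \<kappa> q (D q (X q) Y) * (1 / \<tau>)"
      "G X Y (E2 \<kappa>) = xc2 \<kappa> q (D q (X q) Y)" "G X Y (E3 \<kappa>) = xc3 \<kappa> q (D q (X q) Y)"
      by (simp_all add: E_fr gfr)
    then show ?thesis
      using fr_xc[OF \<kappa> q Gt[OF XY]] \<tau> by (simp add: power2_eq_square)
  qed
  have G2: "G X Y Z = (?g (br X Y) (Z q) - ?g (br Y Z) (X q) + ?g (br Z X) (Y q)) / 2"
    if XYZ: "X \<in> ?Fr" "Y \<in> ?Fr" "Z \<in> ?Fr" for X Y Z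
    using koszul[OF XYZ] by simp
  have m: "E1 \<kappa> \<tau> \<in> ?Fr" "E2 \<kappa> \<in> ?Fr" "E3 \<kappa> \<in> ?Fr" by simp_all
  have \<Gamma>: "D q (E1 \<kappa> \<tau> q) (E1 \<kappa> \<tau>) = fr \<kappa> q 0 0 0" "D q (E2 \<kappa> q) (E1 \<kappa> \<tau>) = fr \<kappa> q 0 0 (?s * \<tau>)"
    "D q (E3 \<kappa> q) (E1 \<kappa> \<tau>) = fr \<kappa> q 0 (- (?s * \<tau>)) 0"
    "D q (E1 \<kappa> \<tau> q) (E2 \<kappa>) = fr \<kappa> q 0 0 (?s * (\<tau>\<^sup>2 - 2) / \<tau>)" "D q (E2 \<kappa> q) (E2 \<kappa>) = fr \<kappa> q 0 0 0"
    "D q (E3 \<kappa> q) (E2 \<kappa>) = fr \<kappa> q (- ?s) 0 0"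
    "D q (E1 \<kappa> \<tau> q) (E3 \<kappa>) = fr \<kappa> q 0 (- (?s * (\<tau>\<^sup>2 - 2) / \<tau>)) 0" "D q (E2 \<kappa> q) (E3 \<kappa>) = fr \<kappa> q ?s 0 0"
    "D q (E3 \<kappa> q) (E3 \<kappa>) = fr \<kappa> q 0 0 0"
    unfolding Gam[OF m(1) m(1)] Gam[OF m(1) m(2)] Gam[OF m(1) m(3)] Gam[OF m(2) m(1)] Gam[OF m(2) m(2)]
      Gam[OF m(2) m(3)] Gam[OF m(3) m(1)] Gam[OF m(3) m(2)] Gam[OF m(3) m(3)] fr_inject[OF \<kappa> q]
    by (simp_all only: G2 m brs) (use \<tau> in \<open>simp_all add: E_fr gfr field_simps power2_eq_square\<close>)
  have lin3: "D q (fr \<kappa> q a b c) Y = (\<tau> * a) *\<^sub>R D q (E1 \<kappa> \<tau> q) Y + (b *\<^sub>R D q (E2 \<kappa> q) Y + c *\<^sub>R D q (E3 \<kappa> q) Y)"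
    if Y: "Y \<in> ?Fr" for Y
  proof -
    have l: "D q (x *\<^sub>R u + y *\<^sub>R v) Y = x *\<^sub>R D q u Y + y *\<^sub>R D q v Y"
      if "u \<in> AdS_tangent q" "v \<in> AdS_tangent q" for x y u v
      using conjunct1[OF conjunct2[OF conjunct2[OF aff[unfolded affine_connection_def]]], rule_format, OF vf[OF Y] q that] .
    have "fr \<kappa> q a b c = (\<tau> * a) *\<^sub>R E1 \<kappa> \<tau> q + 1 *\<^sub>R (b *\<^sub>R E2 \<kappa> q + c *\<^sub>R E3 \<kappa> q)"
      using \<tau> by (simp add: E_fr fr_arith)
    also have "D q \<dots> Y = (\<tau> * a) *\<^sub>R D q (E1 \<kappa> \<tau> q) Y + 1 *\<^sub>R D q (b *\<^sub>R E2 \<kappa> q + c *\<^sub>R E3 \<kappa> q) Y"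
      by (rule l[OF tan[OF m(1)]]) (simp add: E_fr fr_arith)
    finally show ?thesis
      by (simp only: l[OF tan[OF m(2)] tan[OF m(3)]] scaleR_one)
  qed
  show ?t1 ?t2 ?t3
    unfolding lin3[OF m(1)] lin3[OF m(2)] lin3[OF m(3)] \<Gamma>
    using \<tau> by (simp_all add: fr_arith fr_inject[OF \<kappa> q] mult_ac)
qed

locale helix_constants =
  fixes \<kappa> \<tau> lam \<nu> :: real
  assumes \<kappa>: "\<kappa> > 0" and \<tau>: "\<tau> > 0" and lam: "lam \<in> {-1, 1}" and \<nu>: "\<nu> \<noteq> 0"
    and B: "B_const \<tau> lam \<nu> > 0"
begin

text \<open>The squared length of the part of the normal orthogonal to \<open>E1\<close>.\<close>

definition csq :: real where "csq = lam + \<nu>\<^sup>2"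

text \<open>The constant angular velocity, along the integral curves of \<open>T\<close>, of the normal in the frame \<open>E2, E3\<close>.\<close>

definition k :: real where "k = - lam * sqrt \<kappa> * B_const \<tau> lam \<nu> / \<tau>"

lemma lam2 [simp]: "lam * lam = 1" "lam * (lam * x) = x"
  using lam by auto

definition unit_normal :: "real^4 \<Rightarrow> real^4 \<Rightarrow> bool" where
  "unit_normal q n \<longleftrightarrow> q \<in> AdS \<kappa> \<and> n \<in> AdS_tangent q \<and> gtau \<kappa> \<tau> q n n = lam \<and> angle_fun \<kappa> \<tau> lam q n = \<nu>"

lemma unit_normalD:
  assumes "unit_normal q n"
  shows "n = fr \<kappa> q (- lam * \<nu> / \<tau>) (xc2 \<kappa> q n) (xc3 \<kappa> q n)"
    and "(xc2 \<kappa> q n)\<^sup>2 + (xc3 \<kappa> q n)\<^sup>2 = csq" and "q \<in> AdS \<kappa>"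
    and "T_vec \<kappa> \<tau> lam q n = fr \<kappa> q (lam * csq / \<tau>) (- \<nu> * xc2 \<kappa> q n) (- \<nu> * xc3 \<kappa> q n)"
    and "JT_vec \<kappa> \<tau> lam q n = fr \<kappa> q 0 (xc3 \<kappa> q n) (- xc2 \<kappa> q n)"
proof -
  let ?x = "xc1 \<kappa> q n" and ?y = "xc2 \<kappa> q n" and ?z = "xc3 \<kappa> q n"
  show q: "q \<in> AdS \<kappa>" using assms by (simp add: unit_normal_def)
  have n: "n = fr \<kappa> q ?x ?y ?z"
    using assms by (intro fr_xc[OF \<kappa>]) (simp_all add: unit_normal_def)
  have "lam * gtau \<kappa> \<tau> q (fr \<kappa> q ?x ?y ?z) (E1 \<kappa> \<tau> q) = \<nu>"
    using assms n by (simp add: unit_normal_def angle_fun_def)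
  then have "- lam * \<tau> * ?x = \<nu>"
    using \<tau> by (simp add: E_fr gtau_fr[OF \<kappa> q] power2_eq_square)
  then have "lam * \<nu> = - \<tau> * ?x" by (auto simp: mult.assoc)
  then have x: "?x = - lam * \<nu> / \<tau>" using \<tau> by (simp add: field_simps)
  with n show n': "n = fr \<kappa> q (- lam * \<nu> / \<tau>) ?y ?z" by simp
  have "gtau \<kappa> \<tau> q (fr \<kappa> q (- lam * \<nu> / \<tau>) ?y ?z) (fr \<kappa> q (- lam * \<nu> / \<tau>) ?y ?z) = lam"
    using assms n' by (simp add: unit_normal_def)
  then show c: "?y\<^sup>2 + ?z\<^sup>2 = csq"
    using \<tau> by (simp add: gtau_fr[OF \<kappa> q] csq_def power2_eq_square field_simps)
  have "T_vec \<kappa> \<tau> lam q n = E1 \<kappa> \<tau> q - \<nu> *\<^sub>R fr \<kappa> q (- lam * \<nu> / \<tau>) ?y ?z"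
    using assms n' by (simp add: T_vec_def unit_normal_def)
  also have "\<dots> = fr \<kappa> q (lam * csq / \<tau>) (- \<nu> * ?y) (- \<nu> * ?z)"
    unfolding E_fr fr_arith fr_inject[OF \<kappa> q] using \<tau>
    by (simp add: csq_def field_simps power2_eq_square)
  finally show T: "T_vec \<kappa> \<tau> lam q n = fr \<kappa> q (lam * csq / \<tau>) (- \<nu> * ?y) (- \<nu> * ?z)" .
  have "JT_vec \<kappa> \<tau> lam q n = wedge \<kappa> \<tau> q (fr \<kappa> q (- lam * \<nu> / \<tau>) ?y ?z) (fr \<kappa> q (lam * csq / \<tau>) (- \<nu> * ?y) (- \<nu> * ?z))"
    unfolding JT_vec_def T using n' by simp
  also have "\<dots> = fr \<kappa> q 0 ?z (- ?y)"
    unfolding wedge_def comp_fr[OF \<kappa> \<tau> q] unfolding E_fr fr_arith fr_inject[OF \<kappa> q]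
    using \<tau> by (simp add: csq_def algebra_simps power2_eq_square add_divide_distrib)
  finally show "JT_vec \<kappa> \<tau> lam q n = fr \<kappa> q 0 ?z (- ?y)" .
qed

lemma gtau_normal:
  assumes "unit_normal q n"
  shows "gtau \<kappa> \<tau> q n (fr \<kappa> q a b c) = lam * \<nu> * \<tau> * a + xc2 \<kappa> q n * b + xc3 \<kappa> q n * c"
proof -
  note n = unit_normalD(1,3)[OF assms]
  have "gtau \<kappa> \<tau> q (fr \<kappa> q (- lam * \<nu> / \<tau>) (xc2 \<kappa> q n) (xc3 \<kappa> q n)) (fr \<kappa> q a b c) =
      lam * \<nu> * \<tau> * a + xc2 \<kappa> q n * b + xc3 \<kappa> q n * c"
    unfolding gtau_fr[OF \<kappa> n(2)] using \<tau> by (simp add: power2_eq_square)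
  then show ?thesis using n(1) by simp
qed

text \<open>\<open>JT\<close> has no component along \<open>X1\<close>, so that component of
  \<open>U\<close> gives the coefficient of \<open>T\<close>. The coefficient of \<open>JT\<close>
  is found by pairing the \<open>X2\<close>, \<open>X3\<close> parts; orthogonality to the normal
  makes the remaining two equations consistent.\<close>

lemma tangent_decomposition:
  assumes n: "unit_normal q n" and U: "U \<in> AdS_tangent q" "gtau \<kappa> \<tau> q n U = 0" and "csq \<noteq> 0"
  shows "U = (lam * \<tau> * xc1 \<kappa> q U / csq) *\<^sub>R T_vec \<kappa> \<tau> lam q n +
    ((xc3 \<kappa> q n * xc2 \<kappa> q U - xc2 \<kappa> q n * xc3 \<kappa> q U) / csq) *\<^sub>R JT_vec \<kappa> \<tau> lam q n"
proof -
  note n' = unit_normalD[OF n]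
  define a b c y z where abc: "a = xc1 \<kappa> q U" "b = xc2 \<kappa> q U" "c = xc3 \<kappa> q U" "y = xc2 \<kappa> q n" "z = xc3 \<kappa> q n"
  have U': "U = fr \<kappa> q a b c" unfolding abc by (rule fr_xc[OF \<kappa> n'(3) U(1)])
  have 0: "lam * \<nu> * \<tau> * a + y * b + z * c = 0"
    using U(2) gtau_normal[OF n, of a b c] by (simp add: U'[symmetric] abc(4,5))
  have yz: "y * y + z * z = csq" using n'(2) by (simp add: abc power2_eq_square)
  have b: "csq * b = lam * \<tau> * a * (- \<nu> * y) + (z * b - y * c) * z"
    and c: "csq * c = lam * \<tau> * a * (- \<nu> * z) + (z * b - y * c) * (- y)"
    unfolding yz[symmetric] using 0 by algebra+
  have "fr \<kappa> q a b c = (lam * \<tau> * a / csq) *\<^sub>R fr \<kappa> q (lam * csq / \<tau>) (- \<nu> * y) (- \<nu> * z) +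
      ((z * b - y * c) / csq) *\<^sub>R fr \<kappa> q 0 z (- y)"
    unfolding fr_arith fr_inject[OF \<kappa> n'(3)]
  proof (intro conjI)
    show "a = lam * \<tau> * a / csq * (lam * csq / \<tau>) + (z * b - y * c) / csq * 0"
      using assms(4) \<tau> by simp
    have "b = (lam * \<tau> * a * (- \<nu> * y) + (z * b - y * c) * z) / csq"
      unfolding b[symmetric] using assms(4) by simp
    then show "b = lam * \<tau> * a / csq * (- \<nu> * y) + (z * b - y * c) / csq * z"
      by (simp only: add_divide_distrib times_divide_eq_left)
    have "c = (lam * \<tau> * a * (- \<nu> * z) + (z * b - y * c) * (- y)) / csq"
      unfolding c[symmetric] using assms(4) by simp
    then show "c = lam * \<tau> * a / csq * (- \<nu> * z) + (z * b - y * c) / csq * (- y)"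
      by (simp only: add_divide_distrib times_divide_eq_left)
  qed
  from trans[OF U' this] show ?thesis
    unfolding n'(4,5) abc .
qed

definition helix_param :: "(real \<times> real) set \<Rightarrow> (real \<times> real \<Rightarrow> real^4) \<Rightarrow> (real \<times> real \<Rightarrow> real^4) \<Rightarrow> bool" where
  "helix_param V F N \<longleftrightarrow> open V \<and> immersion_on V F \<and> smooth_on V N \<and>
     (\<forall>w\<in>V. unit_normal (F w) (N w) \<and> (\<forall>v. gtau \<kappa> \<tau> (F w) (N w) (frechet_derivative F (at w) v) = 0))"

lemma helix_surface_param:
  assumes "helix_surface \<kappa> \<tau> lam \<nu> M \<A> f N" "local_param M \<A> (V, \<psi>)"
  shows "helix_param V (f \<circ> \<psi>) (N \<circ> \<psi>)"
proof -
  have im: "immersed_surface \<kappa> \<tau> lam M \<A> f N" and ang: "\<forall>p\<in>M. angle_fun \<kappa> \<tau> lam (f p) (N p) = \<nu>"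
    using assms(1) by (simp_all add: helix_surface_def)
  have V: "open V" "\<psi> ` V \<subseteq> M" using assms(2) by (simp_all add: local_param_def)
  have "unit_normal (f p) (N p)" if "p \<in> M" for p
    using im ang that by (auto simp: unit_normal_def immersed_surface_def)
  then show ?thesis
    using immersed_surface_local_param[OF im assms(2)] V unfolding helix_param_def o_def by blast
qed

end

section \<open>The structure equations of a helix surface\<close>

lemma has_derivative_unique_on_open:
  assumes "open V" "w \<in> V" "\<And>z. z \<in> V \<Longrightarrow> f z = g z" "(f has_derivative f') (at w)" "(g has_derivative g') (at w)"
  shows "f' v = g' v"
proof -
  have "(g has_derivative f') (at w)"
    using assms(4) by (rule has_derivative_transform_within_open[OF _ assms(1,2)]) (rule assms(3))
  from has_derivative_unique[OF this assms(5)] show ?thesis by (rule fun_cong)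
qed

lemma inj_derivative_pair:
  fixes f :: "real \<times> real \<Rightarrow> 'b::real_normed_vector"
  assumes "(f has_derivative L) (at w)" "inj L" "p *\<^sub>R L (1, 0) + q *\<^sub>R L (0, 1) = 0"
  shows "p = 0" "q = 0"
proof -
  have "L (p, q) = L (0, 0)"
    using frechet_derivative_pair[OF assms(1), of p q] frechet_derivative_pair[OF assms(1), of 0 0] assms(3) by simp
  then have "(p, q) = (0, 0)" using assms(2) by (rule injD[rotated])
  then show "p = 0" "q = 0" by simp_all
qed

text \<open>Injectivity makes the determinant of the coefficients nonzero, so the system can be
  solved for the preimages of \<open>t\<close> and \<open>j\<close>.\<close>

lemma inj_derivative_basis:
  fixes f :: "real \<times> real \<Rightarrow> 'b::real_normed_vector"
  assumes d: "(f has_derivative L) (at w)" and inj: "inj L"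
    and L: "L (1, 0) = a *\<^sub>R t + b *\<^sub>R j" "L (0, 1) = a' *\<^sub>R t + b' *\<^sub>R j"
  shows "\<exists>\<zeta> \<eta>. L \<zeta> = t \<and> L \<eta> = j"
proof -
  let ?d = "a * b' - a' * b"
  have D: "L (p, q) = (p * a + q * a') *\<^sub>R t + (p * b + q * b') *\<^sub>R j" for p q
    by (simp only: frechet_derivative_pair[OF d, of p q] L) (simp add: algebra_simps)
  have "?d \<noteq> 0"
  proof
    assume 0: "?d = 0"
    have "b' *\<^sub>R L (1, 0) + (- b) *\<^sub>R L (0, 1) = ?d *\<^sub>R t" "(- a') *\<^sub>R L (1, 0) + a *\<^sub>R L (0, 1) = ?d *\<^sub>R j"
      unfolding L by (simp_all add: algebra_simps)
    then have e: "b' *\<^sub>R L (1, 0) + (- b) *\<^sub>R L (0, 1) = 0" "(- a') *\<^sub>R L (1, 0) + a *\<^sub>R L (0, 1) = 0"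
      unfolding 0 by simp_all
    have "b = 0" "a = 0" using inj_derivative_pair(2)[OF d inj e(1)] inj_derivative_pair(2)[OF d inj e(2)] by simp_all
    then have "1 *\<^sub>R L (1, 0) + 0 *\<^sub>R L (0, 1) = 0" by (simp add: L)
    from inj_derivative_pair(1)[OF d inj this] show False by simp
  qed
  then have "L (b' / ?d, - b / ?d) = t" "L (- a' / ?d, a / ?d) = j"
    unfolding D by (simp_all add: diff_divide_distrib[symmetric] add_divide_distrib[symmetric] mult.commute)
  then show ?thesis by blast
qed

context helix_constants
begin

lemma helix_paramD:
  assumes "helix_param V F N"
  shows "open V" "smooth_on V F" "smooth_on V N" "F ` V \<subseteq> AdS \<kappa>"
    and "\<And>w. w \<in> V \<Longrightarrow> unit_normal (F w) (N w)"
    and "\<And>w. w \<in> V \<Longrightarrow> inj (frechet_derivative F (at w))"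
    and "\<And>w v. w \<in> V \<Longrightarrow> gtau \<kappa> \<tau> (F w) (N w) (frechet_derivative F (at w) v) = 0"
    and "\<And>w v. w \<in> V \<Longrightarrow> frechet_derivative F (at w) v \<in> AdS_tangent (F w)"
proof -
  show 1: "open V" "smooth_on V F" "smooth_on V N" and n: "\<And>w. w \<in> V \<Longrightarrow> unit_normal (F w) (N w)"
    and "\<And>w. w \<in> V \<Longrightarrow> inj (frechet_derivative F (at w))"
    "\<And>w v. w \<in> V \<Longrightarrow> gtau \<kappa> \<tau> (F w) (N w) (frechet_derivative F (at w) v) = 0"
    using assms unfolding helix_param_def immersion_on_def by blast+
  show 4: "F ` V \<subseteq> AdS \<kappa>" using unit_normalD(3)[OF n] by blast
  show "frechet_derivative F (at w) v \<in> AdS_tangent (F w)" if "w \<in> V" for w v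
    by (rule AdS_map_tangent[OF 1(1,2) 4 that])
qed

lemma smooth_xc:
  assumes "open V" "smooth_on V F" "smooth_on V U"
  shows "smooth_on V (\<lambda>w. xc1 \<kappa> (F w) (U w))" "smooth_on V (\<lambda>w. xc2 \<kappa> (F w) (U w))" "smooth_on V (\<lambda>w. xc3 \<kappa> (F w) (U w))"
  unfolding xc1_def xc2_def xc3_def
  by (rule smooth_on_minus[OF assms(1) smooth_on_bilinear[OF bilinear_g0 assms(1,3) smooth_on_linear_compose[OF bounded_linear_X(1) assms(1,2)]]]
      smooth_on_bilinear[OF bilinear_g0 assms(1,3) smooth_on_linear_compose[OF bounded_linear_X(2) assms(1,2)]]
      smooth_on_bilinear[OF bilinear_g0 assms(1,3) smooth_on_linear_compose[OF bounded_linear_X(3) assms(1,2)]])+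

text \<open>The differential of the angle of the normal in the plane spanned by \<open>E2\<close> and \<open>E3\<close>.\<close>

definition dangle :: "(real \<times> real \<Rightarrow> real^4) \<Rightarrow> (real \<times> real \<Rightarrow> real^4) \<Rightarrow> real \<times> real \<Rightarrow> real \<times> real \<Rightarrow> real" where
  "dangle F N w v =
    (xc2 \<kappa> (F w) (N w) * frechet_derivative (\<lambda>w. xc3 \<kappa> (F w) (N w)) (at w) v -
     xc3 \<kappa> (F w) (N w) * frechet_derivative (\<lambda>w. xc2 \<kappa> (F w) (N w)) (at w) v) / csq"

context
  fixes V F N
  assumes param: "helix_param V F N"
begin

lemmas prm = helix_paramD[OF param]

abbreviation "n2 \<equiv> \<lambda>w. xc2 \<kappa> (F w) (N w)"
abbreviation "n3 \<equiv> \<lambda>w. xc3 \<kappa> (F w) (N w)"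
abbreviation "dF \<equiv> \<lambda>w. frechet_derivative F (at w)"
abbreviation "p1 \<equiv> \<lambda>v w. xc1 \<kappa> (F w) (frechet_derivative F (at w) v)"
abbreviation "p2 \<equiv> \<lambda>v w. xc2 \<kappa> (F w) (frechet_derivative F (at w) v)"
abbreviation "p3 \<equiv> \<lambda>v w. xc3 \<kappa> (F w) (frechet_derivative F (at w) v)"
abbreviation "Tv \<equiv> \<lambda>w. T_vec \<kappa> \<tau> lam (F w) (N w)"
abbreviation "JTv \<equiv> \<lambda>w. JT_vec \<kappa> \<tau> lam (F w) (N w)"

lemma n_sq: "w \<in> V \<Longrightarrow> n2 w * n2 w + n3 w * n3 w = csq"
  using unit_normalD(2)[OF prm(5)] by (simp add: power2_eq_square)

lemma smooth_n: "smooth_on V n2" "smooth_on V n3"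
  by (rule smooth_xc[OF prm(1-3)])+

lemma has_derivative_n:
  assumes "w \<in> V"
  shows "(n2 has_derivative frechet_derivative n2 (at w)) (at w)" "(n3 has_derivative frechet_derivative n3 (at w)) (at w)"
  by (rule smooth_on_has_derivative[OF smooth_n(1) assms] smooth_on_has_derivative[OF smooth_n(2) assms])+

lemma smooth_p: "smooth_on V (p1 v)" "smooth_on V (p2 v)" "smooth_on V (p3 v)"
  by (rule smooth_xc[OF prm(1,2) smooth_on_frechet_derivative[OF prm(2)]])+

lemma has_derivative_p:
  assumes "w \<in> V"
  shows "(p1 v has_derivative frechet_derivative (p1 v) (at w)) (at w)"
    "(p2 v has_derivative frechet_derivative (p2 v) (at w)) (at w)"
    "(p3 v has_derivative frechet_derivative (p3 v) (at w)) (at w)"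
  by (rule smooth_on_has_derivative[OF smooth_p(1) assms] smooth_on_has_derivative[OF smooth_p(2) assms]
      smooth_on_has_derivative[OF smooth_p(3) assms])+

lemma dF_fr: "w \<in> V \<Longrightarrow> dF w v = fr \<kappa> (F w) (p1 v w) (p2 v w) (p3 v w)"
  using prm(4) by (intro fr_xc[OF \<kappa> _ prm(8)]) auto

lemma constraint: "w \<in> V \<Longrightarrow> lam * \<nu> * \<tau> * p1 v w + n2 w * p2 v w + n3 w * p3 v w = 0"
  using gtau_normal[OF prm(5), of w "p1 v w" "p2 v w" "p3 v w"] prm(7)[of w v] dF_fr[of w v] by simp

text \<open>The vector \<open>(n2, n3)\<close> has constant length, so it can only rotate, and
  \<open>dangle\<close> is the rate.\<close>

lemma d_n:
  assumes "w \<in> V" "csq > 0"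
  shows "frechet_derivative n2 (at w) v = - dangle F N w v * n3 w"
    and "frechet_derivative n3 (at w) v = dangle F N w v * n2 w"
proof -
  have "((\<lambda>w. n2 w * n2 w + n3 w * n3 w) has_derivative
    (\<lambda>v. (n2 w * frechet_derivative n2 (at w) v + frechet_derivative n2 (at w) v * n2 w) +
       (n3 w * frechet_derivative n3 (at w) v + frechet_derivative n3 (at w) v * n3 w))) (at w)"
    by (intro has_derivative_add has_derivative_mult has_derivative_n[OF assms(1)])
  from has_derivative_unique_on_open[OF prm(1) assms(1) n_sq this has_derivative_const, of v]
  have 0: "n2 w * frechet_derivative n2 (at w) v + n3 w * frechet_derivative n3 (at w) v = 0" by simp
  have c: "n2 w * n2 w + n3 w * n3 w = csq" by (rule n_sq[OF assms(1)])
  have "csq * frechet_derivative n2 (at w) v = - (n2 w * frechet_derivative n3 (at w) v - n3 w * frechet_derivative n2 (at w) v) * n3 w"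
    "csq * frechet_derivative n3 (at w) v = (n2 w * frechet_derivative n3 (at w) v - n3 w * frechet_derivative n2 (at w) v) * n2 w"
    unfolding c[symmetric] using 0 by algebra+
  then show "frechet_derivative n2 (at w) v = - dangle F N w v * n3 w"
    "frechet_derivative n3 (at w) v = dangle F N w v * n2 w"
    using assms(2) by (simp_all add: dangle_def field_simps)
qed

lemma maurer_cartan:
  assumes "w \<in> V"
  shows "frechet_derivative (p1 e') (at w) e - frechet_derivative (p1 e) (at w) e' =
      - sqrt \<kappa> * (p2 e w * p3 e' w - p3 e w * p2 e' w)"
    and "frechet_derivative (p2 e') (at w) e - frechet_derivative (p2 e) (at w) e' =
      sqrt \<kappa> * (p3 e w * p1 e' w - p1 e w * p3 e' w)"
    and "frechet_derivative (p3 e') (at w) e - frechet_derivative (p3 e) (at w) e' =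
      sqrt \<kappa> * (p1 e w * p2 e' w - p2 e w * p1 e' w)"
  by (rule structure_equations[OF \<kappa> prm(1,2,4) assms])+

text \<open>Otherwise \<open>n2\<close> and \<open>n3\<close> vanish, the normal is parallel to
  \<open>E1\<close>, and all tangent planes are spanned by \<open>E2\<close> and \<open>E3\<close>.
  That plane field is a contact structure: the first structure equation would make the images of the
  two coordinate directions dependent, against the immersion property.\<close>

lemma csq_pos:
  assumes "w \<in> V"
  shows "csq > 0"
proof (rule ccontr)
  assume "\<not> csq > 0"
  have n0: "n2 z = 0 \<and> n3 z = 0" if "z \<in> V" for z
    using n_sq[OF that] \<open>\<not> csq > 0\<close> by (smt (verit) not_sum_squares_lt_zero sum_squares_eq_zero_iff)
  have p0: "p1 v z = 0" if "z \<in> V" for v z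
    using constraint[OF that, of v] n0[OF that] lam \<nu> \<tau> by auto
  have "frechet_derivative (p1 v) (at w) v' = 0" for v v'
    using has_derivative_unique_on_open[OF prm(1) assms p0 has_derivative_p(1)[OF assms] has_derivative_const] by simp
  then have dep: "p2 (1, 0) w * p3 (0, 1) w - p3 (1, 0) w * p2 (0, 1) w = 0"
    using maurer_cartan(1)[OF assms, of "(0, 1)" "(1, 0)"] \<kappa> by simp
  let ?e = "(1, 0) :: real \<times> real" and ?e' = "(0, 1) :: real \<times> real"
  note d = smooth_on_has_derivative[OF prm(2) assms] and inj = prm(6)[OF assms]
  define P2 P3 Q2 Q3 where "P2 = p2 ?e w" and "P3 = p3 ?e w" and "Q2 = p2 ?e' w" and "Q3 = p3 ?e' w"
  have D: "dF w ?e = fr \<kappa> (F w) 0 P2 P3" "dF w ?e' = fr \<kappa> (F w) 0 Q2 Q3"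
    unfolding P2_def P3_def Q2_def Q3_def using dF_fr[OF assms] p0[OF assms] by metis+
  have "Q2 *\<^sub>R dF w ?e + (- P2) *\<^sub>R dF w ?e' = 0" "Q3 *\<^sub>R dF w ?e + (- P3) *\<^sub>R dF w ?e' = 0"
    using dep unfolding P2_def[symmetric] P3_def[symmetric] Q2_def[symmetric] Q3_def[symmetric]
    by (simp_all add: D fr_arith algebra_simps)
  from inj_derivative_pair(2)[OF d inj this(1)] inj_derivative_pair(2)[OF d inj this(2)]
  have "1 *\<^sub>R dF w ?e + 0 *\<^sub>R dF w ?e' = 0" by (simp add: D fr_arith)
  from inj_derivative_pair(1)[OF d inj this] show False by simp
qed

lemma directions:
  assumes w: "w \<in> V"
  obtains \<zeta> \<eta> where "dF w \<zeta> = Tv w" "dF w \<eta> = JTv w"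
proof -
  note c = csq_pos[OF w]
  define a b where "a v = lam * \<tau> * p1 v w / csq" and "b v = (n3 w * p2 v w - n2 w * p3 v w) / csq" for v
  have ab: "dF w v = a v *\<^sub>R Tv w + b v *\<^sub>R JTv w" for v
    using tangent_decomposition[OF prm(5)[OF w] prm(8)[OF w] prm(7)[OF w] less_imp_neq[OF c, symmetric]] unfolding a_def b_def .
  from inj_derivative_basis[OF smooth_on_has_derivative[OF prm(2) w] prm(6)[OF w] ab[of "(1, 0)"] ab[of "(0, 1)"]]
  obtain \<zeta> \<eta> where "dF w \<zeta> = Tv w" "dF w \<eta> = JTv w" by (elim exE conjE)
  then show ?thesis by (rule that)
qed

lemma xc_T_JT:
  assumes "w \<in> V"
  shows "dF w v = a *\<^sub>R Tv w + b *\<^sub>R JTv w \<Longrightarrow> p1 v w = a * (lam * csq / \<tau>)"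
    "dF w v = a *\<^sub>R Tv w + b *\<^sub>R JTv w \<Longrightarrow> p2 v w = b * n3 w - a * \<nu> * n2 w"
    "dF w v = a *\<^sub>R Tv w + b *\<^sub>R JTv w \<Longrightarrow> p3 v w = - b * n2 w - a * \<nu> * n3 w"
proof -
  note u = unit_normalD[OF prm(5)[OF assms]]
  show "p1 v w = a * (lam * csq / \<tau>)" "p2 v w = b * n3 w - a * \<nu> * n2 w" "p3 v w = - b * n2 w - a * \<nu> * n3 w"
    if "dF w v = a *\<^sub>R Tv w + b *\<^sub>R JTv w"
    using that unfolding u(4,5) fr_arith by (simp_all add: xc_fr[OF \<kappa> u(3)])
qed

text \<open>By the exterior derivative of the relation \<open>g(dF, N) = 0\<close>.\<close>

lemma dangle_T:
  assumes w: "w \<in> V" and \<zeta>: "dF w \<zeta> = Tv w"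
  shows "dangle F N w \<zeta> = k"
proof -
  note c = csq_pos[OF w]
  \<comment> \<open>Both \<zeta> and \<eta> are constant parameter directions that match
    \<open>T\<close> and \<open>JT\<close> at \<open>w\<close> only; this suffices because an
    exterior derivative is tensorial.\<close>
  obtain \<eta> where \<eta>: "dF w \<eta> = JTv w" using directions[OF w] by blast
  have der: "lam * \<nu> * \<tau> * frechet_derivative (p1 v) (at w) v' + (n2 w * frechet_derivative (p2 v) (at w) v' + frechet_derivative n2 (at w) v' * p2 v w)
      + (n3 w * frechet_derivative (p3 v) (at w) v' + frechet_derivative n3 (at w) v' * p3 v w) = 0" for v v'
  proof -
    have "((\<lambda>z. lam * \<nu> * \<tau> * p1 v z + n2 z * p2 v z + n3 z * p3 v z) has_derivative
      (\<lambda>v'. lam * \<nu> * \<tau> * frechet_derivative (p1 v) (at w) v' + (n2 w * frechet_derivative (p2 v) (at w) v' + frechet_derivative n2 (at w) v' * p2 v w)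
      + (n3 w * frechet_derivative (p3 v) (at w) v' + frechet_derivative n3 (at w) v' * p3 v w))) (at w)"
      by (intro has_derivative_add has_derivative_mult has_derivative_mult_right has_derivative_n[OF w] has_derivative_p[OF w])
    from has_derivative_unique_on_open[OF prm(1) w constraint this has_derivative_const] show ?thesis .
  qed
  define L where "L = lam * csq / \<tau>"
  have P: "p1 \<zeta> w = L" "p2 \<zeta> w = - \<nu> * n2 w" "p3 \<zeta> w = - \<nu> * n3 w"
    using xc_T_JT[OF w, of \<zeta> 1 0] \<zeta> by (simp_all add: L_def)
  have Q: "p1 \<eta> w = 0" "p2 \<eta> w = n3 w" "p3 \<eta> w = - n2 w"
    using xc_T_JT[OF w, of \<eta> 0 1] \<eta> by simp_all
  define x y d d' where "x = n2 w" and "y = n3 w" and "d = dangle F N w \<zeta>" and "d' = dangle F N w \<eta>"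
  have xy: "x * x + y * y = csq" using n_sq[OF w] by (simp add: x_def y_def)
  \<comment> \<open>Antisymmetrizing \<open>der\<close> produces the differences governed by
    \<open>maurer_cartan\<close>, and the unknown rate \<open>d'\<close> along \<open>JT\<close>
    cancels.\<close>
  have "lam * \<nu> * \<tau> * (frechet_derivative (p1 \<eta>) (at w) \<zeta> - frechet_derivative (p1 \<zeta>) (at w) \<eta>)
      + x * (frechet_derivative (p2 \<eta>) (at w) \<zeta> - frechet_derivative (p2 \<zeta>) (at w) \<eta>)
      + y * (frechet_derivative (p3 \<eta>) (at w) \<zeta> - frechet_derivative (p3 \<zeta>) (at w) \<eta>)
      + (- d * y) * y + (d * x) * (- x) - ((- d' * y) * (- \<nu> * x) + (d' * x) * (- \<nu> * y)) = 0"
    using der[of \<eta> \<zeta>] der[of \<zeta> \<eta>]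
    unfolding d_n[OF w c] P Q x_def[symmetric] y_def[symmetric] d_def[symmetric] d'_def[symmetric]
    by (simp add: algebra_simps)
  then have "lam * \<nu> * \<tau> * (- sqrt \<kappa> * ((- \<nu> * x) * (- x) - (- \<nu> * y) * y))
      + x * (sqrt \<kappa> * (- L * (- x))) + y * (sqrt \<kappa> * (L * y))
      + (- d * y) * y + (d * x) * (- x) - ((- d' * y) * (- \<nu> * x) + (d' * x) * (- \<nu> * y)) = 0"
    unfolding maurer_cartan[OF w] P Q x_def[symmetric] y_def[symmetric] by simp
  then have "(x * x + y * y) * (- lam * \<nu> * \<nu> * \<tau> * sqrt \<kappa> + sqrt \<kappa> * L - d) = 0"
    by (simp add: algebra_simps)
  then have "d = sqrt \<kappa> * L - lam * \<nu> * \<nu> * \<tau> * sqrt \<kappa>"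
    using c xy by simp
  also have "\<dots> = k"
    using \<tau> by (simp add: L_def k_def B_const_def csq_def field_simps power2_eq_square)
  finally show ?thesis by (simp add: d_def)
qed

text \<open>The structure equations, evaluated on \<open>e\<close> and \<open>e'\<close>.\<close>

lemma adapted_directions:
  assumes e: "\<And>z. z \<in> V \<Longrightarrow> dF z e = Tv z" and e': "\<And>z. z \<in> V \<Longrightarrow> dF z e' = a z *\<^sub>R Tv z + b z *\<^sub>R JTv z"
    and w: "w \<in> V" and a: "(a has_derivative a') (at w)" and b: "(b has_derivative b') (at w)"
  shows "a' e = - sqrt \<kappa> * \<tau> * lam * \<nu> * b w"
    and "b' e = \<nu> * (dangle F N w e' - a w * k)"
proof -
  note c = csq_pos[OF w]
  have P: "p1 e z = lam * csq / \<tau>" "p2 e z = - \<nu> * n2 z" "p3 e z = - \<nu> * n3 z" if "z \<in> V" for z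
    using xc_T_JT[OF that, of e 1 0] e[OF that] by simp_all
  note Q = xc_T_JT[OF _ e']
  have dP: "frechet_derivative (p1 e) (at w) v = 0" "frechet_derivative (p2 e) (at w) v = - \<nu> * frechet_derivative n2 (at w) v"
    "frechet_derivative (p3 e) (at w) v = - \<nu> * frechet_derivative n3 (at w) v" for v
    using has_derivative_unique_on_open[OF prm(1) w P(1) has_derivative_p(1)[OF w] has_derivative_const]
      has_derivative_unique_on_open[OF prm(1) w P(2) has_derivative_p(2)[OF w] has_derivative_mult_right[OF has_derivative_n(1)[OF w]]]
      has_derivative_unique_on_open[OF prm(1) w P(3) has_derivative_p(3)[OF w] has_derivative_mult_right[OF has_derivative_n(2)[OF w]]]
    by blast+
  let ?d2 = "frechet_derivative n2 (at w)" and ?d3 = "frechet_derivative n3 (at w)"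
  have 1: "((\<lambda>z. a z * (lam * csq / \<tau>)) has_derivative (\<lambda>v. a' v * (lam * csq / \<tau>))) (at w)"
    by (rule has_derivative_mult_left[OF a])
  have 2: "((\<lambda>z. b z * n3 z - a z * \<nu> * n2 z) has_derivative
      (\<lambda>v. (b w * ?d3 v + b' v * n3 w) - (a w * \<nu> * ?d2 v + a' v * \<nu> * n2 w))) (at w)"
    by (intro has_derivative_diff has_derivative_mult has_derivative_mult_left has_derivative_n[OF w] a b)
  have 3: "((\<lambda>z. - b z * n2 z - a z * \<nu> * n3 z) has_derivative
      (\<lambda>v. (- b w * ?d2 v + - b' v * n2 w) - (a w * \<nu> * ?d3 v + a' v * \<nu> * n3 w))) (at w)"
    by (intro has_derivative_diff has_derivative_mult has_derivative_mult_left has_derivative_n[OF w] has_derivative_minus a b)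
  have Q': "z \<in> V \<Longrightarrow> p1 e' z = a z * (lam * csq / \<tau>)" "z \<in> V \<Longrightarrow> p2 e' z = b z * n3 z - a z * \<nu> * n2 z"
    "z \<in> V \<Longrightarrow> p3 e' z = - b z * n2 z - a z * \<nu> * n3 z" for z
    by (rule Q; assumption)+
  have dQ: "frechet_derivative (p1 e') (at w) v = a' v * (lam * csq / \<tau>)"
    "frechet_derivative (p2 e') (at w) v = (b w * ?d3 v + b' v * n3 w) - (a w * \<nu> * ?d2 v + a' v * \<nu> * n2 w)"
    "frechet_derivative (p3 e') (at w) v = (- b w * ?d2 v + - b' v * n2 w) - (a w * \<nu> * ?d3 v + a' v * \<nu> * n3 w)" for v
    by (rule has_derivative_unique_on_open[OF prm(1) w Q'(1) has_derivative_p(1)[OF w] 1]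
        has_derivative_unique_on_open[OF prm(1) w Q'(2) has_derivative_p(2)[OF w] 2]
        has_derivative_unique_on_open[OF prm(1) w Q'(3) has_derivative_p(3)[OF w] 3]; assumption)+
  define x y d A B where "x = n2 w" and "y = n3 w" and "d = dangle F N w e'" and "A = a w" and "B = b w"
  define L where "L = lam * csq / \<tau>"
  have xy: "x * x + y * y = csq" using n_sq[OF w] by (simp add: x_def y_def)
  have L: "L \<noteq> 0" using c \<tau> lam by (auto simp: L_def)
  have kT: "dangle F N w e = k" by (rule dangle_T[OF w e[OF w]])
  note eqs = maurer_cartan[OF w, of e' e, unfolded dP dQ P[OF w] Q'[OF w], unfolded d_n[OF w c] kT,
      folded x_def y_def d_def A_def B_def L_def]
  \<comment> \<open>The \<open>X1\<close> equation involves only \<open>a\<close>, since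
    \<open>JT\<close> has no \<open>X1\<close> component and that of \<open>T\<close> is the
    constant \<open>L\<close>.\<close>
  have "a' e * L = - sqrt \<kappa> * (\<nu> * B * (x * x + y * y))"
    using eqs(1) by (simp add: algebra_simps)
  then have "a' e * L = (- sqrt \<kappa> * \<tau> * lam * \<nu> * B) * L"
    using \<tau> by (simp add: xy L_def)
  then have "a' e = - sqrt \<kappa> * \<tau> * lam * \<nu> * B" by (rule mult_right_cancel[OF L, THEN iffD1])
  then show "a' e = - sqrt \<kappa> * \<tau> * lam * \<nu> * b w" by (simp add: B_def)
  \<comment> \<open>The other two equations are paired with \<open>JT\<close>, whose components are
    \<open>(y, - x)\<close>; this eliminates \<open>a'\<close>.\<close>
  have "(x * x + y * y) * (b' e + \<nu> * A * k - \<nu> * d) = 0"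
    using arg_cong[OF eqs(2), of "(*) y"] arg_cong[OF eqs(3), of "(*) x"] by (simp add: algebra_simps)
  then have "b' e + \<nu> * A * k - \<nu> * d = 0" using xy c by simp
  then show "b' e = \<nu> * (dangle F N w e' - a w * k)"
    by (simp add: A_def d_def algebra_simps)
qed

text \<open>In the expansion of \<open>N\<close> the coefficient of \<open>E1\<close> is constant
  and the others rotate at rate \<open>dangle\<close>; the covariant derivatives of the frame
  contribute the multiple of \<open>T\<close>. Thus \<mu> is the angular velocity of the normal
  along \<open>JT\<close>.\<close>

lemma shape_op_JT:
  assumes D: "levi_civita \<kappa> \<tau> D" and w: "w \<in> V" and \<eta>: "dF w \<eta> = JTv w"
  shows "shape_op \<kappa> \<tau> D F N w (JTv w) = (- (sqrt \<kappa> / 2) * lam * \<tau>) *\<^sub>R Tv w + dangle F N w \<eta> *\<^sub>R JTv w"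
proof -
  note c = csq_pos[OF w] and u = unit_normalD[OF prm(5)[OF w]]
  have inv: "inv (dF w) (JTv w) = \<eta>"
    using prm(6)[OF w] \<eta> by (rule inv_f_eq)
  have comps: "comp1 \<kappa> \<tau> (F z) (N z) = - lam * \<nu>" "comp2 \<kappa> \<tau> (F z) (N z) = n2 z" "comp3 \<kappa> \<tau> (F z) (N z) = n3 z" if "z \<in> V" for z
  proof -
    note u = unit_normalD[OF prm(5)[OF that]]
    show "comp1 \<kappa> \<tau> (F z) (N z) = - lam * \<nu>" "comp2 \<kappa> \<tau> (F z) (N z) = n2 z" "comp3 \<kappa> \<tau> (F z) (N z) = n3 z"
      using arg_cong[OF u(1), of "comp1 \<kappa> \<tau> (F z)"] arg_cong[OF u(1), of "comp2 \<kappa> \<tau> (F z)"]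
        arg_cong[OF u(1), of "comp3 \<kappa> \<tau> (F z)"] \<tau>
      unfolding comp_fr[OF \<kappa> \<tau> u(3)] by simp_all
  qed
  have cong: "frechet_derivative f (at w) = frechet_derivative g (at w)"
    if "\<And>z. z \<in> V \<Longrightarrow> f z = g z" "smooth_on V g" for f g :: "real \<times> real \<Rightarrow> real"
  proof -
    have "(f has_derivative frechet_derivative g (at w)) (at w)"
      using smooth_on_has_derivative[OF that(2) w]
      by (rule has_derivative_transform_within_open[OF _ prm(1) w]) (rule that(1)[symmetric])
    then show ?thesis by (rule frechet_derivative_at[symmetric])
  qed
  have "frechet_derivative (\<lambda>z. comp1 \<kappa> \<tau> (F z) (N z)) (at w) = (\<lambda>v. 0)"
    using cong[OF comps(1) smooth_on_const] by simp
  moreover have "frechet_derivative (\<lambda>z. comp2 \<kappa> \<tau> (F z) (N z)) (at w) = frechet_derivative n2 (at w)"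
    by (rule cong[OF comps(2) smooth_n(1)])
  moreover have "frechet_derivative (\<lambda>z. comp3 \<kappa> \<tau> (F z) (N z)) (at w) = frechet_derivative n3 (at w)"
    by (rule cong[OF comps(3) smooth_n(2)])
  moreover have "dF w \<eta> = fr \<kappa> (F w) 0 (n3 w) (- n2 w)" using \<eta> u(5) by simp
  ultimately have "cov_along \<kappa> \<tau> D F N w \<eta> =
      0 *\<^sub>R E1 \<kappa> \<tau> (F w) + (- lam * \<nu>) *\<^sub>R D (F w) (fr \<kappa> (F w) 0 (n3 w) (- n2 w)) (E1 \<kappa> \<tau>)
      + (- dangle F N w \<eta> * n3 w) *\<^sub>R E2 \<kappa> (F w) + n2 w *\<^sub>R D (F w) (fr \<kappa> (F w) 0 (n3 w) (- n2 w)) (E2 \<kappa>)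
      + (dangle F N w \<eta> * n2 w) *\<^sub>R E3 \<kappa> (F w) + n3 w *\<^sub>R D (F w) (fr \<kappa> (F w) 0 (n3 w) (- n2 w)) (E3 \<kappa>)"
    unfolding cov_along_def Let_def by (simp only: comps[OF w] d_n[OF w c])
  then have "cov_along \<kappa> \<tau> D F N w \<eta> = fr \<kappa> (F w) (sqrt \<kappa> / 2 * (n2 w * n2 w + n3 w * n3 w))
      (- lam * \<nu> * (sqrt \<kappa> / 2 * \<tau> * n2 w) - dangle F N w \<eta> * n3 w)
      (- lam * \<nu> * (sqrt \<kappa> / 2 * \<tau> * n3 w) + dangle F N w \<eta> * n2 w)"
    unfolding levi_civita_frame[OF \<kappa> \<tau> D u(3)]
    by (simp add: E_fr fr_arith fr_inject[OF \<kappa> u(3)] algebra_simps)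
  moreover have "shape_op \<kappa> \<tau> D F N w (JTv w) = - cov_along \<kappa> \<tau> D F N w \<eta>"
    by (simp only: shape_op_def inv)
  ultimately show ?thesis
    unfolding u(4,5) n_sq[OF w] using \<tau>
    by (simp add: fr_arith fr_inject[OF \<kappa> u(3)] algebra_simps)
qed

end

end

section \<open>The model curve and the rows of the matrices\<close>

text \<open>\<open>real^4\<close> as a complex plane with complex structure \<open>J1\<close>.\<close>

definition z1 :: "real^4 \<Rightarrow> complex" where "z1 u = Complex (u$1) (u$2)"
definition z2 :: "real^4 \<Rightarrow> complex" where "z2 u = Complex (u$3) (u$4)"

lemma z_eqI: "z1 u = z1 v \<Longrightarrow> z2 u = z2 v \<Longrightarrow> u = v"
  by (rule vec4_eqI) (simp_all add: z1_def z2_def)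

lemma bounded_linear_z: "bounded_linear z1" "bounded_linear z2"
  by (auto intro!: linearI simp: z1_def z2_def complex_eq_iff simp flip: linear_conv_bounded_linear)

lemma z_J:
  "z1 (J1 u) = \<i> * z1 u" "z2 (J1 u) = \<i> * z2 u" "z1 (J2 u) = cnj (z2 u)" "z2 (J2 u) = cnj (z1 u)"
  "z1 (J3 u) = \<i> * cnj (z2 u)" "z2 (J3 u) = \<i> * cnj (z1 u)"
  by (simp_all add: z1_def z2_def complex_eq_iff)

lemma z_linear:
  "z1 (u + v) = z1 u + z1 v" "z2 (u + v) = z2 u + z2 v" "z1 (r *\<^sub>R u) = of_real r * z1 u" "z2 (r *\<^sub>R u) = of_real r * z2 u"
  by (simp_all add: z1_def z2_def complex_eq_iff)

lemma z_fr:
  "z1 (fr \<kappa> q a b c) = of_real (sqrt \<kappa> / 2) * (\<i> * of_real a * z1 q + Complex b c * cnj (z2 q))"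
  "z2 (fr \<kappa> q a b c) = of_real (sqrt \<kappa> / 2) * (\<i> * of_real a * z2 q + Complex b c * cnj (z1 q))"
  unfolding Complex_eq fr_def X1_def X2_def X3_def z_linear z_J by (simp_all only: distrib_left distrib_right mult_ac add_ac)

lemma g0_z: "g0 u v = Re (z1 u * cnj (z1 v) - z2 u * cnj (z2 v))"
  by (simp add: g0_def z1_def z2_def)

text \<open>In complex coordinates the matrix has the rows \<open>(p, q)\<close> and
  \<open>(e * cnj q, e * cnj p)\<close>, where \<open>p\<close> and \<open>q\<close> have moduli
  \<open>cosh \<xi>1\<close> and |\<open>sinh \<xi>1\<close>|. Its determinant is
  \<open>e = - \<i> * cis \<xi>\<close>.\<close>

lemma z_A_mat:
  "z1 (A_mat \<xi> \<xi>1 \<xi>2 \<xi>3 *v u) = of_real (cosh \<xi>1) * cis \<xi>2 * z1 u + of_real (sinh \<xi>1) * cis \<xi>3 * z2 u"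
  "z2 (A_mat \<xi> \<xi>1 \<xi>2 \<xi>3 *v u) = - \<i> * cis \<xi> *
     (cnj (of_real (sinh \<xi>1) * cis \<xi>3) * z1 u + cnj (of_real (cosh \<xi>1) * cis \<xi>2) * z2 u)"
  by (simp_all add: z1_def z2_def complex_eq_iff matrix_vector_mult_def sum_4 A_mat_def Let_def row1_def algebra_simps)

text \<open>Such matrices are pseudo-unitary: they preserve the whole Hermitian form of signature
  (1, 1), of which \<open>g0\<close> is the real part.\<close>

lemma hermitian_identity:
  fixes p q z w z' w' e :: complex
  assumes "p * cnj p - q * cnj q = 1" "e * cnj e = 1"
  shows "(p * z + q * w) * cnj (p * z' + q * w') - e * (cnj q * z + cnj p * w) * cnj (e * (cnj q * z' + cnj p * w')) =
    z * cnj z' - w * cnj w'"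
proof -
  have "(p * z + q * w) * cnj (p * z' + q * w') - e * (cnj q * z + cnj p * w) * cnj (e * (cnj q * z' + cnj p * w')) =
    (p * z + q * w) * cnj (p * z' + q * w') - (e * cnj e) * ((cnj q * z + cnj p * w) * cnj (cnj q * z' + cnj p * w'))"
    by (simp add: algebra_simps)
  also have "\<dots> = (p * cnj p - q * cnj q) * (z * cnj z' - w * cnj w')"
    unfolding assms(2) by (simp add: algebra_simps)
  finally show ?thesis by (simp add: assms(1))
qed

lemma cis_cnj_cis: "cis a * cnj (cis a) = 1"
  by (simp add: cis_cnj cis_mult)

lemma A_mat_unimodular:
  fixes \<xi>1 \<xi>2 \<xi>3 :: real
  defines "p \<equiv> of_real (cosh \<xi>1) * cis \<xi>2" and "q \<equiv> of_real (sinh \<xi>1) * cis \<xi>3"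
  shows "p * cnj p - q * cnj q = 1"
proof -
  have "p * cnj p - q * cnj q = of_real (cosh \<xi>1 * cosh \<xi>1) * (cis \<xi>2 * cnj (cis \<xi>2)) - of_real (sinh \<xi>1 * sinh \<xi>1) * (cis \<xi>3 * cnj (cis \<xi>3))"
  proof -
    have "of_real a * c * cnj (of_real a * c) = of_real (a * a) * (c * cnj c)" for a :: real and c
      by (simp add: mult_ac)
    then show ?thesis unfolding p_def q_def by (simp only:)
  qed
  also have "\<dots> = of_real ((cosh \<xi>1)\<^sup>2 - (sinh \<xi>1)\<^sup>2)"
    unfolding cis_cnj_cis by (simp add: power2_eq_square)
  finally show ?thesis by (simp add: hyperbolic_pythagoras)
qed

lemma A_mat_pseudo_orthogonal: "pseudo_orthogonal (A_mat \<xi> \<xi>1 \<xi>2 \<xi>3)"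
  unfolding pseudo_orthogonal_def g0_z z_A_mat
proof (intro allI arg_cong[of _ _ Re])
  have e: "(- \<i> * cis \<xi>) * cnj (- \<i> * cis \<xi>) = 1"
    using cis_cnj_cis[of \<xi>] by (simp add: algebra_simps)
  show "(of_real (cosh \<xi>1) * cis \<xi>2 * z1 u + of_real (sinh \<xi>1) * cis \<xi>3 * z2 u) * cnj (of_real (cosh \<xi>1) * cis \<xi>2 * z1 v + of_real (sinh \<xi>1) * cis \<xi>3 * z2 v) -
    - \<i> * cis \<xi> * (cnj (of_real (sinh \<xi>1) * cis \<xi>3) * z1 u + cnj (of_real (cosh \<xi>1) * cis \<xi>2) * z2 u) *
      cnj (- \<i> * cis \<xi> * (cnj (of_real (sinh \<xi>1) * cis \<xi>3) * z1 v + cnj (of_real (cosh \<xi>1) * cis \<xi>2) * z2 v)) =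
    z1 u * cnj (z1 v) - z2 u * cnj (z2 v)" for u v
    by (rule hermitian_identity[OF A_mat_unimodular e])
qed

lemma A_mat_commutes_J1: "commutes_J1 (A_mat \<xi> \<xi>1 \<xi>2 \<xi>3)"
  unfolding commutes_J1_def by (intro allI z_eqI) (simp_all add: z_A_mat z_J algebra_simps)

text \<open>The mixed products of \<open>z\<close> and \<open>w\<close> occur together with their
  conjugates and have no imaginary part. Along the model curve the last factor is constant, so
  orthogonality to the normal becomes a condition on the rows alone.\<close>

lemma horizontality_identity:
  fixes p q p' q' z w :: complex
  shows "Im ((p' * z + q' * w) * cnj (p * z - q * w) - (cnj q' * z + cnj p' * w) * cnj (cnj q * z - cnj p * w)) =
    (Im (p' * cnj p) + Im (q' * cnj q)) * Re (z * cnj z - w * cnj w)"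
  by (simp add: algebra_simps)

section \<open>The constants of the model curve, its differential equation, and the rows as first
  integrals\<close>

context helix_constants
begin

text \<open>The curve \<gamma> depends on \<nu> through its absolute value only; the lost sign is
  kept here.\<close>

definition \<epsilon> :: real where "\<epsilon> = sgn (lam * \<nu>)"

abbreviation "\<alpha>1 \<equiv> alpha1 \<kappa> \<tau> lam \<nu>"
abbreviation "\<alpha>2 \<equiv> alpha2 \<kappa> \<tau> lam \<nu>"
abbreviation "rad1 \<equiv> sqrt (w11 \<kappa> \<tau> lam \<nu>)"
abbreviation "rad2 \<equiv> sqrt (- w33 \<kappa> \<tau> lam \<nu>)"
abbreviation "\<gamma> \<equiv> gam \<kappa> \<tau> lam \<nu>"

definition \<beta> :: real where "\<beta> = sqrt (B_const \<tau> lam \<nu>)"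

lemma \<epsilon>: "\<epsilon> * \<epsilon> = 1" "lam * \<nu> = \<epsilon> * \<bar>\<nu>\<bar>" "\<nu> * \<epsilon> = lam * \<bar>\<nu>\<bar>" "\<epsilon> * \<nu> = lam * \<bar>\<nu>\<bar>" "\<epsilon> \<noteq> 0"
  using lam \<nu> by (auto simp: \<epsilon>_def sgn_if)

text \<open>The two factors of \<open>csq\<close> govern the model: up to common positive constants
  they are the frequencies \<open>\<alpha>2\<close>, \<open>\<alpha>1\<close> and also the squared
  radii \<open>w11\<close>, \<open>- w33\<close>.\<close>

lemma \<beta>: "\<beta> * \<beta> = B_const \<tau> lam \<nu>" "\<beta> > 0" "csq = (\<bar>\<nu>\<bar> * \<tau> - \<beta>) * (\<bar>\<nu>\<bar> * \<tau> + \<beta>)"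
proof -
  show b: "\<beta> * \<beta> = B_const \<tau> lam \<nu>" "\<beta> > 0" using B by (simp_all add: \<beta>_def)
  have "(\<bar>\<nu>\<bar> * \<tau> - \<beta>) * (\<bar>\<nu>\<bar> * \<tau> + \<beta>) = (\<bar>\<nu>\<bar> * \<bar>\<nu>\<bar>) * (\<tau> * \<tau>) - \<beta> * \<beta>"
    by (simp add: algebra_simps)
  also have "\<dots> = csq" by (simp only: b) (simp add: B_const_def csq_def power2_eq_square algebra_simps)
  finally show "csq = (\<bar>\<nu>\<bar> * \<tau> - \<beta>) * (\<bar>\<nu>\<bar> * \<tau> + \<beta>)" by (rule sym)
qed

lemma alpha_eq:
  "\<alpha>1 = sqrt \<kappa> / 2 * \<beta> / \<tau> * (\<bar>\<nu>\<bar> * \<tau> + \<beta>)" "\<alpha>2 = sqrt \<kappa> / 2 * \<beta> / \<tau> * (\<bar>\<nu>\<bar> * \<tau> - \<beta>)"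
  unfolding alpha1_def alpha2_def \<beta>_def[symmetric] unfolding \<beta>(1)[symmetric] using \<tau> by (simp_all add: field_simps)

text \<open>The coordinates of \<gamma> rotate with frequencies \<open>- lam * \<alpha>1\<close> and
  \<open>lam * \<alpha>2\<close>; their sum has to be \<open>k\<close> for \<gamma> to satisfy an
  equation whose coefficient rotates with speed \<open>k\<close>.\<close>

lemma alpha_diff: "\<alpha>1 - \<alpha>2 = - lam * k"
  using \<tau> by (simp add: alpha1_def alpha2_def k_def algebra_simps)

lemma kappa_powr: "\<kappa> powr (3 / 2) = \<kappa> * sqrt \<kappa>"
proof -
  have "\<kappa> powr (1 + 1 / 2) = \<kappa> powr 1 * \<kappa> powr (1 / 2)" by (rule powr_add)
  then show ?thesis using \<kappa> by (simp add: powr_half_sqrt)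
qed

lemma w_eq:
  "w11 \<kappa> \<tau> lam \<nu> = 2 / (\<kappa> * \<beta>) * (\<bar>\<nu>\<bar> * \<tau> - \<beta>)" "- w33 \<kappa> \<tau> lam \<nu> = 2 / (\<kappa> * \<beta>) * (\<bar>\<nu>\<bar> * \<tau> + \<beta>)"
proof -
  have f: "4 * t / (c * s * (b * b)) * (s / 2 * b / t * d) = 2 / (c * b) * d"
    if "t > 0" "c > 0" "s > 0" "b > 0" for t c s b d :: real
    using that by (simp add: field_simps)
  show "w11 \<kappa> \<tau> lam \<nu> = 2 / (\<kappa> * \<beta>) * (\<bar>\<nu>\<bar> * \<tau> - \<beta>)" "- w33 \<kappa> \<tau> lam \<nu> = 2 / (\<kappa> * \<beta>) * (\<bar>\<nu>\<bar> * \<tau> + \<beta>)"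
    unfolding w11_def w33_def alpha_eq kappa_powr unfolding \<beta>(1)[symmetric] mult_minus_left minus_minus
    by (rule f[OF \<tau> \<kappa> real_sqrt_gt_zero[OF \<kappa>] \<beta>(2)])+
qed

context
  assumes c0: "csq > 0"
begin

lemma diff_pos: "\<bar>\<nu>\<bar> * \<tau> - \<beta> > 0" "\<bar>\<nu>\<bar> * \<tau> + \<beta> > 0"
proof -
  show "\<bar>\<nu>\<bar> * \<tau> + \<beta> > 0" using \<beta>(2) \<tau> by (simp add: add_nonneg_pos)
  then show "\<bar>\<nu>\<bar> * \<tau> - \<beta> > 0" using c0 \<beta>(3) by (simp add: zero_less_mult_iff)
qed

lemma w_pos: "w11 \<kappa> \<tau> lam \<nu> > 0" "- w33 \<kappa> \<tau> lam \<nu> > 0"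
  unfolding w_eq using diff_pos \<kappa> \<beta>(2) by simp_all

lemma alpha_pos: "\<alpha>1 > 0" "\<alpha>2 > 0"
  unfolding alpha_eq using diff_pos \<kappa> \<tau> \<beta>(2) by simp_all

lemma rad: "rad1 > 0" "rad2 > 0" "rad1 * rad1 - rad2 * rad2 = - 4 / \<kappa>"
proof -
  show "rad1 > 0" "rad2 > 0" using w_pos by simp_all
  have "rad1 * rad1 - rad2 * rad2 = 2 / (\<kappa> * \<beta>) * (\<bar>\<nu>\<bar> * \<tau> - \<beta>) - 2 / (\<kappa> * \<beta>) * (\<bar>\<nu>\<bar> * \<tau> + \<beta>)"
  proof -
    have "rad1 * rad1 = w11 \<kappa> \<tau> lam \<nu>" "rad2 * rad2 = - w33 \<kappa> \<tau> lam \<nu>" using w_pos by simp_all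
    then show ?thesis by (simp only: w_eq)
  qed
  also have "\<dots> = - 4 / \<kappa>" using \<beta>(2) \<kappa> by (simp add: field_simps)
  finally show "rad1 * rad1 - rad2 * rad2 = - 4 / \<kappa>" .
qed

text \<open>The radii are to each other as the square roots of the two factors of
  \<open>csq\<close>, whose product is \<open>sqrt csq\<close>.\<close>

lemma rad_ratio:
  "sqrt csq * rad2 = (\<beta> + \<bar>\<nu>\<bar> * \<tau>) * rad1" "sqrt csq * rad1 = (\<bar>\<nu>\<bar> * \<tau> - \<beta>) * rad2"
proof -
  define a b e where "a = sqrt (\<bar>\<nu>\<bar> * \<tau> - \<beta>)" and "b = sqrt (\<bar>\<nu>\<bar> * \<tau> + \<beta>)" and "e = sqrt (2 / (\<kappa> * \<beta>))"
  have "a * a = \<bar>\<nu>\<bar> * \<tau> - \<beta>" "b * b = \<bar>\<nu>\<bar> * \<tau> + \<beta>"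
    using diff_pos unfolding a_def b_def by simp_all
  moreover have "sqrt csq = a * b" "rad1 = e * a" "rad2 = e * b"
    unfolding a_def b_def e_def w_eq \<beta>(3) by (rule real_sqrt_mult)+
  ultimately show "sqrt csq * rad2 = (\<beta> + \<bar>\<nu>\<bar> * \<tau>) * rad1" "sqrt csq * rad1 = (\<bar>\<nu>\<bar> * \<tau> - \<beta>) * rad2"
    by (simp_all add: mult_ac add.commute)
qed

lemma z_gamma: "z1 (\<gamma> x) = of_real rad1 * cis (- lam * \<alpha>1 * x)" "z2 (\<gamma> x) = of_real rad2 * cis (lam * \<alpha>2 * x)"
  using lam by (auto simp: gam_def z1_def z2_def complex_eq_iff)

text \<open>\<open>mg\<close> plays for the curve \<open>\<gamma>\<close> the role of the component \<open>n2 + i n3\<close> of the normal.\<close>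

definition mg :: "real \<Rightarrow> complex" where "mg x = of_real (\<epsilon> * sqrt csq) * \<i> * cis (k * x)"

text \<open>The antilinear map that conjugates, swaps the two coordinates and multiplies by
  \<open>mg x\<close> acts diagonally on \<open>\<gamma> x\<close>. The phases match because of the
  choice of \<open>k\<close>, the moduli because of the ratio of the radii.\<close>

lemma mg_gamma:
  "mg x * cnj (z2 (\<gamma> x)) = \<i> * of_real (\<epsilon> * (\<beta> + \<bar>\<nu>\<bar> * \<tau>)) * z1 (\<gamma> x)"
  "mg x * cnj (z1 (\<gamma> x)) = \<i> * of_real (\<epsilon> * (\<bar>\<nu>\<bar> * \<tau> - \<beta>)) * z2 (\<gamma> x)"
proof -
  have k: "k = - lam * (\<alpha>1 - \<alpha>2)" unfolding alpha_diff by simp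
  have "cis (k * x) * cnj (cis (lam * \<alpha>2 * x)) = cis (- lam * \<alpha>1 * x)"
    "cis (k * x) * cnj (cis (- lam * \<alpha>1 * x)) = cis (lam * \<alpha>2 * x)"
    unfolding cis_cnj cis_mult k by (rule arg_cong[of _ _ cis]; simp add: algebra_simps)+
  moreover have "mg x * cnj (z2 (\<gamma> x)) = \<i> * of_real (\<epsilon> * (sqrt csq * rad2)) * (cis (k * x) * cnj (cis (lam * \<alpha>2 * x)))"
    "mg x * cnj (z1 (\<gamma> x)) = \<i> * of_real (\<epsilon> * (sqrt csq * rad1)) * (cis (k * x) * cnj (cis (- lam * \<alpha>1 * x)))"
    unfolding mg_def z_gamma by (simp_all add: mult_ac)
  ultimately show "mg x * cnj (z2 (\<gamma> x)) = \<i> * of_real (\<epsilon> * (\<beta> + \<bar>\<nu>\<bar> * \<tau>)) * z1 (\<gamma> x)"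
    "mg x * cnj (z1 (\<gamma> x)) = \<i> * of_real (\<epsilon> * (\<bar>\<nu>\<bar> * \<tau> - \<beta>)) * z2 (\<gamma> x)"
    unfolding rad_ratio z_gamma by (simp_all add: mult_ac)
qed

lemma z_gamma_AdS: "z1 (\<gamma> x) * cnj (z1 (\<gamma> x)) - z2 (\<gamma> x) * cnj (z2 (\<gamma> x)) = of_real (- 4 / \<kappa>)"
proof -
  have "z1 (\<gamma> x) * cnj (z1 (\<gamma> x)) - z2 (\<gamma> x) * cnj (z2 (\<gamma> x)) =
      of_real (rad1 * rad1) * (cis (- lam * \<alpha>1 * x) * cnj (cis (- lam * \<alpha>1 * x)))
      - of_real (rad2 * rad2) * (cis (lam * \<alpha>2 * x) * cnj (cis (lam * \<alpha>2 * x)))"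
    unfolding z_gamma by (simp only: complex_cnj_mult complex_cnj_complex_of_real of_real_mult mult_ac)
  also have "\<dots> = of_real (rad1 * rad1 - rad2 * rad2)" by (simp only: cis_cnj_cis mult_1_right of_real_diff)
  finally show ?thesis by (simp only: rad(3))
qed

text \<open>The right-hand sides are the coordinates of \<open>T\<close> according to
  \<open>z_fr\<close>, with \<open>mg\<close> as the \<open>E2\<close>, \<open>E3\<close> part of
  the normal. By \<open>mg_gamma\<close> each equation is scalar, and \<open>s\<close> identifies
  its frequency.\<close>

lemma gamma_ode:
  "((\<lambda>x. z1 (\<gamma> x)) has_vector_derivative
     of_real (sqrt \<kappa> / 2) * (\<i> * of_real (lam * csq / \<tau>) * z1 (\<gamma> x) - of_real \<nu> * mg x * cnj (z2 (\<gamma> x)))) (at x)"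
  "((\<lambda>x. z2 (\<gamma> x)) has_vector_derivative
     of_real (sqrt \<kappa> / 2) * (\<i> * of_real (lam * csq / \<tau>) * z2 (\<gamma> x) - of_real \<nu> * mg x * cnj (z1 (\<gamma> x)))) (at x)"
proof -
  have s: "- lam * \<alpha>1 = sqrt \<kappa> / 2 * (lam * csq / \<tau> - \<nu> * \<epsilon> * (\<beta> + \<bar>\<nu>\<bar> * \<tau>))"
    "lam * \<alpha>2 = sqrt \<kappa> / 2 * (lam * csq / \<tau> - \<nu> * \<epsilon> * (\<bar>\<nu>\<bar> * \<tau> - \<beta>))"
    unfolding alpha_eq \<epsilon>(3) \<beta>(3) using \<tau> by (simp_all add: field_simps)
  have "((\<lambda>x. of_real rad1 * cis (- lam * \<alpha>1 * x)) has_vector_derivative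
      of_real rad1 * (of_real (- lam * \<alpha>1) * \<i> * cis (- lam * \<alpha>1 * x))) (at x)"
    "((\<lambda>x. of_real rad2 * cis (lam * \<alpha>2 * x)) has_vector_derivative
      of_real rad2 * (of_real (lam * \<alpha>2) * \<i> * cis (lam * \<alpha>2 * x))) (at x)"
    by (intro has_vector_derivative_mult_right has_vector_derivative_cis; auto intro!: derivative_eq_intros)+
  then have d: "((\<lambda>x. z1 (\<gamma> x)) has_vector_derivative (of_real (- lam * \<alpha>1) * \<i> * z1 (\<gamma> x))) (at x)"
    "((\<lambda>x. z2 (\<gamma> x)) has_vector_derivative (of_real (lam * \<alpha>2) * \<i> * z2 (\<gamma> x))) (at x)"
    unfolding z_gamma by (simp_all only: mult_ac)
  have "of_real (- lam * \<alpha>1) * \<i> * z1 (\<gamma> x) =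
      of_real (sqrt \<kappa> / 2) * (\<i> * of_real (lam * csq / \<tau>) * z1 (\<gamma> x) - of_real \<nu> * (mg x * cnj (z2 (\<gamma> x))))"
    "of_real (lam * \<alpha>2) * \<i> * z2 (\<gamma> x) =
      of_real (sqrt \<kappa> / 2) * (\<i> * of_real (lam * csq / \<tau>) * z2 (\<gamma> x) - of_real \<nu> * (mg x * cnj (z1 (\<gamma> x))))"
    unfolding mg_gamma s by (simp_all add: algebra_simps)
  with d show "((\<lambda>x. z1 (\<gamma> x)) has_vector_derivative
     of_real (sqrt \<kappa> / 2) * (\<i> * of_real (lam * csq / \<tau>) * z1 (\<gamma> x) - of_real \<nu> * mg x * cnj (z2 (\<gamma> x)))) (at x)"
  "((\<lambda>x. z2 (\<gamma> x)) has_vector_derivative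
     of_real (sqrt \<kappa> / 2) * (\<i> * of_real (lam * csq / \<tau>) * z2 (\<gamma> x) - of_real \<nu> * mg x * cnj (z1 (\<gamma> x)))) (at x)"
    by (simp_all only: mult.assoc)
qed

text \<open>The first row of the pseudo-unitary matrix that takes \<open>\<gamma> x\<close> to \<open>q\<close>, and whose second row is
  determined by the first one and by \<open>e\<close>.\<close>

definition rowp :: "complex \<Rightarrow> real^4 \<Rightarrow> real \<Rightarrow> complex" where
  "rowp e q x = of_real (- \<kappa> / 4) * (z1 q * cnj (z1 (\<gamma> x)) - e * cnj (z2 q) * z2 (\<gamma> x))"

definition rowq :: "complex \<Rightarrow> real^4 \<Rightarrow> real \<Rightarrow> complex" where
  "rowq e q x = of_real (- \<kappa> / 4) * (e * cnj (z2 q) * z1 (\<gamma> x) - z1 q * cnj (z2 (\<gamma> x)))"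

text \<open>Cramer's rule for the first row as unknown: the equation for \<open>z1 q\<close> and the
  conjugate of that for \<open>z2 q\<close> form a linear system with determinant -4/\<kappa>,
  whence the factor -\<kappa>/4 in \<open>rowp\<close> and \<open>rowq\<close>.\<close>

lemma row_recover:
  assumes "e * cnj e = 1"
  shows "z1 q = rowp e q x * z1 (\<gamma> x) + rowq e q x * z2 (\<gamma> x)"
    and "z2 q = e * (cnj (rowq e q x) * z1 (\<gamma> x) + cnj (rowp e q x) * z2 (\<gamma> x))"
proof -
  define z w f h where "z = z1 (\<gamma> x)" and "w = z2 (\<gamma> x)" and "f = z1 q" and "h = z2 q"
  have n: "z * cnj z - w * cnj w = of_real (- 4 / \<kappa>)" unfolding z_def w_def by (rule z_gamma_AdS)
  have kk: "of_real (- \<kappa> / 4) * of_real (- 4 / \<kappa>) = (1 :: complex)"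
    unfolding of_real_mult[symmetric] using \<kappa> by simp
  have "rowp e q x * z + rowq e q x * w = of_real (- \<kappa> / 4) * (z * cnj z - w * cnj w) * f"
    unfolding rowp_def rowq_def z_def[symmetric] w_def[symmetric] f_def[symmetric] h_def[symmetric]
    by (simp add: algebra_simps)
  also have "\<dots> = f" by (simp only: n kk mult_1_left)
  finally show "z1 q = rowp e q x * z1 (\<gamma> x) + rowq e q x * z2 (\<gamma> x)"
    unfolding z_def w_def f_def by (rule sym)
  have "e * (cnj (rowq e q x) * z + cnj (rowp e q x) * w) = (e * cnj e) * (of_real (- \<kappa> / 4) * (z * cnj z - w * cnj w)) * h"
    unfolding rowp_def rowq_def z_def[symmetric] w_def[symmetric] f_def[symmetric] h_def[symmetric]
    by (simp add: algebra_simps)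
  also have "\<dots> = h" by (simp only: n kk assms mult_1_left)
  finally show "z2 q = e * (cnj (rowq e q x) * z1 (\<gamma> x) + cnj (rowp e q x) * z2 (\<gamma> x))"
    unfolding z_def w_def h_def by (rule sym)
qed

text \<open>The left side minus the norm of \<open>rowq\<close> squared is \<kappa>^2/16 times the
  product of the Hermitian squares of \<open>q\<close> and \<open>\<gamma> x\<close>, both equal to
  -4/\<kappa>.\<close>

lemma row_unimodular:
  assumes "e * cnj e = 1" "q \<in> AdS \<kappa>"
  shows "(norm (rowp e q x))\<^sup>2 = 1 + (norm (rowq e q x))\<^sup>2"
proof -
  define z w f h where "z = z1 (\<gamma> x)" and "w = z2 (\<gamma> x)" and "f = z1 q" and "h = z2 q"
  have n: "z * cnj z - w * cnj w = of_real (- 4 / \<kappa>)" unfolding z_def w_def by (rule z_gamma_AdS)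
  have "Re (f * cnj f - h * cnj h) = - 4 / \<kappa>" using assms(2) by (simp only: AdS_g0 g0_z f_def h_def)
  then have m: "f * cnj f - h * cnj h = of_real (- 4 / \<kappa>)" by (simp add: complex_eq_iff)
  have kk: "of_real (- \<kappa> / 4) * of_real (- 4 / \<kappa>) = (1 :: complex)"
    unfolding of_real_mult[symmetric] using \<kappa> by simp
  have "rowp e q x * cnj (rowp e q x) - rowq e q x * cnj (rowq e q x) =
     (of_real (- \<kappa> / 4) * of_real (- \<kappa> / 4)) * ((z * cnj z - w * cnj w) * (f * cnj f) - (e * cnj e) * (z * cnj z - w * cnj w) * (h * cnj h))"
    unfolding rowp_def rowq_def z_def[symmetric] w_def[symmetric] f_def[symmetric] h_def[symmetric]
    by (simp add: algebra_simps)
  also have "\<dots> = (of_real (- \<kappa> / 4) * (z * cnj z - w * cnj w)) * (of_real (- \<kappa> / 4) * (f * cnj f - h * cnj h))"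
    unfolding assms(1) by (simp add: algebra_simps)
  also have "\<dots> = 1" by (simp only: n m kk mult_1_left)
  finally have "complex_of_real ((norm (rowp e q x))\<^sup>2 - (norm (rowq e q x))\<^sup>2) = 1"
    by (simp only: complex_norm_square of_real_diff)
  then show ?thesis by (metis add.commute diff_eq_eq of_real_eq_1_iff)
qed

text \<open>A pseudo-unitary matrix of determinant \<open>e\<close> carries solutions with
  coefficient \<open>mg\<close> to solutions with coefficient \<open>e * mg\<close>, hence the
  assumption on \<open>Complex a b\<close>. After substitution of both differential equations what
  is left is a multiple of \<open>e * cnj e - 1\<close>.\<close>

lemma row_first_integral:
  fixes F :: "real \<times> real \<Rightarrow> real^4" and X :: "real \<times> real \<Rightarrow> real"
  assumes F: "(F has_derivative F') (at w)" and X: "(X has_derivative X') (at w)" and "X' \<zeta> = 1"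
    and e: "e * cnj e = 1" and T: "F' \<zeta> = fr \<kappa> (F w) (lam * csq / \<tau>) (- \<nu> * a) (- \<nu> * b)"
    and ab: "Complex a b = e * mg (X w)"
  obtains P' Q' where "((\<lambda>w. rowp e (F w) (X w)) has_derivative P') (at w)"
    "((\<lambda>w. rowq e (F w) (X w)) has_derivative Q') (at w)" "P' \<zeta> = 0" "Q' \<zeta> = 0"
proof -
  define s l m where "s = complex_of_real (sqrt \<kappa> / 2)" and "l = complex_of_real (lam * csq / \<tau>)" and "m = mg (X w)"
  define z w' f h where zw: "z = z1 (\<gamma> (X w))" "w' = z2 (\<gamma> (X w))" "f = z1 (F w)" "h = z2 (F w)"
  define dz dw where "dz = s * (\<i> * l * z - of_real \<nu> * m * cnj w')" and "dw = s * (\<i> * l * w' - of_real \<nu> * m * cnj z)"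
  note f = bounded_linear.has_derivative[OF bounded_linear_z(1) F] and h = bounded_linear.has_derivative[OF bounded_linear_z(2) F]
  have gz: "((\<lambda>w. z1 (\<gamma> (X w))) has_derivative (\<lambda>v. X' v *\<^sub>R dz)) (at w)"
    "((\<lambda>w. z2 (\<gamma> (X w))) has_derivative (\<lambda>v. X' v *\<^sub>R dw)) (at w)"
    unfolding dz_def dw_def s_def l_def m_def zw
    by (rule has_derivative_compose[OF X gamma_ode(1)[unfolded has_vector_derivative_def]]
        has_derivative_compose[OF X gamma_ode(2)[unfolded has_vector_derivative_def]])+
  note cnj = bounded_linear.has_derivative[OF bounded_linear_cnj]
  have ts: "z1 (F' \<zeta>) = s * (\<i> * l * f - of_real \<nu> * (e * m) * cnj h)" "z2 (F' \<zeta>) = s * (\<i> * l * h - of_real \<nu> * (e * m) * cnj f)"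
  proof -
    have "Complex (- \<nu> * a) (- \<nu> * b) = - (of_real \<nu> * (e * m))"
      using ab by (simp add: m_def[symmetric]) (metis Complex_mult_complex_of_real complex_of_real_mult_Complex complex_minus mult_minus_left)
    then show "z1 (F' \<zeta>) = s * (\<i> * l * f - of_real \<nu> * (e * m) * cnj h)" "z2 (F' \<zeta>) = s * (\<i> * l * h - of_real \<nu> * (e * m) * cnj f)"
      unfolding T z_fr s_def l_def zw by simp_all
  qed
  have sl: "cnj s = s" "cnj l = l" by (simp_all add: s_def l_def)
  let ?k = "complex_of_real (- \<kappa> / 4)"
  have dp: "((\<lambda>w. rowp e (F w) (X w)) has_derivative
     (\<lambda>v. ?k * ((f * cnj (X' v *\<^sub>R dz) + z1 (F' v) * cnj z) - (e * cnj h * (X' v *\<^sub>R dw) + (e * cnj (z2 (F' v))) * w')))) (at w)"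
    unfolding rowp_def zw by (intro has_derivative_mult_right has_derivative_diff has_derivative_mult cnj f h gz)
  have dq: "((\<lambda>w. rowq e (F w) (X w)) has_derivative
     (\<lambda>v. ?k * ((e * cnj h * (X' v *\<^sub>R dz) + (e * cnj (z2 (F' v))) * z) - (f * cnj (X' v *\<^sub>R dw) + z1 (F' v) * cnj w')))) (at w)"
    unfolding rowq_def zw by (intro has_derivative_mult_right has_derivative_diff has_derivative_mult cnj f h gz)
  have p0: "(f * cnj (X' \<zeta> *\<^sub>R dz) + z1 (F' \<zeta>) * cnj z) - (e * cnj h * (X' \<zeta> *\<^sub>R dw) + (e * cnj (z2 (F' \<zeta>))) * w') = 0"
  proof -
    have "(f * cnj (X' \<zeta> *\<^sub>R dz) + z1 (F' \<zeta>) * cnj z) - (e * cnj h * (X' \<zeta> *\<^sub>R dw) + (e * cnj (z2 (F' \<zeta>))) * w') =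
      s * of_real \<nu> * cnj m * f * w' * (e * cnj e - 1)"
      unfolding ts assms(3) dz_def dw_def by (simp add: sl algebra_simps)
    then show ?thesis by (simp add: e)
  qed
  have q0: "(e * cnj h * (X' \<zeta> *\<^sub>R dz) + (e * cnj (z2 (F' \<zeta>))) * z) - (f * cnj (X' \<zeta> *\<^sub>R dw) + z1 (F' \<zeta>) * cnj w') = 0"
  proof -
    have "(e * cnj h * (X' \<zeta> *\<^sub>R dz) + (e * cnj (z2 (F' \<zeta>))) * z) - (f * cnj (X' \<zeta> *\<^sub>R dw) + z1 (F' \<zeta>) * cnj w') =
      - s * of_real \<nu> * cnj m * f * z * (e * cnj e - 1)"
      unfolding ts assms(3) dz_def dw_def by (simp add: sl algebra_simps)
    then show ?thesis by (simp add: e)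
  qed
  show ?thesis
    by (rule that[OF dp dq]) (simp_all only: p0 q0 mult_zero_right)
qed

text \<open>The left-hand side is the inner product of \<open>U\<close> with the normal.\<close>

lemma normal_horizontal:
  assumes e: "e * cnj e = 1" and q: "z1 q = p * z1 (\<gamma> x) + r * z2 (\<gamma> x)" "z2 q = e * (cnj r * z1 (\<gamma> x) + cnj p * z2 (\<gamma> x))"
    and U: "z1 U = p' * z1 (\<gamma> x) + r' * z2 (\<gamma> x)" "z2 U = e * (cnj r' * z1 (\<gamma> x) + cnj p' * z2 (\<gamma> x))"
    and ab: "Complex a b = e * mg x"
  shows "lam * \<nu> * \<tau> * xc1 \<kappa> q U + a * xc2 \<kappa> q U + b * xc3 \<kappa> q U =
    - (sqrt \<kappa> / 2) * (\<epsilon> * \<beta>) * (4 / \<kappa>) * (Im (p' * cnj p) + Im (r' * cnj r))"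
proof -
  define z w where "z = z1 (\<gamma> x)" and "w = z2 (\<gamma> x)"
  \<comment> \<open>Up to the factor \<open>sqrt \<kappa> / 2\<close>, \<open>M\<close> represents
    through \<open>g0\<close> the pairing with the normal.\<close>
  define M where "M = (- lam * \<nu> * \<tau>) *\<^sub>R J1 q + (a *\<^sub>R J2 q + b *\<^sub>R J3 q)"
  have G1: "lam * \<nu> * \<tau> * xc1 \<kappa> q U + a * xc2 \<kappa> q U + b * xc3 \<kappa> q U = sqrt \<kappa> / 2 * g0 U M"
    by (simp add: M_def xc1_def xc2_def xc3_def X1_def X2_def X3_def g0_simps algebra_simps)
  have G2: "g0 U M = Re (- \<i> * of_real (\<epsilon> * \<beta>) * ((p' * z + r' * w) * cnj (p * z - r * w) - (cnj r' * z + cnj p' * w) * cnj (cnj r * z - cnj p * w)))"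
  proof -
    have mw: "mg x * cnj w = \<i> * of_real (\<epsilon> * (\<beta> + \<bar>\<nu>\<bar> * \<tau>)) * z" and mz: "mg x * cnj z = \<i> * of_real (\<epsilon> * (\<bar>\<nu>\<bar> * \<tau> - \<beta>)) * w"
      unfolding z_def w_def by (rule mg_gamma)+
    have M0: "M = (- (\<epsilon> * \<bar>\<nu>\<bar> * \<tau>)) *\<^sub>R J1 q + (a *\<^sub>R J2 q + b *\<^sub>R J3 q)"
      unfolding M_def \<epsilon>(2)[symmetric] by simp
    have zM: "z1 M = of_real (- (\<epsilon> * \<bar>\<nu>\<bar> * \<tau>)) * (\<i> * (p * z + r * w)) + (e * mg x) * cnj (z2 q)"
      "z2 M = of_real (- (\<epsilon> * \<bar>\<nu>\<bar> * \<tau>)) * (\<i> * (e * (cnj r * z + cnj p * w))) + (e * mg x) * cnj (z1 q)"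
      unfolding M0 z_linear z_J q ab[symmetric] z_def w_def by (simp_all add: complex_eq_iff algebra_simps)
    have em: "(e * mg x) * cnj (z2 q) = (e * cnj e) * (r * (mg x * cnj z) + p * (mg x * cnj w))"
      "(e * mg x) * cnj (z1 q) = e * (cnj p * (mg x * cnj z) + cnj r * (mg x * cnj w))"
      unfolding q z_def[symmetric] w_def[symmetric] by (simp_all add: algebra_simps)
    \<comment> \<open>The terms with \<nu> and \<tau> cancel: up to the factor
      \<open>\<i> * \<epsilon> * \<beta>\<close>, \<open>M\<close> is the image under the matrix of
      \<open>\<gamma> x\<close> with its second coordinate negated.\<close>
    have M: "z1 M = \<i> * of_real (\<epsilon> * \<beta>) * (p * z - r * w)" "z2 M = \<i> * of_real (\<epsilon> * \<beta>) * (e * (cnj r * z - cnj p * w))"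
      unfolding zM em e mw mz by (simp_all add: algebra_simps)
    have "z1 U * cnj (z1 M) - z2 U * cnj (z2 M) = - \<i> * of_real (\<epsilon> * \<beta>) * ((p' * z + r' * w) * cnj (p * z - r * w) - (e * cnj e) * ((cnj r' * z + cnj p' * w) * cnj (cnj r * z - cnj p * w)))"
      unfolding M U z_def[symmetric] w_def[symmetric] by (simp add: algebra_simps)
    then show ?thesis unfolding g0_z e by simp
  qed
  have R: "Re (- \<i> * of_real t * c) = t * Im c" for t c by simp
  have n: "Re (z * cnj z - w * cnj w) = - 4 / \<kappa>"
    unfolding z_def w_def z_gamma_AdS by (rule Re_complex_of_real)
  have "a * (b * (c * (- 4 / \<kappa>))) = - a * b * (4 / \<kappa>) * c" for a b c by simp
  then show ?thesis
    unfolding G1 G2 R horizontality_identity n .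
qed

end

end

section \<open>The torus and the converse\<close>

lemma has_vector_derivative_coordinates:
  fixes F :: "real \<times> real \<Rightarrow> 'b::real_normed_vector"
  assumes "(F has_derivative L) (at (x, y))"
  shows "((\<lambda>t. F (t, y)) has_vector_derivative L (1, 0)) (at x)"
    and "((\<lambda>t. F (x, t)) has_vector_derivative L (0, 1)) (at y)"
proof -
  have "((\<lambda>t. (t, y)) has_derivative (\<lambda>h. (h, 0))) (at x)" "((\<lambda>t. (x, t)) has_derivative (\<lambda>h. (0, h))) (at y)"
    by (auto intro!: derivative_eq_intros)
  from has_derivative_compose[OF this(1) assms] has_derivative_compose[OF this(2) assms]
  have d: "((\<lambda>t. F (t, y)) has_derivative (\<lambda>h. L (h, 0))) (at x)" "((\<lambda>t. F (x, t)) has_derivative (\<lambda>h. L (0, h))) (at y)" .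
  have e: "(\<lambda>h. L (h, 0)) = (\<lambda>h. h *\<^sub>R L (1, 0))" "(\<lambda>h. L (0, h)) = (\<lambda>h. h *\<^sub>R L (0, 1))"
  proof -
    show "(\<lambda>h. L (h, 0)) = (\<lambda>h. h *\<^sub>R L (1, 0))"
    proof
      show "L (h, 0) = h *\<^sub>R L (1, 0)" for h
        using frechet_derivative_pair[OF assms, of h 0] by simp
    qed
    show "(\<lambda>h. L (0, h)) = (\<lambda>h. h *\<^sub>R L (0, 1))"
    proof
      show "L (0, h) = h *\<^sub>R L (0, 1)" for h
        using frechet_derivative_pair[OF assms, of 0 h] by simp
    qed
  qed
  show "((\<lambda>t. F (t, y)) has_vector_derivative L (1, 0)) (at x)"
    "((\<lambda>t. F (x, t)) has_vector_derivative L (0, 1)) (at y)"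
    unfolding has_vector_derivative_def e[symmetric] by (rule d)+
qed

text \<open>Change of the radius contributes a real multiple of \<open>u * cnj u\<close>; only
  rotation reaches the imaginary part.\<close>

lemma polar_derivative:
  assumes "(r has_real_derivative r') (at y)" "(s has_real_derivative s') (at y)"
  obtains u' where "((\<lambda>y. of_real (r y) * cis (s y)) has_vector_derivative u') (at y)"
    "Im (u' * cnj (of_real (r y) * cis (s y))) = (r y)\<^sup>2 * s'"
proof -
  have r: "((\<lambda>y. complex_of_real (r y)) has_vector_derivative of_real r') (at y)"
    using assms(1) by (intro has_vector_derivative_of_real) (simp add: has_real_derivative_iff_has_vector_derivative)
  let ?u = "of_real (r y) * (of_real s' * \<i> * cis (s y)) + of_real r' * cis (s y)"
  have "?u * cnj (of_real (r y) * cis (s y)) = of_real (r y) * (of_real (r y * s') * \<i> + of_real r') * (cis (s y) * cnj (cis (s y)))"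
    by (simp add: algebra_simps)
  then have "?u * cnj (of_real (r y) * cis (s y)) = of_real (r y) * (of_real (r y * s') * \<i> + of_real r')"
    by (simp only: cis_cnj_cis mult_1_right)
  then have "Im (?u * cnj (of_real (r y) * cis (s y))) = Im (of_real (r y) * (of_real (r y * s') * \<i> + of_real r'))"
    by (rule arg_cong)
  also have "\<dots> = (r y)\<^sup>2 * s'" by (simp add: power2_eq_square)
  finally have "Im (?u * cnj (of_real (r y) * cis (s y))) = (r y)\<^sup>2 * s'" .
  with has_vector_derivative_mult[OF r has_vector_derivative_cis[OF assms(2)]] show ?thesis by (rule that)
qed

lemma smooth_on_real_deriv:
  fixes f :: "real \<Rightarrow> real"
  assumes "smooth_on J f" "y \<in> J"
  shows "(f has_real_derivative deriv f y) (at y)"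
proof -
  have "(f has_real_derivative frechet_derivative f (at y) 1) (at y)"
    using smooth_on_has_vector_derivative[OF assms] by (simp only: has_real_derivative_iff_has_vector_derivative)
  then show ?thesis by (simp only: DERIV_imp_deriv)
qed

text \<open>The differential condition of \<open>admissible_angles\<close> in a form free of polar
  coordinates, in which it makes sense across zeros of the second entry as well.\<close>

lemma polar_rows:
  assumes "smooth_on J \<xi>1" "smooth_on J \<xi>2" "smooth_on J \<xi>3" "y \<in> J"
  obtains p' q' where
    "((\<lambda>y. of_real (cosh (\<xi>1 y)) * cis (\<xi>2 y)) has_vector_derivative p') (at y)"
    "((\<lambda>y. of_real (sinh (\<xi>1 y)) * cis (\<xi>3 y)) has_vector_derivative q') (at y)"
    "Im (p' * cnj (of_real (cosh (\<xi>1 y)) * cis (\<xi>2 y))) + Im (q' * cnj (of_real (sinh (\<xi>1 y)) * cis (\<xi>3 y))) =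
      (cosh (\<xi>1 y))\<^sup>2 * deriv \<xi>2 y + (sinh (\<xi>1 y))\<^sup>2 * deriv \<xi>3 y"
proof -
  note d = smooth_on_real_deriv[OF _ assms(4)]
  obtain p' where p: "((\<lambda>y. of_real (cosh (\<xi>1 y)) * cis (\<xi>2 y)) has_vector_derivative p') (at y)"
    "Im (p' * cnj (of_real (cosh (\<xi>1 y)) * cis (\<xi>2 y))) = (cosh (\<xi>1 y))\<^sup>2 * deriv \<xi>2 y"
    using polar_derivative[OF has_field_derivative_cosh[OF d[OF assms(1)]] d[OF assms(2)]] .
  obtain q' where q: "((\<lambda>y. of_real (sinh (\<xi>1 y)) * cis (\<xi>3 y)) has_vector_derivative q') (at y)"
    "Im (q' * cnj (of_real (sinh (\<xi>1 y)) * cis (\<xi>3 y))) = (sinh (\<xi>1 y))\<^sup>2 * deriv \<xi>3 y"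
    using polar_derivative[OF has_field_derivative_sinh[OF d[OF assms(1)]] d[OF assms(3)]] .
  from p(1) q(1) show ?thesis by (rule that) (simp only: p(2) q(2))
qed

lemma lorentz_torus_pos:
  assumes r: "r > 0" and s: "s > 0"
  shows "lorentz_torus r s"
  unfolding lorentz_torus_def
proof (intro conjI ballI r s)
  fix p assume p: "p \<in> torus r s"
  have P: "p$1 * p$1 + p$2 * p$2 = r * r" "p$3 * p$3 + p$4 * p$4 = s * s"
    using p by (simp_all add: torus_def power2_eq_square)
  \<comment> \<open>Unit tangents of the two circles; the second is timelike because the last two
    coordinates carry the minus signs of \<open>g0\<close>.\<close>
  define u v :: "real^4" where "u = vector [- p$2 / r, p$1 / r, 0, 0]" and "v = vector [0, 0, - p$4 / s, p$3 / s]"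
  have "torus_tangent p = span {u, v}"
  proof (intro set_eqI iffI)
    fix x assume "x \<in> torus_tangent p"
    then have x: "p$1 * x$1 + p$2 * x$2 = 0" "p$3 * x$3 + p$4 * x$4 = 0" by (simp_all add: torus_tangent_def)
    let ?a = "(p$1 * x$2 - p$2 * x$1) / r" and ?b = "(p$3 * x$4 - p$4 * x$3) / s"
    have e: "r * r * x$1 = (p$1 * x$2 - p$2 * x$1) * (- p$2)" "r * r * x$2 = (p$1 * x$2 - p$2 * x$1) * p$1"
      "s * s * x$3 = (p$3 * x$4 - p$4 * x$3) * (- p$4)" "s * s * x$4 = (p$3 * x$4 - p$4 * x$3) * p$3"
      unfolding P[symmetric] using x by algebra+
    have "x = ?a *\<^sub>R u + ?b *\<^sub>R v"
      by (rule vec4_eqI) (use e r s in \<open>simp_all add: u_def v_def field_simps\<close>)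
    moreover have "?a *\<^sub>R u + ?b *\<^sub>R v \<in> span {u, v}"
      by (intro span_add span_scale span_base) auto
    ultimately show "x \<in> span {u, v}" by (rule ssubst)
  next
    fix x assume "x \<in> span {u, v}"
    then obtain a b where "x - a *\<^sub>R u = b *\<^sub>R v" by (auto simp: span_insert span_singleton)
    then have "x = a *\<^sub>R u + b *\<^sub>R v" by (simp add: algebra_simps)
    then show "x \<in> torus_tangent p" by (simp add: torus_tangent_def u_def v_def algebra_simps)
  qed
  moreover have "g0 u u = (p$1 * p$1 + p$2 * p$2) / (r * r)" "g0 v v = - ((p$3 * p$3 + p$4 * p$4) / (s * s))" "g0 u v = 0"
    by (simp_all add: g0_def u_def v_def add_divide_distrib)
  then have "g0 u u = 1" "g0 v v = - 1" "g0 u v = 0"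
    unfolding P using r s by simp_all
  ultimately show "\<exists>u v. torus_tangent p = span {u, v} \<and> g0 u u = 1 \<and> g0 v v = - 1 \<and> g0 u v = 0" by blast
qed

lemma torus_subset_AdS:
  assumes "r * r - s * s = - 4 / \<kappa>"
  shows "torus r s \<subseteq> AdS \<kappa>"
proof
  fix x assume "x \<in> torus r s"
  then have "x$1 * x$1 + x$2 * x$2 = r * r" "x$3 * x$3 + x$4 * x$4 = s * s"
    by (simp_all add: torus_def power2_eq_square)
  then have "x$1 * x$1 + x$2 * x$2 - x$3 * x$3 - x$4 * x$4 = r * r - s * s" by linarith
  then show "x \<in> AdS \<kappa>" unfolding assms by (simp add: AdS_def power2_eq_square)
qed

lemma has_vector_derivative_scaleR_const:
  assumes "(f has_real_derivative f') (at x)"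
  shows "((\<lambda>x. f x *\<^sub>R v) has_vector_derivative f' *\<^sub>R v) (at x)"
  by (rule bounded_linear.has_vector_derivative[OF bounded_linear_scaleR_left
      assms[unfolded has_real_derivative_iff_has_vector_derivative]])

text \<open>The acceleration is -a^2 times the position in the first plane and -b^2 times that in
  the second, hence orthogonal to the tangents of both circles. Nonzero radii and frequencies keep
  both components nonconstant.\<close>

lemma torus_helix_geodesic:
  fixes l r s a b :: real
  assumes l: "l * l = 1" and nz: "r \<noteq> 0" "s \<noteq> 0" "a \<noteq> 0" "b \<noteq> 0"
  shows "twisted_geodesic r s (\<lambda>x. vector [r * cos (a * x), - l * r * sin (a * x), s * cos (b * x), l * s * sin (b * x)])"
    (is "twisted_geodesic r s ?c")
proof -
  define v1 v2 v3 v4 :: "real^4" where v: "v1 = vector [r, 0, 0, 0]" "v2 = vector [0, - l * r, 0, 0]"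
    "v3 = vector [0, 0, s, 0]" "v4 = vector [0, 0, 0, l * s]"
  define c where "c x = cos (a * x) *\<^sub>R v1 + sin (a * x) *\<^sub>R v2 + cos (b * x) *\<^sub>R v3 + sin (b * x) *\<^sub>R v4" for x
  have c: "?c = c"
    by (rule ext, rule vec4_eqI) (simp_all add: c_def v)
  have trig: "((\<lambda>x. cos (m * x)) has_real_derivative - m * sin (m * x)) (at x)"
    "((\<lambda>x. sin (m * x)) has_real_derivative m * cos (m * x)) (at x)" for m x :: real
    by (auto intro!: derivative_eq_intros)
  have dc: "(c has_vector_derivative (- a * sin (a * x)) *\<^sub>R v1 + (a * cos (a * x)) *\<^sub>R v2
      + (- b * sin (b * x)) *\<^sub>R v3 + (b * cos (b * x)) *\<^sub>R v4) (at x)" for x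
    unfolding c_def[abs_def] by (intro has_vector_derivative_add has_vector_derivative_scaleR_const trig)
  have ddc: "((\<lambda>x. (- a * sin (a * x)) *\<^sub>R v1 + (a * cos (a * x)) *\<^sub>R v2
      + (- b * sin (b * x)) *\<^sub>R v3 + (b * cos (b * x)) *\<^sub>R v4) has_vector_derivative
      (- a * (a * cos (a * x))) *\<^sub>R v1 + (a * (- a * sin (a * x))) *\<^sub>R v2
      + (- b * (b * cos (b * x))) *\<^sub>R v3 + (b * (- b * sin (b * x))) *\<^sub>R v4) (at x)" for x
    by (intro has_vector_derivative_add has_vector_derivative_scaleR_const DERIV_cmult trig)
  have "smooth_on UNIV c"
    unfolding c_def[abs_def]
    by (intro smooth_on_add smooth_on_scaleR smooth_on_cos smooth_on_sin smooth_on_mult smooth_on_const smooth_on_id open_UNIV)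
  moreover have nth: "c t $ 1 = r * cos (a * t)" "c t $ 2 = - l * r * sin (a * t)"
    "c t $ 3 = s * cos (b * t)" "c t $ 4 = l * s * sin (b * t)" for t
    by (simp_all add: c[symmetric])
  have "c t \<in> torus r s" for t
  proof -
    have sq: "(p * x) * (p * x) + (- l * p * y) * (- l * p * y) = p * p * (x * x + (l * l) * (y * y))"
      "(p * x) * (p * x) + (l * p * y) * (l * p * y) = p * p * (x * x + (l * l) * (y * y))" for p x y
      by (simp_all add: algebra_simps)
    have cs: "cos t * cos t + sin t * sin t = 1" for t :: real
      using sin_cos_squared_add2[of t] by (simp add: power2_eq_square)
    show ?thesis
      unfolding torus_def mem_Collect_eq nth power2_eq_square sq l mult_1_left cs by simp
  qed
  moreover have "g0 (vector_derivative (\<lambda>s. vector_derivative c (at s)) (at t)) w = 0" if w: "w \<in> torus_tangent (c t)" for t w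
  proof -
    have 1: "vector_derivative c (at x) = (- a * sin (a * x)) *\<^sub>R v1 + (a * cos (a * x)) *\<^sub>R v2
      + (- b * sin (b * x)) *\<^sub>R v3 + (b * cos (b * x)) *\<^sub>R v4" for x
      by (rule vector_derivative_at[OF dc])
    have "g0 (vector_derivative (\<lambda>s. vector_derivative c (at s)) (at t)) w =
      - (a * a) * (c t $ 1 * w $ 1 + c t $ 2 * w $ 2) + (b * b) * (c t $ 3 * w $ 3 + c t $ 4 * w $ 4)"
      unfolding 1 vector_derivative_at[OF ddc] nth by (simp add: g0_def v algebra_simps)
    then show ?thesis using w by (simp add: torus_tangent_def)
  qed
  moreover have "\<not> (\<exists>z. \<forall>t. (c t $ 1, c t $ 2) = z)"
  proof
    assume "\<exists>z. \<forall>t. (c t $ 1, c t $ 2) = z"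
    \<comment> \<open>After half a period the cosine has changed its sign.\<close>
    then have "(c 0 $ 1, c 0 $ 2) = (c (pi / a) $ 1, c (pi / a) $ 2)" by (elim exE) simp
    then show False using nz by (simp add: nth)
  qed
  moreover have "\<not> (\<exists>z. \<forall>t. (c t $ 3, c t $ 4) = z)"
  proof
    assume "\<exists>z. \<forall>t. (c t $ 3, c t $ 4) = z"
    then have "(c 0 $ 3, c 0 $ 4) = (c (pi / b) $ 3, c (pi / b) $ 4)" by (elim exE) simp
    then show False using nz by (simp add: nth)
  qed
  ultimately show ?thesis unfolding c twisted_geodesic_def torus_geodesic_def by (intro conjI allI ballI) assumption+
qed

section \<open>The model curve as a geodesic of the torus, and the converse\<close>

context helix_constants
begin

context
  assumes c0: "csq > 0"
begin

lemma torus_AdS: "torus rad1 rad2 \<subseteq> AdS \<kappa>"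
  by (rule torus_subset_AdS[OF rad(3)[OF c0]])

lemma gamma_geodesic: "twisted_geodesic rad1 rad2 \<gamma>"
proof -
  have "\<gamma> = (\<lambda>x. vector [rad1 * cos (\<alpha>1 * x), - lam * rad1 * sin (\<alpha>1 * x), rad2 * cos (\<alpha>2 * x), lam * rad2 * sin (\<alpha>2 * x)])"
    by (rule ext) (rule gam_def)
  moreover have "rad1 \<noteq> 0" "rad2 \<noteq> 0" "\<alpha>1 \<noteq> 0" "\<alpha>2 \<noteq> 0"
    using rad(1,2)[OF c0] alpha_pos[OF c0] by linarith+
  ultimately show ?thesis
    using torus_helix_geodesic[OF lam2(1)] by (simp only:)
qed

text \<open>The normal is determined by its constant component along \<open>E1\<close> and by its angle \<open>k x + const\<close>
  in the plane of \<open>E2\<close> and \<open>E3\<close>.\<close>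

lemma family_is_helix:
  fixes V J \<xi> \<xi>1 \<xi>2 \<xi>3
  defines "F \<equiv> \<lambda>(x, y). A_mat \<xi> (\<xi>1 y) (\<xi>2 y) (\<xi>3 y) *v \<gamma> x"
  assumes V: "open V" "V \<subseteq> UNIV \<times> J" and adm: "admissible_angles J \<xi>1 \<xi>2 \<xi>3" and F: "immersion_on V F"
  shows "\<exists>N. helix_surface \<kappa> \<tau> lam \<nu> V {(V, \<lambda>z. z)} F N"
proof -
  define e where "e = - \<i> * cis \<xi>"
  have e: "e * cnj e = 1" using cis_cnj_cis[of \<xi>] by (simp add: e_def algebra_simps)
  define n where "n x = e * mg x" for x
  have n: "n x = of_real (\<epsilon> * sqrt csq) * cis (\<xi> + k * x)" for x
  proof -
    have "(- \<i> * c) * (R * \<i> * d) = R * (c * d)" for c R d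
      by (simp add: complex_eq_iff algebra_simps)
    then show ?thesis
      unfolding n_def e_def mg_def[OF c0] by (simp only: cis_mult)
  qed
  define N where "N = (\<lambda>(x, y). fr \<kappa> (F (x, y)) (- lam * \<nu> / \<tau>) (Re (n x)) (Im (n x)))"
  define p q where "p y = complex_of_real (cosh (\<xi>1 y)) * cis (\<xi>2 y)" and "q y = complex_of_real (sinh (\<xi>1 y)) * cis (\<xi>3 y)" for y
  have zF: "z1 (F (x, y)) = p y * z1 (\<gamma> x) + q y * z2 (\<gamma> x)" "z2 (F (x, y)) = e * (cnj (q y) * z1 (\<gamma> x) + cnj (p y) * z2 (\<gamma> x))" for x y
    by (simp_all add: F_def z_A_mat p_def q_def e_def)
  have FA: "F w \<in> AdS \<kappa>" for w
  proof -
    obtain x y where w: "w = (x, y)" by (cases w)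
    have "g0 (F w) (F w) = g0 (\<gamma> x) (\<gamma> x)"
      using A_mat_pseudo_orthogonal by (simp add: F_def w pseudo_orthogonal_def)
    also have "\<dots> = - 4 / \<kappa>" unfolding g0_z z_gamma_AdS[OF c0] by simp
    finally show ?thesis by (simp add: AdS_g0)
  qed
  have sF: "smooth_on V F" using F by (simp add: immersion_on_def)
  have unit: "unit_normal (F w) (N w)" for w
  proof -
    obtain x y where w: "w = (x, y)" by (cases w)
    have R: "of_real R * c * cnj (of_real R * c) = of_real (R * R) * (c * cnj c)" for R :: real and c
      by (simp add: mult_ac)
    have "(\<epsilon> * sqrt csq) * (\<epsilon> * sqrt csq) = (\<epsilon> * \<epsilon>) * (sqrt csq * sqrt csq)" by (simp only: mult_ac)
    also have "\<dots> = csq" using c0 \<epsilon>(1) by simp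
    finally have "n x * cnj (n x) = of_real csq"
      unfolding n R by (simp only: cis_cnj_cis mult_1_right)
    then have nn: "Re (n x) * Re (n x) + Im (n x) * Im (n x) = csq"
      by (simp add: complex_eq_iff)
    have l: "lam * (\<nu> * (lam * \<nu>)) = \<nu> * \<nu>" using lam by auto
    then show ?thesis
      using nn \<tau> unfolding w unit_normal_def angle_fun_def N_def prod.case E_fr gtau_fr[OF \<kappa> FA]
      by (simp add: FA csq_def power2_eq_square l)
  qed
  have orth: "gtau \<kappa> \<tau> (F w) (N w) (frechet_derivative F (at w) v) = 0" if w: "w \<in> V" for w v
  proof -
    obtain x y where xy: "w = (x, y)" by (cases w)
    obtain a b where v: "v = (a, b)" by (cases v)
    let ?L = "frechet_derivative F (at w)"
    have L: "(F has_derivative ?L) (at (x, y))" using smooth_on_has_derivative[OF sF w] by (simp only: xy)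
    have xc: "xc2 \<kappa> (F w) (N w) = Re (n x)" "xc3 \<kappa> (F w) (N w) = Im (n x)"
      unfolding N_def xy prod.case by (rule xc_fr[OF \<kappa> FA])+
    have zero: "gtau \<kappa> \<tau> (F w) (N w) U = lam * \<nu> * \<tau> * xc1 \<kappa> (F w) U + Re (n x) * xc2 \<kappa> (F w) U + Im (n x) * xc3 \<kappa> (F w) U"
      if "U \<in> AdS_tangent (F w)" for U
      using gtau_normal[OF unit[of w], of "xc1 \<kappa> (F w) U" "xc2 \<kappa> (F w) U" "xc3 \<kappa> (F w) U"] fr_xc[OF \<kappa> FA that]
      by (simp only: xc)
    have tan: "?L v \<in> AdS_tangent (F w)" for v
      by (rule AdS_map_tangent[OF V(1) sF _ w]) (use FA in blast)
    \<comment> \<open>This is \<open>gamma_ode\<close> carried along by the matrix: conjugating the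
      second coordinate of \<open>F\<close> brings in \<open>cnj e\<close>, which the factor
      \<open>e\<close> of \<open>n x\<close> compensates.\<close>
    have "?L (1, 0) = fr \<kappa> (F w) (lam * csq / \<tau>) (- \<nu> * Re (n x)) (- \<nu> * Im (n x))"
    proof (rule z_eqI)
      note d = has_vector_derivative_coordinates(1)[OF L]
      have Cn: "Complex (- \<nu> * Re (n x)) (- \<nu> * Im (n x)) = - of_real \<nu> * n x" by (simp add: complex_eq_iff)
      have m: "mg x * cnj (z2 (F w)) * e = mg x * (cnj (z1 (\<gamma> x)) * q y + cnj (z2 (\<gamma> x)) * p y)"
      proof -
        have "mg x * cnj (z2 (F w)) * e = (e * cnj e) * (mg x * (cnj (z1 (\<gamma> x)) * q y + cnj (z2 (\<gamma> x)) * p y))"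
          unfolding xy zF by (simp add: algebra_simps)
        then show ?thesis by (simp only: e mult_1_left)
      qed
      let ?s = "complex_of_real (sqrt \<kappa> / 2)"
      have "((\<lambda>t. p y * z1 (\<gamma> t) + q y * z2 (\<gamma> t)) has_vector_derivative
         p y * (?s * (\<i> * of_real (lam * csq / \<tau>) * z1 (\<gamma> x) - of_real \<nu> * mg x * cnj (z2 (\<gamma> x)))) +
         q y * (?s * (\<i> * of_real (lam * csq / \<tau>) * z2 (\<gamma> x) - of_real \<nu> * mg x * cnj (z1 (\<gamma> x))))) (at x)"
        by (intro has_vector_derivative_add has_vector_derivative_mult_right gamma_ode[OF c0])
      moreover have "((\<lambda>t. p y * z1 (\<gamma> t) + q y * z2 (\<gamma> t)) has_vector_derivative z1 (?L (1, 0))) (at x)"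
        using bounded_linear.has_vector_derivative[OF bounded_linear_z(1) d] unfolding zF .
      ultimately have "z1 (?L (1, 0)) = p y * (?s * (\<i> * of_real (lam * csq / \<tau>) * z1 (\<gamma> x) - of_real \<nu> * mg x * cnj (z2 (\<gamma> x)))) +
         q y * (?s * (\<i> * of_real (lam * csq / \<tau>) * z2 (\<gamma> x) - of_real \<nu> * mg x * cnj (z1 (\<gamma> x))))"
        by (rule vector_derivative_unique_at[symmetric])
      also have "\<dots> = ?s * (\<i> * of_real (lam * csq / \<tau>) * z1 (F w) - of_real \<nu> * (mg x * (cnj (z1 (\<gamma> x)) * q y + cnj (z2 (\<gamma> x)) * p y)))"
        unfolding xy zF by (simp add: algebra_simps)
      also have "\<dots> = z1 (fr \<kappa> (F w) (lam * csq / \<tau>) (- \<nu> * Re (n x)) (- \<nu> * Im (n x)))"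
        unfolding m[symmetric] z_fr Cn unfolding n_def by (simp add: algebra_simps)
      finally show "z1 (?L (1, 0)) = z1 (fr \<kappa> (F w) (lam * csq / \<tau>) (- \<nu> * Re (n x)) (- \<nu> * Im (n x)))" .
      have "((\<lambda>t. e * (cnj (q y) * z1 (\<gamma> t) + cnj (p y) * z2 (\<gamma> t))) has_vector_derivative
         e * (cnj (q y) * (?s * (\<i> * of_real (lam * csq / \<tau>) * z1 (\<gamma> x) - of_real \<nu> * mg x * cnj (z2 (\<gamma> x)))) +
         cnj (p y) * (?s * (\<i> * of_real (lam * csq / \<tau>) * z2 (\<gamma> x) - of_real \<nu> * mg x * cnj (z1 (\<gamma> x)))))) (at x)"
        by (intro has_vector_derivative_add has_vector_derivative_mult_right gamma_ode[OF c0])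
      moreover have "((\<lambda>t. e * (cnj (q y) * z1 (\<gamma> t) + cnj (p y) * z2 (\<gamma> t))) has_vector_derivative z2 (?L (1, 0))) (at x)"
        using bounded_linear.has_vector_derivative[OF bounded_linear_z(2) d] unfolding zF .
      ultimately have "z2 (?L (1, 0)) = e * (cnj (q y) * (?s * (\<i> * of_real (lam * csq / \<tau>) * z1 (\<gamma> x) - of_real \<nu> * mg x * cnj (z2 (\<gamma> x)))) +
         cnj (p y) * (?s * (\<i> * of_real (lam * csq / \<tau>) * z2 (\<gamma> x) - of_real \<nu> * mg x * cnj (z1 (\<gamma> x)))))"
        by (rule vector_derivative_unique_at[symmetric])
      also have "\<dots> = z2 (fr \<kappa> (F w) (lam * csq / \<tau>) (- \<nu> * Re (n x)) (- \<nu> * Im (n x)))"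
        unfolding z_fr Cn unfolding n_def xy zF by (simp add: algebra_simps)
      finally show "z2 (?L (1, 0)) = z2 (fr \<kappa> (F w) (lam * csq / \<tau>) (- \<nu> * Re (n x)) (- \<nu> * Im (n x)))" .
    qed
    also have "\<dots> = T_vec \<kappa> \<tau> lam (F w) (N w)"
      unfolding unit_normalD(4)[OF unit] xc ..
    finally have "?L (1, 0) = T_vec \<kappa> \<tau> lam (F w) (N w)" .
    then have 1: "gtau \<kappa> \<tau> (F w) (N w) (?L (1, 0)) = 0"
      unfolding unit_normalD(4)[OF unit] using gtau_normal[OF unit[of w]] unit_normalD(2)[OF unit[of w]] \<tau>
      by (simp add: power2_eq_square algebra_simps) (metis distrib_left mult.commute mult.left_commute)
    have y: "y \<in> J" using w V(2) xy by auto
    obtain p' q' where pq: "(p has_vector_derivative p') (at y)" "(q has_vector_derivative q') (at y)"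
      "Im (p' * cnj (p y)) + Im (q' * cnj (q y)) = (cosh (\<xi>1 y))\<^sup>2 * deriv \<xi>2 y + (sinh (\<xi>1 y))\<^sup>2 * deriv \<xi>3 y"
      using polar_rows[of J \<xi>1 \<xi>2 \<xi>3 y] adm y unfolding p_def[abs_def] q_def[abs_def] admissible_angles_def by blast
    note d = has_vector_derivative_coordinates(2)[OF L]
    note cnj = bounded_linear.has_vector_derivative[OF bounded_linear_cnj]
    have "((\<lambda>t. p t * z1 (\<gamma> x) + q t * z2 (\<gamma> x)) has_vector_derivative p' * z1 (\<gamma> x) + q' * z2 (\<gamma> x)) (at y)"
      by (intro has_vector_derivative_add has_vector_derivative_mult_left pq)
    moreover have "((\<lambda>t. p t * z1 (\<gamma> x) + q t * z2 (\<gamma> x)) has_vector_derivative z1 (?L (0, 1))) (at y)"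
      using bounded_linear.has_vector_derivative[OF bounded_linear_z(1) d] unfolding zF .
    ultimately have U1: "z1 (?L (0, 1)) = p' * z1 (\<gamma> x) + q' * z2 (\<gamma> x)"
      by (rule vector_derivative_unique_at[symmetric])
    have "((\<lambda>t. e * (cnj (q t) * z1 (\<gamma> x) + cnj (p t) * z2 (\<gamma> x))) has_vector_derivative e * (cnj q' * z1 (\<gamma> x) + cnj p' * z2 (\<gamma> x))) (at y)"
      by (intro has_vector_derivative_add has_vector_derivative_mult_left has_vector_derivative_mult_right cnj pq)
    moreover have "((\<lambda>t. e * (cnj (q t) * z1 (\<gamma> x) + cnj (p t) * z2 (\<gamma> x))) has_vector_derivative z2 (?L (0, 1))) (at y)"
      using bounded_linear.has_vector_derivative[OF bounded_linear_z(2) d] unfolding zF .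
    ultimately have U2: "z2 (?L (0, 1)) = e * (cnj q' * z1 (\<gamma> x) + cnj p' * z2 (\<gamma> x))"
      by (rule vector_derivative_unique_at[symmetric])
    \<comment> \<open>The condition on the derivatives of \<open>\<xi>2\<close> and
      \<open>\<xi>3\<close> enters here, as orthogonality of the second coordinate field to
      \<open>N\<close>.\<close>
    have "Im (p' * cnj (p y)) + Im (q' * cnj (q y)) = 0"
      unfolding pq(3) using adm y by (simp add: admissible_angles_def)
    note hor = this
    have C: "Complex (Re (n x)) (Im (n x)) = e * mg x" unfolding n_def by (rule complex_surj)
    have "gtau \<kappa> \<tau> (F w) (N w) (?L (0, 1)) =
        - (sqrt \<kappa> / 2) * (\<epsilon> * \<beta>) * (4 / \<kappa>) * (Im (p' * cnj (p y)) + Im (q' * cnj (q y)))"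
      unfolding zero[OF tan] by (rule normal_horizontal[OF c0 e zF[of x y, folded xy] U1 U2 C])
    then have 2: "gtau \<kappa> \<tau> (F w) (N w) (?L (0, 1)) = 0"
      unfolding hor by simp
    have "?L v = a *\<^sub>R ?L (1, 0) + b *\<^sub>R ?L (0, 1)"
      unfolding v using L xy by (intro frechet_derivative_pair) simp
    moreover have "gtau \<kappa> \<tau> q n (a *\<^sub>R u + b *\<^sub>R u') = a * gtau \<kappa> \<tau> q n u + b * gtau \<kappa> \<tau> q n u'" for q n u u'
      by (simp add: gtau_def g0_simps algebra_simps)
    ultimately show ?thesis
      using 1 2 by simp
  qed
  have "smooth_on V N"
  proof -
    have fst: "smooth_on V (\<lambda>w. \<xi> + k * fst w)"
      using V(1) by (intro smooth_on_add smooth_on_mult smooth_on_const smooth_on_linear bounded_linear_fst)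
    have X: "smooth_on V (\<lambda>w. X1 \<kappa> (F w))" "smooth_on V (\<lambda>w. X2 \<kappa> (F w))" "smooth_on V (\<lambda>w. X3 \<kappa> (F w))"
      by (rule smooth_on_linear_compose[OF bounded_linear_X(1) V(1) sF] smooth_on_linear_compose[OF bounded_linear_X(2) V(1) sF]
          smooth_on_linear_compose[OF bounded_linear_X(3) V(1) sF])+
    have c: "smooth_on V (\<lambda>w. (\<epsilon> * sqrt csq) * cos (\<xi> + k * fst w))"
      by (rule smooth_on_mult[OF V(1) smooth_on_const smooth_on_cos[OF V(1) fst]])
    have s: "smooth_on V (\<lambda>w. (\<epsilon> * sqrt csq) * sin (\<xi> + k * fst w))"
      by (rule smooth_on_mult[OF V(1) smooth_on_const smooth_on_sin[OF V(1) fst]])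
    have N: "N = (\<lambda>w. (- lam * \<nu> / \<tau>) *\<^sub>R X1 \<kappa> (F w) + ((\<epsilon> * sqrt csq) * cos (\<xi> + k * fst w)) *\<^sub>R X2 \<kappa> (F w) + ((\<epsilon> * sqrt csq) * sin (\<xi> + k * fst w)) *\<^sub>R X3 \<kappa> (F w))"
      by (simp add: N_def fr_def n split_beta fun_eq_iff)
    show ?thesis
      unfolding N by (rule smooth_on_add[OF V(1) smooth_on_add[OF V(1) smooth_on_scaleR[OF V(1) smooth_on_const X(1)]
        smooth_on_scaleR[OF V(1) c X(2)]] smooth_on_scaleR[OF V(1) s X(3)]])
  qed
  moreover have "smooth_surface V {(V, \<lambda>z. z)}"
  proof -
    have id: "inv_into V (\<lambda>z. z) z = z" if "z \<in> V" for z
      using inv_into_f_f[of "\<lambda>z. z" V z] that by (simp add: inj_on_def)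
    have sid: "smooth_on V (\<lambda>z. inv_into V (\<lambda>z. z) z)"
      by (rule smooth_on_cong[OF V(1) _ smooth_on_id[OF V(1)]]) (rule id[symmetric])
    have S: "V \<inter> (\<lambda>z. z) -` (\<lambda>z. z) ` V = V" by auto
    have "smooth_transition (V, \<lambda>z. z) (V, \<lambda>z. z)"
      unfolding smooth_transition_def Let_def fst_conv snd_conv S o_def using V(1) sid by (rule conjI)
    then show ?thesis
      using V(1) unfolding smooth_surface_def local_param_def by (auto simp: inj_on_def)
  qed
  ultimately have "immersed_surface \<kappa> \<tau> lam V {(V, \<lambda>z. z)} F N"
    using F FA unit orth unfolding immersed_surface_def o_def unit_normal_def by blast
  moreover have "\<forall>p\<in>V. angle_fun \<kappa> \<tau> lam (F p) (N p) = \<nu>"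
    using unit unfolding unit_normal_def by blast
  ultimately have "helix_surface \<kappa> \<tau> lam \<nu> V {(V, \<lambda>z. z)} F N"
    unfolding helix_surface_def by (rule conjI)
  then show ?thesis by blast
qed

end

end

section \<open>Position vectors in adapted coordinates\<close>

lemma constant_on_box:
  fixes f :: "real \<times> real \<Rightarrow> 'b::real_normed_vector"
  assumes "open V" "convex V" "\<And>w. w \<in> V \<Longrightarrow> (f has_derivative L w) (at w)"
    and "\<And>w. w \<in> V \<Longrightarrow> L w (1, 0) = 0" "\<And>w. w \<in> V \<Longrightarrow> L w (0, 1) = 0"
  obtains c where "\<forall>w\<in>V. f w = c"
proof -
  have "(f has_derivative (\<lambda>h. 0)) (at w within V)" if w: "w \<in> V" for w
  proof -
    have "L w h = 0" for h
      using frechet_derivative_pair[OF assms(3)[OF w], of "fst h" "snd h"] assms(4,5)[OF w] by simp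
    then have "L w = (\<lambda>h. 0)" by (rule ext)
    with has_derivative_at_withinI[OF assms(3)[OF w]] show ?thesis by (simp only:)
  qed
  from has_derivative_zero_constant[OF assms(2) this] show ?thesis
    using that by blast
qed

lemma z_zero: "z1 0 = 0" "z2 0 = 0"
  by (simp_all add: z1_def z2_def complex_eq_iff)

context helix_constants
begin

text \<open>Turning the \<open>E2\<close>, \<open>E3\<close> part of the normal back by the angle
  \<open>k * X\<close> gives a function with vanishing partial derivatives, constant on the convex
  domain. Its modulus is \<open>sqrt csq\<close> and its argument is the phase sought.\<close>

lemma normal_angle_constant:
  assumes prm: "helix_param V F N" and conv: "convex V" and X: "\<And>w. w \<in> V \<Longrightarrow> (X has_derivative X' w) (at w)"
    and dang: "\<And>w. w \<in> V \<Longrightarrow> dangle F N w (1, 0) = k * X' w (1, 0)" "\<And>w. w \<in> V \<Longrightarrow> dangle F N w (0, 1) = k * X' w (0, 1)"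
    and ne: "w0 \<in> V"
  obtains \<phi>0 where "\<forall>w\<in>V. Complex (xc2 \<kappa> (F w) (N w)) (xc3 \<kappa> (F w) (N w)) = of_real (sqrt csq) * cis (k * X w + \<phi>0)"
proof -
  note c = csq_pos[OF prm ne]
  let ?n2 = "\<lambda>w. xc2 \<kappa> (F w) (N w)" and ?n3 = "\<lambda>w. xc3 \<kappa> (F w) (N w)"
  let ?n = "\<lambda>w. of_real (?n2 w) + \<i> * of_real (?n3 w) :: complex"
  let ?d2 = "\<lambda>w. frechet_derivative ?n2 (at w)" and ?d3 = "\<lambda>w. frechet_derivative ?n3 (at w)"
  define Z where "Z w = ?n w * cis (- (k * X w))" for w
  define L where "L w v = ?n w * ((- (k * X' w v)) *\<^sub>R (\<i> * cis (- (k * X w)))) + (of_real (?d2 w v) + \<i> * of_real (?d3 w v)) * cis (- (k * X w))" for w v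
  have dZ: "(Z has_derivative L w) (at w)" if w: "w \<in> V" for w
  proof -
    have x: "((\<lambda>w. - (k * X w)) has_derivative (\<lambda>v. - (k * X' w v))) (at w)"
      by (intro has_derivative_minus has_derivative_mult_right X[OF w])
    show ?thesis unfolding Z_def[abs_def] L_def[abs_def]
      by (intro has_derivative_mult has_derivative_add has_derivative_mult_right has_derivative_of_real
          has_derivative_n[OF prm w] has_derivative_cis x)
  qed
  have L0: "L w v = 0" if w: "w \<in> V" and "dangle F N w v = k * X' w v" for w v
  proof -
    have "of_real (?d2 w v) + \<i> * of_real (?d3 w v) = \<i> * of_real (k * X' w v) * ?n w"
      unfolding d_n[OF prm w c] that(2) by (simp add: complex_eq_iff algebra_simps)
    then show ?thesis unfolding L_def by (simp only:) (simp add: scaleR_conv_of_real algebra_simps)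
  qed
  obtain z where z: "\<forall>w\<in>V. Z w = z"
    by (rule constant_on_box[OF helix_paramD(1)[OF prm] conv dZ L0[OF _ dang(1)] L0[OF _ dang(2)]])
  have n: "?n w = z * cis (k * X w)" if "w \<in> V" for w
  proof -
    have "?n w = Z w * cis (k * X w)" by (simp add: Z_def mult.assoc cis_mult)
    then show ?thesis using z that by simp
  qed
  have "norm z = sqrt csq"
  proof -
    have "norm z = norm (?n w0)" unfolding n[OF ne] by (simp add: norm_mult)
    also have "\<dots> = sqrt (?n2 w0 * ?n2 w0 + ?n3 w0 * ?n3 w0)" by (simp add: cmod_def power2_eq_square)
    finally show ?thesis by (simp only: n_sq[OF prm ne])
  qed
  then have zz: "z = of_real (sqrt csq) * cis (Arg z)"
    using rcis_cmod_Arg[of z] by (simp only: rcis_def)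
  have "?n w = of_real (sqrt csq) * cis (k * X w + Arg z)" if "w \<in> V" for w
  proof -
    have "?n w = z * cis (k * X w)" by (rule n[OF that])
    also have "\<dots> = of_real (sqrt csq) * cis (Arg z) * cis (k * X w)" using zz by (rule arg_cong)
    also have "\<dots> = of_real (sqrt csq) * (cis (k * X w) * cis (Arg z))" by (simp only: mult_ac)
    finally show ?thesis by (simp only: cis_mult)
  qed
  then show ?thesis by (intro that[of "Arg z"]) (simp add: Complex_eq)
qed

text \<open>The sign of \<open>lam * \<nu>\<close> is absorbed into the constant \<open>\<xi>\<close> of the matrices.\<close>

lemma mg_phase:
  assumes "csq > 0"
  obtains \<xi> where "\<And>x. of_real (sqrt csq) * cis (k * x + \<phi>0) = - \<i> * cis \<xi> * mg x"
proof -
  define \<xi> where "\<xi> = (if \<epsilon> > 0 then \<phi>0 else \<phi>0 + pi)"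
  have "\<epsilon> = 1 \<or> \<epsilon> = - 1" using \<epsilon>(1) square_eq_1_iff by blast
  then have \<xi>: "cis \<xi> = of_real \<epsilon> * cis \<phi>0" by (auto simp: \<xi>_def cis_mult[symmetric])
  have e: "of_real \<epsilon> * of_real \<epsilon> = (1 :: complex)" unfolding of_real_mult[symmetric] \<epsilon>(1) by simp
  have "- \<i> * cis \<xi> * mg x = (of_real \<epsilon> * of_real \<epsilon>) * (of_real (sqrt csq) * (cis (k * x) * cis \<phi>0))" for x
    unfolding \<xi> mg_def[OF assms] by (simp add: algebra_simps)
  then show ?thesis by (intro that[of \<xi>]) (simp only: e mult_1_left cis_mult)
qed

lemma rows_smooth:
  assumes c0: "csq > 0" and J: "open J" and F: "smooth_on J F"
  shows "smooth_on J (\<lambda>y. rowp e (F y) x)" "smooth_on J (\<lambda>y. rowq e (F y) x)"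
proof -
  have 1: "smooth_on J (\<lambda>y. z1 (F y))" "smooth_on J (\<lambda>y. z2 (F y))"
    by (rule smooth_on_linear_compose[OF bounded_linear_z(1) J F] smooth_on_linear_compose[OF bounded_linear_z(2) J F])+
  have 2: "smooth_on J (\<lambda>y. cnj (z2 (F y)))"
    by (rule smooth_on_linear_compose[OF bounded_linear_cnj J 1(2)])
  show "smooth_on J (\<lambda>y. rowp e (F y) x)" "smooth_on J (\<lambda>y. rowq e (F y) x)"
    unfolding rowp_def[OF c0] rowq_def[OF c0]
    by (intro smooth_on_mult smooth_on_diff smooth_on_const 1 2 J)+
qed

text \<open>By regularity of the curve of rows, the entry \<open>q\<close> has only simple zeros.\<close>

lemma rows_to_angles:
  assumes J: "open J" "is_interval J" and p: "smooth_on J p" and q: "smooth_on J q"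
    and norm: "\<And>y. y \<in> J \<Longrightarrow> (norm (p y))\<^sup>2 = 1 + (norm (q y))\<^sup>2"
    and hor: "\<And>y. y \<in> J \<Longrightarrow> Im (frechet_derivative p (at y) 1 * cnj (p y)) + Im (frechet_derivative q (at y) 1 * cnj (q y)) = 0"
    and reg: "\<And>y. y \<in> J \<Longrightarrow> frechet_derivative p (at y) 1 = 0 \<Longrightarrow> frechet_derivative q (at y) 1 \<noteq> 0"
  obtains \<xi>1 \<xi>2 \<xi>3 where "admissible_angles J \<xi>1 \<xi>2 \<xi>3"
    "\<forall>y\<in>J. p y = of_real (cosh (\<xi>1 y)) * cis (\<xi>2 y) \<and> q y = of_real (sinh (\<xi>1 y)) * cis (\<xi>3 y)"
proof -
  define p' q' where "p' y = frechet_derivative p (at y) 1" and "q' y = frechet_derivative q (at y) 1" for y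
  have dp: "(p has_vector_derivative p' y) (at y)" and dq: "(q has_vector_derivative q' y) (at y)" if "y \<in> J" for y
    unfolding p'_def q'_def by (rule smooth_on_has_vector_derivative[OF p that] smooth_on_has_vector_derivative[OF q that])+
  have p0: "p y \<noteq> 0" if "y \<in> J" for y
  proof
    assume "p y = 0"
    then have "0 = 1 + (norm (q y))\<^sup>2" using norm[OF that] by simp
    then show False using zero_le_power2[of "norm (q y)"] by linarith
  qed
  \<comment> \<open>At a multiple zero of \<open>q\<close>, the derivative of |p|^2 - |q|^2 = 1
    kills the real part of \<open>p' * cnj p\<close> and \<open>hor\<close> the imaginary part; then
    both rows would be stationary, against \<open>reg\<close>.\<close>
  have q_simple: "q' y \<noteq> 0" if y: "y \<in> J" and "q y = 0" for y
  proof
    assume "q' y = 0"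
    note cnj = bounded_linear.has_vector_derivative[OF bounded_linear_cnj]
    have "((\<lambda>y. p y * cnj (p y) - q y * cnj (q y)) has_vector_derivative
      (p y * cnj (p' y) + p' y * cnj (p y)) - (q y * cnj (q' y) + q' y * cnj (q y))) (at y)"
      by (intro has_vector_derivative_diff has_vector_derivative_mult cnj dp[OF y] dq[OF y])
    moreover have "((\<lambda>y. p y * cnj (p y) - q y * cnj (q y)) has_vector_derivative 0) (at y)"
    proof (rule has_vector_derivative_transform_within_open[OF has_vector_derivative_const J(1) y])
      show "1 = p y * cnj (p y) - q y * cnj (q y)" if "y \<in> J" for y
        using norm[OF that] unfolding complex_norm_square[symmetric] by simp
    qed
    ultimately have "(p y * cnj (p' y) + p' y * cnj (p y)) - (q y * cnj (q' y) + q' y * cnj (q y)) = 0"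
      by (rule vector_derivative_unique_at)
    then have "p y * cnj (p' y) + p' y * cnj (p y) = 0" using \<open>q y = 0\<close> by simp
    then have "Re (p' y * cnj (p y)) = 0" by (simp add: complex_eq_iff algebra_simps)
    moreover have "Im (p' y * cnj (p y)) = 0" using hor[OF y] \<open>q y = 0\<close> by (simp add: p'_def)
    ultimately have "p' y * cnj (p y) = 0" by (simp only: complex_eq_iff zero_complex.sel simp_thms)
    then have "p' y = 0" using p0[OF y] by simp
    with reg[OF y] \<open>q' y = 0\<close> show False unfolding p'_def q'_def by blast
  qed
  \<comment> \<open>Conjugates, because the polar lemmas deliver the phase with a minus
    sign.\<close>
  have sc: "smooth_on J (\<lambda>y. cnj (p y))" "smooth_on J (\<lambda>y. cnj (q y))"
    by (rule smooth_on_linear_compose[OF bounded_linear_cnj J(1) p] smooth_on_linear_compose[OF bounded_linear_cnj J(1) q])+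
  have "cnj (p y) \<noteq> 0" if "y \<in> J" for y using p0[OF that] by simp
  from smooth_polar[OF J sc(1) this] obtain \<xi>2 where \<xi>2: "smooth_on J \<xi>2" "\<forall>y\<in>J. cnj (p y) = of_real (norm (cnj (p y))) * cis (- \<xi>2 y)"
    by blast
  have "frechet_derivative (\<lambda>y. cnj (q y)) (at y) 1 \<noteq> 0" if y: "y \<in> J" "cnj (q y) = 0" for y
  proof -
    have "((\<lambda>y. cnj (q y)) has_vector_derivative cnj (q' y)) (at y)"
      by (rule bounded_linear.has_vector_derivative[OF bounded_linear_cnj dq[OF y(1)]])
    from vector_derivative_unique_at[OF this smooth_on_has_vector_derivative[OF sc(2) y(1)]]
    show ?thesis using q_simple[OF y(1)] y(2) by (metis complex_cnj_zero_iff)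
  qed
  from smooth_signed_polar[OF J sc(2) this] obtain \<sigma> \<xi>3 where \<sigma>: "smooth_on J \<sigma>" "smooth_on J \<xi>3"
    "\<forall>y\<in>J. cnj (q y) = of_real (\<sigma> y) * cis (- \<xi>3 y)" by blast
  \<comment> \<open>The signed modulus of \<open>q\<close> is taken as \<open>sinh \<xi>1\<close>;
    the modulus of \<open>p\<close> is then automatically \<open>cosh \<xi>1\<close>.\<close>
  define \<xi>1 where "\<xi>1 y = arsinh (\<sigma> y)" for y
  have s1: "smooth_on J \<xi>1" unfolding \<xi>1_def[abs_def] by (rule smooth_on_arsinh[OF J(1) \<sigma>(1)])
  have eq: "p y = of_real (cosh (\<xi>1 y)) * cis (\<xi>2 y)" "q y = of_real (sinh (\<xi>1 y)) * cis (\<xi>3 y)" if y: "y \<in> J" for y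
  proof -
    have "cnj (cnj (q y)) = cnj (of_real (\<sigma> y) * cis (- \<xi>3 y))" using bspec[OF \<sigma>(3) y] by (rule arg_cong)
    then have q1: "q y = of_real (\<sigma> y) * cis (\<xi>3 y)" by (simp add: cis_cnj)
    then show "q y = of_real (sinh (\<xi>1 y)) * cis (\<xi>3 y)" by (simp add: \<xi>1_def)
    have "cnj (cnj (p y)) = cnj (of_real (norm (cnj (p y))) * cis (- \<xi>2 y))" using bspec[OF \<xi>2(2) y] by (rule arg_cong)
    then have p1: "p y = of_real (norm (p y)) * cis (\<xi>2 y)" by (simp add: cis_cnj)
    have "norm (q y) = \<bar>\<sigma> y\<bar>" unfolding q1 by (simp add: norm_mult)
    then have "(norm (p y))\<^sup>2 = 1 + (\<sigma> y)\<^sup>2" using norm[OF y] by simp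
    also have "\<dots> = (cosh (\<xi>1 y))\<^sup>2" using hyperbolic_pythagoras[of "\<xi>1 y"] by (simp add: \<xi>1_def)
    finally have "norm (p y) = cosh (\<xi>1 y)" using cosh_real_nonneg[of "\<xi>1 y"] by (simp add: power2_eq_iff_nonneg)
    with p1 show "p y = of_real (cosh (\<xi>1 y)) * cis (\<xi>2 y)" by simp
  qed
  have "(cosh (\<xi>1 y))\<^sup>2 * deriv \<xi>2 y + (sinh (\<xi>1 y))\<^sup>2 * deriv \<xi>3 y = 0" if y: "y \<in> J" for y
  proof -
    obtain P' Q' where PQ: "((\<lambda>y. of_real (cosh (\<xi>1 y)) * cis (\<xi>2 y)) has_vector_derivative P') (at y)"
      "((\<lambda>y. of_real (sinh (\<xi>1 y)) * cis (\<xi>3 y)) has_vector_derivative Q') (at y)"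
      "Im (P' * cnj (of_real (cosh (\<xi>1 y)) * cis (\<xi>2 y))) + Im (Q' * cnj (of_real (sinh (\<xi>1 y)) * cis (\<xi>3 y))) =
        (cosh (\<xi>1 y))\<^sup>2 * deriv \<xi>2 y + (sinh (\<xi>1 y))\<^sup>2 * deriv \<xi>3 y"
      using polar_rows[OF s1 \<xi>2(1) \<sigma>(2) y] .
    have "(p has_vector_derivative P') (at y)"
      by (rule has_vector_derivative_transform_within_open[OF PQ(1) J(1) y]) (rule eq(1)[symmetric])
    then have P': "P' = p' y" using dp[OF y] by (rule vector_derivative_unique_at)
    have "(q has_vector_derivative Q') (at y)"
      by (rule has_vector_derivative_transform_within_open[OF PQ(2) J(1) y]) (rule eq(2)[symmetric])
    then have Q': "Q' = q' y" using dq[OF y] by (rule vector_derivative_unique_at)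
    show ?thesis using PQ(3) hor[OF y] unfolding eq[OF y, symmetric] P' Q' p'_def q'_def by linarith
  qed
  then have "admissible_angles J \<xi>1 \<xi>2 \<xi>3"
    unfolding admissible_angles_def using s1 \<xi>2(1) \<sigma>(2) by blast
  moreover have "\<forall>y\<in>J. p y = of_real (cosh (\<xi>1 y)) * cis (\<xi>2 y) \<and> q y = of_real (sinh (\<xi>1 y)) * cis (\<xi>3 y)"
    using eq by blast
  ultimately show ?thesis by (rule that)
qed

text \<open>Two properties of the coordinates suffice: the first coordinate field is
  \<open>T\<close>, and the phase of the normal is constant in \<open>y\<close>. The first makes the
  rows independent of \<open>x\<close>, and together they give the normal the same phase
  \<open>k * x\<close> as in the model, up to a constant, so that a single \<open>e\<close> serves
  all \<open>y\<close>.\<close>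

lemma helix_coords_form:
  assumes V: "open I" "is_interval I" "open J" "is_interval J" "x0 \<in> I" "y0 \<in> J"
    and prm: "helix_param (I \<times> J) F N"
    and Fx: "\<And>w. w \<in> I \<times> J \<Longrightarrow> frechet_derivative F (at w) (1, 0) = T_vec \<kappa> \<tau> lam (F w) (N w)"
    and ang: "\<And>w. w \<in> I \<times> J \<Longrightarrow> dangle F N w (0, 1) = 0"
  obtains \<xi> \<xi>1 \<xi>2 \<xi>3 where "admissible_angles J \<xi>1 \<xi>2 \<xi>3"
    "\<forall>x\<in>I. \<forall>y\<in>J. F (x, y) = A_mat \<xi> (\<xi>1 y) (\<xi>2 y) (\<xi>3 y) *v \<gamma> x"
proof -
  let ?V = "I \<times> J"
  have w0: "(x0, y0) \<in> ?V" using V(5,6) by simp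
  note c0 = csq_pos[OF prm w0]
  note P = helix_paramD[OF prm]
  have conv: "convex ?V" using V(2,4) by (intro convex_Times is_interval_convex)
  have fst: "(fst has_derivative fst) (at w)" for w :: "real \<times> real"
    by (rule bounded_linear_imp_has_derivative[OF bounded_linear_fst])
  have "dangle F N w (1, 0) = k * fst (1, 0 :: real)" if "w \<in> ?V" for w
    using dangle_T[OF prm that Fx[OF that]] by simp
  moreover have "dangle F N w (0, 1) = k * fst (0, 1 :: real)" if "w \<in> ?V" for w
    using ang[OF that] by simp
  ultimately obtain \<phi>0 where \<phi>0: "\<forall>w\<in>?V. Complex (xc2 \<kappa> (F w) (N w)) (xc3 \<kappa> (F w) (N w)) = of_real (sqrt csq) * cis (k * fst w + \<phi>0)"
    using normal_angle_constant[OF prm conv fst _ _ w0] by blast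
  obtain \<xi> where \<xi>: "\<And>x. of_real (sqrt csq) * cis (k * x + \<phi>0) = - \<i> * cis \<xi> * mg x"
    using mg_phase[OF c0] by blast
  define e where "e = - \<i> * cis \<xi>"
  have e: "e * cnj e = 1" using cis_cnj_cis[of \<xi>] by (simp add: e_def algebra_simps)
  have n: "Complex (xc2 \<kappa> (F w) (N w)) (xc3 \<kappa> (F w) (N w)) = e * mg (fst w)" if "w \<in> ?V" for w
    using bspec[OF \<phi>0 that] unfolding \<xi> e_def .
  have dF: "(F has_derivative frechet_derivative F (at w)) (at w)" if "w \<in> ?V" for w
    using P(2) that by (rule smooth_on_has_derivative)
  \<comment> \<open>The rows do not change along \<open>x\<close>, so they can be read off on the
    line \<open>x = x0\<close> as smooth functions of \<open>y\<close>.\<close>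
  have const: "rowp e (F (x, y)) x = rowp e (F (x0, y)) x0 \<and> rowq e (F (x, y)) x = rowq e (F (x0, y)) x0"
    if x: "x \<in> I" and y: "y \<in> J" for x y
  proof -
    have d: "((\<lambda>t. rowp e (F (t, y)) t) has_vector_derivative 0) (at t) \<and> ((\<lambda>t. rowq e (F (t, y)) t) has_vector_derivative 0) (at t)"
      if t: "t \<in> I" for t
    proof -
      have w: "(t, y) \<in> ?V" using t y by simp
      have T: "frechet_derivative F (at (t, y)) (1, 0) =
          fr \<kappa> (F (t, y)) (lam * csq / \<tau>) (- \<nu> * xc2 \<kappa> (F (t, y)) (N (t, y))) (- \<nu> * xc3 \<kappa> (F (t, y)) (N (t, y)))"
        unfolding Fx[OF w] by (rule unit_normalD(4)[OF P(5)[OF w]])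
      obtain P' Q' where PQ: "((\<lambda>w. rowp e (F w) (fst w)) has_derivative P') (at (t, y))"
        "((\<lambda>w. rowq e (F w) (fst w)) has_derivative Q') (at (t, y))" "P' (1, 0) = 0" "Q' (1, 0) = 0"
        by (rule row_first_integral[OF c0 dF[OF w] fst _ e T n[OF w]]) simp
      show ?thesis
        using has_vector_derivative_coordinates(1)[OF PQ(1)] has_vector_derivative_coordinates(1)[OF PQ(2)]
        unfolding PQ(3,4) fst_conv by (rule conjI)
    qed
    obtain a where a: "\<And>t. t \<in> I \<Longrightarrow> rowp e (F (t, y)) t = a"
    proof (rule has_vector_derivative_zero_constant[OF is_interval_convex[OF V(2)] has_vector_derivative_at_within[OF conjunct1[OF d]]])
      fix c assume "\<And>t. t \<in> I \<Longrightarrow> rowp e (F (t, y)) t = c"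
      then show thesis by (rule that)
    qed
    obtain b where b: "\<And>t. t \<in> I \<Longrightarrow> rowq e (F (t, y)) t = b"
    proof (rule has_vector_derivative_zero_constant[OF is_interval_convex[OF V(2)] has_vector_derivative_at_within[OF conjunct2[OF d]]])
      fix c assume "\<And>t. t \<in> I \<Longrightarrow> rowq e (F (t, y)) t = c"
      then show thesis by (rule that)
    qed
    show ?thesis unfolding a[OF x] a[OF V(5)] b[OF x] b[OF V(5)] by simp
  qed
  define p q where "p y = rowp e (F (x0, y)) x0" and "q y = rowq e (F (x0, y)) x0" for y
  have zF: "z1 (F (x, y)) = p y * z1 (\<gamma> x) + q y * z2 (\<gamma> x)"
    "z2 (F (x, y)) = e * (cnj (q y) * z1 (\<gamma> x) + cnj (p y) * z2 (\<gamma> x))" if "x \<in> I" "y \<in> J" for x y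
    using row_recover[OF c0 e, of "F (x, y)" x] const[OF that] by (simp_all add: p_def q_def)
  have "smooth_on J (\<lambda>y. (x0, y))" by (intro smooth_on_Pair smooth_on_const smooth_on_id V(3))
  then have "smooth_on J (\<lambda>y. F (x0, y))"
    using V(5) by (intro smooth_on_compose[OF P(2) V(3) P(1)]) auto
  from rows_smooth[OF c0 V(3) this] have sp: "smooth_on J p" "smooth_on J q"
    unfolding p_def[abs_def] q_def[abs_def] .
  have norm: "(norm (p y))\<^sup>2 = 1 + (norm (q y))\<^sup>2" if "y \<in> J" for y
    unfolding p_def q_def using P(4) V(5) that by (intro row_unimodular[OF c0 e]) auto
  have U: "z1 (frechet_derivative F (at (x0, y)) (0, 1)) = frechet_derivative p (at y) 1 * z1 (\<gamma> x0) + frechet_derivative q (at y) 1 * z2 (\<gamma> x0)"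
    "z2 (frechet_derivative F (at (x0, y)) (0, 1)) = e * (cnj (frechet_derivative q (at y) 1) * z1 (\<gamma> x0) + cnj (frechet_derivative p (at y) 1) * z2 (\<gamma> x0))"
    if y: "y \<in> J" for y
  proof -
    have w: "(x0, y) \<in> ?V" using V(5) y by simp
    note d = has_vector_derivative_coordinates(2)[OF dF[OF w]]
    note cnj = bounded_linear.has_vector_derivative[OF bounded_linear_cnj]
    note dp = smooth_on_has_vector_derivative[OF sp(1) y] and dq = smooth_on_has_vector_derivative[OF sp(2) y]
    have "((\<lambda>t. p t * z1 (\<gamma> x0) + q t * z2 (\<gamma> x0)) has_vector_derivative
        frechet_derivative p (at y) 1 * z1 (\<gamma> x0) + frechet_derivative q (at y) 1 * z2 (\<gamma> x0)) (at y)"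
      by (intro has_vector_derivative_add has_vector_derivative_mult_left dp dq)
    then have "((\<lambda>t. z1 (F (x0, t))) has_vector_derivative
        frechet_derivative p (at y) 1 * z1 (\<gamma> x0) + frechet_derivative q (at y) 1 * z2 (\<gamma> x0)) (at y)"
      by (rule has_vector_derivative_transform_within_open[OF _ V(3) y]) (rule zF(1)[OF V(5), symmetric])
    from vector_derivative_unique_at[OF bounded_linear.has_vector_derivative[OF bounded_linear_z(1) d] this]
    show "z1 (frechet_derivative F (at (x0, y)) (0, 1)) = frechet_derivative p (at y) 1 * z1 (\<gamma> x0) + frechet_derivative q (at y) 1 * z2 (\<gamma> x0)" .
    have "((\<lambda>t. e * (cnj (q t) * z1 (\<gamma> x0) + cnj (p t) * z2 (\<gamma> x0))) has_vector_derivative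
        e * (cnj (frechet_derivative q (at y) 1) * z1 (\<gamma> x0) + cnj (frechet_derivative p (at y) 1) * z2 (\<gamma> x0))) (at y)"
      by (intro has_vector_derivative_add has_vector_derivative_mult_left has_vector_derivative_mult_right cnj dp dq)
    then have "((\<lambda>t. z2 (F (x0, t))) has_vector_derivative
        e * (cnj (frechet_derivative q (at y) 1) * z1 (\<gamma> x0) + cnj (frechet_derivative p (at y) 1) * z2 (\<gamma> x0))) (at y)"
      by (rule has_vector_derivative_transform_within_open[OF _ V(3) y]) (rule zF(2)[OF V(5), symmetric])
    from vector_derivative_unique_at[OF bounded_linear.has_vector_derivative[OF bounded_linear_z(2) d] this]
    show "z2 (frechet_derivative F (at (x0, y)) (0, 1)) = e * (cnj (frechet_derivative q (at y) 1) * z1 (\<gamma> x0) + cnj (frechet_derivative p (at y) 1) * z2 (\<gamma> x0))" .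
  qed
  have hor: "Im (frechet_derivative p (at y) 1 * cnj (p y)) + Im (frechet_derivative q (at y) 1 * cnj (q y)) = 0" if y: "y \<in> J" for y
  proof -
    have w: "(x0, y) \<in> ?V" using V(5) y by simp
    have "- (sqrt \<kappa> / 2) * (\<epsilon> * \<beta>) * (4 / \<kappa>) *
        (Im (frechet_derivative p (at y) 1 * cnj (p y)) + Im (frechet_derivative q (at y) 1 * cnj (q y))) = 0"
      using normal_horizontal[OF c0 e zF[OF V(5) y] U[OF y] n[OF w, unfolded fst_conv]]
        constraint[OF prm w, of "(0, 1)"] by linarith
    moreover have "- (sqrt \<kappa> / 2) * (\<epsilon> * \<beta>) * (4 / \<kappa>) \<noteq> 0" using \<kappa> \<epsilon>(5) \<beta>(2) by simp
    ultimately show ?thesis by (simp only: mult_eq_0_iff simp_thms)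
  qed
  \<comment> \<open>If both rows were stationary, the second coordinate field of the immersion would
    vanish.\<close>
  have reg: "frechet_derivative q (at y) 1 \<noteq> 0" if y: "y \<in> J" and 0: "frechet_derivative p (at y) 1 = 0" for y
  proof
    assume "frechet_derivative q (at y) 1 = 0"
    then have "frechet_derivative F (at (x0, y)) (0, 1) = 0"
      using U[OF y] 0 by (intro z_eqI) (simp_all add: z_zero)
    then have "0 *\<^sub>R frechet_derivative F (at (x0, y)) (1, 0) + 1 *\<^sub>R frechet_derivative F (at (x0, y)) (0, 1) = 0" by simp
    moreover have w: "(x0, y) \<in> ?V" using V(5) y by simp
    ultimately have "(1 :: real) = 0" using inj_derivative_pair(2)[OF dF[OF w] P(6)[OF w]] by blast
    then show False by simp
  qed
  obtain \<xi>1 \<xi>2 \<xi>3 where \<xi>s: "admissible_angles J \<xi>1 \<xi>2 \<xi>3"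
    "\<forall>y\<in>J. p y = of_real (cosh (\<xi>1 y)) * cis (\<xi>2 y) \<and> q y = of_real (sinh (\<xi>1 y)) * cis (\<xi>3 y)"
    using rows_to_angles[OF V(3,4) sp norm hor reg] .
  have "F (x, y) = A_mat \<xi> (\<xi>1 y) (\<xi>2 y) (\<xi>3 y) *v \<gamma> x" if "x \<in> I" "y \<in> J" for x y
  proof -
    have pq: "of_real (cosh (\<xi>1 y)) * cis (\<xi>2 y) = p y" "of_real (sinh (\<xi>1 y)) * cis (\<xi>3 y) = q y"
      using bspec[OF \<xi>s(2) that(2)] by simp_all
    show ?thesis
      by (rule z_eqI) (simp_all only: zF[OF that] z_A_mat pq e_def)
  qed
  with \<xi>s(1) show ?thesis by (intro that[of \<xi>1 \<xi>2 \<xi>3 \<xi>]) blast+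
qed

end

section \<open>Existence of adapted coordinates\<close>

text \<open>On \<zeta> and \<open>v0\<close> the pair of functionals has a diagonal matrix with
  nonzero entries.\<close>

lemma inj_plane_functionals:
  fixes X' S' :: "real \<times> real \<Rightarrow> real"
  assumes X: "linear X'" and S: "linear S'" and v0: "X' v0 = 0" "S' v0 \<noteq> 0" and z: "X' \<zeta> = 1" "S' \<zeta> = 0"
  shows "inj (\<lambda>v. (X' v, S' v))"
proof -
  obtain a b where ab: "\<And>p q. X' (p, q) = p * a + q * b"
  proof
    show "X' (p, q) = p * X' (1, 0) + q * X' (0, 1)" for p q
      using linear_add[OF X, of "p *\<^sub>R (1, 0)" "q *\<^sub>R (0, 1)"] linear_scale[OF X, of p "(1, 0)"] linear_scale[OF X, of q "(0, 1)"] by simp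
  qed
  obtain c d where cd: "\<And>p q. S' (p, q) = p * c + q * d"
  proof
    show "S' (p, q) = p * S' (1, 0) + q * S' (0, 1)" for p q
      using linear_add[OF S, of "p *\<^sub>R (1, 0)" "q *\<^sub>R (0, 1)"] linear_scale[OF S, of p "(1, 0)"] linear_scale[OF S, of q "(0, 1)"] by simp
  qed
  obtain v1 v2 z1 z2 where v: "v0 = (v1, v2)" "\<zeta> = (z1, z2)" by (cases v0, cases \<zeta>)
  have e: "v1 * a + v2 * b = 0" "v1 * c + v2 * d \<noteq> 0" "z1 * a + z2 * b = 1" "z1 * c + z2 * d = 0"
    using v0 z by (simp_all add: v ab cd)
  have "(a * d - b * c) * (z1 * v2 - z2 * v1) = (z1 * a + z2 * b) * (v1 * c + v2 * d) - (z1 * c + z2 * d) * (v1 * a + v2 * b)"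
    by (simp add: algebra_simps)
  then have det: "a * d - b * c \<noteq> 0" using e by auto
  have lin: "linear (\<lambda>v. (X' v, S' v))"
    by (rule linearI) (simp_all add: linear_add[OF X] linear_add[OF S] linear_scale[OF X] linear_scale[OF S])
  show ?thesis
  proof (rule linear_injective_0[OF lin, THEN iffD2], intro allI impI)
    fix v assume "(X' v, S' v) = 0"
    moreover obtain p q where pq: "v = (p, q)" by (cases v)
    ultimately have "p * a + q * b = 0" "p * c + q * d = 0" by (simp_all add: ab cd zero_prod_def)
    then have "(a * d - b * c) * p = 0" "(a * d - b * c) * q = 0" by algebra+
    then show "v = 0" using det by (simp add: pq zero_prod_def)
  qed
qed

context helix_constants
begin

lemma k_nonzero: "k \<noteq> 0"
  using lam \<kappa> \<tau> B by (auto simp: k_def)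

lemma helix_param_subset:
  assumes "helix_param V F N" "open W" "W \<subseteq> V"
  shows "helix_param W F N"
  using assms smooth_on_subset unfolding helix_param_def immersion_on_def by (meson subsetD)

text \<open>The coordinate \<open>x\<close> is the angle of the normal, up to the factor \<open>k\<close>.\<close>

lemma angle_coordinate:
  assumes prm: "helix_param V F N" and w0: "w0 \<in> V"
  obtains W X where "open W" "w0 \<in> W" "W \<subseteq> V" "smooth_on W X"
    "\<forall>w\<in>W. \<forall>v. frechet_derivative X (at w) v = dangle F N w v / k"
proof -
  note c0 = csq_pos[OF prm w0] and P = helix_paramD[OF prm]
  let ?n2 = "\<lambda>w. xc2 \<kappa> (F w) (N w)" and ?n3 = "\<lambda>w. xc3 \<kappa> (F w) (N w)"
  define m2 m3 where "m2 = ?n2 w0" and "m3 = ?n3 w0"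
  \<comment> \<open>Up to the factor \<open>csq\<close>, sine and cosine of the angle measured from
    its value at \<open>w0\<close>; where the cosine is positive, \<open>arctan\<close> gives a
    smooth branch.\<close>
  define u v where "u w = ?n3 w * m2 - ?n2 w * m3" and "v w = ?n2 w * m2 + ?n3 w * m3" for w
  note sn = smooth_n[OF prm]
  have su: "smooth_on V u" "smooth_on V v"
    unfolding u_def[abs_def] v_def[abs_def] by (intro smooth_on_add smooth_on_diff smooth_on_mult smooth_on_const sn P(1))+
  define W where "W = V \<inter> v -` {0<..}"
  have W: "open W" unfolding W_def
    using smooth_on_imp_continuous_on[OF su(2)] P(1) by (rule continuous_open_preimage) simp
  have "v w0 = csq" using n_sq[OF prm w0] by (simp add: v_def m2_def m3_def)
  then have w0W: "w0 \<in> W" using w0 c0 by (simp add: W_def)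
  have WV: "W \<subseteq> V" by (auto simp: W_def)
  have sW: "smooth_on W u" "smooth_on W v" by (rule smooth_on_subset[OF su(1) WV] smooth_on_subset[OF su(2) WV])+
  have vpos: "v w > 0" if "w \<in> W" for w using that by (simp add: W_def)
  define X where "X w = arctan (u w / v w) / k" for w
  have "smooth_on W (\<lambda>w. u w / v w)" by (rule smooth_on_divide[OF W sW]) (use vpos in force)
  then have sX: "smooth_on W X" unfolding X_def[abs_def]
    by (rule smooth_on_divide[OF W smooth_on_arctan[OF W] smooth_on_const]) (rule k_nonzero)
  have "frechet_derivative X (at w) e = dangle F N w e / k" if w: "w \<in> W" for w e
  proof -
    have wV: "w \<in> V" using w WV by blast
    let ?d = "\<lambda>e. dangle F N w e"
    have n': "(?n2 has_derivative (\<lambda>e. - ?d e * ?n3 w)) (at w)" "(?n3 has_derivative (\<lambda>e. ?d e * ?n2 w)) (at w)"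
      by (rule has_derivative_eq_rhs[OF has_derivative_n(1)[OF prm wV] ext[OF d_n(1)[OF prm wV c0]]]
          has_derivative_eq_rhs[OF has_derivative_n(2)[OF prm wV] ext[OF d_n(2)[OF prm wV c0]]])+
    have du: "(u has_derivative (\<lambda>e. ?d e * v w)) (at w)"
      unfolding u_def[abs_def]
      by (rule has_derivative_eq_rhs[OF has_derivative_diff[OF has_derivative_mult_left[OF n'(2)] has_derivative_mult_left[OF n'(1)]]])
        (simp add: v_def fun_eq_iff algebra_simps)
    have dv: "(v has_derivative (\<lambda>e. - ?d e * u w)) (at w)"
      unfolding v_def[abs_def]
      by (rule has_derivative_eq_rhs[OF has_derivative_add[OF has_derivative_mult_left[OF n'(1)] has_derivative_mult_left[OF n'(2)]]])
        (simp add: u_def fun_eq_iff algebra_simps)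
    have v0: "v w \<noteq> 0" using vpos[OF w] by simp
    have "((\<lambda>w. arctan (u w / v w)) has_derivative
        (\<lambda>e. inverse (1 + (u w / v w)\<^sup>2) * ((?d e * v w * v w - u w * (- ?d e * u w)) / (v w * v w)))) (at w)"
      using DERIV_compose_FDERIV[OF DERIV_arctan has_derivative_divide'[OF du dv v0]] by (simp only: mult.commute)
    then have dX: "(X has_derivative
        (\<lambda>e. inverse (1 + (u w / v w)\<^sup>2) * ((?d e * v w * v w - u w * (- ?d e * u w)) / (v w * v w)) / k)) (at w)"
      unfolding X_def[abs_def] by (rule bounded_linear.has_derivative[OF bounded_linear_divide])
    have "inverse (1 + (a / b)\<^sup>2) * ((d * b * b - a * (- d * a)) / (b * b)) = d" if "b \<noteq> 0" for a b d :: real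
    proof -
      have "b * b + a * a \<noteq> 0" using that by (simp add: sum_squares_eq_zero_iff)
      moreover have "1 + (a / b)\<^sup>2 = (b * b + a * a) / (b * b)" using that by (simp add: field_simps power2_eq_square)
      moreover have "d * b * b - a * (- d * a) = d * (b * b + a * a)" by (simp add: algebra_simps)
      ultimately show ?thesis using that by simp
    qed
    from this[OF v0] show ?thesis
      unfolding frechet_derivative_at[OF dX, symmetric] by (simp only:)
  qed
  then show ?thesis using that[OF W w0W WV sX] by blast
qed

lemma dangle_zero:
  assumes prm: "helix_param V F N" and w: "w \<in> V"
    and n: "\<forall>w\<in>V. Complex (xc2 \<kappa> (F w) (N w)) (xc3 \<kappa> (F w) (N w)) = of_real (sqrt csq) * cis (k * fst w + \<phi>0)"
  shows "dangle F N w (0, 1) = 0"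
proof -
  have f: "((\<lambda>w. k * fst w + \<phi>0) has_derivative (\<lambda>v. k * fst v)) (at w)"
    by (auto intro!: derivative_eq_intros)
  have "((\<lambda>w. sqrt csq * cos (k * fst w + \<phi>0)) has_derivative (\<lambda>v. sqrt csq * (- sin (k * fst w + \<phi>0) * (k * fst v)))) (at w)"
    "((\<lambda>w. sqrt csq * sin (k * fst w + \<phi>0)) has_derivative (\<lambda>v. sqrt csq * (cos (k * fst w + \<phi>0) * (k * fst v)))) (at w)"
    by (rule has_derivative_mult_right,
        rule has_derivative_eq_rhs[OF DERIV_compose_FDERIV[OF DERIV_cos f]] has_derivative_eq_rhs[OF DERIV_compose_FDERIV[OF DERIV_sin f]],
        simp add: fun_eq_iff)+
  note d = this
  have e: "xc2 \<kappa> (F z) (N z) = sqrt csq * cos (k * fst z + \<phi>0)" "xc3 \<kappa> (F z) (N z) = sqrt csq * sin (k * fst z + \<phi>0)" if "z \<in> V" for z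
    using bspec[OF n that] by (simp_all add: complex_eq_iff)
  have "frechet_derivative (\<lambda>w. xc2 \<kappa> (F w) (N w)) (at w) (0, 1) = 0" "frechet_derivative (\<lambda>w. xc3 \<kappa> (F w) (N w)) (at w) (0, 1) = 0"
    using has_derivative_unique_on_open[OF helix_paramD(1)[OF prm] w e(1) has_derivative_n(1)[OF prm w] d(1), of "(0, 1)"]
      has_derivative_unique_on_open[OF helix_paramD(1)[OF prm] w e(2) has_derivative_n(2)[OF prm w] d(2), of "(0, 1)"] by simp_all
  then show ?thesis by (simp add: dangle_def)
qed

text \<open>The second component of \<open>\<Phi>\<close> is one of the first integrals given by the rows.\<close>

lemma straighten:
  assumes prm: "helix_param V F N" and w0: "w0 \<in> V"
  obtains W \<Phi> \<phi>0 where "open W" "w0 \<in> W" "W \<subseteq> V" "smooth_on W (\<Phi> :: real \<times> real \<Rightarrow> real \<times> real)" "inj (frechet_derivative \<Phi> (at w0))"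
    "\<forall>w\<in>W. \<forall>\<zeta>. frechet_derivative F (at w) \<zeta> = T_vec \<kappa> \<tau> lam (F w) (N w) \<longrightarrow> frechet_derivative \<Phi> (at w) \<zeta> = (1, 0)"
    "\<forall>w\<in>W. Complex (xc2 \<kappa> (F w) (N w)) (xc3 \<kappa> (F w) (N w)) = of_real (sqrt csq) * cis (k * fst (\<Phi> w) + \<phi>0)"
proof -
  note c0 = csq_pos[OF prm w0]
  obtain W0 X where W0: "open W0" "w0 \<in> W0" "W0 \<subseteq> V" "smooth_on W0 X"
    "\<forall>w\<in>W0. \<forall>v. frechet_derivative X (at w) v = dangle F N w v / k"
    using angle_coordinate[OF prm w0] .
  obtain r where r: "r > 0" "ball w0 r \<subseteq> W0" using openE[OF W0(1,2)] by blast
  define W where "W = ball w0 r"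
  have W: "open W" "w0 \<in> W" "W \<subseteq> V" "convex W" "W \<subseteq> W0" using r W0(3) by (auto simp: W_def)
  have prmW: "helix_param W F N" by (rule helix_param_subset[OF prm W(1,3)])
  note P = helix_paramD[OF prmW]
  have sX: "smooth_on W X" by (rule smooth_on_subset[OF W0(4) W(5)])
  have dX: "(X has_derivative frechet_derivative X (at w)) (at w)" if "w \<in> W" for w
    using sX that by (rule smooth_on_has_derivative)
  have X': "frechet_derivative X (at w) v = dangle F N w v / k" if "w \<in> W" for w v
    using W0(5) that W(5) by blast
  have dang: "dangle F N w v = k * frechet_derivative X (at w) v" if "w \<in> W" for w v
    using X'[OF that] k_nonzero by simp
  obtain \<phi>0 where \<phi>0: "\<forall>w\<in>W. Complex (xc2 \<kappa> (F w) (N w)) (xc3 \<kappa> (F w) (N w)) = of_real (sqrt csq) * cis (k * X w + \<phi>0)"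
    using normal_angle_constant[OF prmW W(4) dX dang dang W(2)] .
  obtain \<xi> where \<xi>: "\<And>x. of_real (sqrt csq) * cis (k * x + \<phi>0) = - \<i> * cis \<xi> * mg x"
    using mg_phase[OF c0] by blast
  define e where "e = - \<i> * cis \<xi>"
  have e: "e * cnj e = 1" using cis_cnj_cis[of \<xi>] by (simp add: e_def algebra_simps)
  have n: "Complex (xc2 \<kappa> (F w) (N w)) (xc3 \<kappa> (F w) (N w)) = e * mg (X w)" if "w \<in> W" for w
    using bspec[OF \<phi>0 that] unfolding \<xi> e_def .
  have dF: "(F has_derivative frechet_derivative F (at w)) (at w)" if "w \<in> W" for w
    using P(2) that by (rule smooth_on_has_derivative)
  define p q where "p w = rowp e (F w) (X w)" and "q w = rowq e (F w) (X w)" for w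
  have sz: "smooth_on UNIV (\<lambda>x. z1 (\<gamma> x))" "smooth_on UNIV (\<lambda>x. z2 (\<gamma> x))"
    using gamma_geodesic[OF c0] unfolding twisted_geodesic_def torus_geodesic_def
    by (blast intro: smooth_on_linear_compose[OF bounded_linear_z(1) open_UNIV] smooth_on_linear_compose[OF bounded_linear_z(2) open_UNIV])+
  have sg: "smooth_on W (\<lambda>w. z1 (\<gamma> (X w)))" "smooth_on W (\<lambda>w. z2 (\<gamma> (X w)))"
    by (rule smooth_on_compose[OF sz(1) W(1) open_UNIV subset_UNIV sX] smooth_on_compose[OF sz(2) W(1) open_UNIV subset_UNIV sX])+
  have szF: "smooth_on W (\<lambda>w. z1 (F w))" "smooth_on W (\<lambda>w. z2 (F w))"
    by (rule smooth_on_linear_compose[OF bounded_linear_z(1) W(1) P(2)] smooth_on_linear_compose[OF bounded_linear_z(2) W(1) P(2)])+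
  note cn = smooth_on_linear_compose[OF bounded_linear_cnj W(1)]
  have spq: "smooth_on W p" "smooth_on W q"
    unfolding p_def[abs_def] q_def[abs_def] rowp_def[OF c0] rowq_def[OF c0]
    by (intro smooth_on_mult smooth_on_diff smooth_on_const sg szF cn[OF sg(1)] cn[OF sg(2)] cn[OF szF(2)] W(1))+
  have dp: "(p has_derivative frechet_derivative p (at w)) (at w)" and dq: "(q has_derivative frechet_derivative q (at w)) (at w)" if "w \<in> W" for w
    by (rule smooth_on_has_derivative[OF spq(1) that] smooth_on_has_derivative[OF spq(2) that])+
  have first: "frechet_derivative X (at w) \<zeta> = 1 \<and> frechet_derivative p (at w) \<zeta> = 0 \<and> frechet_derivative q (at w) \<zeta> = 0"
    if w: "w \<in> W" and \<zeta>: "frechet_derivative F (at w) \<zeta> = T_vec \<kappa> \<tau> lam (F w) (N w)" for w \<zeta>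
  proof -
    have X1: "frechet_derivative X (at w) \<zeta> = 1"
      using X'[OF w] dangle_T[OF prmW w \<zeta>] k_nonzero by simp
    have T: "frechet_derivative F (at w) \<zeta> = fr \<kappa> (F w) (lam * csq / \<tau>) (- \<nu> * xc2 \<kappa> (F w) (N w)) (- \<nu> * xc3 \<kappa> (F w) (N w))"
      unfolding \<zeta> by (rule unit_normalD(4)[OF P(5)[OF w]])
    obtain P' Q' where PQ: "((\<lambda>w. rowp e (F w) (X w)) has_derivative P') (at w)"
      "((\<lambda>w. rowq e (F w) (X w)) has_derivative Q') (at w)" "P' \<zeta> = 0" "Q' \<zeta> = 0"
      by (rule row_first_integral[OF c0 dF[OF w] dX[OF w] X1 e T n[OF w]])
    show ?thesis
      using X1 PQ(3,4) unfolding p_def[abs_def] q_def[abs_def] frechet_derivative_at[OF PQ(1), symmetric] frechet_derivative_at[OF PQ(2), symmetric]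
      by simp
  qed
  obtain \<zeta>0 where \<zeta>0: "frechet_derivative F (at w0) \<zeta>0 = T_vec \<kappa> \<tau> lam (F w0) (N w0)"
    using directions[OF prm w0] .
  let ?X' = "frechet_derivative X (at w0)" and ?p' = "frechet_derivative p (at w0)" and ?q' = "frechet_derivative q (at w0)"
  \<comment> \<open>The direction of the level line of \<open>X\<close> through \<open>w0\<close>,
    along which a second coordinate has to vary.\<close>
  define v0 where "v0 = (?X' (0, 1), - ?X' (1, 0))"
  have Xv0: "?X' v0 = 0" unfolding v0_def frechet_derivative_pair[OF dX[OF W(2)], of "?X' (0, 1)" "- ?X' (1, 0)"] by simp
  have "v0 \<noteq> 0"
  proof
    assume "v0 = 0"
    then have "?X' (0, 1) = 0" "?X' (1, 0) = 0" by (simp_all add: v0_def zero_prod_def)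
    then have "?X' \<zeta>0 = 0" using frechet_derivative_pair[OF dX[OF W(2)], of "fst \<zeta>0" "snd \<zeta>0"] by simp
    with first[OF W(2) \<zeta>0] show False by simp
  qed
  \<comment> \<open>By \<open>row_recover\<close> the position is a function of \<open>p\<close>,
    \<open>q\<close> and \<open>X\<close>; if none of them varied along \<open>v0\<close>, the
    immersion would be singular there.\<close>
  have "?p' v0 \<noteq> 0 \<or> ?q' v0 \<noteq> 0"
  proof (rule ccontr)
    assume "\<not> ?thesis"
    then have pq0: "?p' v0 = 0" "?q' v0 = 0" by auto
    obtain dz dw where g: "((\<lambda>w. z1 (\<gamma> (X w))) has_derivative (\<lambda>v. ?X' v *\<^sub>R dz)) (at w0)"
      "((\<lambda>w. z2 (\<gamma> (X w))) has_derivative (\<lambda>v. ?X' v *\<^sub>R dw)) (at w0)"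
      using has_derivative_compose[OF dX[OF W(2)] gamma_ode(1)[OF c0, unfolded has_vector_derivative_def]]
        has_derivative_compose[OF dX[OF W(2)] gamma_ode(2)[OF c0, unfolded has_vector_derivative_def]] by blast
    note cnj = bounded_linear.has_derivative[OF bounded_linear_cnj]
    have "((\<lambda>w. p w * z1 (\<gamma> (X w)) + q w * z2 (\<gamma> (X w))) has_derivative
      (\<lambda>v. (p w0 * (?X' v *\<^sub>R dz) + ?p' v * z1 (\<gamma> (X w0))) + (q w0 * (?X' v *\<^sub>R dw) + ?q' v * z2 (\<gamma> (X w0))))) (at w0)"
      by (intro has_derivative_add has_derivative_mult g dp dq W(2))
    then have 1: "((\<lambda>w. z1 (F w)) has_derivative
      (\<lambda>v. (p w0 * (?X' v *\<^sub>R dz) + ?p' v * z1 (\<gamma> (X w0))) + (q w0 * (?X' v *\<^sub>R dw) + ?q' v * z2 (\<gamma> (X w0))))) (at w0)"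
      unfolding p_def q_def row_recover(1)[OF c0 e, symmetric] .
    have "((\<lambda>w. e * (cnj (q w) * z1 (\<gamma> (X w)) + cnj (p w) * z2 (\<gamma> (X w)))) has_derivative
      (\<lambda>v. e * ((cnj (q w0) * (?X' v *\<^sub>R dz) + cnj (?q' v) * z1 (\<gamma> (X w0))) + (cnj (p w0) * (?X' v *\<^sub>R dw) + cnj (?p' v) * z2 (\<gamma> (X w0)))))) (at w0)"
      by (intro has_derivative_mult_right has_derivative_add has_derivative_mult g cnj dp dq W(2))
    then have 2: "((\<lambda>w. z2 (F w)) has_derivative
      (\<lambda>v. e * ((cnj (q w0) * (?X' v *\<^sub>R dz) + cnj (?q' v) * z1 (\<gamma> (X w0))) + (cnj (p w0) * (?X' v *\<^sub>R dw) + cnj (?p' v) * z2 (\<gamma> (X w0)))))) (at w0)"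
      unfolding p_def q_def row_recover(2)[OF c0 e, symmetric] .
    have "z1 (frechet_derivative F (at w0) v0) = 0" "z2 (frechet_derivative F (at w0) v0) = 0"
      using fun_cong[OF has_derivative_unique[OF bounded_linear.has_derivative[OF bounded_linear_z(1) dF[OF W(2)]] 1], of v0]
        fun_cong[OF has_derivative_unique[OF bounded_linear.has_derivative[OF bounded_linear_z(2) dF[OF W(2)]] 2], of v0]
      by (simp_all add: pq0 Xv0)
    then have "frechet_derivative F (at w0) v0 = 0" by (intro z_eqI) (simp_all add: z_zero)
    also have "\<dots> = frechet_derivative F (at w0) 0" using linear_0[OF has_derivative_linear[OF dF[OF W(2)]]] by simp
    finally show False using injD[OF P(6)[OF W(2)]] \<open>v0 \<noteq> 0\<close> by blast
  qed
  \<comment> \<open>\<open>S\<close> is one of the four real and imaginary parts of \<open>p\<close>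
    and \<open>q\<close>.\<close>
  then obtain S :: "real \<times> real \<Rightarrow> real" where S: "smooth_on W S" "frechet_derivative S (at w0) v0 \<noteq> 0"
    "\<And>w \<zeta>. w \<in> W \<Longrightarrow> frechet_derivative F (at w) \<zeta> = T_vec \<kappa> \<tau> lam (F w) (N w) \<Longrightarrow> frechet_derivative S (at w) \<zeta> = 0"
  proof -
    have D: "frechet_derivative (\<lambda>w. Re (h w)) (at w) v = Re (frechet_derivative h (at w) v)"
      "frechet_derivative (\<lambda>w. Im (h w)) (at w) v = Im (frechet_derivative h (at w) v)"
      if "smooth_on W h" "w \<in> W" for h :: "real \<times> real \<Rightarrow> complex" and w v
      by (rule fun_cong[OF frechet_derivative_at[OF bounded_linear.has_derivative[OF bounded_linear_Re smooth_on_has_derivative[OF that]]], symmetric]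
          fun_cong[OF frechet_derivative_at[OF bounded_linear.has_derivative[OF bounded_linear_Im smooth_on_has_derivative[OF that]]], symmetric])+
    have R: thesis if h: "smooth_on W h" "frechet_derivative h (at w0) v0 \<noteq> 0"
      "\<And>w \<zeta>. w \<in> W \<Longrightarrow> frechet_derivative F (at w) \<zeta> = T_vec \<kappa> \<tau> lam (F w) (N w) \<Longrightarrow> frechet_derivative h (at w) \<zeta> = 0"
      and S: "\<And>S :: real \<times> real \<Rightarrow> real. smooth_on W S \<Longrightarrow> frechet_derivative S (at w0) v0 \<noteq> 0 \<Longrightarrow>
        (\<And>w \<zeta>. w \<in> W \<Longrightarrow> frechet_derivative F (at w) \<zeta> = T_vec \<kappa> \<tau> lam (F w) (N w) \<Longrightarrow> frechet_derivative S (at w) \<zeta> = 0) \<Longrightarrow> thesis"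
      for h :: "real \<times> real \<Rightarrow> complex" and thesis
    proof (cases "Re (frechet_derivative h (at w0) v0) = 0")
      case False
      show ?thesis
        by (rule S[OF smooth_on_Re[OF W(1) h(1)]]) (simp_all only: D[OF h(1) W(2)] D[OF h(1)] False h(3) not_False_eq_True zero_complex.sel)
    next
      case True
      then have "Im (frechet_derivative h (at w0) v0) \<noteq> 0" using h(2) by (simp add: complex_eq_iff)
      then show ?thesis
        by (intro S[OF smooth_on_Im[OF W(1) h(1)]]) (simp_all only: D[OF h(1) W(2)] D[OF h(1)] h(3) not_False_eq_True zero_complex.sel)
    qed
    assume that: "\<And>S :: real \<times> real \<Rightarrow> real. smooth_on W S \<Longrightarrow> frechet_derivative S (at w0) v0 \<noteq> 0 \<Longrightarrow>
        (\<And>w \<zeta>. w \<in> W \<Longrightarrow> frechet_derivative F (at w) \<zeta> = T_vec \<kappa> \<tau> lam (F w) (N w) \<Longrightarrow> frechet_derivative S (at w) \<zeta> = 0) \<Longrightarrow> thesis"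
    show thesis
    proof (cases "?p' v0 = 0")
      case False
      show thesis
        by (rule R[OF spq(1) False _ that]) (use first in blast)
    next
      case True
      then have q0: "?q' v0 \<noteq> 0" using \<open>?p' v0 \<noteq> 0 \<or> ?q' v0 \<noteq> 0\<close> by blast
      show thesis
        by (rule R[OF spq(2) q0 _ that]) (use first in blast)
    qed
  qed
  define \<Phi> where "\<Phi> w = (X w, S w)" for w
  have s\<Phi>: "smooth_on W \<Phi>" unfolding \<Phi>_def[abs_def] by (intro smooth_on_Pair W(1) sX S(1))
  have D\<Phi>: "frechet_derivative \<Phi> (at w) = (\<lambda>v. (frechet_derivative X (at w) v, frechet_derivative S (at w) v))" if "w \<in> W" for w
    unfolding \<Phi>_def[abs_def]
    by (rule frechet_derivative_at[symmetric]) (intro has_derivative_Pair dX[OF that] smooth_on_has_derivative[OF S(1) that])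
  have "inj (frechet_derivative \<Phi> (at w0))"
    unfolding D\<Phi>[OF W(2)]
  proof (rule inj_plane_functionals[where X' = ?X' and S' = "frechet_derivative S (at w0)", OF _ _ Xv0 S(2)])
    show "linear ?X'" "linear (frechet_derivative S (at w0))"
      using has_derivative_linear[OF dX[OF W(2)]] has_derivative_linear[OF smooth_on_has_derivative[OF S(1) W(2)]] by blast+
    show "?X' \<zeta>0 = 1" using first[OF W(2) \<zeta>0] by blast
    show "frechet_derivative S (at w0) \<zeta>0 = 0" by (rule S(3)[OF W(2) \<zeta>0])
  qed
  moreover have "\<forall>w\<in>W. \<forall>\<zeta>. frechet_derivative F (at w) \<zeta> = T_vec \<kappa> \<tau> lam (F w) (N w) \<longrightarrow> frechet_derivative \<Phi> (at w) \<zeta> = (1, 0)"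
  proof (intro ballI allI impI)
    fix w \<zeta> assume w: "w \<in> W" and \<zeta>: "frechet_derivative F (at w) \<zeta> = T_vec \<kappa> \<tau> lam (F w) (N w)"
    show "frechet_derivative \<Phi> (at w) \<zeta> = (1, 0)"
      unfolding D\<Phi>[OF w] using first[OF w \<zeta>] S(3)[OF w \<zeta>] by (simp only:)
  qed
  moreover have "\<forall>w\<in>W. Complex (xc2 \<kappa> (F w) (N w)) (xc3 \<kappa> (F w) (N w)) = of_real (sqrt csq) * cis (k * fst (\<Phi> w) + \<phi>0)"
    using \<phi>0 by (simp only: \<Phi>_def fst_conv)
  ultimately show ?thesis by (rule that[OF W(1-3) s\<Phi>])
qed

lemma dangle_pair:
  assumes "helix_param V F N" "w \<in> V"
  shows "dangle F N w (p, q) = p * dangle F N w (1, 0) + q * dangle F N w (0, 1)"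
  unfolding dangle_def
    frechet_derivative_pair[OF has_derivative_n(1)[OF assms], of p q]
    frechet_derivative_pair[OF has_derivative_n(2)[OF assms], of p q]
  by (simp add: field_simps add_divide_distrib diff_divide_distrib)

lemma frechet_derivative_reparam:
  assumes "smooth_on V F" "smooth_on W G" "G ` W \<subseteq> V" "z \<in> W"
  shows "frechet_derivative (\<lambda>z. F (G z)) (at z) v = frechet_derivative F (at (G z)) (frechet_derivative G (at z) v)"
proof -
  have "((\<lambda>z. F (G z)) has_derivative (\<lambda>v. frechet_derivative F (at (G z)) (frechet_derivative G (at z) v))) (at z)"
    by (rule has_derivative_compose[OF smooth_on_has_derivative[OF assms(2,4)] smooth_on_has_derivative[OF assms(1)]])
      (use assms(3,4) in blast)
  from fun_cong[OF frechet_derivative_at[OF this], of v] show ?thesis by (rule sym)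
qed

text \<open>The map \<Phi> of \<open>straighten\<close> is inverted locally. Since its derivative
  sends the preimage of \<open>T\<close> to \<open>(1, 0)\<close>, the new first coordinate field is
  \<open>T\<close>, and the phase of the normal depends on the first coordinate only.\<close>

lemma straight_chart:
  assumes hs: "helix_surface \<kappa> \<tau> lam \<nu> M \<A> f N" and p: "p \<in> M"
  obtains I J \<psi> \<phi>0 where "open I" "is_interval I" "open J" "is_interval J" "p \<in> \<psi> ` (I \<times> J)"
    "local_param M \<A> (I \<times> J, \<psi>)"
    "\<forall>z\<in>I \<times> J. frechet_derivative (f \<circ> \<psi>) (at z) (1, 0) = T_vec \<kappa> \<tau> lam ((f \<circ> \<psi>) z) ((N \<circ> \<psi>) z)"
    "\<forall>z\<in>I \<times> J. Complex (xc2 \<kappa> ((f \<circ> \<psi>) z) ((N \<circ> \<psi>) z)) (xc3 \<kappa> ((f \<circ> \<psi>) z) ((N \<circ> \<psi>) z)) =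
      of_real (sqrt csq) * cis (k * fst z + \<phi>0)"
proof -
  have "smooth_surface M \<A>" using hs by (simp add: helix_surface_def immersed_surface_def)
  then obtain V \<phi> w0 where A: "(V, \<phi>) \<in> \<A>" and w0: "w0 \<in> V" "\<phi> w0 = p" and lp: "local_param M \<A> (V, \<phi>)"
    using p unfolding smooth_surface_def by fastforce
  note prm = helix_surface_param[OF hs lp]
  obtain W and \<Phi> :: "real \<times> real \<Rightarrow> real \<times> real" and \<phi>0 where W: "open W" "w0 \<in> W" "W \<subseteq> V" and \<Phi>: "smooth_on W \<Phi>" "inj (frechet_derivative \<Phi> (at w0))"
    and \<Phi>T: "\<forall>w\<in>W. \<forall>\<zeta>. frechet_derivative (f \<circ> \<phi>) (at w) \<zeta> = T_vec \<kappa> \<tau> lam ((f \<circ> \<phi>) w) ((N \<circ> \<phi>) w) \<longrightarrow> frechet_derivative \<Phi> (at w) \<zeta> = (1, 0)"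
    and n: "\<forall>w\<in>W. Complex (xc2 \<kappa> ((f \<circ> \<phi>) w) ((N \<circ> \<phi>) w)) (xc3 \<kappa> ((f \<circ> \<phi>) w) ((N \<circ> \<phi>) w)) = of_real (sqrt csq) * cis (k * fst (\<Phi> w) + \<phi>0)"
    using straighten[OF prm w0(1)] .
  note prmW = helix_param_subset[OF prm W(1,3)]
  have "local_param M \<A> (W, \<phi> \<circ> (\<lambda>x. x))"
    by (rule local_param_reparam[OF lp W(1) smooth_on_id[OF W(1)] _ _ smooth_on_id]) (use W lp in \<open>auto simp: local_param_def\<close>)
  then have lpW: "local_param M \<A> (W, \<phi>)" by (simp only: o_def)
  obtain I J G where IJ: "open I" "is_interval I" "open J" "is_interval J" "\<Phi> w0 \<in> I \<times> J"
    and G: "smooth_on (I \<times> J) G" "G ` (I \<times> J) \<subseteq> W" "open (G ` (I \<times> J))" "G (\<Phi> w0) = w0"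
    and \<Phi>G: "\<forall>z\<in>I \<times> J. \<Phi> (G z) = z"
    and DG: "\<forall>z\<in>I \<times> J. inj (frechet_derivative \<Phi> (at (G z))) \<and> frechet_derivative G (at z) = inv (frechet_derivative \<Phi> (at (G z)))"
    using smooth_local_inverse[OF W(1,2) \<Phi>] .
  have lp1: "local_param M \<A> (I \<times> J, \<phi> \<circ> G)"
    by (rule local_param_reparam[OF lpW open_Times[OF IJ(1,3)] G(1-3) \<Phi>(1) bspec[OF \<Phi>G]])
  have sF: "smooth_on W (\<lambda>w. f (\<phi> w))" using helix_paramD(2)[OF prmW] by (simp only: o_def)
  have T: "frechet_derivative (f \<circ> (\<phi> \<circ> G)) (at z) (1, 0) = T_vec \<kappa> \<tau> lam ((f \<circ> (\<phi> \<circ> G)) z) ((N \<circ> (\<phi> \<circ> G)) z)"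
    if z: "z \<in> I \<times> J" for z
  proof -
    have w: "G z \<in> W" using G(2) z by blast
    obtain \<zeta> where \<zeta>: "frechet_derivative (f \<circ> \<phi>) (at (G z)) \<zeta> = T_vec \<kappa> \<tau> lam ((f \<circ> \<phi>) (G z)) ((N \<circ> \<phi>) (G z))"
      using directions[OF prmW w] .
    have P: "frechet_derivative \<Phi> (at (G z)) \<zeta> = (1, 0)" by (rule mp[OF spec[OF bspec[OF \<Phi>T w]] \<zeta>])
    have "frechet_derivative G (at z) (1, 0) = \<zeta>"
      unfolding conjunct2[OF bspec[OF DG z]] P[symmetric] by (rule inv_f_f[OF conjunct1[OF bspec[OF DG z]]])
    then show ?thesis
      using frechet_derivative_reparam[OF sF G(1,2) z, of "(1, 0)"] \<zeta> by (simp only: o_def)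
  qed
  have n1: "Complex (xc2 \<kappa> ((f \<circ> (\<phi> \<circ> G)) z) ((N \<circ> (\<phi> \<circ> G)) z)) (xc3 \<kappa> ((f \<circ> (\<phi> \<circ> G)) z) ((N \<circ> (\<phi> \<circ> G)) z)) =
      of_real (sqrt csq) * cis (k * fst z + \<phi>0)" if z: "z \<in> I \<times> J" for z
  proof -
    have w: "G z \<in> W" using G(2) z by blast
    from bspec[OF n w] show ?thesis unfolding bspec[OF \<Phi>G z] by (simp only: o_def)
  qed
  have pI: "p \<in> (\<phi> \<circ> G) ` (I \<times> J)"
    by (rule image_eqI[OF _ IJ(5)]) (simp add: G(4) w0(2))
  show ?thesis
    by (rule that[OF IJ(1-4) pI lp1], rule ballI, rule T, assumption, rule ballI, rule n1, assumption)
qed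

text \<open>With the phase of the normal constant in the second coordinate,
  \<open>adapted_directions\<close> reads a' = - sqrt(\<kappa>) \<tau> lam \<nu> b and b' = - \<nu>
  k a, an oscillator conserving b^2 + (B/\<tau>^2) a^2. This energy therefore depends on the second
  coordinate only and is normalized by reparametrizing that coordinate.\<close>

lemma arclength_chart:
  assumes hs: "helix_surface \<kappa> \<tau> lam \<nu> M \<A> f N" and p: "p \<in> M"
  obtains I J \<psi> a b where "open I" "is_interval I" "open J" "is_interval J" "p \<in> \<psi> ` (I \<times> J)"
    "local_param M \<A> (I \<times> J, \<psi>)" "smooth_on (I \<times> J) a" "smooth_on (I \<times> J) b"
    "\<forall>z\<in>I \<times> J. frechet_derivative (f \<circ> \<psi>) (at z) (1, 0) = T_vec \<kappa> \<tau> lam ((f \<circ> \<psi>) z) ((N \<circ> \<psi>) z)"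
    "\<forall>z\<in>I \<times> J. frechet_derivative (f \<circ> \<psi>) (at z) (0, 1) =
      a z *\<^sub>R T_vec \<kappa> \<tau> lam ((f \<circ> \<psi>) z) ((N \<circ> \<psi>) z) + b z *\<^sub>R JT_vec \<kappa> \<tau> lam ((f \<circ> \<psi>) z) ((N \<circ> \<psi>) z)"
    "\<forall>z\<in>I \<times> J. (b z)\<^sup>2 + B_const \<tau> lam \<nu> / \<tau>\<^sup>2 * (a z)\<^sup>2 = 1"
    "\<forall>z\<in>I \<times> J. dangle (f \<circ> \<psi>) (N \<circ> \<psi>) z (0, 1) = 0"
proof -
  obtain I J \<psi> \<phi>0 where IJ: "open I" "is_interval I" "open J" "is_interval J" "p \<in> \<psi> ` (I \<times> J)"
    and lp: "local_param M \<A> (I \<times> J, \<psi>)"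
    and T: "\<forall>z\<in>I \<times> J. frechet_derivative (f \<circ> \<psi>) (at z) (1, 0) = T_vec \<kappa> \<tau> lam ((f \<circ> \<psi>) z) ((N \<circ> \<psi>) z)"
    and n: "\<forall>z\<in>I \<times> J. Complex (xc2 \<kappa> ((f \<circ> \<psi>) z) ((N \<circ> \<psi>) z)) (xc3 \<kappa> ((f \<circ> \<psi>) z) ((N \<circ> \<psi>) z)) =
      of_real (sqrt csq) * cis (k * fst z + \<phi>0)"
    using straight_chart[OF hs p] .
  obtain z0 where z0: "z0 \<in> I \<times> J" "\<psi> z0 = p" using IJ(5) by blast
  obtain x0 s0 where xs0: "z0 = (x0, s0)" by (cases z0)
  have x0: "x0 \<in> I" "s0 \<in> J" using z0(1) by (simp_all add: xs0)
  define F Nn where "F = f \<circ> \<psi>" and "Nn = N \<circ> \<psi>"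
  have oV: "open (I \<times> J)" by (rule open_Times[OF IJ(1,3)])
  have prm: "helix_param (I \<times> J) F Nn" unfolding F_def Nn_def by (rule helix_surface_param[OF hs lp])
  note P = helix_paramD[OF prm] and c0 = csq_pos[OF prm z0(1)]
  define a1 where "a1 z = lam * \<tau> * xc1 \<kappa> (F z) (frechet_derivative F (at z) (0, 1)) / csq" for z
  define b1 where "b1 z = (xc3 \<kappa> (F z) (Nn z) * xc2 \<kappa> (F z) (frechet_derivative F (at z) (0, 1)) -
      xc2 \<kappa> (F z) (Nn z) * xc3 \<kappa> (F z) (frechet_derivative F (at z) (0, 1))) / csq" for z
  have cn: "csq \<noteq> 0" using c0 by simp
  note sd = smooth_xc[OF oV P(2) smooth_on_frechet_derivative[OF P(2)]] and sn = smooth_n[OF prm]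
  have sa: "smooth_on (I \<times> J) a1"
    unfolding a1_def[abs_def] by (rule smooth_on_divide[OF oV smooth_on_mult[OF oV smooth_on_const sd(1)] smooth_on_const cn])
  have sb: "smooth_on (I \<times> J) b1"
    unfolding b1_def[abs_def]
    by (rule smooth_on_divide[OF oV smooth_on_diff[OF oV smooth_on_mult[OF oV sn(2) sd(2)] smooth_on_mult[OF oV sn(1) sd(3)]] smooth_on_const cn])
  have T1: "frechet_derivative F (at z) (1, 0) = T_vec \<kappa> \<tau> lam (F z) (Nn z)" if "z \<in> I \<times> J" for z
    using bspec[OF T that] by (simp only: F_def Nn_def)
  have D1: "frechet_derivative F (at z) (0, 1) = a1 z *\<^sub>R T_vec \<kappa> \<tau> lam (F z) (Nn z) + b1 z *\<^sub>R JT_vec \<kappa> \<tau> lam (F z) (Nn z)"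
    if "z \<in> I \<times> J" for z
    unfolding a1_def b1_def by (rule tangent_decomposition[OF P(5)[OF that] P(8)[OF that] P(7)[OF that] cn])
  have ang: "dangle F Nn z (0, 1) = 0" if "z \<in> I \<times> J" for z
    by (rule dangle_zero[OF prm that]) (use n in \<open>simp only: F_def Nn_def\<close>)
  define R2 where "R2 z = (b1 z)\<^sup>2 + B_const \<tau> lam \<nu> / \<tau>\<^sup>2 * (a1 z)\<^sup>2" for z
  have R2pos: "R2 z > 0" if z: "z \<in> I \<times> J" for z
  proof -
    have "a1 z \<noteq> 0 \<or> b1 z \<noteq> 0"
    proof (rule ccontr)
      assume "\<not> ?thesis"
      then have "frechet_derivative F (at z) (0, 1) = 0" unfolding D1[OF z] by simp
      then have "0 *\<^sub>R frechet_derivative F (at z) (1, 0) + 1 *\<^sub>R frechet_derivative F (at z) (0, 1) = 0" by simp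
      from inj_derivative_pair(2)[OF smooth_on_has_derivative[OF P(2) z] P(6)[OF z] this] show False by simp
    qed
    then have "(b1 z)\<^sup>2 > 0 \<or> B_const \<tau> lam \<nu> / \<tau>\<^sup>2 * (a1 z)\<^sup>2 > 0" using B \<tau> by auto
    moreover have "(b1 z)\<^sup>2 \<ge> 0" "B_const \<tau> lam \<nu> / \<tau>\<^sup>2 * (a1 z)\<^sup>2 \<ge> 0" using B by simp_all
    ultimately show ?thesis unfolding R2_def by linarith
  qed
  have R2x: "R2 (x, s) = R2 (x0, s)" if x: "x \<in> I" and s: "s \<in> J" for x s
  proof (rule has_derivative_zero_unique_connected[of I "\<lambda>t. R2 (t, s)"])
    show "open I" by (rule IJ(1))
    show "connected I" using IJ(2) by (simp add: is_interval_connected)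
    show "x \<in> I" "x0 \<in> I" using x x0 by simp_all
    fix t assume t: "t \<in> I"
    let ?w = "(t, s)"
    have w: "?w \<in> I \<times> J" using t s by simp
    note da = smooth_on_has_derivative[OF sa w] and db = smooth_on_has_derivative[OF sb w]
    have ad: "frechet_derivative a1 (at ?w) (1, 0) = - sqrt \<kappa> * \<tau> * lam * \<nu> * b1 ?w"
      "frechet_derivative b1 (at ?w) (1, 0) = \<nu> * (dangle F Nn ?w (0, 1) - a1 ?w * k)"
      by (rule adapted_directions(1)[OF prm T1 D1 w da db] adapted_directions(2)[OF prm T1 D1 w da db]; assumption)+
    note va = has_vector_derivative_coordinates(1)[OF da, folded has_real_derivative_iff_has_vector_derivative]
      and vb = has_vector_derivative_coordinates(1)[OF db, folded has_real_derivative_iff_has_vector_derivative]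
    have "((\<lambda>t. R2 (t, s)) has_real_derivative
      2 * b1 ?w * frechet_derivative b1 (at ?w) (1, 0) + B_const \<tau> lam \<nu> / \<tau>\<^sup>2 * (2 * a1 ?w * frechet_derivative a1 (at ?w) (1, 0))) (at t)"
      unfolding R2_def by (rule derivative_eq_intros va vb refl | simp)+
    moreover have "2 * b1 ?w * frechet_derivative b1 (at ?w) (1, 0) + B_const \<tau> lam \<nu> / \<tau>\<^sup>2 * (2 * a1 ?w * frechet_derivative a1 (at ?w) (1, 0)) = 0"
      unfolding ad ang[OF w] k_def using \<tau> by (simp add: field_simps power2_eq_square)
    ultimately have "((\<lambda>t. R2 (t, s)) has_real_derivative 0) (at t)" by simp
    then show "((\<lambda>t. R2 (t, s)) has_derivative (\<lambda>h. 0)) (at t)" by (simp add: has_field_derivative_def lambda_zero)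
  qed
  define R where "R s = sqrt (R2 (x0, s))" for s
  have Rpos: "R s > 0" if "s \<in> J" for s unfolding R_def using R2pos[of "(x0, s)"] that x0 by simp
  have pair: "smooth_on J (\<lambda>s. (x0, s))" by (rule smooth_on_Pair[OF IJ(3) smooth_on_const smooth_on_id[OF IJ(3)]])
  have sR2: "smooth_on (I \<times> J) R2" unfolding R2_def[abs_def]
    by (rule smooth_on_add[OF oV smooth_on_power[OF oV sb] smooth_on_mult[OF oV smooth_on_const smooth_on_power[OF oV sa]]])
  have "smooth_on J (\<lambda>s. R2 (x0, s))"
    by (rule smooth_on_compose[OF sR2 IJ(3) oV _ pair]) (use x0 in auto)
  then have sR: "smooth_on J R"
    unfolding R_def[abs_def] by (rule smooth_on_sqrt[OF IJ(3)]) (use R2pos x0 in auto)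
  \<comment> \<open>The new second coordinate has the derivative \<open>R\<close>, the root of the
    energy, so its coordinate field is the old one divided by \<open>R\<close>.\<close>
  obtain Y where Y: "smooth_on J Y" "\<And>s. s \<in> J \<Longrightarrow> (Y has_real_derivative R s) (at s)"
  proof (rule smooth_antiderivative[OF IJ(3,4) sR])
    fix Y assume "smooth_on J Y" "\<And>s. s \<in> J \<Longrightarrow> (Y has_real_derivative R s) (at s)"
    then show thesis by (rule that)
  qed
  define \<Phi> where "\<Phi> z = (fst z, Y (snd z))" for z :: "real \<times> real"
  have ssnd: "smooth_on (I \<times> J) (\<lambda>z. snd z)" and sfst: "smooth_on (I \<times> J) (\<lambda>z. fst z)"
    by (rule smooth_on_linear[OF bounded_linear_snd oV] smooth_on_linear[OF bounded_linear_fst oV])+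
  have "smooth_on (I \<times> J) (\<lambda>z. Y (snd z))"
    by (rule smooth_on_compose[OF Y(1) oV IJ(3) _ ssnd]) auto
  then have s\<Phi>: "smooth_on (I \<times> J) \<Phi>" unfolding \<Phi>_def[abs_def] by (rule smooth_on_Pair[OF oV sfst])
  have D\<Phi>: "frechet_derivative \<Phi> (at z) = (\<lambda>v. (fst v, R (snd z) * snd v))" if z: "z \<in> I \<times> J" for z
  proof -
    have "snd z \<in> J" using z by auto
    from has_derivative_compose[OF bounded_linear_imp_has_derivative[OF bounded_linear_snd] Y(2)[OF this, unfolded has_field_derivative_def]]
    have "((\<lambda>z. Y (snd z)) has_derivative (\<lambda>v. R (snd z) * snd v)) (at z)" .
    from has_derivative_Pair[OF bounded_linear_imp_has_derivative[OF bounded_linear_fst] this]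
    show ?thesis unfolding \<Phi>_def[abs_def] by (rule frechet_derivative_at[symmetric])
  qed
  have inj\<Phi>: "inj (frechet_derivative \<Phi> (at z))" if z: "z \<in> I \<times> J" for z
  proof -
    have "R (snd z) \<noteq> 0" using Rpos[of "snd z"] z by auto
    then show ?thesis unfolding D\<Phi>[OF z] by (auto simp: inj_on_def prod_eq_iff)
  qed
  obtain I2 J2 G where IJ2: "open I2" "is_interval I2" "open J2" "is_interval J2" "\<Phi> z0 \<in> I2 \<times> J2"
    and G: "smooth_on (I2 \<times> J2) G" "G ` (I2 \<times> J2) \<subseteq> I \<times> J" "open (G ` (I2 \<times> J2))" "G (\<Phi> z0) = z0"
    and \<Phi>G: "\<forall>z\<in>I2 \<times> J2. \<Phi> (G z) = z"
    and DG: "\<forall>z\<in>I2 \<times> J2. inj (frechet_derivative \<Phi> (at (G z))) \<and> frechet_derivative G (at z) = inv (frechet_derivative \<Phi> (at (G z)))"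
    using smooth_local_inverse[OF oV z0(1) s\<Phi> inj\<Phi>[OF z0(1)]] .
  have oV2: "open (I2 \<times> J2)" by (rule open_Times[OF IJ2(1,3)])
  have lp2: "local_param M \<A> (I2 \<times> J2, \<psi> \<circ> G)"
    by (rule local_param_reparam[OF lp oV2 G(1-3) s\<Phi> bspec[OF \<Phi>G]])
  have GV: "G z \<in> I \<times> J" if "z \<in> I2 \<times> J2" for z using G(2) that by blast
  have DGv: "frechet_derivative G (at z) (1, 0) = (1, 0)" "frechet_derivative G (at z) (0, 1) = (1 / R (snd (G z))) *\<^sub>R (0, 1)"
    if z: "z \<in> I2 \<times> J2" for z
  proof -
    have R0: "R (snd (G z)) \<noteq> 0" using Rpos[of "snd (G z)"] GV[OF z] by auto
    have "frechet_derivative \<Phi> (at (G z)) (1, 0) = (1, 0)"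
      "frechet_derivative \<Phi> (at (G z)) ((1 / R (snd (G z))) *\<^sub>R (0, 1)) = (0, 1)"
      unfolding D\<Phi>[OF GV[OF z]] using R0 by simp_all
    then show "frechet_derivative G (at z) (1, 0) = (1, 0)" "frechet_derivative G (at z) (0, 1) = (1 / R (snd (G z))) *\<^sub>R (0, 1)"
      unfolding conjunct2[OF bspec[OF DG z]] using inv_f_eq[OF conjunct1[OF bspec[OF DG z]]] by blast+
  qed
  have eq: "f \<circ> (\<psi> \<circ> G) = (\<lambda>z. F (G z))" "N \<circ> (\<psi> \<circ> G) = (\<lambda>z. Nn (G z))"
    by (simp_all only: F_def Nn_def o_def)
  have prm2: "helix_param (I2 \<times> J2) (\<lambda>z. F (G z)) (\<lambda>z. Nn (G z))"
    using helix_surface_param[OF hs lp2] unfolding eq .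
  define a b where "a z = a1 (G z) / R (snd (G z))" and "b z = b1 (G z) / R (snd (G z))" for z
  have RG: "R (snd (G z)) \<noteq> 0" if "z \<in> I2 \<times> J2" for z using Rpos[of "snd (G z)"] GV[OF that] by auto
  have sRG: "smooth_on (I2 \<times> J2) (\<lambda>z. R (snd (G z)))"
    by (rule smooth_on_compose[OF sR oV2 IJ(3) _ smooth_on_linear_compose[OF bounded_linear_snd oV2 G(1)]]) (use GV in force)
  have sab: "smooth_on (I2 \<times> J2) a" "smooth_on (I2 \<times> J2) b"
    unfolding a_def[abs_def] b_def[abs_def]
    by (rule smooth_on_divide[OF oV2 smooth_on_compose[OF sa oV2 oV G(2,1)] sRG RG]
        smooth_on_divide[OF oV2 smooth_on_compose[OF sb oV2 oV G(2,1)] sRG RG]; assumption)+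
  have T2: "frechet_derivative (\<lambda>z. F (G z)) (at z) (1, 0) = T_vec \<kappa> \<tau> lam (F (G z)) (Nn (G z))" if z: "z \<in> I2 \<times> J2" for z
    unfolding frechet_derivative_reparam[OF P(2) G(1,2) z] DGv[OF z] by (rule T1[OF GV[OF z]])
  have D2: "frechet_derivative (\<lambda>z. F (G z)) (at z) (0, 1) = a z *\<^sub>R T_vec \<kappa> \<tau> lam (F (G z)) (Nn (G z)) + b z *\<^sub>R JT_vec \<kappa> \<tau> lam (F (G z)) (Nn (G z))"
    if z: "z \<in> I2 \<times> J2" for z
    unfolding frechet_derivative_reparam[OF P(2) G(1,2) z] DGv[OF z]
      linear_scale[OF has_derivative_linear[OF smooth_on_has_derivative[OF P(2) GV[OF z]]]] D1[OF GV[OF z]]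
    by (simp add: a_def b_def scaleR_add_right)
  have "(b z)\<^sup>2 + B_const \<tau> lam \<nu> / \<tau>\<^sup>2 * (a z)\<^sup>2 = 1" if z: "z \<in> I2 \<times> J2" for z
  proof -
    obtain x s where G': "G z = (x, s)" "x \<in> I" "s \<in> J" using GV[OF z] by (cases "G z") auto
    have "(R s)\<^sup>2 = R2 (G z)" unfolding G' R2x[OF G'(2,3)] R_def using R2pos[of "(x0, s)"] x0 G'(3) by simp
    moreover have "R s \<noteq> 0" using Rpos[OF G'(3)] by simp
    moreover have "(b z)\<^sup>2 + B_const \<tau> lam \<nu> / \<tau>\<^sup>2 * (a z)\<^sup>2 = R2 (G z) / (R s)\<^sup>2"
      unfolding a_def b_def R2_def G' by (simp add: power_divide add_divide_distrib)
    ultimately show ?thesis using R2pos[OF GV[OF z]] by simp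
  qed
  note ab = this
  \<comment> \<open>The change of parameters leaves the first coordinate fixed, and with it the
    phase of the normal.\<close>
  have ang2: "dangle (\<lambda>z. F (G z)) (\<lambda>z. Nn (G z)) z (0, 1) = 0" if z: "z \<in> I2 \<times> J2" for z
  proof (rule dangle_zero[OF prm2 z, of \<phi>0], rule ballI)
    fix z assume z: "z \<in> I2 \<times> J2"
    have "fst (\<Phi> (G z)) = fst z" unfolding bspec[OF \<Phi>G z] ..
    then have "fst (G z) = fst z" by (simp only: \<Phi>_def fst_conv)
    with bspec[OF n GV[OF z]] show "Complex (xc2 \<kappa> (F (G z)) (Nn (G z))) (xc3 \<kappa> (F (G z)) (Nn (G z))) =
        of_real (sqrt csq) * cis (k * fst z + \<phi>0)"
      by (simp only: F_def Nn_def o_def)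
  qed
  have pI: "p \<in> (\<psi> \<circ> G) ` (I2 \<times> J2)"
    by (rule image_eqI[OF _ IJ2(5)]) (simp add: G(4) z0(2))
  show ?thesis
    by (rule that[OF IJ2(1-4) pI lp2 sab, unfolded eq], rule ballI, rule T2, assumption, rule ballI, rule D2, assumption, rule ballI, rule ab, assumption, rule ballI, rule ang2, assumption)
qed

lemma sqrt_kB: "sqrt (\<kappa> * B_const \<tau> lam \<nu>) = sqrt \<kappa> * sqrt (B_const \<tau> lam \<nu>)"
  by (rule real_sqrt_mult)

lemma a_k: "lam * \<tau> / sqrt (B_const \<tau> lam \<nu>) * s * k = - sqrt (\<kappa> * B_const \<tau> lam \<nu>) * s"
proof -
  define r where "r = sqrt (B_const \<tau> lam \<nu>)"
  have r: "B_const \<tau> lam \<nu> = r * r" "r > 0" using B by (simp_all add: r_def)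
  have "lam * \<tau> / r * s * (- lam * sqrt \<kappa> * (r * r) / \<tau>) = - (lam * lam) * (sqrt \<kappa> * r * s)"
    using r(2) \<tau> by (simp add: field_simps)
  also have "\<dots> = - (sqrt \<kappa> * r) * s" unfolding lam2(1) by simp
  finally show ?thesis
    unfolding sqrt_kB k_def r_def[symmetric] unfolding r(1) .
qed

text \<open>The oscillator for \<open>a\<close> and \<open>b\<close> is a uniform rotation of one
  complex number of modulus 1, and \<eta> is a smooth phase of that number at \<open>x = 0\<close>,
  computed from the base point \<open>x0\<close>.\<close>

lemma angle_form:
  assumes IJ: "open I" "is_interval I" "open J" "is_interval J" and x0: "x0 \<in> I"
    and prm: "helix_param (I \<times> J) F N" and sm: "smooth_on (I \<times> J) a" "smooth_on (I \<times> J) b"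
    and T: "\<And>z. z \<in> I \<times> J \<Longrightarrow> frechet_derivative F (at z) (1, 0) = T_vec \<kappa> \<tau> lam (F z) (N z)"
    and D: "\<And>z. z \<in> I \<times> J \<Longrightarrow> frechet_derivative F (at z) (0, 1) = a z *\<^sub>R T_vec \<kappa> \<tau> lam (F z) (N z) + b z *\<^sub>R JT_vec \<kappa> \<tau> lam (F z) (N z)"
    and ab: "\<And>z. z \<in> I \<times> J \<Longrightarrow> (b z)\<^sup>2 + B_const \<tau> lam \<nu> / \<tau>\<^sup>2 * (a z)\<^sup>2 = 1"
    and ang: "\<And>z. z \<in> I \<times> J \<Longrightarrow> dangle F N z (0, 1) = 0"
  obtains \<eta> where "smooth_on J \<eta>"
    "\<forall>x\<in>I. \<forall>y\<in>J. b (x, y) = cos (\<eta> y - \<nu> * sqrt (\<kappa> * B_const \<tau> lam \<nu>) * x) \<and>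
      a (x, y) = lam * \<tau> / sqrt (B_const \<tau> lam \<nu>) * sin (\<eta> y - \<nu> * sqrt (\<kappa> * B_const \<tau> lam \<nu>) * x)"
proof -
  define r where "r = sqrt (B_const \<tau> lam \<nu>)"
  have r: "B_const \<tau> lam \<nu> = r * r" "r > 0" using B by (simp_all add: r_def)
  define m where "m = \<nu> * sqrt (\<kappa> * B_const \<tau> lam \<nu>)"
  have m: "m = \<nu> * (sqrt \<kappa> * r)" by (simp only: m_def sqrt_kB r_def)
  have oV: "open (I \<times> J)" by (rule open_Times[OF IJ(1,3)])
  \<comment> \<open>The weight of \<open>a\<close> makes |h|^2 the energy, and the factor
    \<open>lam\<close> makes \<open>h\<close> rotate with velocity \<open>- m\<close> for either
    sign of \<open>lam\<close>.\<close>
  define h where "h z = complex_of_real (b z) + \<i> * of_real (lam * r / \<tau> * a z)" for z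
  have sh: "smooth_on (I \<times> J) h"
    unfolding h_def[abs_def]
    by (rule smooth_on_add[OF oV smooth_on_linear_compose[OF bounded_linear_of_real oV sm(2)]
      smooth_on_mult[OF oV smooth_on_const smooth_on_linear_compose[OF bounded_linear_of_real oV smooth_on_mult[OF oV smooth_on_const sm(1)]]]])
  have hx: "h (x, y) * cis (m * x) = h (x0, y) * cis (m * x0)" if x: "x \<in> I" and y: "y \<in> J" for x y
  proof (rule has_derivative_zero_unique_connected[of I "\<lambda>t. h (t, y) * cis (m * t)"])
    show "open I" by (rule IJ(1))
    show "connected I" using IJ(2) by (simp add: is_interval_connected)
    show "x \<in> I" "x0 \<in> I" by (rule x x0)+
    fix t assume t: "t \<in> I"
    let ?w = "(t, y)"
    have w: "?w \<in> I \<times> J" using t y by simp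
    note da = smooth_on_has_derivative[OF sm(1) w] and db = smooth_on_has_derivative[OF sm(2) w]
    have ad: "frechet_derivative a (at ?w) (1, 0) = - sqrt \<kappa> * \<tau> * lam * \<nu> * b ?w"
      "frechet_derivative b (at ?w) (1, 0) = \<nu> * (dangle F N ?w (0, 1) - a ?w * k)"
      by (rule adapted_directions(1)[OF prm T D w da db] adapted_directions(2)[OF prm T D w da db]; assumption)+
    note va = has_vector_derivative_coordinates(1)[OF da] and vb = has_vector_derivative_coordinates(1)[OF db]
    note of = bounded_linear.has_vector_derivative[OF bounded_linear_of_real]
    have "((\<lambda>t. m * t) has_real_derivative m) (at t)" by (auto intro!: derivative_eq_intros)
    note vc = has_vector_derivative_cis[OF this]
    have "((\<lambda>t. h (t, y) * cis (m * t)) has_vector_derivative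
      h ?w * (of_real m * \<i> * cis (m * t)) +
      (of_real (frechet_derivative b (at ?w) (1, 0)) + \<i> * of_real (lam * r / \<tau> * frechet_derivative a (at ?w) (1, 0))) * cis (m * t)) (at t)"
      unfolding h_def
      by (intro has_vector_derivative_mult has_vector_derivative_add has_vector_derivative_mult_right of va vb vc)
    moreover have "h ?w * (of_real m * \<i> * cis (m * t)) +
      (of_real (frechet_derivative b (at ?w) (1, 0)) + \<i> * of_real (lam * r / \<tau> * frechet_derivative a (at ?w) (1, 0))) * cis (m * t) = 0"
    proof -
      have e1: "frechet_derivative b (at ?w) (1, 0) = m * (lam * r / \<tau> * a ?w)"
        unfolding ad ang[OF w] k_def r(1) m using \<tau> by (simp add: field_simps)
      have e2: "lam * r / \<tau> * frechet_derivative a (at ?w) (1, 0) = - m * b ?w"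
      proof -
        have "lam * r / \<tau> * (- sqrt \<kappa> * \<tau> * lam * \<nu> * b ?w) = - (lam * lam) * (m * b ?w)"
          unfolding m using \<tau> by (simp add: field_simps)
        then show ?thesis unfolding ad lam2(1) by simp
      qed
      show ?thesis unfolding e1 e2 h_def by (simp add: complex_eq_iff algebra_simps)
    qed
    ultimately have "((\<lambda>t. h (t, y) * cis (m * t)) has_vector_derivative 0) (at t)" by (simp only:)
    then show "((\<lambda>t. h (t, y) * cis (m * t)) has_derivative (\<lambda>h. 0)) (at t)"
      by (simp only: has_vector_derivative_def scaleR_zero_right)
  qed
  have nh: "norm (h z) = 1" if z: "z \<in> I \<times> J" for z
  proof -
    have "(lam * r / \<tau> * a z)\<^sup>2 = (lam * lam) * (r * r / \<tau>\<^sup>2 * (a z)\<^sup>2)" by (simp add: power2_eq_square)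
    then have "(b z)\<^sup>2 + (lam * r / \<tau> * a z)\<^sup>2 = 1" using ab[OF z] unfolding r(1) lam2(1) by simp
    moreover have "h z = Complex (b z) (lam * r / \<tau> * a z)" by (simp add: h_def complex_eq_iff)
    ultimately show ?thesis by (simp only: complex_norm real_sqrt_one)
  qed
  define u where "u y = h (x0, y) * cis (m * x0)" for y
  have pair: "smooth_on J (\<lambda>s. (x0, s))" by (rule smooth_on_Pair[OF IJ(3) smooth_on_const smooth_on_id[OF IJ(3)]])
  have "smooth_on J (\<lambda>y. h (x0, y))"
    by (rule smooth_on_compose[OF sh IJ(3) oV _ pair]) (use x0 in auto)
  then have su: "smooth_on J u"
    unfolding u_def[abs_def] by (rule smooth_on_mult[OF IJ(3) _ smooth_on_const])
  have nu: "norm (u y) = 1" if "y \<in> J" for y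
    using nh[of "(x0, y)"] that x0 by (simp add: u_def norm_mult)
  have "u y \<noteq> 0" if "y \<in> J" for y using nu[OF that] by auto
  from smooth_polar[OF IJ(3,4) su this] obtain \<xi> where \<xi>: "smooth_on J \<xi>" "\<forall>y\<in>J. u y = of_real (norm (u y)) * cis (- \<xi> y)" .
  show ?thesis
  proof (rule that[of "\<lambda>y. - \<xi> y"], goal_cases)
    case 1 show ?case by (rule smooth_on_minus[OF IJ(3) \<xi>(1)])
  next
    case 2 show ?case
    proof (intro ballI)
      fix x y assume x: "x \<in> I" and y: "y \<in> J"
      have "h (x, y) * cis (m * x) = cis (- \<xi> y)"
        using hx[OF x y] bspec[OF \<xi>(2) y] nu[OF y] by (simp add: u_def)
      then have "h (x, y) * (cis (m * x) * cis (- (m * x))) = cis (- \<xi> y) * cis (- (m * x))" by (simp only: mult.assoc[symmetric])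
      then have "h (x, y) = cis (- \<xi> y - m * x)" by (simp add: cis_mult)
      then have "b (x, y) = cos (- \<xi> y - m * x)" "lam * r / \<tau> * a (x, y) = sin (- \<xi> y - m * x)"
        by (simp_all add: h_def complex_eq_iff)
      moreover have "a (x, y) = lam * \<tau> / r * (lam * r / \<tau> * a (x, y))"
      proof -
        have "lam * \<tau> / r * (lam * r / \<tau> * a (x, y)) = (lam * lam) * a (x, y)" using r(2) \<tau> by (simp add: field_simps)
        then show ?thesis unfolding lam2(1) by simp
      qed
      ultimately show "b (x, y) = cos (- \<xi> y - \<nu> * sqrt (\<kappa> * B_const \<tau> lam \<nu>) * x) \<and>
        a (x, y) = lam * \<tau> / sqrt (B_const \<tau> lam \<nu>) * sin (- \<xi> y - \<nu> * sqrt (\<kappa> * B_const \<tau> lam \<nu>) * x)"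
        unfolding m_def[symmetric] r_def[symmetric] by (simp only:)
    qed
  qed
qed

text \<open>It remains to recognize \<mu>. By \<open>shape_op_JT\<close> it is the rate of the phase
  along \<open>JT\<close>, which is the second coordinate field minus \<open>a\<close> times the
  first, divided by \<open>b\<close>; only the first turns the normal, so \<mu> is - a k /
  b.\<close>

lemma helix_coords_exist:
  assumes LC: "levi_civita \<kappa> \<tau> D" and hs: "helix_surface \<kappa> \<tau> lam \<nu> M \<A> f N" and p: "p \<in> M"
  shows "\<exists>I J \<psi> \<eta>. helix_coords \<kappa> \<tau> lam \<nu> D M \<A> f N I J \<psi> \<eta> \<and> p \<in> \<psi> ` (I \<times> J)"
proof -
  obtain I J \<psi> a b where IJ: "open I" "is_interval I" "open J" "is_interval J" "p \<in> \<psi> ` (I \<times> J)"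
    and lp: "local_param M \<A> (I \<times> J, \<psi>)" and sm: "smooth_on (I \<times> J) a" "smooth_on (I \<times> J) b"
    and T: "\<forall>z\<in>I \<times> J. frechet_derivative (f \<circ> \<psi>) (at z) (1, 0) = T_vec \<kappa> \<tau> lam ((f \<circ> \<psi>) z) ((N \<circ> \<psi>) z)"
    and D: "\<forall>z\<in>I \<times> J. frechet_derivative (f \<circ> \<psi>) (at z) (0, 1) =
      a z *\<^sub>R T_vec \<kappa> \<tau> lam ((f \<circ> \<psi>) z) ((N \<circ> \<psi>) z) + b z *\<^sub>R JT_vec \<kappa> \<tau> lam ((f \<circ> \<psi>) z) ((N \<circ> \<psi>) z)"
    and ab: "\<forall>z\<in>I \<times> J. (b z)\<^sup>2 + B_const \<tau> lam \<nu> / \<tau>\<^sup>2 * (a z)\<^sup>2 = 1"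
    and ang: "\<forall>z\<in>I \<times> J. dangle (f \<circ> \<psi>) (N \<circ> \<psi>) z (0, 1) = 0"
    using arclength_chart[OF hs p] .
  from IJ(5) obtain x0 y0 where xy0: "x0 \<in> I" "y0 \<in> J" by blast
  note prm = helix_surface_param[OF hs lp]
  note P = helix_paramD[OF prm]
  obtain \<eta> where \<eta>: "smooth_on J \<eta>"
    "\<forall>x\<in>I. \<forall>y\<in>J. b (x, y) = cos (\<eta> y - \<nu> * sqrt (\<kappa> * B_const \<tau> lam \<nu>) * x) \<and>
      a (x, y) = lam * \<tau> / sqrt (B_const \<tau> lam \<nu>) * sin (\<eta> y - \<nu> * sqrt (\<kappa> * B_const \<tau> lam \<nu>) * x)"
    using angle_form[OF IJ(1-4) xy0(1) prm sm bspec[OF T] bspec[OF D] bspec[OF ab] bspec[OF ang]] .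
  have "helix_coords \<kappa> \<tau> lam \<nu> D M \<A> f N I J \<psi> \<eta>"
    unfolding helix_coords_def
  proof (intro conjI IJ(1-4) lp \<eta>(1) ballI)
    show "I \<noteq> {}" "J \<noteq> {}" using xy0 by blast+
    fix x y assume x: "x \<in> I" and y: "y \<in> J"
    have w: "(x, y) \<in> I \<times> J" using x y by simp
    let ?\<theta> = "\<eta> y - \<nu> * sqrt (\<kappa> * B_const \<tau> lam \<nu>) * x"
    let ?T = "T_vec \<kappa> \<tau> lam ((f \<circ> \<psi>) (x, y)) ((N \<circ> \<psi>) (x, y))" and ?JT = "JT_vec \<kappa> \<tau> lam ((f \<circ> \<psi>) (x, y)) ((N \<circ> \<psi>) (x, y))"
    let ?L = "frechet_derivative (f \<circ> \<psi>) (at (x, y))"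
    have b: "b (x, y) = cos ?\<theta>" and a: "a (x, y) = lam * \<tau> / sqrt (B_const \<tau> lam \<nu>) * sin ?\<theta>"
      using bspec[OF bspec[OF \<eta>(2) x] y] by (rule conjunct1, rule conjunct2)
    have L1: "?L (1, 0) = ?T" by (rule bspec[OF T w])
    have L2: "?L (0, 1) = a (x, y) *\<^sub>R ?T + b (x, y) *\<^sub>R ?JT" by (rule bspec[OF D w])
    note dL = smooth_on_has_derivative[OF P(2) w]
    \<comment> \<open>A zero of \<open>b\<close> would make the two coordinate fields parallel; so
      the cosine below the tangent does not vanish.\<close>
    have b0: "b (x, y) \<noteq> 0"
    proof
      assume "b (x, y) = 0"
      then have "(- a (x, y)) *\<^sub>R ?L (1, 0) + 1 *\<^sub>R ?L (0, 1) = 0" unfolding L1 L2 by simp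
      from inj_derivative_pair(2)[OF dL P(6)[OF w] this] show False by simp
    qed
    have "?L (- a (x, y) / b (x, y), 1 / b (x, y)) = ?JT"
      unfolding frechet_derivative_pair[OF dL, of "- a (x, y) / b (x, y)" "1 / b (x, y)"] L1 L2
      using b0 by (simp add: scaleR_add_right)
    note S = shape_op_JT[OF prm LC w this]
    have "dangle (f \<circ> \<psi>) (N \<circ> \<psi>) (x, y) (- a (x, y) / b (x, y), 1 / b (x, y)) = - a (x, y) / b (x, y) * k"
      unfolding dangle_pair[OF prm w, of "- a (x, y) / b (x, y)"] dangle_T[OF prm w L1] bspec[OF ang w] by simp
    also have "\<dots> = - (a (x, y) * k) / b (x, y)" by simp
    also have "\<dots> = sqrt (\<kappa> * B_const \<tau> lam \<nu>) * tan ?\<theta>"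
      unfolding a b a_k tan_def by simp
    finally have \<mu>: "dangle (f \<circ> \<psi>) (N \<circ> \<psi>) (x, y) (- a (x, y) / b (x, y), 1 / b (x, y)) = sqrt (\<kappa> * B_const \<tau> lam \<nu>) * tan ?\<theta>" .
    have L2': "?L (0, 1) = (lam * \<tau> / sqrt (B_const \<tau> lam \<nu>) * sin ?\<theta>) *\<^sub>R ?T + cos ?\<theta> *\<^sub>R ?JT"
      unfolding L2 a b ..
    show "let B = B_const \<tau> lam \<nu>;
            p = \<psi> (x, y);
            dF = frechet_derivative (f \<circ> \<psi>) (at (x, y));
            T = T_vec \<kappa> \<tau> lam (f p) (N p);
            JT = JT_vec \<kappa> \<tau> lam (f p) (N p);
            \<theta> = \<eta> y - \<nu> * sqrt (\<kappa> * B) * x;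
            \<mu> = sqrt (\<kappa> * B) * tan \<theta>;
            b = cos \<theta>;
            a = lam * \<tau> / sqrt B * sin \<theta>
        in dF (1, 0) = T \<and> dF (0, 1) = a *\<^sub>R T + b *\<^sub>R JT \<and>
           shape_op \<kappa> \<tau> D (f \<circ> \<psi>) (N \<circ> \<psi>) (x, y) JT
             = (- (sqrt \<kappa> / 2) * lam * \<tau>) *\<^sub>R T + \<mu> *\<^sub>R JT"
      unfolding Let_def
      using L1 L2' S[unfolded \<mu>] unfolding o_apply by (intro conjI)
  qed
  with IJ(5) show ?thesis by blast
qed

text \<open>The coordinates come without any direct information on the normal, but the prescribed
  \<open>b\<close> determines b' along \<open>T\<close>, and comparison with
  \<open>adapted_directions\<close> shows that the phase of the normal does not depend on
  \<open>y\<close>. Then \<open>helix_coords_form\<close> applies.\<close>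

lemma helix_coords_position:
  assumes hs: "helix_surface \<kappa> \<tau> lam \<nu> M \<A> f N"
    and hc: "helix_coords \<kappa> \<tau> lam \<nu> D M \<A> f N I J \<psi> \<eta>"
  obtains \<xi> \<xi>1 \<xi>2 \<xi>3 where "csq > 0" "admissible_angles J \<xi>1 \<xi>2 \<xi>3"
    "\<forall>x\<in>I. \<forall>y\<in>J. f (\<psi> (x, y)) = A_mat \<xi> (\<xi>1 y) (\<xi>2 y) (\<xi>3 y) *v \<gamma> x"
proof -
  from hc have IJ: "open I" "is_interval I" "I \<noteq> {}" "open J" "is_interval J" "J \<noteq> {}"
    and lp: "local_param M \<A> (I \<times> J, \<psi>)" and \<eta>: "smooth_on J \<eta>"
    unfolding helix_coords_def by blast+
  obtain x0 y0 where xy0: "x0 \<in> I" "y0 \<in> J" using IJ by blast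
  note prm = helix_surface_param[OF hs lp]
  define m where "m = \<nu> * sqrt (\<kappa> * B_const \<tau> lam \<nu>)"
  define \<theta> where "\<theta> z = \<eta> (snd z) - m * fst z" for z :: "real \<times> real"
  define a b where "a z = lam * \<tau> / sqrt (B_const \<tau> lam \<nu>) * sin (\<theta> z)" and "b z = cos (\<theta> z)" for z
  have H: "frechet_derivative (f \<circ> \<psi>) (at z) (1, 0) = T_vec \<kappa> \<tau> lam ((f \<circ> \<psi>) z) ((N \<circ> \<psi>) z) \<and>
    frechet_derivative (f \<circ> \<psi>) (at z) (0, 1) =
      a z *\<^sub>R T_vec \<kappa> \<tau> lam ((f \<circ> \<psi>) z) ((N \<circ> \<psi>) z) + b z *\<^sub>R JT_vec \<kappa> \<tau> lam ((f \<circ> \<psi>) z) ((N \<circ> \<psi>) z)"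
    if "z \<in> I \<times> J" for z
  proof -
    obtain x y where z: "z = (x, y)" by (cases z)
    with \<open>z \<in> I \<times> J\<close> have xy: "x \<in> I" "y \<in> J" by simp_all
    from hc have "\<forall>x\<in>I. \<forall>y\<in>J.
        let B = B_const \<tau> lam \<nu>;
            p = \<psi> (x, y);
            dF = frechet_derivative (f \<circ> \<psi>) (at (x, y));
            T = T_vec \<kappa> \<tau> lam (f p) (N p);
            JT = JT_vec \<kappa> \<tau> lam (f p) (N p);
            \<theta> = \<eta> y - \<nu> * sqrt (\<kappa> * B) * x;
            \<mu> = sqrt (\<kappa> * B) * tan \<theta>;
            b = cos \<theta>;
            a = lam * \<tau> / sqrt B * sin \<theta>
        in dF (1, 0) = T \<and> dF (0, 1) = a *\<^sub>R T + b *\<^sub>R JT \<and>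
           shape_op \<kappa> \<tau> D (f \<circ> \<psi>) (N \<circ> \<psi>) (x, y) JT
             = (- (sqrt \<kappa> / 2) * lam * \<tau>) *\<^sub>R T + \<mu> *\<^sub>R JT"
      unfolding helix_coords_def by (elim conjE)
    from bspec[OF bspec[OF this xy(1)] xy(2), unfolded Let_def] show ?thesis
      unfolding a_def b_def \<theta>_def m_def z fst_conv snd_conv o_apply by (elim conjE) (intro conjI)
  qed
  note T = conjunct1[OF H] and D = conjunct2[OF H]
  have ang: "dangle (f \<circ> \<psi>) (N \<circ> \<psi>) z (0, 1) = 0" if z: "z \<in> I \<times> J" for z
  proof -
    have y: "snd z \<in> J" using z by auto
    obtain d where d: "(\<eta> has_derivative d) (at (snd z))" using smooth_on_has_derivative[OF \<eta> y] by blast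
    have "((\<lambda>z. \<eta> (snd z)) has_derivative (\<lambda>v. d (snd v))) (at z)"
      by (rule has_derivative_compose[OF bounded_linear_imp_has_derivative[OF bounded_linear_snd] d])
    from has_derivative_diff[OF this has_derivative_mult_right[OF bounded_linear_imp_has_derivative[OF bounded_linear_fst]]]
    have d\<theta>: "(\<theta> has_derivative (\<lambda>v. d (snd v) - m * fst v)) (at z)" unfolding \<theta>_def[abs_def] .
    have db: "(b has_derivative (\<lambda>v. (d (snd v) - m * fst v) * - sin (\<theta> z))) (at z)"
      unfolding b_def[abs_def] by (rule DERIV_compose_FDERIV[OF DERIV_cos d\<theta>])
    have da: "(a has_derivative (\<lambda>v. lam * \<tau> / sqrt (B_const \<tau> lam \<nu>) * ((d (snd v) - m * fst v) * cos (\<theta> z)))) (at z)"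
      unfolding a_def[abs_def] by (rule has_derivative_mult_right[OF DERIV_compose_FDERIV[OF DERIV_sin d\<theta>]])
    have "(d (snd (1::real, 0::real)) - m * fst (1::real, 0::real)) * - sin (\<theta> z) = \<nu> * (dangle (f \<circ> \<psi>) (N \<circ> \<psi>) z (0, 1) - a z * k)"
      by (rule adapted_directions(2)[OF prm T D z da db]; assumption)
    \<comment> \<open>The function \<eta> depends on \<open>y\<close> alone and drops out of the
      derivative in direction \<open>(1, 0)\<close>.\<close>
    moreover have "d 0 = 0" by (rule linear_0[OF has_derivative_linear[OF d]])
    ultimately have "m * sin (\<theta> z) = \<nu> * (dangle (f \<circ> \<psi>) (N \<circ> \<psi>) z (0, 1) - a z * k)" by simp
    then have "\<nu> * dangle (f \<circ> \<psi>) (N \<circ> \<psi>) z (0, 1) = 0"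
      unfolding a_def a_k m_def by (simp add: algebra_simps)
    then show ?thesis using \<nu> by simp
  qed
  have c0: "csq > 0" by (rule csq_pos[OF prm, of "(x0, y0)"]) (use xy0 in simp)
  show ?thesis
  proof (rule helix_coords_form[OF IJ(1,2,4,5) xy0 prm T ang])
    fix \<xi> \<xi>1 \<xi>2 \<xi>3
    assume "admissible_angles J \<xi>1 \<xi>2 \<xi>3"
      "\<forall>x\<in>I. \<forall>y\<in>J. (f \<circ> \<psi>) (x, y) = A_mat \<xi> (\<xi>1 y) (\<xi>2 y) (\<xi>3 y) *v \<gamma> x"
    then show thesis unfolding o_apply by (rule that[OF c0])
  qed
qed

end

theorem theorem6p1:
  fixes \<kappa> \<tau> lam \<nu> :: real and D :: connection
  assumes "\<kappa> > 0" and "\<tau> > 0"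
    and "levi_civita \<kappa> \<tau> D"
    and "lam \<in> {-1, 1}" and "\<nu> \<noteq> 0" and "B_const \<tau> lam \<nu> > 0"
  shows
    "(\<forall>(M :: 'm set) \<A> f N. helix_surface \<kappa> \<tau> lam \<nu> M \<A> f N \<longrightarrow>
        (\<forall>p\<in>M. \<exists>I J \<psi> \<eta>. helix_coords \<kappa> \<tau> lam \<nu> D M \<A> f N I J \<psi> \<eta> \<and> p \<in> \<psi> ` (I \<times> J)) \<and>
        (\<forall>I J \<psi> \<eta>. helix_coords \<kappa> \<tau> lam \<nu> D M \<A> f N I J \<psi> \<eta> \<longrightarrow>
           w11 \<kappa> \<tau> lam \<nu> > 0 \<and> w33 \<kappa> \<tau> lam \<nu> < 0 \<and>
           lorentz_torus (sqrt (w11 \<kappa> \<tau> lam \<nu>)) (sqrt (- w33 \<kappa> \<tau> lam \<nu>)) \<and>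
           torus (sqrt (w11 \<kappa> \<tau> lam \<nu>)) (sqrt (- w33 \<kappa> \<tau> lam \<nu>)) \<subseteq> AdS \<kappa> \<and>
           twisted_geodesic (sqrt (w11 \<kappa> \<tau> lam \<nu>)) (sqrt (- w33 \<kappa> \<tau> lam \<nu>)) (gam \<kappa> \<tau> lam \<nu>) \<and>
           (\<exists>\<xi> \<xi>1 \<xi>2 \<xi>3. admissible_angles J \<xi>1 \<xi>2 \<xi>3 \<and>
              (\<forall>y\<in>J. pseudo_orthogonal (A_mat \<xi> (\<xi>1 y) (\<xi>2 y) (\<xi>3 y)) \<and>
                      commutes_J1 (A_mat \<xi> (\<xi>1 y) (\<xi>2 y) (\<xi>3 y))) \<and>
              (\<forall>x\<in>I. \<forall>y\<in>J.
                 f (\<psi> (x, y)) = A_mat \<xi> (\<xi>1 y) (\<xi>2 y) (\<xi>3 y) *v gam \<kappa> \<tau> lam \<nu> x))))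
     \<and>
     (lam + \<nu>^2 > 0 \<longrightarrow>
        (\<forall>V J \<xi> \<xi>1 \<xi>2 \<xi>3 F.
           open J \<and> is_interval J \<and> open V \<and> V \<subseteq> UNIV \<times> J \<and>
           admissible_angles J \<xi>1 \<xi>2 \<xi>3 \<and>
           F = (\<lambda>(x, y). A_mat \<xi> (\<xi>1 y) (\<xi>2 y) (\<xi>3 y) *v gam \<kappa> \<tau> lam \<nu> x) \<and>
           immersion_on V F \<longrightarrow>
           (\<exists>N. helix_surface \<kappa> \<tau> lam \<nu> V {(V, \<lambda>z. z)} F N)))"
proof -
  interpret helix_constants \<kappa> \<tau> lam \<nu>
    by (rule helix_constants.intro) (fact assms)+
  show ?thesis
  proof (intro conjI allI impI ballI)
    fix M :: "'m set" and \<A> f N p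
    assume "helix_surface \<kappa> \<tau> lam \<nu> M \<A> f N" "p \<in> M"
    then show "\<exists>I J \<psi> \<eta>. helix_coords \<kappa> \<tau> lam \<nu> D M \<A> f N I J \<psi> \<eta> \<and> p \<in> \<psi> ` (I \<times> J)"
      by (rule helix_coords_exist[OF assms(3)])
  next
    fix M :: "'m set" and \<A> f N I J \<psi> \<eta>
    assume h: "helix_surface \<kappa> \<tau> lam \<nu> M \<A> f N" "helix_coords \<kappa> \<tau> lam \<nu> D M \<A> f N I J \<psi> \<eta>"
    obtain \<xi> \<xi>1 \<xi>2 \<xi>3 where c0: "csq > 0" and A: "admissible_angles J \<xi>1 \<xi>2 \<xi>3"
      "\<forall>x\<in>I. \<forall>y\<in>J. f (\<psi> (x, y)) = A_mat \<xi> (\<xi>1 y) (\<xi>2 y) (\<xi>3 y) *v gam \<kappa> \<tau> lam \<nu> x"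
      using helix_coords_position[OF h] .
    show "w11 \<kappa> \<tau> lam \<nu> > 0" "w33 \<kappa> \<tau> lam \<nu> < 0" using w_pos[OF c0] by simp_all
    show "lorentz_torus (sqrt (w11 \<kappa> \<tau> lam \<nu>)) (sqrt (- w33 \<kappa> \<tau> lam \<nu>))"
      by (rule lorentz_torus_pos) (use w_pos[OF c0] in simp_all)
    show "torus (sqrt (w11 \<kappa> \<tau> lam \<nu>)) (sqrt (- w33 \<kappa> \<tau> lam \<nu>)) \<subseteq> AdS \<kappa>"
      by (rule torus_AdS[OF c0])
    show "twisted_geodesic (sqrt (w11 \<kappa> \<tau> lam \<nu>)) (sqrt (- w33 \<kappa> \<tau> lam \<nu>)) (gam \<kappa> \<tau> lam \<nu>)"
      by (rule gamma_geodesic[OF c0])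
    show "\<exists>\<xi> \<xi>1 \<xi>2 \<xi>3. admissible_angles J \<xi>1 \<xi>2 \<xi>3 \<and>
              (\<forall>y\<in>J. pseudo_orthogonal (A_mat \<xi> (\<xi>1 y) (\<xi>2 y) (\<xi>3 y)) \<and>
                      commutes_J1 (A_mat \<xi> (\<xi>1 y) (\<xi>2 y) (\<xi>3 y))) \<and>
              (\<forall>x\<in>I. \<forall>y\<in>J.
                 f (\<psi> (x, y)) = A_mat \<xi> (\<xi>1 y) (\<xi>2 y) (\<xi>3 y) *v gam \<kappa> \<tau> lam \<nu> x)"
      using A A_mat_pseudo_orthogonal A_mat_commutes_J1 by blast
  next
    fix V J \<xi> \<xi>1 \<xi>2 \<xi>3 F
    assume "lam + \<nu>^2 > 0"
    then have c0: "csq > 0" by (simp only: csq_def)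
    assume h: "open J \<and> is_interval J \<and> open V \<and> V \<subseteq> UNIV \<times> J \<and>
           admissible_angles J \<xi>1 \<xi>2 \<xi>3 \<and>
           F = (\<lambda>(x, y). A_mat \<xi> (\<xi>1 y) (\<xi>2 y) (\<xi>3 y) *v gam \<kappa> \<tau> lam \<nu> x) \<and>
           immersion_on V F"
    then have F: "F = (\<lambda>(x, y). A_mat \<xi> (\<xi>1 y) (\<xi>2 y) (\<xi>3 y) *v gam \<kappa> \<tau> lam \<nu> x)" by blast
    show "\<exists>N. helix_surface \<kappa> \<tau> lam \<nu> V {(V, \<lambda>z. z)} F N"
      using h unfolding F by (intro family_is_helix[OF c0]) blast+
  qed
qed

end
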